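(* Let $G\rightrightarrows X$ be a proper locally compact groupoid, $A\to X$ a Banach algebra $G$-bundle, $E\to X$ a Banach $A$-module bundle, $\sigma$ an $A$-valued multiplier for $G$, and $T:s^*E\to t^*E$ an $A$-linear almost $\sigma$-representation. Then there exists a $\sigma$-representation $R:s^*E\to t^*E$ such that $\|R(g)-T(g)\|\le 4\,b(T,tg)\,r(T,tg)$ for all $g\in G$. Moreover, if $E\to X$ is locally trivial of class $C^0$ with a given $\mathrm{GI}(\boldsymbol E)$-structure and $T$ is uniformly continuous relative to it, then $R$ can be chosen uniformly continuous relative to the same structure.
   Context: A locally compact groupoid is a topological groupoid $G\rightrightarrows X$ (source $s$, target $t$, units $1x$, composable pairs $G\times_{s,t}G=\{(g,h):sg=th\}$) whose arrow space is locally compact Hausdorff, equipped with a continuous left Haar system $\{\mu^x\}$: Radon measures with support $t^{-1}(x)$, left invariant, with $x\mapsto\int\varphi\,d\mu^x$ continuous for $\varphi\in C_c(G)$. A cutoff function is a continuous $c:X\to\mathbb R_{\ge0}$ with $\mathrm{supp}(c\circ s)\cap t^{-1}(C)$ compact for compact $C$ and every orbit meeting $\{c>0\}$; $G$ is proper if one exists. $Gx$ is the orbit of $x$. Banach bundle (Fell): Hausdorff space $E$ with continuous open surjection $p:E\to X$, continuous fiberwise real vector operations, continuous norm making fibers Banach spaces, such that nets $e_i$ with $pe_i\to x$, $|e_i|\to0$ converge to $0_x$; morphisms are continuous fiberwise linear maps. Banach algebra bundle: continuous fiberwise multiplications and unit section, fibers unital Banach algebras with $|ab|\le|a||b|$,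 $|1|=1$; $A^\times$ invertibles. Banach $A$-module bundle: continuous action $A\times_XE\to E$ with $|ae|\le|a||e|$, $1e=e$. Banach algebra $G$-bundle: continuous left $G$-action by isometric algebra isomorphisms $A_{sg}\to A_{tg}$, $a\mapsto ga$. $A$-valued multiplier: continuous $\sigma$ on $G\times_{s,t}G$ with $\sigma(g,h)\in A_{tg}^\times$ central, $\sigma(g,h)=1$ if $g$ or $h$ is a unit, $\sigma(g,h)\sigma(gh,k)=g\sigma(h,k)\sigma(g,hk)$. A pseudorepresentation is a morphism $T:s^*E\to t^*E$ over $\mathrm{id}_G$ (operators $T(g):E_{sg}\to E_{tg}$); $A$-linear if $T(g)(ae)=ga\cdot T(g)e$. A $\sigma$-representation is an $A$-linear pseudorepresentation $R$ with $R(1x)=\mathrm{id}$ and $\sigma(g,h)R(gh)=R(g)R(h)$ for composable $(g,h)$. With $\ell(\sigma,g)=\max\{1,|\sigma(g,g^{-1})^{-1}|\}$: $r(T,x)=\sup_{y\in Gx}\|\mathrm{id}-T(1y)\|+\sup_{g\in t^{-1}(Gx),h\in G^{sg}}\ell(\sigma,g)\|\sigma(g,h)T(gh)-T(g)T(h)\|$, $b(T,x)=\sup_{g\in t^{-1}(Gx)}\ell(\sigma,g)\|T(g)\|$; $T$ is an almost $\sigma$-representation if $r(T,x)\le\min\{1/4,b(T,x)^{-2}/9\}$ for all $x$. Local triviality: a local trivialization of the Banach $A$-module bundle $E$ by a Banach space $\boldsymbol E$ over an open $U$ is an isomorphism $U\times\boldsymbol E\cong E|U$ of Banach bundles over $U$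 under which the action of $A|U$ becomes an operator-norm continuous map $A|U\to\mathrm{End}(\boldsymbol E)$. A $\mathrm{GL}(\boldsymbol E)$-structure is an equivalence class of atlases of such trivializations whose transition functions $U\to\mathrm{GL}(\boldsymbol E)$ are operator-norm continuous; it is a $\mathrm{GI}(\boldsymbol E)$-structure if it contains an atlas of norm-preserving trivializations ($E$ is then "locally trivial of class $C^0$"). Pullbacks $s^*E,t^*E\to G$ inherit such structures. A pseudorepresentation $T$ is uniformly continuous if for every pair of local trivializations of $s^*E$ and $t^*E$ over a common open $W\subset G$ belonging to the pulled-back structures, the local expression $W\to\mathcal L(\boldsymbol E,\boldsymbol E)$ of $T$ is operator-norm continuous. *)

theory Defs
  imports "HOL-Analysis.Analysis"
begin

record ('g,'x) groupoid =
  arr  :: "'g topology"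
  obj  :: "'x topology"
  src  :: "'g \<Rightarrow> 'x"
  tgt  :: "'g \<Rightarrow> 'x"
  unit :: "'x \<Rightarrow> 'g"
  comp :: "'g \<Rightarrow> 'g \<Rightarrow> 'g"
  ginv :: "'g \<Rightarrow> 'g"

definition composable :: "('g,'x) groupoid \<Rightarrow> ('g \<times> 'g) set" where
  "composable G = {(g,h). g \<in> topspace (arr G) \<and> h \<in> topspace (arr G) \<and> src G g = tgt G h}"

definition topological_groupoid :: "('g,'x) groupoid \<Rightarrow> bool" where
  "topological_groupoid G \<longleftrightarrow>
     (let GG = topspace (arr G); X = topspace (obj G); s = src G; t = tgt G;
          u = unit G; m = comp G; i = ginv G in
       (\<forall>x\<in>X. u x \<in> GG \<and> s (u x) = x \<and> t (u x) = x) \<and>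
       (\<forall>g\<in>GG. s g \<in> X \<and> t g \<in> X \<and> i g \<in> GG \<and> s (i g) = t g \<and> t (i g) = s g \<and>
                 m g (i g) = u (t g) \<and> m (i g) g = u (s g) \<and>
                 m (u (t g)) g = g \<and> m g (u (s g)) = g) \<and>
       (\<forall>(g,h)\<in>composable G. m g h \<in> GG \<and> s (m g h) = s h \<and> t (m g h) = t g) \<and>
       (\<forall>g h k. (g,h) \<in> composable G \<and> (h,k) \<in> composable G \<longrightarrow> m (m g h) k = m g (m h k)) \<and>
       continuous_map (arr G) (obj G) s \<and> continuous_map (arr G) (obj G) t \<and>
       continuous_map (obj G) (arr G) u \<and> continuous_map (arr G) (arr G) i \<and>
       continuous_map (subtopology (prod_topology (arr G) (arr G)) (composable G)) (arr G)
          (\<lambda>(g,h). m g h))"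

definition orbit :: "('g,'x) groupoid \<Rightarrow> 'x \<Rightarrow> 'x set" where
  "orbit G x = {tgt G g | g. g \<in> topspace (arr G) \<and> src G g = x}"

definition borel_sets_of :: "'a topology \<Rightarrow> 'a set set" where
  "borel_sets_of T = sigma_sets (topspace T) {U. openin T U}"

definition radon_measure :: "'a topology \<Rightarrow> 'a measure \<Rightarrow> bool" where
  "radon_measure T M \<longleftrightarrow>
     space M = topspace T \<and> sets M = borel_sets_of T \<and>
     (\<forall>K. compactin T K \<longrightarrow> emeasure M K < \<infinity>) \<and>
     (\<forall>B\<in>sets M. emeasure M B = (INF U\<in>{U. openin T U \<and> B \<subseteq> U}. emeasure M U)) \<and>
     (\<forall>U. openin T U \<longrightarrow> emeasure M U = (SUP K\<in>{K. compactin T K \<and> K \<subseteq> U}. emeasure M K))"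

definition measure_support :: "'a topology \<Rightarrow> 'a measure \<Rightarrow> 'a set" where
  "measure_support T M = {y \<in> topspace T. \<forall>U. openin T U \<and> y \<in> U \<longrightarrow> emeasure M U > 0}"

definition Cc :: "'a topology \<Rightarrow> ('a \<Rightarrow> real) set" where
  "Cc T = {\<phi>. continuous_map T euclideanreal \<phi> \<and>
              compactin T (T closure_of {y \<in> topspace T. \<phi> y \<noteq> 0})}"

definition left_haar_system :: "('g,'x) groupoid \<Rightarrow> ('x \<Rightarrow> 'g measure) \<Rightarrow> bool" where
  "left_haar_system G \<mu> \<longleftrightarrow>
     (\<forall>x\<in>topspace (obj G). radon_measure (arr G) (\<mu> x) \<and>
        measure_support (arr G) (\<mu> x) = {g \<in> topspace (arr G). tgt G g = x}) \<and>
     (\<forall>g\<in>topspace (arr G). \<forall>\<phi>\<in>Cc (arr G).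
        (\<integral>h. indicator {h. tgt G h = src G g} h * \<phi> (comp G g h) \<partial>(\<mu> (src G g)))
          = (\<integral>h. \<phi> h \<partial>(\<mu> (tgt G g)))) \<and>
     (\<forall>\<phi>\<in>Cc (arr G). continuous_map (obj G) euclideanreal (\<lambda>x. \<integral>h. \<phi> h \<partial>(\<mu> x)))"

definition locally_compact_groupoid :: "('g,'x) groupoid \<Rightarrow> ('x \<Rightarrow> 'g measure) \<Rightarrow> bool" where
  "locally_compact_groupoid G \<mu> \<longleftrightarrow>
     topological_groupoid G \<and> locally_compact_space (arr G) \<and> Hausdorff_space (arr G) \<and>
     left_haar_system G \<mu>"

definition cutoff_function :: "('g,'x) groupoid \<Rightarrow> ('x \<Rightarrow> real) \<Rightarrow> bool" where
  "cutoff_function G c \<longleftrightarrow>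
     continuous_map (obj G) euclideanreal c \<and> (\<forall>x\<in>topspace (obj G). c x \<ge> 0) \<and>
     (\<forall>C. compactin (obj G) C \<longrightarrow>
        compactin (arr G) ((arr G closure_of {g \<in> topspace (arr G). c (src G g) \<noteq> 0})
                            \<inter> {g \<in> topspace (arr G). tgt G g \<in> C})) \<and>
     (\<forall>x\<in>topspace (obj G). \<exists>y\<in>orbit G x. c y > 0)"

definition proper_groupoid :: "('g,'x) groupoid \<Rightarrow> bool" where
  "proper_groupoid G \<longleftrightarrow> (\<exists>c. cutoff_function G c)"

record ('x,'e) bbundle =
  btop   :: "'e topology"
  bproj  :: "'e \<Rightarrow> 'x"
  bzero  :: "'x \<Rightarrow> 'e"
  badd   :: "'e \<Rightarrow> 'e \<Rightarrow> 'e"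
  bscale :: "real \<Rightarrow> 'e \<Rightarrow> 'e"
  bnorm  :: "'e \<Rightarrow> real"

record ('x,'a) balg = "('x,'a) bbundle" +
  bmult :: "'a \<Rightarrow> 'a \<Rightarrow> 'a"
  bone  :: "'x \<Rightarrow> 'a"

definition fiber :: "('x,'e,'z) bbundle_scheme \<Rightarrow> 'x \<Rightarrow> 'e set" where
  "fiber E x = {e \<in> topspace (btop E). bproj E e = x}"

definition fibered_pairs :: "('x,'e,'z) bbundle_scheme \<Rightarrow> ('e \<times> 'e) set" where
  "fibered_pairs E = {(e,f). e \<in> topspace (btop E) \<and> f \<in> topspace (btop E) \<and> bproj E e = bproj E f}"

definition bminus :: "('x,'e,'z) bbundle_scheme \<Rightarrow> 'e \<Rightarrow> 'e \<Rightarrow> 'e" where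
  "bminus E e f = badd E e (bscale E (-1) f)"

text \<open>Fell's Banach bundles. Nets are encoded by filters on the total space
  (a net converges iff its image filter does).\<close>
definition banach_bundle :: "'x topology \<Rightarrow> ('x,'e,'z) bbundle_scheme \<Rightarrow> bool" where
  "banach_bundle X E \<longleftrightarrow>
     Hausdorff_space (btop E) \<and>
     continuous_map (btop E) X (bproj E) \<and> open_map (btop E) X (bproj E) \<and>
     bproj E ` topspace (btop E) = topspace X \<and>
     continuous_map (subtopology (prod_topology (btop E) (btop E)) (fibered_pairs E)) (btop E)
        (\<lambda>(e,f). badd E e f) \<and>
     continuous_map (prod_topology euclideanreal (btop E)) (btop E) (\<lambda>(c,e). bscale E c e) \<and>
     continuous_map (btop E) euclideanreal (bnorm E) \<and>
     (\<forall>x\<in>topspace X.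
        bzero E x \<in> fiber E x \<and>
        (\<forall>e\<in>fiber E x. \<forall>f\<in>fiber E x. badd E e f \<in> fiber E x) \<and>
        (\<forall>c. \<forall>e\<in>fiber E x. bscale E c e \<in> fiber E x) \<and>
        (\<forall>e\<in>fiber E x. \<forall>f\<in>fiber E x. \<forall>g\<in>fiber E x.
            badd E (badd E e f) g = badd E e (badd E f g)) \<and>
        (\<forall>e\<in>fiber E x. \<forall>f\<in>fiber E x. badd E e f = badd E f e) \<and>
        (\<forall>e\<in>fiber E x. badd E e (bzero E x) = e) \<and>
        (\<forall>e\<in>fiber E x. badd E e (bscale E (-1) e) = bzero E x) \<and>
        (\<forall>e\<in>fiber E x. bscale E 1 e = e) \<and>
        (\<forall>a b. \<forall>e\<in>fiber E x. bscale E a (bscale E b e) = bscale E (a*b) e) \<and>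
        (\<forall>a b. \<forall>e\<in>fiber E x. bscale E (a+b) e = badd E (bscale E a e) (bscale E b e)) \<and>
        (\<forall>a. \<forall>e\<in>fiber E x. \<forall>f\<in>fiber E x.
            bscale E a (badd E e f) = badd E (bscale E a e) (bscale E a f)) \<and>
        (\<forall>e\<in>fiber E x. bnorm E e \<ge> 0 \<and> (bnorm E e = 0 \<longleftrightarrow> e = bzero E x)) \<and>
        (\<forall>a. \<forall>e\<in>fiber E x. bnorm E (bscale E a e) = \<bar>a\<bar> * bnorm E e) \<and>
        (\<forall>e\<in>fiber E x. \<forall>f\<in>fiber E x. bnorm E (badd E e f) \<le> bnorm E e + bnorm E f) \<and>
        (\<forall>S. (\<forall>n. S n \<in> fiber E x) \<and>
             (\<forall>\<epsilon>>0. \<exists>N. \<forall>m\<ge>N. \<forall>n\<ge>N. bnorm E (bminus E (S m) (S n)) < \<epsilon>) \<longrightarrow>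
             (\<exists>l\<in>fiber E x. (\<lambda>n. bnorm E (bminus E (S n) l)) \<longlonglongrightarrow> 0))) \<and>
     (\<forall>F::'e filter. \<forall>x\<in>topspace X.
        eventually (\<lambda>e. e \<in> topspace (btop E)) F \<and> limitin X (bproj E) x F \<and>
        ((\<lambda>e. bnorm E e) \<longlongrightarrow> 0) F \<longrightarrow> limitin (btop E) (\<lambda>e. e) (bzero E x) F)"

definition fib_linear ::
  "('x,'e,'z) bbundle_scheme \<Rightarrow> ('y,'f,'w) bbundle_scheme \<Rightarrow> 'x \<Rightarrow> 'y \<Rightarrow> ('e \<Rightarrow> 'f) \<Rightarrow> bool" where
  "fib_linear E F x y L \<longleftrightarrow>
     (\<forall>e\<in>fiber E x. L e \<in> fiber F y) \<and>
     (\<forall>e\<in>fiber E x. \<forall>f\<in>fiber E x. L (badd E e f) = badd F (L e) (L f)) \<and>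
     (\<forall>c. \<forall>e\<in>fiber E x. L (bscale E c e) = bscale F c (L e))"

definition banach_algebra_bundle :: "'x topology \<Rightarrow> ('x,'a,'z) balg_scheme \<Rightarrow> bool" where
  "banach_algebra_bundle X A \<longleftrightarrow>
     banach_bundle X A \<and>
     continuous_map (subtopology (prod_topology (btop A) (btop A)) (fibered_pairs A)) (btop A)
        (\<lambda>(a,b). bmult A a b) \<and>
     continuous_map X (btop A) (bone A) \<and>
     (\<forall>x\<in>topspace X.
        bone A x \<in> fiber A x \<and> bnorm A (bone A x) = 1 \<and>
        (\<forall>a\<in>fiber A x. \<forall>b\<in>fiber A x. bmult A a b \<in> fiber A x \<and>
            bnorm A (bmult A a b) \<le> bnorm A a * bnorm A b) \<and>
        (\<forall>a\<in>fiber A x. \<forall>b\<in>fiber A x. \<forall>c\<in>fiber A x.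
            bmult A (bmult A a b) c = bmult A a (bmult A b c) \<and>
            bmult A a (badd A b c) = badd A (bmult A a b) (bmult A a c) \<and>
            bmult A (badd A a b) c = badd A (bmult A a c) (bmult A b c)) \<and>
        (\<forall>r. \<forall>a\<in>fiber A x. \<forall>b\<in>fiber A x.
            bmult A (bscale A r a) b = bscale A r (bmult A a b) \<and>
            bmult A a (bscale A r b) = bscale A r (bmult A a b)) \<and>
        (\<forall>a\<in>fiber A x. bmult A (bone A x) a = a \<and> bmult A a (bone A x) = a))"

definition invertible_in :: "('x,'a,'z) balg_scheme \<Rightarrow> 'a \<Rightarrow> bool" where
  "invertible_in A a \<longleftrightarrow> a \<in> topspace (btop A) \<and>
     (\<exists>b\<in>fiber A (bproj A a). bmult A a b = bone A (bproj A a) \<and> bmult A b a = bone A (bproj A a))"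

definition ainv :: "('x,'a,'z) balg_scheme \<Rightarrow> 'a \<Rightarrow> 'a" where
  "ainv A a = (THE b. b \<in> fiber A (bproj A a) \<and> bmult A a b = bone A (bproj A a) \<and>
                      bmult A b a = bone A (bproj A a))"

definition central_in :: "('x,'a,'z) balg_scheme \<Rightarrow> 'a \<Rightarrow> bool" where
  "central_in A a \<longleftrightarrow> (\<forall>b\<in>fiber A (bproj A a). bmult A a b = bmult A b a)"

definition banach_module_bundle ::
  "'x topology \<Rightarrow> ('x,'a,'z) balg_scheme \<Rightarrow> ('x,'e,'w) bbundle_scheme \<Rightarrow> ('a \<Rightarrow> 'e \<Rightarrow> 'e) \<Rightarrow> bool" where
  "banach_module_bundle X A E act \<longleftrightarrow>
     banach_algebra_bundle X A \<and> banach_bundle X E \<and>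
     continuous_map
       (subtopology (prod_topology (btop A) (btop E))
          {(a,e). a \<in> topspace (btop A) \<and> e \<in> topspace (btop E) \<and> bproj A a = bproj E e})
       (btop E) (\<lambda>(a,e). act a e) \<and>
     (\<forall>x\<in>topspace X. \<forall>a\<in>fiber A x. \<forall>e\<in>fiber E x.
        act a e \<in> fiber E x \<and> bnorm E (act a e) \<le> bnorm A a * bnorm E e) \<and>
     (\<forall>x\<in>topspace X. \<forall>e\<in>fiber E x. act (bone A x) e = e) \<and>
     (\<forall>x\<in>topspace X. \<forall>a\<in>fiber A x. \<forall>b\<in>fiber A x. \<forall>e\<in>fiber E x. \<forall>f\<in>fiber E x. \<forall>r.
        act (bmult A a b) e = act a (act b e) \<and>
        act (badd A a b) e = badd E (act a e) (act b e) \<and>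
        act a (badd E e f) = badd E (act a e) (act a f) \<and>
        act (bscale A r a) e = bscale E r (act a e) \<and>
        act a (bscale E r e) = bscale E r (act a e))"

definition banach_algebra_G_bundle ::
  "('g,'x) groupoid \<Rightarrow> ('x,'a,'z) balg_scheme \<Rightarrow> ('g \<Rightarrow> 'a \<Rightarrow> 'a) \<Rightarrow> bool" where
  "banach_algebra_G_bundle G A gact \<longleftrightarrow>
     banach_algebra_bundle (obj G) A \<and>
     continuous_map
       (subtopology (prod_topology (arr G) (btop A))
          {(g,a). g \<in> topspace (arr G) \<and> a \<in> topspace (btop A) \<and> bproj A a = src G g})
       (btop A) (\<lambda>(g,a). gact g a) \<and>
     (\<forall>g\<in>topspace (arr G).
        fib_linear A A (src G g) (tgt G g) (gact g) \<and>
        bij_betw (gact g) (fiber A (src G g)) (fiber A (tgt G g)) \<and>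
        gact g (bone A (src G g)) = bone A (tgt G g) \<and>
        (\<forall>a\<in>fiber A (src G g). bnorm A (gact g a) = bnorm A a) \<and>
        (\<forall>a\<in>fiber A (src G g). \<forall>b\<in>fiber A (src G g).
           gact g (bmult A a b) = bmult A (gact g a) (gact g b))) \<and>
     (\<forall>x\<in>topspace (obj G). \<forall>a\<in>fiber A x. gact (unit G x) a = a) \<and>
     (\<forall>(g,h)\<in>composable G. \<forall>a\<in>fiber A (src G h). gact (comp G g h) a = gact g (gact h a))"

definition is_unit :: "('g,'x) groupoid \<Rightarrow> 'g \<Rightarrow> bool" where
  "is_unit G g \<longleftrightarrow> g \<in> unit G ` topspace (obj G)"

definition multiplier ::
  "('g,'x) groupoid \<Rightarrow> ('x,'a,'z) balg_scheme \<Rightarrow> ('g \<Rightarrow> 'a \<Rightarrow> 'a) \<Rightarrow> ('g \<Rightarrow> 'g \<Rightarrow> 'a) \<Rightarrow> bool" where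
  "multiplier G A gact \<sigma> \<longleftrightarrow>
     continuous_map (subtopology (prod_topology (arr G) (arr G)) (composable G)) (btop A)
        (\<lambda>(g,h). \<sigma> g h) \<and>
     (\<forall>(g,h)\<in>composable G.
        \<sigma> g h \<in> fiber A (tgt G g) \<and> invertible_in A (\<sigma> g h) \<and> central_in A (\<sigma> g h) \<and>
        (is_unit G g \<or> is_unit G h \<longrightarrow> \<sigma> g h = bone A (tgt G g))) \<and>
     (\<forall>g h k. (g,h) \<in> composable G \<and> (h,k) \<in> composable G \<longrightarrow>
        bmult A (\<sigma> g h) (\<sigma> (comp G g h) k) = bmult A (gact g (\<sigma> h k)) (\<sigma> g (comp G h k)))"

definition pullback_bundle ::
  "'g topology \<Rightarrow> ('g \<Rightarrow> 'x) \<Rightarrow> ('x,'e,'z) bbundle_scheme \<Rightarrow> ('g, 'g \<times> 'e) bbundle" where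
  "pullback_bundle T f E =
     \<lparr> btop = subtopology (prod_topology T (btop E)) {(g,e). bproj E e = f g},
       bproj = fst,
       bzero = (\<lambda>g. (g, bzero E (f g))),
       badd = (\<lambda>(g,e) (h,e'). (g, badd E e e')),
       bscale = (\<lambda>c (g,e). (g, bscale E c e)),
       bnorm = (\<lambda>(g,e). bnorm E e) \<rparr>"

definition pullback_alg ::
  "'g topology \<Rightarrow> ('g \<Rightarrow> 'x) \<Rightarrow> ('x,'a,'z) balg_scheme \<Rightarrow> ('g, 'g \<times> 'a) balg" where
  "pullback_alg T f A =
     \<lparr> btop = subtopology (prod_topology T (btop A)) {(g,a). bproj A a = f g},
       bproj = fst,
       bzero = (\<lambda>g. (g, bzero A (f g))),
       badd = (\<lambda>(g,e) (h,e'). (g, badd A e e')),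
       bscale = (\<lambda>c (g,e). (g, bscale A c e)),
       bnorm = (\<lambda>(g,e). bnorm A e),
       bmult = (\<lambda>(g,a) (h,b). (g, bmult A a b)),
       bone = (\<lambda>g. (g, bone A (f g))) \<rparr>"

definition pullback_act :: "('a \<Rightarrow> 'e \<Rightarrow> 'e) \<Rightarrow> ('g \<times> 'a) \<Rightarrow> ('g \<times> 'e) \<Rightarrow> ('g \<times> 'e)" where
  "pullback_act act = (\<lambda>(g,a) (h,e). (h, act a e))"

definition pseudorep ::
  "('g,'x) groupoid \<Rightarrow> ('x,'e,'z) bbundle_scheme \<Rightarrow> ('g \<Rightarrow> 'e \<Rightarrow> 'e) \<Rightarrow> bool" where
  "pseudorep G E T \<longleftrightarrow>
     continuous_map (btop (pullback_bundle (arr G) (src G) E))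
                    (btop (pullback_bundle (arr G) (tgt G) E)) (\<lambda>(g,e). (g, T g e)) \<and>
     (\<forall>g\<in>topspace (arr G). fib_linear E E (src G g) (tgt G g) (T g))"

definition A_linear ::
  "('g,'x) groupoid \<Rightarrow> ('x,'a,'z) balg_scheme \<Rightarrow> ('x,'e,'w) bbundle_scheme \<Rightarrow>
   ('a \<Rightarrow> 'e \<Rightarrow> 'e) \<Rightarrow> ('g \<Rightarrow> 'a \<Rightarrow> 'a) \<Rightarrow> ('g \<Rightarrow> 'e \<Rightarrow> 'e) \<Rightarrow> bool" where
  "A_linear G A E act gact T \<longleftrightarrow>
     (\<forall>g\<in>topspace (arr G). \<forall>a\<in>fiber A (src G g). \<forall>e\<in>fiber E (src G g).
        T g (act a e) = act (gact g a) (T g e))"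

definition sigma_rep ::
  "('g,'x) groupoid \<Rightarrow> ('x,'a,'z) balg_scheme \<Rightarrow> ('x,'e,'w) bbundle_scheme \<Rightarrow>
   ('a \<Rightarrow> 'e \<Rightarrow> 'e) \<Rightarrow> ('g \<Rightarrow> 'a \<Rightarrow> 'a) \<Rightarrow> ('g \<Rightarrow> 'g \<Rightarrow> 'a) \<Rightarrow> ('g \<Rightarrow> 'e \<Rightarrow> 'e) \<Rightarrow> bool" where
  "sigma_rep G A E act gact \<sigma> R \<longleftrightarrow>
     pseudorep G E R \<and> A_linear G A E act gact R \<and>
     (\<forall>x\<in>topspace (obj G). \<forall>e\<in>fiber E x. R (unit G x) e = e) \<and>
     (\<forall>(g,h)\<in>composable G. \<forall>e\<in>fiber E (src G h).
        act (\<sigma> g h) (R (comp G g h) e) = R g (R h e))"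

definition opnorm :: "('x,'e,'z) bbundle_scheme \<Rightarrow> 'x \<Rightarrow> ('e \<Rightarrow> 'e) \<Rightarrow> ereal" where
  "opnorm E x L = (SUP e\<in>{e\<in>fiber E x. bnorm E e \<le> 1}. ereal (bnorm E (L e)))"

definition ell :: "('g,'x) groupoid \<Rightarrow> ('x,'a,'z) balg_scheme \<Rightarrow> ('g \<Rightarrow> 'g \<Rightarrow> 'a) \<Rightarrow> 'g \<Rightarrow> real" where
  "ell G A \<sigma> g = max 1 (bnorm A (ainv A (\<sigma> g (ginv G g))))"

definition rdef ::
  "('g,'x) groupoid \<Rightarrow> ('x,'a,'z) balg_scheme \<Rightarrow> ('x,'e,'w) bbundle_scheme \<Rightarrow>
   ('a \<Rightarrow> 'e \<Rightarrow> 'e) \<Rightarrow> ('g \<Rightarrow> 'g \<Rightarrow> 'a) \<Rightarrow> ('g \<Rightarrow> 'e \<Rightarrow> 'e) \<Rightarrow> 'x \<Rightarrow> ereal" where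
  "rdef G A E act \<sigma> T x =
     (SUP y\<in>orbit G x. opnorm E y (\<lambda>e. bminus E e (T (unit G y) e))) +
     (SUP (g,h)\<in>{(g,h). (g,h) \<in> composable G \<and> tgt G g \<in> orbit G x}.
        ereal (ell G A \<sigma> g) *
        opnorm E (src G h) (\<lambda>e. bminus E (act (\<sigma> g h) (T (comp G g h) e)) (T g (T h e))))"

definition bdef ::
  "('g,'x) groupoid \<Rightarrow> ('x,'a,'z) balg_scheme \<Rightarrow> ('x,'e,'w) bbundle_scheme \<Rightarrow>
   ('g \<Rightarrow> 'g \<Rightarrow> 'a) \<Rightarrow> ('g \<Rightarrow> 'e \<Rightarrow> 'e) \<Rightarrow> 'x \<Rightarrow> ereal" where
  "bdef G A E \<sigma> T x =
     (SUP g\<in>{g \<in> topspace (arr G). tgt G g \<in> orbit G x}.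
        ereal (ell G A \<sigma> g) * opnorm E (src G g) (T g))"

definition almost_sigma_rep ::
  "('g,'x) groupoid \<Rightarrow> ('x,'a,'z) balg_scheme \<Rightarrow> ('x,'e,'w) bbundle_scheme \<Rightarrow>
   ('a \<Rightarrow> 'e \<Rightarrow> 'e) \<Rightarrow> ('g \<Rightarrow> 'g \<Rightarrow> 'a) \<Rightarrow> ('g \<Rightarrow> 'e \<Rightarrow> 'e) \<Rightarrow> bool" where
  "almost_sigma_rep G A E act \<sigma> T \<longleftrightarrow>
     pseudorep G E T \<and>
     (\<forall>x\<in>topspace (obj G).
        rdef G A E act \<sigma> T x \<le> min (1/4) (inverse ((bdef G A E \<sigma> T x)\<^sup>2) / 9))"

definition chart_inv :: "('b \<Rightarrow> 'v \<Rightarrow> 'e) \<Rightarrow> 'b \<Rightarrow> 'e \<Rightarrow> 'v" where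
  "chart_inv \<phi> b e = (THE v. \<phi> b v = e)"

definition local_triv ::
  "'b topology \<Rightarrow> ('b,'a,'z) balg_scheme \<Rightarrow> ('b,'e,'w) bbundle_scheme \<Rightarrow> ('a \<Rightarrow> 'e \<Rightarrow> 'e) \<Rightarrow>
   'b set \<times> ('b \<Rightarrow> 'v::banach \<Rightarrow> 'e) \<Rightarrow> bool" where
  "local_triv B A E act c \<longleftrightarrow>
     (let U = fst c; \<phi> = snd c in
       openin B U \<and>
       (\<forall>b\<in>U. bij_betw (\<phi> b) UNIV (fiber E b) \<and>
               (\<forall>v w. \<phi> b (v + w) = badd E (\<phi> b v) (\<phi> b w)) \<and>
               (\<forall>r v. \<phi> b (r *\<^sub>R v) = bscale E r (\<phi> b v))) \<and>
       homeomorphic_map (prod_topology (subtopology B U) euclidean)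
          (subtopology (btop E) {e \<in> topspace (btop E). bproj E e \<in> U}) (\<lambda>(b,v). \<phi> b v) \<and>
       (\<exists>F :: 'a \<Rightarrow> ('v \<Rightarrow>\<^sub>L 'v).
          continuous_map (subtopology (btop A) {a \<in> topspace (btop A). bproj A a \<in> U}) euclidean F \<and>
          (\<forall>a\<in>topspace (btop A). bproj A a \<in> U \<longrightarrow>
             (\<forall>v. blinfun_apply (F a) v = chart_inv \<phi> (bproj A a) (act a (\<phi> (bproj A a) v))))))"

definition norm_preserving_chart ::
  "('b,'e,'w) bbundle_scheme \<Rightarrow> 'b set \<times> ('b \<Rightarrow> 'v::banach \<Rightarrow> 'e) \<Rightarrow> bool" where
  "norm_preserving_chart E c \<longleftrightarrow> (\<forall>b\<in>fst c. \<forall>v. bnorm E (snd c b v) = norm v)"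

definition compatible ::
  "'b topology \<Rightarrow> 'b set \<times> ('b \<Rightarrow> 'v::banach \<Rightarrow> 'e) \<Rightarrow> 'b set \<times> ('b \<Rightarrow> 'v \<Rightarrow> 'e) \<Rightarrow> bool" where
  "compatible B c d \<longleftrightarrow>
     (\<exists>F :: 'b \<Rightarrow> ('v \<Rightarrow>\<^sub>L 'v).
        continuous_map (subtopology B (fst c \<inter> fst d)) euclidean F \<and>
        (\<forall>b\<in>fst c \<inter> fst d. \<forall>v. blinfun_apply (F b) v = chart_inv (snd d) b (snd c b v)))"

definition is_atlas ::
  "'b topology \<Rightarrow> ('b,'a,'z) balg_scheme \<Rightarrow> ('b,'e,'w) bbundle_scheme \<Rightarrow> ('a \<Rightarrow> 'e \<Rightarrow> 'e) \<Rightarrow>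
   ('b set \<times> ('b \<Rightarrow> 'v::banach \<Rightarrow> 'e)) set \<Rightarrow> bool" where
  "is_atlas B A E act \<A> \<longleftrightarrow>
     (\<forall>c\<in>\<A>. local_triv B A E act c) \<and> topspace B \<subseteq> \<Union>(fst ` \<A>) \<and>
     (\<forall>c\<in>\<A>. \<forall>d\<in>\<A>. compatible B c d)"

text \<open>A GL-structure is the equivalence class of the atlas; a chart belongs to it
  iff it is compatible (both ways) with every chart of the atlas.\<close>
definition in_structure ::
  "'b topology \<Rightarrow> ('b,'a,'z) balg_scheme \<Rightarrow> ('b,'e,'w) bbundle_scheme \<Rightarrow> ('a \<Rightarrow> 'e \<Rightarrow> 'e) \<Rightarrow>
   ('b set \<times> ('b \<Rightarrow> 'v::banach \<Rightarrow> 'e)) set \<Rightarrow> 'b set \<times> ('b \<Rightarrow> 'v \<Rightarrow> 'e) \<Rightarrow> bool" where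
  "in_structure B A E act \<A> c \<longleftrightarrow>
     local_triv B A E act c \<and> (\<forall>d\<in>\<A>. compatible B c d \<and> compatible B d c)"

definition GI_structure ::
  "'b topology \<Rightarrow> ('b,'a,'z) balg_scheme \<Rightarrow> ('b,'e,'w) bbundle_scheme \<Rightarrow> ('a \<Rightarrow> 'e \<Rightarrow> 'e) \<Rightarrow>
   ('b set \<times> ('b \<Rightarrow> 'v::banach \<Rightarrow> 'e)) set \<Rightarrow> bool" where
  "GI_structure B A E act \<A> \<longleftrightarrow>
     is_atlas B A E act \<A> \<and>
     (\<exists>\<N>. is_atlas B A E act \<N> \<and> (\<forall>c\<in>\<N>. norm_preserving_chart E c) \<and>
          (\<forall>c\<in>\<N>. in_structure B A E act \<A> c))"

definition pullback_atlas ::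
  "'g topology \<Rightarrow> ('g \<Rightarrow> 'x) \<Rightarrow> ('x set \<times> ('x \<Rightarrow> 'v \<Rightarrow> 'e)) set \<Rightarrow>
   ('g set \<times> ('g \<Rightarrow> 'v \<Rightarrow> 'g \<times> 'e)) set" where
  "pullback_atlas T f \<A> =
     (\<lambda>(U,\<phi>). ({g \<in> topspace T. f g \<in> U}, \<lambda>g v. (g, \<phi> (f g) v))) ` \<A>"

definition uniformly_continuous_rep ::
  "('g,'x) groupoid \<Rightarrow> ('x,'a,'z) balg_scheme \<Rightarrow> ('x,'e,'w) bbundle_scheme \<Rightarrow> ('a \<Rightarrow> 'e \<Rightarrow> 'e) \<Rightarrow>
   ('x set \<times> ('x \<Rightarrow> 'v::banach \<Rightarrow> 'e)) set \<Rightarrow> ('g \<Rightarrow> 'e \<Rightarrow> 'e) \<Rightarrow> bool" where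
  "uniformly_continuous_rep G A E act \<A> T \<longleftrightarrow>
     (\<forall>W \<psi> \<theta>.
        in_structure (arr G) (pullback_alg (arr G) (src G) A) (pullback_bundle (arr G) (src G) E)
           (pullback_act act) (pullback_atlas (arr G) (src G) \<A>) (W, \<psi>) \<and>
        in_structure (arr G) (pullback_alg (arr G) (tgt G) A) (pullback_bundle (arr G) (tgt G) E)
           (pullback_act act) (pullback_atlas (arr G) (tgt G) \<A>) (W, \<theta>) \<longrightarrow>
        (\<exists>F :: 'g \<Rightarrow> ('v \<Rightarrow>\<^sub>L 'v).
           continuous_map (subtopology (arr G) W) euclidean F \<and>
           (\<forall>g\<in>W. \<forall>v. blinfun_apply (F g) v = chart_inv \<theta> g (g, T g (snd (\<psi> g v))))))"

end

theory Submission
  imports Defs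
begin

text \<open>
  If \<open>\<sigma>(g,h) T(gh) = T(g) T(h)\<close> held exactly, then \<open>T(g)\<close> would equal
  \<open>D(g,k) = \<sigma>(g,k) T(gk) T(k)\<^sup>-\<^sup>1\<close> for every \<open>k\<close> with target the source of \<open>g\<close>. One therefore replaces \<open>T(g)\<close>
  by the average of \<open>D(g,k)\<close> over \<open>k\<close> with respect to the Haar system weighted by a normalised
  cutoff function. The cocycle identity gives \<open>D(g,hk) D(h,k) = \<sigma>(g,h) D(gh,k)\<close>, so by invariance the
  defect of the average is the covariance of \<open>k \<mapsto> D(g,hk)\<close> and \<open>k \<mapsto> D(h,k)\<close>, which is
  quadratic in the defect of \<open>T\<close>. Iteration converges geometrically, uniformly over the whole groupoid
  because \<open>b r \<le> 1/4\<close> on every orbit with \<open>b\<close> finite, and \<open>T\<close> is already multiplicative on the others.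

  Fibers are sets, not types, and need not be separable. Integrals in a fiber are therefore characterised
  by bounded linear functionals; Hahn--Banach also reduces identities and norm
  estimates in a fiber to those for real numbers.
\<close>

section \<open>Banach bundles\<close>

text \<open>The weight \<open>ell\<close> enters because the inverse of \<open>T(k)\<close> is
  reached only through \<open>\<sigma>(k^-1,k)^-1 T(k^-1) T(k)\<close>, which differs from the
  identity by at most \<open>r\<close>; \<open>ell\<close> at \<open>k^-1\<close> bounds the inverse
  multiplier. Since \<open>r \<le> 1/4\<close>, the inverse of \<open>T(k)\<close> has norm at most
  \<open>4/3 b\<close>, and \<open>D(g,k)\<close> differs from \<open>T(g)\<close> by at most
  \<open>4/3 b r\<close>. Two such deviations multiply to
  \<open>2 (4/3 b r)^2 = 32/9 (b^2 r) r\<close>, so \<open>b^2 r \<le> 1/9\<close> turns the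
  quadratic estimate into a contraction of \<open>r\<close>. The constant \<open>b\<close> may grow
  along the iteration and need not be bounded on the base; only the product \<open>b r\<close> is
  followed, and it controls the error. The second obstacle is topological. Continuity in a Fell
  bundle is proved here without sections: the projection is open, so every fiber near that of
  \<open>v\<close> meets any given neighbourhood of \<open>v\<close>, and all estimates are made
  against vectors picked in such neighbourhoods. The continuity of the inverse operators and of the
  integral are both obtained in this way.\<close>

lemma continuous_map_openI:
  assumes 1: "\<And>z. z \<in> topspace Z \<Longrightarrow> f z \<in> topspace Y"
    and 2: "\<And>z N. z \<in> topspace Z \<Longrightarrow> openin Y N \<Longrightarrow> f z \<in> N \<Longrightarrow>
           \<exists>M. openin Z M \<and> z \<in> M \<and> (\<forall>y\<in>M. f y \<in> N)"
  shows "continuous_map Z Y f"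
  unfolding continuous_map_eq_topcontinuous_at topcontinuous_at_def
proof (intro ballI conjI allI impI)
  fix z N assume "z \<in> topspace Z" "openin Y N \<and> f z \<in> N"
  then show "\<exists>M. openin Z M \<and> z \<in> M \<and> (\<forall>y\<in>M. f y \<in> N)" using 2[of z N] by simp
qed (use 1 in auto)

lemma continuous_map_openD:
  assumes "continuous_map Z Y f" "z \<in> topspace Z" "openin Y N" "f z \<in> N"
  obtains M where "openin Z M" "z \<in> M" "\<And>y. y \<in> M \<Longrightarrow> f y \<in> N"
proof -
  have "topcontinuous_at Z Y f z" using assms(1,2) unfolding continuous_map_eq_topcontinuous_at by simp
  then have "\<exists>M. openin Z M \<and> z \<in> M \<and> (\<forall>y\<in>M. f y \<in> N)"
    unfolding topcontinuous_at_def using assms(3,4) by simp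
  then show ?thesis using that by metis
qed

lemma openin_prod_subE:
  assumes "openin (subtopology (prod_topology A B) S) M" "(u,v) \<in> M"
  obtains U V where "openin A U" "u \<in> U" "openin B V" "v \<in> V"
    "\<And>e f. e \<in> U \<Longrightarrow> f \<in> V \<Longrightarrow> (e,f) \<in> S \<Longrightarrow> (e,f) \<in> M"
proof -
  obtain M' where M': "openin (prod_topology A B) M'" "M = M' \<inter> S"
    using assms(1) unfolding openin_subtopology by metis
  have "(u,v) \<in> M'" using M' assms(2) by simp
  then obtain U V where "openin A U" "openin B V" "u \<in> U" "v \<in> V" "U \<times> V \<subseteq> M'"
    using M'(1)[unfolded openin_prod_topology_alt] by metis
  then show ?thesis using that[of U V] M'(2) by auto
qed

locale fell_bundle =
  fixes X :: "'x topology" and E :: "('x,'e,'z) bbundle_scheme"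
  assumes banach: "banach_bundle X E"
begin

lemma fiberD: "e \<in> fiber E x \<Longrightarrow> e \<in> topspace (btop E)" "e \<in> fiber E x \<Longrightarrow> bproj E e = x"
  by (auto simp: fiber_def)

lemma fiberI: "e \<in> topspace (btop E) \<Longrightarrow> bproj E e = x \<Longrightarrow> e \<in> fiber E x"
  by (auto simp: fiber_def)

lemmas bundle_rest1 = banach[unfolded banach_bundle_def, THEN conjunct2]
lemmas proj_cont = bundle_rest1[THEN conjunct1]
lemmas bundle_rest2 = bundle_rest1[THEN conjunct2]
lemmas proj_open = bundle_rest2[THEN conjunct1]
lemmas bundle_rest3 = bundle_rest2[THEN conjunct2]
lemmas proj_image = bundle_rest3[THEN conjunct1]
lemmas bundle_rest4 = bundle_rest3[THEN conjunct2]
lemmas add_cont = bundle_rest4[THEN conjunct1]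
lemmas bundle_rest5 = bundle_rest4[THEN conjunct2]
lemmas scale_cont = bundle_rest5[THEN conjunct1]
lemmas bundle_rest6 = bundle_rest5[THEN conjunct2]
lemmas norm_cont = bundle_rest6[THEN conjunct1]
lemmas bundle_rest7 = bundle_rest6[THEN conjunct2]
lemmas fiber_rest1 = bundle_rest7[THEN conjunct1, THEN bspec]
lemmas zero_filter = bundle_rest7[THEN conjunct2]

lemma base: "e \<in> fiber E x \<Longrightarrow> x \<in> topspace X"
  using proj_image unfolding fiber_def by blast

lemma zero_converge:
  fixes F :: "'e filter"
  assumes "x \<in> topspace X" "eventually (\<lambda>e. e \<in> topspace (btop E)) F" "limitin X (bproj E) x F"
    "((\<lambda>e. bnorm E e) \<longlongrightarrow> 0) F"
  shows "limitin (btop E) (\<lambda>e. e) (bzero E x) F"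
  using zero_filter assms by blast

lemmas zero_in [simp] = fiber_rest1[THEN conjunct1]

lemmas fiber_rest2 = fiber_rest1[THEN conjunct2]
lemmas fiber_ax2 = fiber_rest2[THEN conjunct1]
lemmas fiber_rest3 = fiber_rest2[THEN conjunct2]
lemmas fiber_ax3 = fiber_rest3[THEN conjunct1]
lemmas fiber_rest4 = fiber_rest3[THEN conjunct2]
lemmas fiber_ax4 = fiber_rest4[THEN conjunct1]
lemmas fiber_rest5 = fiber_rest4[THEN conjunct2]
lemmas fiber_ax5 = fiber_rest5[THEN conjunct1]
lemmas fiber_rest6 = fiber_rest5[THEN conjunct2]
lemmas fiber_ax6 = fiber_rest6[THEN conjunct1]
lemmas fiber_rest7 = fiber_rest6[THEN conjunct2]
lemmas fiber_ax7 = fiber_rest7[THEN conjunct1]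
lemmas fiber_rest8 = fiber_rest7[THEN conjunct2]
lemmas fiber_ax8 = fiber_rest8[THEN conjunct1]
lemmas fiber_rest9 = fiber_rest8[THEN conjunct2]
lemmas fiber_ax9 = fiber_rest9[THEN conjunct1]
lemmas fiber_rest10 = fiber_rest9[THEN conjunct2]
lemmas fiber_ax10 = fiber_rest10[THEN conjunct1]
lemmas fiber_rest11 = fiber_rest10[THEN conjunct2]
lemmas fiber_ax11 = fiber_rest11[THEN conjunct1]
lemmas fiber_rest12 = fiber_rest11[THEN conjunct2]
lemmas fiber_ax12 = fiber_rest12[THEN conjunct1]
lemmas fiber_rest13 = fiber_rest12[THEN conjunct2]
lemmas fiber_ax13 = fiber_rest13[THEN conjunct1]
lemmas fiber_rest14 = fiber_rest13[THEN conjunct2]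
lemmas fiber_ax14 = fiber_rest14[THEN conjunct1]
lemmas fiber_rest15 = fiber_rest14[THEN conjunct2]

lemma add_in [simp]: "e \<in> fiber E x \<Longrightarrow> f \<in> fiber E x \<Longrightarrow> badd E e f \<in> fiber E x"
  using fiber_ax2[OF base, of e x] by blast

lemma scale_in [simp]: "e \<in> fiber E x \<Longrightarrow> bscale E c e \<in> fiber E x"
  using fiber_ax3[OF base, of e x] by blast

lemma add_assoc: "e \<in> fiber E x \<Longrightarrow> f \<in> fiber E x \<Longrightarrow> g \<in> fiber E x \<Longrightarrow>
      badd E (badd E e f) g = badd E e (badd E f g)"
  using fiber_ax4[OF base, of e x] by blast

lemma add_comm: "e \<in> fiber E x \<Longrightarrow> f \<in> fiber E x \<Longrightarrow> badd E e f = badd E f e"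
  using fiber_ax5[OF base, of e x] by blast

lemma add_zero: "e \<in> fiber E x \<Longrightarrow> badd E e (bzero E x) = e"
  using fiber_ax6[OF base, of e x] by blast

lemma add_neg: "e \<in> fiber E x \<Longrightarrow> badd E e (bscale E (-1) e) = bzero E x"
  using fiber_ax7[OF base, of e x] by blast

lemma scale_one: "e \<in> fiber E x \<Longrightarrow> bscale E 1 e = e"
  using fiber_ax8[OF base, of e x] by blast

lemma scale_scale: "e \<in> fiber E x \<Longrightarrow> bscale E a (bscale E b e) = bscale E (a*b) e"
  using fiber_ax9[OF base, of e x] by blast

lemma scale_add_left: "e \<in> fiber E x \<Longrightarrow> bscale E (a+b) e = badd E (bscale E a e) (bscale E b e)"
  using fiber_ax10[OF base, of e x] by blast

lemma scale_add_right: "e \<in> fiber E x \<Longrightarrow> f \<in> fiber E x \<Longrightarrow>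
      bscale E a (badd E e f) = badd E (bscale E a e) (bscale E a f)"
  using fiber_ax11[OF base, of e x] by blast

lemma norm_ge0: "e \<in> fiber E x \<Longrightarrow> bnorm E e \<ge> 0"
  using fiber_ax12[OF base, of e x] by blast

lemma norm_eq0: "e \<in> fiber E x \<Longrightarrow> bnorm E e = 0 \<longleftrightarrow> e = bzero E x"
  using fiber_ax12[OF base, of e x] by blast

lemma norm_scale: "e \<in> fiber E x \<Longrightarrow> bnorm E (bscale E a e) = \<bar>a\<bar> * bnorm E e"
  using fiber_ax13[OF base, of e x] by blast

lemma norm_tri: "e \<in> fiber E x \<Longrightarrow> f \<in> fiber E x \<Longrightarrow> bnorm E (badd E e f) \<le> bnorm E e + bnorm E f"
  using fiber_ax14[OF base, of e x] by blast

lemma fiber_complete: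
  assumes "\<And>n. S n \<in> fiber E x"
    "\<And>\<epsilon>. \<epsilon> > 0 \<Longrightarrow> \<exists>N. \<forall>m\<ge>N. \<forall>n\<ge>N. bnorm E (bminus E (S m) (S n)) < \<epsilon>"
  obtains l where "l \<in> fiber E x" "(\<lambda>n. bnorm E (bminus E (S n) l)) \<longlonglongrightarrow> 0"
proof -
  have "x \<in> topspace X" using base assms(1) by blast
  then have "\<exists>l\<in>fiber E x. (\<lambda>n. bnorm E (bminus E (S n) l)) \<longlonglongrightarrow> 0"
    using fiber_rest15[of x] assms by blast
  then show ?thesis using that by blast
qed

lemma minus_in [simp]: "e \<in> fiber E x \<Longrightarrow> f \<in> fiber E x \<Longrightarrow> bminus E e f \<in> fiber E x"
  by (simp add: bminus_def)

lemma scale_0: "e \<in> fiber E x \<Longrightarrow> bscale E 0 e = bzero E x"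
  using norm_eq0[of "bscale E 0 e" x] by (simp add: norm_scale)

lemma scale_zero: "x \<in> topspace X \<Longrightarrow> bscale E c (bzero E x) = bzero E x"
  using norm_eq0[of "bscale E c (bzero E x)" x] norm_eq0[of "bzero E x" x]
    norm_scale[of "bzero E x" x c] by simp

lemma minus_eq_zero:
  assumes "e \<in> fiber E x" "f \<in> fiber E x" "bminus E e f = bzero E x" shows "e = f"
proof -
  have x: "x \<in> topspace X" using base assms by blast
  have "f = badd E (bminus E e f) f" using assms x by (simp add: add_zero add_comm[of "bzero E x" x f])
  also have "\<dots> = badd E e (badd E f (bscale E (-1) f))" using assms
    using add_assoc[of e x "bscale E (-1) f" f] add_comm[of "bscale E (-1) f" x f] by (simp add: bminus_def)
  also have "\<dots> = e" using assms by (simp add: add_neg add_zero)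
  finally show ?thesis by simp
qed

section \<open>Sublinear functionals and the dual unit ball of a fiber\<close>

definition sublin :: "'x \<Rightarrow> ('e \<Rightarrow> real) \<Rightarrow> bool" where
  "sublin x p \<longleftrightarrow> (\<forall>e\<in>fiber E x. \<forall>f\<in>fiber E x. p (badd E e f) \<le> p e + p f) \<and>
     (\<forall>t>0. \<forall>e\<in>fiber E x. p (bscale E t e) = t * p e) \<and>
     (\<forall>e\<in>fiber E x. p e \<le> bnorm E e) \<and> (\<forall>e. e \<notin> fiber E x \<longrightarrow> p e = 0)"

text \<open>Only the closed unit ball of the dual space: the bound by the norm itself keeps the
  duality formula for the norm free of constants. Values off the fiber are left arbitrary.\<close>

definition dual :: "'x \<Rightarrow> ('e \<Rightarrow> real) set" where
  "dual x = {\<phi>. (\<forall>e\<in>fiber E x. \<forall>f\<in>fiber E x. \<phi> (badd E e f) = \<phi> e + \<phi> f) \<and>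
     (\<forall>t. \<forall>e\<in>fiber E x. \<phi> (bscale E t e) = t * \<phi> e) \<and> (\<forall>e\<in>fiber E x. \<phi> e \<le> bnorm E e)}"

lemma sublinD:
  assumes "sublin x p"
  shows "e \<in> fiber E x \<Longrightarrow> f \<in> fiber E x \<Longrightarrow> p (badd E e f) \<le> p e + p f"
    "t > 0 \<Longrightarrow> e \<in> fiber E x \<Longrightarrow> p (bscale E t e) = t * p e"
    "e \<in> fiber E x \<Longrightarrow> p e \<le> bnorm E e" "e \<notin> fiber E x \<Longrightarrow> p e = 0"
  using assms unfolding sublin_def by blast+

lemma sublin_zero: assumes "sublin x p" "x \<in> topspace X" shows "p (bzero E x) = 0"
  using sublinD(2)[OF assms(1), of 2 "bzero E x"] assms(2) by (simp add: scale_zero)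

lemma sublin_scale: assumes "sublin x p" "t \<ge> 0" "e \<in> fiber E x" shows "p (bscale E t e) = t * p e"
  using sublinD(2)[OF assms(1), of t e] assms sublin_zero[OF assms(1)] scale_0[of e x] base[of e x]
  by (cases "t = 0") auto

text \<open>This bound keeps the infimum of a family of sublinear functionals finite.\<close>

lemma sublin_lower: assumes "sublin x p" "e \<in> fiber E x" shows "- bnorm E e \<le> p e"
proof -
  have "0 = p (badd E e (bscale E (-1) e))"
    using assms sublin_zero[OF assms(1) base[OF assms(2)]] by (simp add: add_neg)
  also have "\<dots> \<le> p e + p (bscale E (-1) e)" using assms by (simp add: sublinD(1)[of x])
  also have "\<dots> \<le> p e + bnorm E e" using sublinD(3)[OF assms(1), of "bscale E (-1) e"] assms
    by (simp add: norm_scale)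
  finally show ?thesis by simp
qed

text \<open>The parameter \<open>t = 0\<close> gives \<open>q e\<close>, and \<open>t = 1\<close> at
  \<open>e = -a\<close> gives \<open>- q a\<close>. The construction thus lowers \<open>q\<close> to
  a functional whose value at \<open>-a\<close> is at most \<open>- q a\<close>, as linearity along
  \<open>a\<close> demands.\<close>

definition shave :: "'x \<Rightarrow> ('e \<Rightarrow> real) \<Rightarrow> 'e \<Rightarrow> 'e \<Rightarrow> real" where
  "shave x q a e = (if e \<in> fiber E x then INF t\<in>{0..}. q (badd E e (bscale E t a)) - t * q a else 0)"

lemma shave_bdd:
  assumes "sublin x q" "a \<in> fiber E x" "e \<in> fiber E x"
  shows "bdd_below ((\<lambda>t. q (badd E e (bscale E t a)) - t * q a) ` {0..})"
proof (rule bdd_belowI2)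
  fix t :: real assume t: "t \<in> {0..}"
  have "t * q a = q (badd E (badd E e (bscale E t a)) (bscale E (-1) e))"
  proof -
    have "badd E (badd E e (bscale E t a)) (bscale E (-1) e) = badd E (bscale E t a) (badd E e (bscale E (-1) e))"
      using assms
      by (simp add: add_comm[of e x "bscale E t a"] add_assoc[of _ x])
    also have "\<dots> = bscale E t a" using assms by (simp add: add_neg add_zero)
    finally show ?thesis using sublin_scale[OF assms(1) _ assms(2), of t] t by simp
  qed
  also have "\<dots> \<le> q (badd E e (bscale E t a)) + q (bscale E (-1) e)" using assms by (simp add: sublinD(1)[of x])
  also have "q (bscale E (-1) e) \<le> bnorm E e" using sublinD(3)[OF assms(1), of "bscale E (-1) e"] assms
    by (simp add: norm_scale)
  finally show "- bnorm E e \<le> q (badd E e (bscale E t a)) - t * q a" by simp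
qed

lemma shave_le:
  assumes "sublin x q" "a \<in> fiber E x" "e \<in> fiber E x" "t \<ge> 0"
  shows "shave x q a e \<le> q (badd E e (bscale E t a)) - t * q a"
  unfolding shave_def using assms by (auto intro!: cINF_lower shave_bdd)

lemma shave_ge:
  assumes "e \<in> fiber E x" "\<And>t. t \<ge> 0 \<Longrightarrow> c \<le> q (badd E e (bscale E t a)) - t * q a"
  shows "c \<le> shave x q a e"
  unfolding shave_def using assms by (auto intro!: cINF_greatest)

lemma shave_le_self:
  assumes "sublin x q" "a \<in> fiber E x" shows "shave x q a e \<le> q e"
proof (cases "e \<in> fiber E x")
  case True
  then show ?thesis using shave_le[OF assms True, of 0] assms by (simp add: scale_0 add_zero)
next
  case False then show ?thesis using assms by (simp add: shave_def sublinD(4))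
qed

lemma shave_sublin:
  assumes q: "sublin x q" and a: "a \<in> fiber E x" shows "sublin x (shave x q a)"
proof -
  have add: "shave x q a (badd E e f) \<le> shave x q a e + shave x q a f"
    if e: "e \<in> fiber E x" and f: "f \<in> fiber E x" for e f
  proof -
    \<comment> \<open>The parameters of the two infima add: \<open>t\<close> for \<open>e\<close>
      and \<open>s\<close> for \<open>f\<close> give the admissible parameter \<open>t + s\<close>
      for the sum.\<close>
    have *: "shave x q a (badd E e f) \<le> (q (badd E e (bscale E t a)) - t * q a) + (q (badd E f (bscale E s a)) - s * q a)"
      if "t \<ge> 0" "s \<ge> 0" for t s
    proof -
      have "badd E (badd E e f) (bscale E (t+s) a) = badd E (badd E e (bscale E t a)) (badd E f (bscale E s a))"
      proof -
        have "badd E (badd E e f) (bscale E (t+s) a) = badd E e (badd E (badd E f (bscale E t a)) (bscale E s a))"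
          using e f a by (simp add: scale_add_left[of _ x] add_assoc[of _ x])
        also have "\<dots> = badd E e (badd E (badd E (bscale E t a) f) (bscale E s a))"
          using e f a by (simp add: add_comm[of f x])
        also have "\<dots> = badd E (badd E e (bscale E t a)) (badd E f (bscale E s a))"
          using e f a by (simp add: add_assoc[of _ x])
        finally show ?thesis .
      qed
      moreover have "shave x q a (badd E e f) \<le> q (badd E (badd E e f) (bscale E (t+s) a)) - (t+s) * q a"
        using shave_le[OF q a, of "badd E e f" "t+s"] e f that by simp
      moreover have "q (badd E (badd E e (bscale E t a)) (badd E f (bscale E s a)))
         \<le> q (badd E e (bscale E t a)) + q (badd E f (bscale E s a))"
        using e f a by (intro sublinD(1)[OF q]) auto
      ultimately show ?thesis by (simp add: algebra_simps)
    qed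
    have "shave x q a (badd E e f) - (q (badd E f (bscale E s a)) - s * q a) \<le> shave x q a e" if "s \<ge> 0" for s
      using *[OF _ that] by (intro shave_ge e) (simp add: algebra_simps)
    then have "shave x q a (badd E e f) - shave x q a e \<le> shave x q a f"
      by (intro shave_ge f) (simp add: algebra_simps)
    then show ?thesis by simp
  qed
  \<comment> \<open>Replacing the parameter \<open>t\<close> by \<open>r * t\<close> gives this
    inequality; the same inequality with the factor \<open>1/r\<close> gives the converse.\<close>
  have half: "shave x q a (bscale E r e) \<le> r * shave x q a e" if r: "r > 0" and e: "e \<in> fiber E x" for r e
  proof -
    have "shave x q a (bscale E r e) / r \<le> shave x q a e"
    proof (rule shave_ge[OF e])
      fix t :: real assume t: "t \<ge> 0"
      have "shave x q a (bscale E r e) \<le> q (badd E (bscale E r e) (bscale E (r*t) a)) - (r*t) * q a"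
        using shave_le[OF q a, of "bscale E r e" "r*t"] e r t by simp
      also have "badd E (bscale E r e) (bscale E (r*t) a) = bscale E r (badd E e (bscale E t a))"
        using e a by (simp add: scale_add_right scale_scale)
      also have "q \<dots> = r * q (badd E e (bscale E t a))" using e a r by (simp add: sublinD(2)[OF q])
      finally show "shave x q a (bscale E r e) / r \<le> q (badd E e (bscale E t a)) - t * q a"
        using r by (simp add: field_simps)
    qed
    then show ?thesis using r by (simp add: field_simps)
  qed
  have hom: "shave x q a (bscale E r e) = r * shave x q a e" if r: "r > 0" and e: "e \<in> fiber E x" for r e
  proof (rule antisym[OF half[OF r e]])
    have "shave x q a (bscale E (1/r) (bscale E r e)) \<le> (1/r) * shave x q a (bscale E r e)"
      using r e by (intro half) auto
    then show "r * shave x q a e \<le> shave x q a (bscale E r e)" using r e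
      by (simp add: scale_scale scale_one field_simps)
  qed
  have "shave x q a e \<le> bnorm E e" if "e \<in> fiber E x" for e
    using shave_le_self[OF q a, of e] sublinD(3)[OF q that] by simp
  then show ?thesis unfolding sublin_def using add hom by (auto simp: shave_def)
qed

text \<open>Of two members of a chain one lies below both, and it bounds the value at a sum by mixed
  values of the two; this is how subadditivity passes to the infimum.\<close>

lemma sublin_chain_Inf:
  assumes ne: "C \<noteq> {}" and C: "\<And>p. p \<in> C \<Longrightarrow> sublin x p"
    and chain: "\<And>p q. p \<in> C \<Longrightarrow> q \<in> C \<Longrightarrow> p \<le> q \<or> q \<le> p"
  defines "u \<equiv> (\<lambda>e. if e \<in> fiber E x then INF p\<in>C. p e else 0)"
  shows "sublin x u" "\<And>p. p \<in> C \<Longrightarrow> u \<le> p"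
proof -
  have bdd: "bdd_below ((\<lambda>p. p e) ` C)" if "e \<in> fiber E x" for e
    by (rule bdd_belowI2[of _ "- bnorm E e"]) (use C sublin_lower that in auto)
  have le: "u e \<le> p e" if "e \<in> fiber E x" "p \<in> C" for e p
    using that bdd by (auto simp: u_def intro: cINF_lower)
  have ge: "c \<le> u e" if "e \<in> fiber E x" "\<And>p. p \<in> C \<Longrightarrow> c \<le> p e" for e c
    using that ne by (auto simp: u_def intro: cINF_greatest)
  show "u \<le> p" if "p \<in> C" for p
  proof (rule le_funI)
    fix e show "u e \<le> p e" using le[of e p] sublinD(4)[OF C[OF that], of e] that by (auto simp: u_def)
  qed
  have add: "u (badd E e f) \<le> u e + u f" if e: "e \<in> fiber E x" and f: "f \<in> fiber E x" for e f
  proof -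
    have *: "u (badd E e f) \<le> p e + q f" if pq: "p \<in> C" "q \<in> C" for p q
    proof -
      obtain m where m: "m \<in> C" "m \<le> p" "m \<le> q" using chain[OF pq] pq by blast
      have "u (badd E e f) \<le> m (badd E e f)" using le m e f by simp
      also have "\<dots> \<le> m e + m f" using sublinD(1)[OF C[OF m(1)] e f] .
      also have "\<dots> \<le> p e + q f" using m by (simp add: add_mono le_funD)
      finally show ?thesis .
    qed
    have "u (badd E e f) - q f \<le> u e" if "q \<in> C" for q
      using *[OF _ that] by (intro ge e) (simp add: algebra_simps)
    then have "u (badd E e f) - u e \<le> u f" by (intro ge f) (simp add: algebra_simps)
    then show ?thesis by simp
  qed
  have half: "u (bscale E r e) \<le> r * u e" if r: "r > 0" and e: "e \<in> fiber E x" for r e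
  proof -
    have "u (bscale E r e) / r \<le> u e"
    proof (rule ge[OF e])
      fix p assume p: "p \<in> C"
      have "u (bscale E r e) \<le> p (bscale E r e)" using le p e by simp
      also have "\<dots> = r * p e" using sublinD(2)[OF C[OF p] r e] .
      finally show "u (bscale E r e) / r \<le> p e" using r by (simp add: field_simps)
    qed
    then show ?thesis using r by (simp add: field_simps)
  qed
  have hom: "u (bscale E r e) = r * u e" if r: "r > 0" and e: "e \<in> fiber E x" for r e
  proof (rule antisym[OF half[OF r e]])
    have "u (bscale E (1/r) (bscale E r e)) \<le> (1/r) * u (bscale E r e)"
      using r e by (intro half) auto
    then show "r * u e \<le> u (bscale E r e)" using r e
      by (simp add: scale_scale scale_one field_simps)
  qed
  obtain p where p: "p \<in> C" using ne by blast
  have "u e \<le> bnorm E e" if "e \<in> fiber E x" for e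
    using le[OF that p] sublinD(3)[OF C[OF p] that] by simp
  then show "sublin x u" unfolding sublin_def using add hom by (auto simp: u_def)
qed

text \<open>A minimal sublinear functional is linear, because shaving it along any direction
  cannot decrease it; this proves Hahn--Banach in a form that needs no subspaces.\<close>

lemma hahn_banach:
  assumes v: "v \<in> fiber E x"
  obtains \<phi> where "\<phi> \<in> dual x" "\<phi> v = bnorm E v"
proof -
  have x: "x \<in> topspace X" using base v .
  define n where "n = (\<lambda>e. if e \<in> fiber E x then bnorm E e else 0)"
  have n: "sublin x n" unfolding sublin_def n_def by (auto simp: norm_tri norm_scale)
  \<comment> \<open>Shaving the norm along \<open>v\<close> forces
    \<open>q (-v) \<le> - bnorm E v\<close>, so any linear functional below \<open>q\<close> is at
    least \<open>bnorm E v\<close> at \<open>v\<close>.\<close>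
  define q where "q = shave x n v"
  have q: "sublin x q" using shave_sublin[OF n v] by (simp add: q_def)
  have "q (bscale E (-1) v) \<le> n (badd E (bscale E (-1) v) (bscale E 1 v)) - 1 * n v"
    unfolding q_def by (rule shave_le[OF n v]) (use v in auto)
  also have "badd E (bscale E (-1) v) (bscale E 1 v) = bzero E x"
    using v by (simp add: scale_one add_comm[of _ x v] add_neg)
  finally have qv: "q (bscale E (-1) v) \<le> - bnorm E v"
    using sublin_zero[OF n x] v by (simp add: n_def)
  \<comment> \<open>Zorn's lemma yields maximal elements, hence the reversed order. Sublinear
    functionals are 0 off the fiber by definition, so comparing functions on the whole type amounts
    to comparing them on the fiber.\<close>
  define P where "P = (\<lambda>(a::'e\<Rightarrow>real) b. b \<le> a)"
  define S where "S = {p. sublin x p \<and> p \<le> q}"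
  have "\<exists>m\<in>S. \<forall>a\<in>S. P m a \<longrightarrow> a = m"
  proof (rule predicate_Zorn)
    show "partial_order_on S (relation_of P S)"
      by (rule partial_order_on_relation_ofI) (auto simp: P_def)
    fix C assume C: "C \<in> Chains (relation_of P S)"
    then have CS: "C \<subseteq> S" unfolding Chains_def relation_of_def by blast
    have ch: "p \<le> r \<or> r \<le> p" if "p \<in> C" "r \<in> C" for p r
      using C that unfolding Chains_def relation_of_def P_def by blast
    show "\<exists>u\<in>S. \<forall>a\<in>C. P a u"
    proof (cases "C = {}")
      case True then show ?thesis using q by (auto simp: S_def)
    next
      case False
      have Cs: "\<And>p. p \<in> C \<Longrightarrow> sublin x p" using CS by (auto simp: S_def)
      define u where "u = (\<lambda>e. if e \<in> fiber E x then INF p\<in>C. p e else 0)"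
      have u: "sublin x u" "\<And>p. p \<in> C \<Longrightarrow> u \<le> p"
        using sublin_chain_Inf[OF False Cs ch] unfolding u_def by auto
      obtain p where "p \<in> C" using False by blast
      then have "u \<le> q" using u(2)[of p] CS by (auto simp: S_def intro: order_trans)
      then show ?thesis using u by (intro bexI[of _ u]) (auto simp: S_def P_def)
    qed
  qed
  then obtain m where m: "sublin x m" "m \<le> q" and min: "\<And>a. sublin x a \<Longrightarrow> a \<le> m \<Longrightarrow> a = m"
    unfolding S_def P_def by (auto intro: order_trans)
  have add: "m (badd E e a) = m e + m a" if e: "e \<in> fiber E x" and a: "a \<in> fiber E x" for e a
  proof -
    have "shave x m a = m"
      using shave_sublin[OF m(1) a] shave_le_self[OF m(1) a] by (intro min) (auto simp: le_fun_def)
    then have "m e \<le> m (badd E e (bscale E 1 a)) - 1 * m a"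
      using shave_le[OF m(1) a e, of 1] by simp
    then show ?thesis using sublinD(1)[OF m(1) e a] a by (simp add: scale_one)
  qed
  have neg: "m (bscale E (-1) e) = - m e" if e: "e \<in> fiber E x" for e
    using add[of e "bscale E (-1) e"] e sublin_zero[OF m(1) x] by (simp add: add_neg)
  have hom: "m (bscale E t e) = t * m e" if e: "e \<in> fiber E x" for t e
  proof (cases "t \<ge> 0")
    case True then show ?thesis using sublin_scale[OF m(1) _ e] by simp
  next
    case False
    have "m (bscale E t e) = m (bscale E (-1) (bscale E (-t) e))" using e by (simp add: scale_scale)
    also have "\<dots> = - m (bscale E (-t) e)" using neg e by simp
    also have "\<dots> = t * m e" using sublin_scale[OF m(1) _ e, of "-t"] False by simp
    finally show ?thesis .
  qed
  have "m \<in> dual x" unfolding dual_def using add hom sublinD(3)[OF m(1)] by auto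
  moreover have "m v = bnorm E v"
    using qv neg[OF v] sublinD(3)[OF m(1) v] le_funD[OF m(2), of "bscale E (-1) v"] by linarith
  ultimately show ?thesis using that by blast
qed

lemma dual_add [simp]: "\<phi> \<in> dual x \<Longrightarrow> e \<in> fiber E x \<Longrightarrow> f \<in> fiber E x \<Longrightarrow> \<phi> (badd E e f) = \<phi> e + \<phi> f"
  and dual_scale [simp]: "\<phi> \<in> dual x \<Longrightarrow> e \<in> fiber E x \<Longrightarrow> \<phi> (bscale E t e) = t * \<phi> e"
  and dual_le: "\<phi> \<in> dual x \<Longrightarrow> e \<in> fiber E x \<Longrightarrow> \<phi> e \<le> bnorm E e"
  unfolding dual_def by auto

lemma dual_minus [simp]: "\<phi> \<in> dual x \<Longrightarrow> e \<in> fiber E x \<Longrightarrow> f \<in> fiber E x \<Longrightarrow> \<phi> (bminus E e f) = \<phi> e - \<phi> f"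
  by (simp add: bminus_def)

lemma dual_zero [simp]: "\<phi> \<in> dual x \<Longrightarrow> x \<in> topspace X \<Longrightarrow> \<phi> (bzero E x) = 0"
  using dual_scale[of \<phi> x "bzero E x" 0] by (simp add: scale_zero)

lemma dual_abs: "\<phi> \<in> dual x \<Longrightarrow> e \<in> fiber E x \<Longrightarrow> \<bar>\<phi> e\<bar> \<le> bnorm E e"
  using dual_le[of \<phi> x e] dual_le[of \<phi> x "bscale E (-1) e"] by (simp add: norm_scale)

text \<open>One-sided bounds suffice because some functional of the dual unit ball attains the
  norm.\<close>

lemma norm_leI: "e \<in> fiber E x \<Longrightarrow> (\<And>\<phi>. \<phi> \<in> dual x \<Longrightarrow> \<phi> e \<le> C) \<Longrightarrow> bnorm E e \<le> C"
  using hahn_banach by metis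

lemma fiber_eqI:
  assumes "e \<in> fiber E x" "f \<in> fiber E x" "\<And>\<phi>. \<phi> \<in> dual x \<Longrightarrow> \<phi> e = \<phi> f" shows "e = f"
proof (rule minus_eq_zero[OF assms(1,2)])
  have "\<phi> (bminus E e f) \<le> 0" if "\<phi> \<in> dual x" for \<phi>
    using assms(3)[OF that] assms(1,2) that by simp
  then have "bnorm E (bminus E e f) \<le> 0" using assms by (intro norm_leI[of _ x]) auto
  then have "bnorm E (bminus E e f) = 0" using norm_ge0[of "bminus E e f" x] assms by auto
  then show "bminus E e f = bzero E x" using norm_eq0[of "bminus E e f" x] assms by simp
qed

lemma norm_minus_commute: "e \<in> fiber E x \<Longrightarrow> f \<in> fiber E x \<Longrightarrow> bnorm E (bminus E e f) = bnorm E (bminus E f e)"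
proof -
  assume *: "e \<in> fiber E x" "f \<in> fiber E x"
  then have "bminus E e f = bscale E (-1) (bminus E f e)" by (intro fiber_eqI[of _ x]) auto
  then show ?thesis using norm_scale[of "bminus E f e" x "-1"] * by simp
qed

lemma norm_minus_tri:
  assumes "e \<in> fiber E x" "f \<in> fiber E x" "g \<in> fiber E x"
  shows "bnorm E (bminus E e g) \<le> bnorm E (bminus E e f) + bnorm E (bminus E f g)"
proof (rule norm_leI[of _ x])
  fix \<phi> assume \<phi>: "\<phi> \<in> dual x"
  have "\<phi> (bminus E e g) = \<phi> (bminus E e f) + \<phi> (bminus E f g)" using \<phi> assms by simp
  also have "\<dots> \<le> bnorm E (bminus E e f) + bnorm E (bminus E f g)"
    using \<phi> assms by (intro add_mono dual_le[of _ x]) auto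
  finally show "\<phi> (bminus E e g) \<le> \<dots>" .
qed (use assms in auto)

lemma norm_le_minus:
  assumes "e \<in> fiber E x" "f \<in> fiber E x"
  shows "bnorm E e \<le> bnorm E f + bnorm E (bminus E e f)"
proof (rule norm_leI[of _ x])
  fix \<phi> assume \<phi>: "\<phi> \<in> dual x"
  have "\<phi> e = \<phi> f + \<phi> (bminus E e f)" using \<phi> assms by simp
  also have "\<dots> \<le> bnorm E f + bnorm E (bminus E e f)" using \<phi> assms by (intro add_mono dual_le[of _ x]) auto
  finally show "\<phi> e \<le> \<dots>" .
qed (use assms in auto)

lemma norm_minus_self: "e \<in> fiber E x \<Longrightarrow> bnorm E (bminus E e e) = 0"
  using norm_eq0[of "bminus E e e" x] by (simp add: bminus_def add_neg base)

lemma norm_zero [simp]: "x \<in> topspace X \<Longrightarrow> bnorm E (bzero E x) = 0"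
  using norm_eq0[of "bzero E x" x] by simp

section \<open>Continuity criteria in a Banach bundle\<close>

lemma cont_add:
  assumes "continuous_map Z (btop E) u" "continuous_map Z (btop E) v"
    "\<And>z. z \<in> topspace Z \<Longrightarrow> bproj E (u z) = bproj E (v z)"
  shows "continuous_map Z (btop E) (\<lambda>z. badd E (u z) (v z))"
proof -
  have "continuous_map Z (subtopology (prod_topology (btop E) (btop E)) (fibered_pairs E)) (\<lambda>z. (u z, v z))"
    using assms continuous_map_image_subset_topspace[OF assms(1)] continuous_map_image_subset_topspace[OF assms(2)]
    by (auto simp: continuous_map_in_subtopology fibered_pairs_def intro!: continuous_map_pairedI)
  from continuous_map_compose[OF this add_cont] show ?thesis by (simp add: o_def)
qed

lemma cont_scale:
  assumes "continuous_map Z euclideanreal a" "continuous_map Z (btop E) v"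
  shows "continuous_map Z (btop E) (\<lambda>z. bscale E (a z) (v z))"
proof -
  have "continuous_map Z (prod_topology euclideanreal (btop E)) (\<lambda>z. (a z, v z))"
    using assms by (auto intro!: continuous_map_pairedI)
  from continuous_map_compose[OF this scale_cont] show ?thesis by (simp add: o_def)
qed

lemma cont_fiber_proj: "e \<in> topspace (btop E) \<Longrightarrow> bproj E (bscale E c e) = bproj E e"
  using scale_in[of e "bproj E e" c] by (auto simp: fiber_def)

lemma cont_minus:
  assumes "continuous_map Z (btop E) u" "continuous_map Z (btop E) v"
    "\<And>z. z \<in> topspace Z \<Longrightarrow> bproj E (u z) = bproj E (v z)"
  shows "continuous_map Z (btop E) (\<lambda>z. bminus E (u z) (v z))"
  unfolding bminus_def using assms continuous_map_image_subset_topspace[OF assms(2)]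
  by (intro cont_add cont_scale) (auto simp: cont_fiber_proj)

lemma cont_norm:
  assumes "continuous_map Z (btop E) u"
  shows "continuous_map Z euclideanreal (\<lambda>z. bnorm E (u z))"
  using continuous_map_compose[OF assms norm_cont] by (simp add: o_def)

lemma cont_proj:
  assumes "continuous_map Z (btop E) u"
  shows "continuous_map Z X (\<lambda>z. bproj E (u z))"
  using continuous_map_compose[OF assms proj_cont] by (simp add: o_def)

text \<open>The axiom on nets is applied to the coarsest filter that converges to \<open>x\<close>
  in the base and has norm tending to 0. It then says that a tube of small vectors over a
  neighbourhood of \<open>x\<close> fits into every neighbourhood of the zero vector.\<close>

lemma zero_nbhd:
  assumes x: "x \<in> topspace X" and U: "openin (btop E) U" "bzero E x \<in> U"
  obtains \<epsilon> B where "\<epsilon> > 0" "openin X B" "x \<in> B"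
    "\<And>e. e \<in> topspace (btop E) \<Longrightarrow> bproj E e \<in> B \<Longrightarrow> bnorm E e < \<epsilon> \<Longrightarrow> e \<in> U"
proof -
  define F where "F = inf (inf (filtercomap (bproj E) (nhdsin X x)) (filtercomap (bnorm E) (nhds 0)))
      (principal (topspace (btop E)))"
  have "limitin (btop E) (\<lambda>e. e) (bzero E x) F"
  proof (rule zero_converge[OF x])
    show "eventually (\<lambda>e. e \<in> topspace (btop E)) F" unfolding F_def eventually_inf_principal by simp
    show "limitin X (bproj E) x F" unfolding limitin_def
    proof (intro conjI allI impI x)
      fix B assume "openin X B \<and> x \<in> B"
      then have "eventually (\<lambda>y. y \<in> B) (nhdsin X x)" unfolding eventually_nhdsin by blast
      then have "eventually (\<lambda>e. bproj E e \<in> B) (filtercomap (bproj E) (nhdsin X x))"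
        by (rule eventually_filtercomapI)
      then show "eventually (\<lambda>e. bproj E e \<in> B) F" unfolding F_def
        by (rule filter_leD[rotated]) (simp add: le_infI1)
    qed
    show "((\<lambda>e. bnorm E e) \<longlongrightarrow> 0) F" unfolding F_def
      by (simp add: filterlim_iff_le_filtercomap le_infI1)
  qed
  then have "eventually (\<lambda>e. e \<in> U) F" using U unfolding limitin_def by blast
  then have "eventually (\<lambda>e. e \<in> topspace (btop E) \<longrightarrow> e \<in> U)
      (inf (filtercomap (bproj E) (nhdsin X x)) (filtercomap (bnorm E) (nhds 0)))"
    unfolding F_def eventually_inf_principal .
  then obtain Q' R' where Q': "eventually Q' (filtercomap (bproj E) (nhdsin X x))"
    and R': "eventually R' (filtercomap (bnorm E) (nhds 0))"
    and QR': "\<And>e. Q' e \<Longrightarrow> R' e \<Longrightarrow> e \<in> topspace (btop E) \<Longrightarrow> e \<in> U"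
    unfolding eventually_inf by metis
  obtain Q where Q: "eventually Q (nhdsin X x)" "\<And>e. Q (bproj E e) \<Longrightarrow> Q' e"
    using Q' unfolding eventually_filtercomap by metis
  obtain R where R: "eventually R (nhds (0::real))" "\<And>e. R (bnorm E e) \<Longrightarrow> R' e"
    using R' unfolding eventually_filtercomap by metis
  have QR: "\<And>e. e \<in> topspace (btop E) \<Longrightarrow> Q (bproj E e) \<Longrightarrow> R (bnorm E e) \<Longrightarrow> e \<in> U"
    using QR' Q(2) R(2) by metis
  obtain B where B: "openin X B" "x \<in> B" "\<And>y. y \<in> B \<Longrightarrow> Q y" using Q(1) x unfolding eventually_nhdsin by metis
  obtain \<epsilon> where \<epsilon>: "\<epsilon> > 0" "\<And>r. dist r 0 < \<epsilon> \<Longrightarrow> R r" using R(1) unfolding eventually_nhds_metric by metis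
  show ?thesis
  proof (rule that[OF \<epsilon>(1) B(1,2)])
    fix e assume e: "e \<in> topspace (btop E)" "bproj E e \<in> B" "bnorm E e < \<epsilon>"
    have "bnorm E e \<ge> 0" using norm_ge0[OF fiberI[OF e(1) refl]] .
    then show "e \<in> U" using QR[OF e(1)] B(3)[OF e(2)] \<epsilon>(2)[of "bnorm E e"] e(3) by simp
  qed
qed

text \<open>Continuity of addition at \<open>(v, 0)\<close> carries \<open>zero_nbhd\<close> to
  \<open>v\<close>. The tube is centred at every \<open>e\<close> of \<open>V\<close>, in whatever
  fiber it lies, instead of along a section through \<open>v\<close>.\<close>

lemma vec_nbhd:
  assumes v: "v \<in> topspace (btop E)" and N: "openin (btop E) N" "v \<in> N"
  obtains \<epsilon> V where "\<epsilon> > 0" "openin (btop E) V" "v \<in> V"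
    "\<And>e f. e \<in> V \<Longrightarrow> f \<in> topspace (btop E) \<Longrightarrow> bproj E f = bproj E e \<Longrightarrow> bnorm E (bminus E f e) < \<epsilon> \<Longrightarrow> f \<in> N"
proof -
  let ?x = "bproj E v"
  have vf: "v \<in> fiber E ?x" using v by (simp add: fiber_def)
  have x: "?x \<in> topspace X" using base[OF vf] .
  let ?P = "subtopology (prod_topology (btop E) (btop E)) (fibered_pairs E)"
  have "(v, bzero E ?x) \<in> topspace ?P" using v zero_in[OF x]
    by (auto simp: fibered_pairs_def fiber_def)
  moreover have "(\<lambda>(e,f). badd E e f) (v, bzero E ?x) \<in> N" using N add_zero[OF vf] by simp
  ultimately obtain M where M: "openin ?P M" "(v, bzero E ?x) \<in> M" "\<And>y. y \<in> M \<Longrightarrow> (\<lambda>(e,f). badd E e f) y \<in> N"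
    using continuous_map_openD[OF add_cont _ N(1)] by metis
  obtain V U where VU: "openin (btop E) V" "v \<in> V" "openin (btop E) U" "bzero E ?x \<in> U"
    "\<And>e f. e \<in> V \<Longrightarrow> f \<in> U \<Longrightarrow> (e,f) \<in> fibered_pairs E \<Longrightarrow> (e,f) \<in> M"
    using openin_prod_subE[OF M(1,2)] by metis
  obtain \<epsilon> B where B: "\<epsilon> > 0" "openin X B" "?x \<in> B"
    "\<And>e. e \<in> topspace (btop E) \<Longrightarrow> bproj E e \<in> B \<Longrightarrow> bnorm E e < \<epsilon> \<Longrightarrow> e \<in> U"
    using zero_nbhd[OF x VU(3,4)] by metis
  define V' where "V' = {e \<in> topspace (btop E). bproj E e \<in> B} \<inter> V"
  show ?thesis
  proof (rule that[OF B(1)])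
    show "openin (btop E) V'" unfolding V'_def
      using openin_continuous_map_preimage[OF proj_cont B(2)] VU(1) by blast
    show "v \<in> V'" unfolding V'_def using v B VU by auto
    fix e f assume e: "e \<in> V'" and f: "f \<in> topspace (btop E)" "bproj E f = bproj E e" "bnorm E (bminus E f e) < \<epsilon>"
    let ?y = "bproj E e"
    have ef: "e \<in> fiber E ?y" "f \<in> fiber E ?y" using e f by (auto simp: fiber_def V'_def)
    have d: "bminus E f e \<in> fiber E ?y" using ef by simp
    have "bminus E f e \<in> U" using B(4)[of "bminus E f e"] d e f by (auto simp: fiber_def V'_def)
    then have "(e, bminus E f e) \<in> M" using e d by (intro VU(5)) (auto simp: V'_def fibered_pairs_def fiber_def)
    then have "badd E e (bminus E f e) \<in> N" using M(3) by fastforce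
    moreover have "badd E e (bminus E f e) = f" by (rule fiber_eqI[of _ ?y]) (use ef in auto)
    ultimately show "f \<in> N" by simp
  qed
qed

text \<open>Over each nearby point a single comparison vector from a given neighbourhood of
  \<open>J z\<close> is enough; \<open>vec_nbhd\<close> absorbs the remaining distance.\<close>

lemma cont_crit:
  assumes J: "\<And>z. z \<in> topspace Z \<Longrightarrow> J z \<in> fiber E (\<pi> z)"
    and crit: "\<And>z V \<epsilon>. z \<in> topspace Z \<Longrightarrow> openin (btop E) V \<Longrightarrow> J z \<in> V \<Longrightarrow> \<epsilon> > 0 \<Longrightarrow>
      \<exists>N. openin Z N \<and> z \<in> N \<and> (\<forall>y\<in>N. \<exists>e\<in>V. e \<in> fiber E (\<pi> y) \<and> bnorm E (bminus E (J y) e) < \<epsilon>)"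
  shows "continuous_map Z (btop E) J"
proof (rule continuous_map_openI)
  show "J z \<in> topspace (btop E)" if "z \<in> topspace Z" for z using J[OF that] fiberD by blast
  fix z N assume z: "z \<in> topspace Z" and N: "openin (btop E) N" "J z \<in> N"
  have "J z \<in> topspace (btop E)" using J[OF z] fiberD by blast
  then obtain \<epsilon> V where V: "\<epsilon> > 0" "openin (btop E) V" "J z \<in> V"
    "\<And>e f. e \<in> V \<Longrightarrow> f \<in> topspace (btop E) \<Longrightarrow> bproj E f = bproj E e \<Longrightarrow> bnorm E (bminus E f e) < \<epsilon> \<Longrightarrow> f \<in> N"
    using vec_nbhd N by metis
  obtain M where M: "openin Z M" "z \<in> M" "\<forall>y\<in>M. \<exists>e\<in>V. e \<in> fiber E (\<pi> y) \<and> bnorm E (bminus E (J y) e) < \<epsilon>"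
    using crit[OF z V(2,3,1)] by blast
  have "J y \<in> N" if y: "y \<in> M" for y
  proof -
    have "y \<in> topspace Z" using M y openin_subset by blast
    then show ?thesis using M(3) y V(4) J[of y] fiberD by metis
  qed
  then show "\<exists>M. openin Z M \<and> z \<in> M \<and> (\<forall>y\<in>M. J y \<in> N)" using M by blast
qed

text \<open>Openness of the projection stands in for a local section: all fibers near that of
  \<open>v\<close> meet \<open>V\<close>.\<close>

lemma lift_nbhd:
  assumes "continuous_map Z X \<pi>" "z \<in> topspace Z" "openin (btop E) V" "v \<in> V" "bproj E v = \<pi> z"
  obtains N where "openin Z N" "z \<in> N" "\<And>y. y \<in> N \<Longrightarrow> \<exists>e\<in>V. e \<in> fiber E (\<pi> y)"
proof -
  have "openin X (bproj E ` V)" using proj_open assms(3) by (simp add: open_map_def)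
  moreover have "\<pi> z \<in> bproj E ` V" using assms by force
  ultimately obtain N where N: "openin Z N" "z \<in> N" "\<And>y. y \<in> N \<Longrightarrow> \<pi> y \<in> bproj E ` V"
    using continuous_map_openD[OF assms(1,2)] by metis
  show ?thesis
  proof (rule that[OF N(1,2)])
    fix y assume "y \<in> N"
    then obtain e where "e \<in> V" "bproj E e = \<pi> y" using N(3) by (metis imageE)
    then show "\<exists>e\<in>V. e \<in> fiber E (\<pi> y)" using openin_subset[OF assms(3)] by (auto simp: fiber_def)
  qed
qed

lemma dist_nbhd:
  assumes "u \<in> fiber E x" "v \<in> fiber E x" "bnorm E (bminus E u v) < \<epsilon>"
  obtains U V where "openin (btop E) U" "u \<in> U" "openin (btop E) V" "v \<in> V"
    "\<And>e f. e \<in> U \<Longrightarrow> f \<in> V \<Longrightarrow> bproj E e = bproj E f \<Longrightarrow> bnorm E (bminus E e f) < \<epsilon>"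
proof -
  let ?P = "subtopology (prod_topology (btop E) (btop E)) (fibered_pairs E)"
  have fst: "continuous_map ?P (btop E) fst" and snd: "continuous_map ?P (btop E) snd"
    by (auto intro: continuous_map_from_subtopology continuous_map_fst continuous_map_snd)
  have "continuous_map ?P euclideanreal (\<lambda>p. bnorm E (bminus E (fst p) (snd p)))"
    by (intro cont_norm cont_minus fst snd) (auto simp: fibered_pairs_def)
  moreover have "(u,v) \<in> topspace ?P" using assms by (auto simp: fibered_pairs_def fiber_def)
  moreover have "openin euclideanreal {..<\<epsilon>}" by auto
  ultimately obtain M where M: "openin ?P M" "(u,v) \<in> M"
    "\<And>y. y \<in> M \<Longrightarrow> bnorm E (bminus E (fst y) (snd y)) \<in> {..<\<epsilon>}"
    using continuous_map_openD[of ?P euclideanreal "\<lambda>p. bnorm E (bminus E (fst p) (snd p))" "(u,v)" "{..<\<epsilon>}"]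
      assms(3) by auto
  obtain U V where VU: "openin (btop E) U" "u \<in> U" "openin (btop E) V" "v \<in> V"
    "\<And>e f. e \<in> U \<Longrightarrow> f \<in> V \<Longrightarrow> (e,f) \<in> fibered_pairs E \<Longrightarrow> (e,f) \<in> M"
    using openin_prod_subE[OF M(1,2)] by metis
  show ?thesis
  proof (rule that[OF VU(1-4)])
    fix e f assume "e \<in> U" "f \<in> V" "bproj E e = bproj E f"
    then have "(e,f) \<in> M" using openin_subset[OF VU(1)] openin_subset[OF VU(3)]
      by (intro VU(5)) (auto simp: fibered_pairs_def)
    then show "bnorm E (bminus E e f) < \<epsilon>" using M(3) by fastforce
  qed
qed

text \<open>The comparison vector \<open>v\<close> is only near \<open>J z\<close>, and its
  neighbourhood may be chosen freely; in exchange the estimate must hold against all vectors of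
  \<open>V\<close>. It reduces to \<open>cont_crit\<close> because over one and the same point there
  are vectors close to \<open>J z\<close> and vectors close to \<open>v\<close>, at small distance
  from each other by \<open>dist_nbhd\<close>.\<close>

lemma cont_crit2:
  assumes J: "\<And>z. z \<in> topspace Z \<Longrightarrow> J z \<in> fiber E (\<pi> z)" and \<pi>: "continuous_map Z X \<pi>"
    and crit: "\<And>z \<epsilon>. z \<in> topspace Z \<Longrightarrow> \<epsilon> > 0 \<Longrightarrow>
      \<exists>v V N. v \<in> fiber E (\<pi> z) \<and> bnorm E (bminus E (J z) v) < \<epsilon> \<and> openin (btop E) V \<and> v \<in> V \<and>
        openin Z N \<and> z \<in> N \<and>
        (\<forall>y\<in>N. \<forall>e\<in>V. e \<in> fiber E (\<pi> y) \<longrightarrow> bnorm E (bminus E (J y) e) < \<epsilon>)"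
  shows "continuous_map Z (btop E) J"
proof (rule cont_crit[OF J])
  fix z V0 and \<epsilon>0 :: real
  assume z: "z \<in> topspace Z" and V0: "openin (btop E) V0" "J z \<in> V0" and "\<epsilon>0 > 0"
  then obtain v V N where v: "v \<in> fiber E (\<pi> z)" "bnorm E (bminus E (J z) v) < \<epsilon>0/2"
    "openin (btop E) V" "v \<in> V" "openin Z N" "z \<in> N"
    and c: "\<And>y e. y \<in> N \<Longrightarrow> e \<in> V \<Longrightarrow> e \<in> fiber E (\<pi> y) \<Longrightarrow> bnorm E (bminus E (J y) e) < \<epsilon>0/2"
    using crit[of z "\<epsilon>0/2"] by auto
  obtain U1 U2 where U: "openin (btop E) U1" "J z \<in> U1" "openin (btop E) U2" "v \<in> U2"
    "\<And>e f. e \<in> U1 \<Longrightarrow> f \<in> U2 \<Longrightarrow> bproj E e = bproj E f \<Longrightarrow> bnorm E (bminus E e f) < \<epsilon>0/2"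
    using dist_nbhd[OF J[OF z] v(1,2)] by metis
  obtain N1 where N1: "openin Z N1" "z \<in> N1" "\<And>y. y \<in> N1 \<Longrightarrow> \<exists>e\<in>V0 \<inter> U1. e \<in> fiber E (\<pi> y)"
    using lift_nbhd[OF \<pi> z, of "V0 \<inter> U1" "J z"] V0 U J[OF z] by (auto simp: fiber_def)
  obtain N2 where N2: "openin Z N2" "z \<in> N2" "\<And>y. y \<in> N2 \<Longrightarrow> \<exists>e\<in>V \<inter> U2. e \<in> fiber E (\<pi> y)"
    using lift_nbhd[OF \<pi> z, of "V \<inter> U2" v] v U by (auto simp: fiber_def)
  have "\<exists>e\<in>V0. e \<in> fiber E (\<pi> y) \<and> bnorm E (bminus E (J y) e) < \<epsilon>0" if y: "y \<in> N \<inter> N1 \<inter> N2" for y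
  proof -
    obtain e f where e: "e \<in> V0" "e \<in> U1" "e \<in> fiber E (\<pi> y)" and f: "f \<in> V" "f \<in> U2" "f \<in> fiber E (\<pi> y)"
      using N1(3) N2(3) y by blast
    have Jy: "J y \<in> fiber E (\<pi> y)" using J y v(5) openin_subset by blast
    have "bnorm E (bminus E (J y) e) \<le> bnorm E (bminus E (J y) f) + bnorm E (bminus E f e)"
      using norm_minus_tri[OF Jy f(3) e(3)] .
    also have "bnorm E (bminus E (J y) f) < \<epsilon>0/2" using c f y by blast
    also have "bnorm E (bminus E f e) < \<epsilon>0/2" using U(5)[OF e(2) f(2)] e f norm_minus_commute[OF e(3) f(3)]
      by (auto simp: fiber_def)
    finally show ?thesis using e by auto
  qed
  then show "\<exists>N. openin Z N \<and> z \<in> N \<and> (\<forall>y\<in>N. \<exists>e\<in>V0. e \<in> fiber E (\<pi> y) \<and> bnorm E (bminus E (J y) e) < \<epsilon>0)"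
    using v N1 N2 by (intro exI[of _ "N \<inter> N1 \<inter> N2"]) auto
qed

lemma cont_uniform_limit:
  assumes J: "\<And>z. z \<in> topspace Z \<Longrightarrow> J z \<in> fiber E (\<pi> z)"
    and S: "\<And>n z. z \<in> topspace Z \<Longrightarrow> S n z \<in> fiber E (\<pi> z)" and \<pi>: "continuous_map Z X \<pi>"
    and cont: "\<And>n. continuous_map Z (btop E) (S n)"
    and lim: "\<And>z \<epsilon>. z \<in> topspace Z \<Longrightarrow> \<epsilon> > 0 \<Longrightarrow>
      \<exists>n N. openin Z N \<and> z \<in> N \<and> (\<forall>y\<in>N. bnorm E (bminus E (J y) (S n y)) < \<epsilon>)"
  shows "continuous_map Z (btop E) J"
proof (rule cont_crit2[OF J \<pi>])
  fix z and \<epsilon> :: real assume z: "z \<in> topspace Z" and \<epsilon>: "\<epsilon> > 0"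
  obtain n N where N: "openin Z N" "z \<in> N" "\<And>y. y \<in> N \<Longrightarrow> bnorm E (bminus E (J y) (S n y)) < \<epsilon>/2"
    using lim[OF z, of "\<epsilon>/2"] \<epsilon> by auto
  have "bnorm E (bminus E (S n z) (S n z)) < \<epsilon>/2" using \<epsilon> norm_minus_self[OF S[OF z]] by simp
  then obtain U1 U2 where U: "openin (btop E) U1" "S n z \<in> U1" "openin (btop E) U2" "S n z \<in> U2"
    "\<And>e f. e \<in> U1 \<Longrightarrow> f \<in> U2 \<Longrightarrow> bproj E e = bproj E f \<Longrightarrow> bnorm E (bminus E e f) < \<epsilon>/2"
    using dist_nbhd[OF S[OF z] S[OF z]] by metis
  obtain M where M: "openin Z M" "z \<in> M" "\<And>y. y \<in> M \<Longrightarrow> S n y \<in> U1"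
    using continuous_map_openD[OF cont z U(1,2)] by metis
  have "bnorm E (bminus E (J y) e) < \<epsilon>" if y: "y \<in> N \<inter> M" and e: "e \<in> U2" "e \<in> fiber E (\<pi> y)" for y e
  proof -
    have yz: "y \<in> topspace Z" using y N(1) openin_subset by blast
    have "bnorm E (bminus E (J y) e) \<le> bnorm E (bminus E (J y) (S n y)) + bnorm E (bminus E (S n y) e)"
      using norm_minus_tri[OF J[OF yz] S[OF yz] e(2)] .
    also have "bnorm E (bminus E (J y) (S n y)) < \<epsilon>/2" using N y by blast
    also have "bnorm E (bminus E (S n y) e) < \<epsilon>/2" using U(5)[OF M(3) e(1)] y e S[OF yz, of n] by (auto simp: fiber_def)
    finally show ?thesis by simp
  qed
  moreover have "bnorm E (bminus E (J z) (S n z)) < \<epsilon>" using N(2,3) \<epsilon> by fastforce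
  ultimately show "\<exists>v V N. v \<in> fiber E (\<pi> z) \<and> bnorm E (bminus E (J z) v) < \<epsilon> \<and> openin (btop E) V \<and> v \<in> V \<and>
        openin Z N \<and> z \<in> N \<and>
        (\<forall>y\<in>N. \<forall>e\<in>V. e \<in> fiber E (\<pi> y) \<longrightarrow> bnorm E (bminus E (J y) e) < \<epsilon>)"
    using S[OF z] U N M by (intro exI[of _ "S n z"] exI[of _ U2] exI[of _ "N \<inter> M"]) auto
qed

end

section \<open>Haar averages on a proper groupoid\<close>

lemma continuous_map_local:
  assumes "\<And>z. z \<in> topspace Z \<Longrightarrow> \<exists>B g. openin Z B \<and> z \<in> B \<and> continuous_map Z Y g \<and> (\<forall>y\<in>B. f y = g y)"
  shows "continuous_map Z Y f"
proof (rule continuous_map_openI)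
  fix z assume z: "z \<in> topspace Z"
  obtain B g where B: "openin Z B" "z \<in> B" "continuous_map Z Y g" "\<And>y. y \<in> B \<Longrightarrow> f y = g y"
    using assms[OF z] by metis
  show "f z \<in> topspace Y" using B z continuous_map_image_subset_topspace[OF B(3)] by force
  fix N assume N: "openin Y N" "f z \<in> N"
  then have "g z \<in> N" using B by simp
  then obtain M where M: "openin Z M" "z \<in> M" "\<And>y. y \<in> M \<Longrightarrow> g y \<in> N"
    using continuous_map_openD[OF B(3) z N(1)] by metis
  show "\<exists>M. openin Z M \<and> z \<in> M \<and> (\<forall>y\<in>M. f y \<in> N)"
    using M B by (intro exI[of _ "M \<inter> B"]) auto
qed

locale lc_groupoid =
  fixes G :: "('g,'x) groupoid" and \<mu> :: "'x \<Rightarrow> 'g measure"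
  assumes lcg: "locally_compact_groupoid G \<mu>"
begin

abbreviation "Ga \<equiv> topspace (arr G)"
abbreviation "Xo \<equiv> topspace (obj G)"

lemma top_grpd: "topological_groupoid G" and loc_comp: "locally_compact_space (arr G)"
  and arr_haus: "Hausdorff_space (arr G)" and haar: "left_haar_system G \<mu>"
  using lcg unfolding locally_compact_groupoid_def by simp_all

lemmas grpd_units = top_grpd[unfolded topological_groupoid_def Let_def]
lemmas grpd_inverses = grpd_units[THEN conjunct2]
lemmas grpd_products = grpd_inverses[THEN conjunct2]
lemmas grpd_assoc = grpd_products[THEN conjunct2]
lemmas cont_src0 = grpd_assoc[THEN conjunct2, THEN conjunct1]
lemmas cont_tgt0 = grpd_assoc[THEN conjunct2, THEN conjunct2, THEN conjunct1]
lemmas cont_unit0 = grpd_assoc[THEN conjunct2, THEN conjunct2, THEN conjunct2, THEN conjunct1]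
lemmas cont_inv0 = grpd_assoc[THEN conjunct2, THEN conjunct2, THEN conjunct2, THEN conjunct2, THEN conjunct1]
lemmas cont_comp0 = grpd_assoc[THEN conjunct2, THEN conjunct2, THEN conjunct2, THEN conjunct2, THEN conjunct2]

lemma unit_in [simp]: "x \<in> Xo \<Longrightarrow> unit G x \<in> Ga"
  and src_unit [simp]: "x \<in> Xo \<Longrightarrow> src G (unit G x) = x"
  and tgt_unit [simp]: "x \<in> Xo \<Longrightarrow> tgt G (unit G x) = x"
  using grpd_units[THEN conjunct1] by simp_all

lemma src_in [simp]: "g \<in> Ga \<Longrightarrow> src G g \<in> Xo"
  and tgt_in [simp]: "g \<in> Ga \<Longrightarrow> tgt G g \<in> Xo"
  and inv_in [simp]: "g \<in> Ga \<Longrightarrow> ginv G g \<in> Ga"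
  and src_inv [simp]: "g \<in> Ga \<Longrightarrow> src G (ginv G g) = tgt G g"
  and tgt_inv [simp]: "g \<in> Ga \<Longrightarrow> tgt G (ginv G g) = src G g"
  and comp_inv [simp]: "g \<in> Ga \<Longrightarrow> comp G g (ginv G g) = unit G (tgt G g)"
  and inv_comp [simp]: "g \<in> Ga \<Longrightarrow> comp G (ginv G g) g = unit G (src G g)"
  and unit_comp [simp]: "g \<in> Ga \<Longrightarrow> comp G (unit G (tgt G g)) g = g"
  and comp_unit [simp]: "g \<in> Ga \<Longrightarrow> comp G g (unit G (src G g)) = g"
  using grpd_inverses[THEN conjunct1] by simp_all

lemma composableI [intro]: "g \<in> Ga \<Longrightarrow> h \<in> Ga \<Longrightarrow> src G g = tgt G h \<Longrightarrow> (g,h) \<in> composable G"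
  by (simp add: composable_def)

lemma comp_in [simp]: "g \<in> Ga \<Longrightarrow> h \<in> Ga \<Longrightarrow> src G g = tgt G h \<Longrightarrow> comp G g h \<in> Ga"
  and src_comp [simp]: "g \<in> Ga \<Longrightarrow> h \<in> Ga \<Longrightarrow> src G g = tgt G h \<Longrightarrow> src G (comp G g h) = src G h"
  and tgt_comp [simp]: "g \<in> Ga \<Longrightarrow> h \<in> Ga \<Longrightarrow> src G g = tgt G h \<Longrightarrow> tgt G (comp G g h) = tgt G g"
  using bspec[OF grpd_products[THEN conjunct1] composableI, of g h] by simp_all

lemma comp_assoc:
  "g \<in> Ga \<Longrightarrow> h \<in> Ga \<Longrightarrow> k \<in> Ga \<Longrightarrow> src G g = tgt G h \<Longrightarrow> src G h = tgt G k \<Longrightarrow>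
    comp G (comp G g h) k = comp G g (comp G h k)"
  using grpd_assoc[THEN conjunct1, rule_format, of g h k] composableI by simp

lemma comp_inv_cancel:
  assumes "g \<in> Ga" "h \<in> Ga" "src G g = tgt G h" shows "comp G (ginv G g) (comp G g h) = h"
  using comp_assoc[of "ginv G g" g h] assms by simp

lemma cont_src: "continuous_map Z (arr G) u \<Longrightarrow> continuous_map Z (obj G) (\<lambda>z. src G (u z))"
  and cont_tgt: "continuous_map Z (arr G) u \<Longrightarrow> continuous_map Z (obj G) (\<lambda>z. tgt G (u z))"
  and cont_ginv: "continuous_map Z (arr G) u \<Longrightarrow> continuous_map Z (arr G) (\<lambda>z. ginv G (u z))"
  using continuous_map_compose[OF _ cont_src0, of Z u] continuous_map_compose[OF _ cont_tgt0, of Z u]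
    continuous_map_compose[OF _ cont_inv0, of Z u] by (simp_all add: o_def)

lemma cont_comp:
  assumes "continuous_map Z (arr G) u" "continuous_map Z (arr G) v"
    "\<And>z. z \<in> topspace Z \<Longrightarrow> src G (u z) = tgt G (v z)"
  shows "continuous_map Z (arr G) (\<lambda>z. comp G (u z) (v z))"
proof -
  have "continuous_map Z (subtopology (prod_topology (arr G) (arr G)) (composable G)) (\<lambda>z. (u z, v z))"
    using assms continuous_map_image_subset_topspace[OF assms(1)] continuous_map_image_subset_topspace[OF assms(2)]
    by (auto simp: continuous_map_in_subtopology composable_def intro!: continuous_map_pairedI)
  from continuous_map_compose[OF this cont_comp0] show ?thesis by (simp add: o_def)
qed

text \<open>The unit map is a section of the source map, so the object space inherits the Hausdorff
  property and local compactness from the arrow space.\<close>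

lemma src_retraction: "retraction_map (arr G) (obj G) (src G)"
  unfolding retraction_map_def retraction_maps_def using cont_src0 cont_unit0 by auto

lemma obj_haus: "Hausdorff_space (obj G)"
  using Hausdorff_space_retraction_map_image[OF src_retraction arr_haus] .

lemma obj_loc_comp: "locally_compact_space (obj G)"
  using locally_compact_space_retraction_map_image[OF src_retraction loc_comp] .

lemma arr_creg: "completely_regular_space (arr G)"
  using loc_comp arr_haus
  by (simp add: locally_compact_Hausdorff_imp_regular_space locally_compact_regular_imp_completely_regular_space)

lemma obj_creg: "completely_regular_space (obj G)"
  using obj_loc_comp obj_haus
  by (simp add: locally_compact_Hausdorff_imp_regular_space locally_compact_regular_imp_completely_regular_space)

lemma bump:
  assumes x: "x \<in> Xo"
  obtains \<eta> B C where "continuous_map (obj G) euclideanreal \<eta>" "openin (obj G) B" "x \<in> B"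
    "\<And>y. y \<in> B \<Longrightarrow> \<eta> y = 1" "compactin (obj G) C" "B \<subseteq> C" "\<And>y. y \<in> Xo \<Longrightarrow> y \<notin> C \<Longrightarrow> \<eta> y = 0"
    "\<And>y. y \<in> Xo \<Longrightarrow> 0 \<le> \<eta> y"
proof -
  obtain U C where U: "openin (obj G) U" "compactin (obj G) C" "x \<in> U" "U \<subseteq> C"
    using obj_loc_comp x unfolding locally_compact_space_def by metis
  have "closedin (obj G) (Xo - U)" "x \<in> Xo - (Xo - U)" using U x by auto
  then obtain f where f: "continuous_map (obj G) (top_of_set {0..1}) f" "f x = (0::real)" "f ` (Xo - U) \<subseteq> {1}"
    using obj_creg unfolding completely_regular_space_def by metis
  have fc: "continuous_map (obj G) euclideanreal f" using f(1) continuous_map_into_fulltopology by blast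
  have f1: "f y \<le> 1" if "y \<in> Xo" for y using continuous_map_image_subset_topspace[OF f(1)] that by auto
  \<comment> \<open>Doubling and truncating gives a plateau: the function is 1 on a whole
    neighbourhood of \<open>x\<close>, so inserting it changes no integral over the target fibers
    near \<open>x\<close>.\<close>
  define \<eta> where "\<eta> = (\<lambda>y. min 1 (2 * (1 - f y)))"
  define B where "B = {y \<in> Xo. f y \<in> {..<1/2}}"
  have B: "openin (obj G) B" unfolding B_def by (rule openin_continuous_map_preimage[OF fc]) auto
  have c: "continuous_map (obj G) euclideanreal \<eta>" unfolding \<eta>_def using fc
    by (intro continuous_intros) auto
  have out: "\<eta> y = 0" if "y \<in> Xo" "y \<notin> U" for y using f(3) that by (auto simp: \<eta>_def)
  show ?thesis
  proof (rule that[OF c B _ _ U(2)])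
    show "x \<in> B" using f x by (simp add: B_def)
    show "\<eta> y = 1" if "y \<in> B" for y using that by (simp add: \<eta>_def B_def)
    show "B \<subseteq> C" using f(3) U by (force simp: B_def)
    show "\<eta> y = 0" if "y \<in> Xo" "y \<notin> C" for y using out that U by blast
    show "0 \<le> \<eta> y" if "y \<in> Xo" for y using f1[OF that] by (simp add: \<eta>_def)
  qed
qed

section \<open>The Haar system and integrals against a cutoff function\<close>

lemma radon: "x \<in> Xo \<Longrightarrow> radon_measure (arr G) (\<mu> x)"
  and supp: "x \<in> Xo \<Longrightarrow> measure_support (arr G) (\<mu> x) = {g \<in> Ga. tgt G g = x}"
  using haar unfolding left_haar_system_def by simp_all

lemma left_inv: "g \<in> Ga \<Longrightarrow> \<phi> \<in> Cc (arr G) \<Longrightarrow>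
    (\<integral>h. indicator {h. tgt G h = src G g} h * \<phi> (comp G g h) \<partial>(\<mu> (src G g))) = (\<integral>h. \<phi> h \<partial>(\<mu> (tgt G g)))"
  using haar unfolding left_haar_system_def by simp

lemma haar_cont: "\<phi> \<in> Cc (arr G) \<Longrightarrow> continuous_map (obj G) euclideanreal (\<lambda>x. \<integral>h. \<phi> h \<partial>(\<mu> x))"
  using haar unfolding left_haar_system_def by simp

lemma space_mu [simp]: "x \<in> Xo \<Longrightarrow> space (\<mu> x) = Ga"
  using radon unfolding radon_measure_def by blast

lemma sets_open: "x \<in> Xo \<Longrightarrow> openin (arr G) U \<Longrightarrow> U \<in> sets (\<mu> x)"
proof -
  assume x: "x \<in> Xo" and U: "openin (arr G) U"
  have "sets (\<mu> x) = borel_sets_of (arr G)" using radon[OF x] unfolding radon_measure_def by blast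
  then show ?thesis using U unfolding borel_sets_of_def by (simp add: sigma_sets.Basic)
qed

lemma sets_closed: assumes x: "x \<in> Xo" and C: "closedin (arr G) C" shows "C \<in> sets (\<mu> x)"
proof -
  have "space (\<mu> x) - (Ga - C) \<in> sets (\<mu> x)" using C by (intro sets.compl_sets sets_open x) auto
  moreover have "Ga - (Ga - C) = C" using closedin_subset[OF C] by blast
  ultimately show ?thesis using x by simp
qed

lemma emeasure_compact: "x \<in> Xo \<Longrightarrow> compactin (arr G) K \<Longrightarrow> emeasure (\<mu> x) K < \<infinity>"
  using radon unfolding radon_measure_def by blast

lemma inner_reg: "x \<in> Xo \<Longrightarrow> openin (arr G) U \<Longrightarrow>
    emeasure (\<mu> x) U = (SUP K\<in>{K. compactin (arr G) K \<and> K \<subseteq> U}. emeasure (\<mu> x) K)"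
  using radon unfolding radon_measure_def by blast

lemma tfib_closed: assumes "x \<in> Xo" shows "closedin (arr G) {k \<in> Ga. tgt G k = x}"
proof -
  have "closedin (obj G) {x}" using obj_haus assms by (simp add: closedin_Hausdorff_singleton)
  from closedin_continuous_map_preimage[OF cont_tgt0 this] show ?thesis by simp
qed

text \<open>Every point off the support has a null neighbourhood, hence compact subsets of the
  complement are null. Inner regularity on open sets then makes the whole complement null, where no
  countable cover by null sets is at hand.\<close>

lemma AE_tgt: assumes x: "x \<in> Xo" shows "AE k in \<mu> x. tgt G k = x"
proof -
  define U where "U = {k \<in> Ga. tgt G k \<noteq> x}"
  have "U = Ga - {k \<in> Ga. tgt G k = x}" by (auto simp: U_def)
  then have U: "openin (arr G) U" using tfib_closed[OF x] by (simp add: closedin_def)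
  have "emeasure (\<mu> x) K = 0" if K: "compactin (arr G) K" "K \<subseteq> U" for K
  proof -
    have "\<exists>V. openin (arr G) V \<and> k \<in> V \<and> emeasure (\<mu> x) V = 0" if "k \<in> K" for k
    proof -
      have k: "k \<in> Ga" "tgt G k \<noteq> x" using K that U_def by auto
      then have "k \<notin> measure_support (arr G) (\<mu> x)" using supp[OF x] by simp
      then show ?thesis using k unfolding measure_support_def by auto
    qed
    then obtain V where V: "\<And>k. k \<in> K \<Longrightarrow> openin (arr G) (V k) \<and> k \<in> V k \<and> emeasure (\<mu> x) (V k) = 0"
      by metis
    then have "\<exists>\<F>. finite \<F> \<and> \<F> \<subseteq> V ` K \<and> K \<subseteq> \<Union>\<F>"
      using K(1) unfolding compactin_def by (elim conjE allE[of _ "V ` K"]) blast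
    then obtain \<F> where F: "finite \<F>" "\<F> \<subseteq> V ` K" "K \<subseteq> \<Union>\<F>" by metis
    have "A \<in> null_sets (\<mu> x)" if A: "A \<in> \<F>" for A
    proof -
      obtain k where "k \<in> K" "A = V k" using F(2) A by blast
      then show ?thesis using V[of k] sets_open[OF x] by (auto simp: null_sets_def)
    qed
    then have "\<Union>\<F> \<in> null_sets (\<mu> x)" using F(1) by (metis null_sets.finite_Union subsetI)
    moreover have "K \<in> sets (\<mu> x)" using compactin_imp_closedin[OF arr_haus K(1)] sets_closed[OF x] by blast
    ultimately show ?thesis using F(3) by (metis null_setsD1 null_sets_subset)
  qed
  then have "emeasure (\<mu> x) U = 0" unfolding inner_reg[OF x U]
    by (intro antisym SUP_least) auto
  then have "U \<in> null_sets (\<mu> x)" using sets_open[OF x U] by blast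
  then show ?thesis by (rule AE_I') (use x in \<open>auto simp: U_def\<close>)
qed

lemma cont_measurable:
  assumes "x \<in> Xo" "continuous_map (arr G) euclideanreal f" shows "f \<in> borel_measurable (\<mu> x)"
proof (rule borel_measurableI)
  fix S :: "real set" assume "open S"
  then have "openin (arr G) {k \<in> Ga. f k \<in> S}" by (intro openin_continuous_map_preimage[OF assms(2)]) auto
  moreover have "f -` S \<inter> space (\<mu> x) = {k \<in> Ga. f k \<in> S}" using assms by auto
  ultimately show "f -` S \<inter> space (\<mu> x) \<in> sets (\<mu> x)" using sets_open[OF assms(1)] by simp
qed

lemma Cc_cont: "F \<in> Cc (arr G) \<Longrightarrow> continuous_map (arr G) euclideanreal F"
  by (simp add: Cc_def)

lemma Cc_integrable: assumes x: "x \<in> Xo" and F: "F \<in> Cc (arr G)" shows "integrable (\<mu> x) F"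
proof -
  let ?K = "arr G closure_of {k \<in> Ga. F k \<noteq> 0}"
  have K: "compactin (arr G) ?K" and c: "continuous_map (arr G) euclideanreal F"
    using F by (auto simp: Cc_def)
  have "compact (F ` ?K)" using image_compactin[OF K c] by simp
  then have "bounded (F ` ?K)" by (rule compact_imp_bounded)
  then obtain B where "\<forall>r\<in>F ` ?K. norm r \<le> B" unfolding bounded_iff by metis
  then have B: "\<And>k. k \<in> ?K \<Longrightarrow> norm (F k) \<le> B" by simp
  have sub: "k \<in> ?K" if "k \<in> Ga" "F k \<noteq> 0" for k
    using closure_of_subset[of "{k \<in> Ga. F k \<noteq> 0}" "arr G"] that by auto
  show ?thesis
  proof (rule integrableI_bounded_set[of ?K _ _ B])
    show "?K \<in> sets (\<mu> x)" using sets_closed[OF x] by simp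
    show "F \<in> borel_measurable (\<mu> x)" using cont_measurable[OF x c] .
    show "emeasure (\<mu> x) ?K < \<infinity>" using emeasure_compact[OF x K] .
    show "AE k in \<mu> x. k \<in> ?K \<longrightarrow> norm (F k) \<le> B" using B by auto
    show "AE k in \<mu> x. k \<notin> ?K \<longrightarrow> F k = 0" using sub x by (intro AE_I2) auto
  qed
qed

lemma cutoff_facts:
  assumes "cutoff_function G c"
  shows "continuous_map (obj G) euclideanreal c" "x \<in> Xo \<Longrightarrow> c x \<ge> 0"
    "compactin (obj G) C \<Longrightarrow> compactin (arr G) ((arr G closure_of {g \<in> Ga. c (src G g) \<noteq> 0}) \<inter> {g \<in> Ga. tgt G g \<in> C})"
    "x \<in> Xo \<Longrightarrow> \<exists>k\<in>Ga. tgt G k = x \<and> c (src G k) > 0"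
proof -
  show "continuous_map (obj G) euclideanreal c" "x \<in> Xo \<Longrightarrow> c x \<ge> 0"
    "compactin (obj G) C \<Longrightarrow> compactin (arr G) ((arr G closure_of {g \<in> Ga. c (src G g) \<noteq> 0}) \<inter> {g \<in> Ga. tgt G g \<in> C})"
    using assms unfolding cutoff_function_def by simp_all
  assume x: "x \<in> Xo"
  then obtain y where y: "y \<in> orbit G x" "c y > 0" using assms unfolding cutoff_function_def by blast
  then obtain g where "g \<in> Ga" "src G g = x" "y = tgt G g" unfolding orbit_def by blast
  then show "\<exists>k\<in>Ga. tgt G k = x \<and> c (src G k) > 0" using y by (intro bexI[of _ "ginv G g"]) auto
qed

text \<open>The function \<open>c (src G k)\<close> need not have compact support; its support is
  compact only over a compact set of targets. The factor \<open>\<eta> (tgt G k)\<close> confines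
  the targets.\<close>

lemma Cc_cut:
  assumes c: "cutoff_function G c" and \<eta>: "continuous_map (obj G) euclideanreal \<eta>"
    and C: "compactin (obj G) C" "\<And>y. y \<in> Xo \<Longrightarrow> y \<notin> C \<Longrightarrow> \<eta> y = 0"
    and F: "continuous_map (arr G) euclideanreal F"
  shows "(\<lambda>k. c (src G k) * \<eta> (tgt G k) * F k) \<in> Cc (arr G)"
proof -
  let ?f = "\<lambda>k. c (src G k) * \<eta> (tgt G k) * F k"
  let ?L = "(arr G closure_of {g \<in> Ga. c (src G g) \<noteq> 0}) \<inter> {g \<in> Ga. tgt G g \<in> C}"
  have cont: "continuous_map (arr G) euclideanreal ?f"
    using continuous_map_compose[OF cont_src0 cutoff_facts(1)[OF c]] continuous_map_compose[OF cont_tgt0 \<eta>] F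
    by (intro continuous_intros) (auto simp: o_def)
  have "closedin (obj G) C" using compactin_imp_closedin[OF obj_haus C(1)] .
  then have L: "closedin (arr G) ?L"
    by (intro closedin_Int closedin_closure_of closedin_continuous_map_preimage[OF cont_tgt0])
  have "{k \<in> Ga. ?f k \<noteq> 0} \<subseteq> ?L"
  proof
    fix k assume "k \<in> {k \<in> Ga. ?f k \<noteq> 0}"
    then have k: "k \<in> Ga" "c (src G k) \<noteq> 0" "\<eta> (tgt G k) \<noteq> 0" by auto
    then have "k \<in> arr G closure_of {g \<in> Ga. c (src G g) \<noteq> 0}"
      using closure_of_subset[of "{g \<in> Ga. c (src G g) \<noteq> 0}" "arr G"] by blast
    moreover have "tgt G k \<in> C" using C(2)[of "tgt G k"] k by auto
    ultimately show "k \<in> ?L" using k by simp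
  qed
  then have "arr G closure_of {k \<in> Ga. ?f k \<noteq> 0} \<subseteq> ?L" using L by (rule closure_of_minimal)
  then have "compactin (arr G) (arr G closure_of {k \<in> Ga. ?f k \<noteq> 0})"
    using closed_compactin[OF cutoff_facts(3)[OF c C(1)]] by simp
  then show ?thesis using cont by (simp add: Cc_def)
qed

text \<open>Continuity of the Haar system speaks of compactly supported functions only. Near a given
  \<open>x\<close> the integrand may be multiplied by a bump in the target, since the measure over
  \<open>y\<close> lives on arrows with target \<open>y\<close>, where the bump is 1.\<close>

lemma int_cut_cont:
  assumes c: "cutoff_function G c" and F: "continuous_map (arr G) euclideanreal F"
  shows "continuous_map (obj G) euclideanreal (\<lambda>x. \<integral>k. c (src G k) * F k \<partial>\<mu> x)"
proof (rule continuous_map_local)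
  fix x assume x: "x \<in> Xo"
  obtain \<eta> B C where \<eta>: "continuous_map (obj G) euclideanreal \<eta>" and B: "openin (obj G) B" "x \<in> B"
    "\<And>y. y \<in> B \<Longrightarrow> \<eta> y = 1" and C: "compactin (obj G) C" "\<And>y. y \<in> Xo \<Longrightarrow> y \<notin> C \<Longrightarrow> \<eta> y = 0"
    by (rule bump[OF x]) blast
  note cut = Cc_cut[OF c \<eta> C F]
  have "(\<integral>k. c (src G k) * F k \<partial>\<mu> y) = (\<integral>k. c (src G k) * \<eta> (tgt G k) * F k \<partial>\<mu> y)" if y: "y \<in> B" for y
  proof (rule integral_cong_AE)
    have yX: "y \<in> Xo" using B(1) y openin_subset by blast
    have "continuous_map (arr G) euclideanreal (\<lambda>k. c (src G k) * F k)"
      using continuous_map_compose[OF cont_src0 cutoff_facts(1)[OF c]] F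
      by (intro continuous_intros) (auto simp: o_def)
    then show "(\<lambda>k. c (src G k) * F k) \<in> borel_measurable (\<mu> y)" by (rule cont_measurable[OF yX])
    show "(\<lambda>k. c (src G k) * \<eta> (tgt G k) * F k) \<in> borel_measurable (\<mu> y)"
      using cont_measurable[OF yX Cc_cont[OF cut]] .
    show "AE k in \<mu> y. c (src G k) * F k = c (src G k) * \<eta> (tgt G k) * F k"
      using B(3)[OF y] by (auto intro: eventually_mono[OF AE_tgt[OF yX]])
  qed
  then show "\<exists>B g. openin (obj G) B \<and> x \<in> B \<and> continuous_map (obj G) euclideanreal g \<and>
      (\<forall>y\<in>B. (\<integral>k. c (src G k) * F k \<partial>\<mu> y) = g y)"
    using haar_cont[OF cut] B by blast
qed

lemma int_cut_pos:
  assumes c: "cutoff_function G c" and x: "x \<in> Xo"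
  shows "(\<integral>k. c (src G k) \<partial>\<mu> x) > 0"
proof -
  obtain \<eta> B C where \<eta>: "continuous_map (obj G) euclideanreal \<eta>" and B: "openin (obj G) B" "x \<in> B"
    "\<And>y. y \<in> B \<Longrightarrow> \<eta> y = 1" and C: "compactin (obj G) C" "\<And>y. y \<in> Xo \<Longrightarrow> y \<notin> C \<Longrightarrow> \<eta> y = 0"
    and pos: "\<And>y. y \<in> Xo \<Longrightarrow> 0 \<le> \<eta> y"
    by (rule bump[OF x]) blast
  define f where "f = (\<lambda>k. c (src G k) * \<eta> (tgt G k) * 1)"
  have f: "f \<in> Cc (arr G)" unfolding f_def by (rule Cc_cut[OF c \<eta> C]) auto
  have cs: "continuous_map (arr G) euclideanreal (\<lambda>k. c (src G k))"
    using continuous_map_compose[OF cont_src0 cutoff_facts(1)[OF c]] by (simp add: o_def)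
  have eq: "(\<integral>k. c (src G k) \<partial>\<mu> x) = (\<integral>k. f k \<partial>\<mu> x)"
  proof (rule integral_cong_AE)
    show "AE k in \<mu> x. c (src G k) = f k" using B by (auto simp: f_def intro: eventually_mono[OF AE_tgt[OF x]])
  qed (use cont_measurable[OF x] cs Cc_cont[OF f] in auto)
  have nn: "f k \<ge> 0" if "k \<in> Ga" for k using cutoff_facts(2)[OF c] pos that by (simp add: f_def)
  have AEnn: "AE k in \<mu> x. 0 \<le> f k" using nn x by (intro AE_I2) auto
  have ge: "(\<integral>k. f k \<partial>\<mu> x) \<ge> 0" by (rule integral_nonneg_AE[OF AEnn])
  have "(\<integral>k. f k \<partial>\<mu> x) \<noteq> 0"
  proof
    assume "(\<integral>k. f k \<partial>\<mu> x) = 0"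
    then have AE0: "AE k in \<mu> x. f k = 0"
      using integral_nonneg_eq_0_iff_AE[OF Cc_integrable[OF x f] AEnn] by simp
    obtain k where k: "k \<in> Ga" "tgt G k = x" "c (src G k) > 0" using cutoff_facts(4)[OF c x] by blast
    \<comment> \<open>The cutoff is positive at some arrow of the target fiber; that fiber is the
      support of the measure, so the open set where \<open>f\<close> is nonzero has positive
      measure.\<close>
    define U where "U = {k \<in> Ga. f k \<in> - {0}}"
    have U: "openin (arr G) U" unfolding U_def
      by (rule openin_continuous_map_preimage[OF Cc_cont[OF f]]) auto
    have "k \<in> U" using k B by (simp add: U_def f_def)
    moreover have "k \<in> measure_support (arr G) (\<mu> x)" using supp[OF x] k by simp
    ultimately have "emeasure (\<mu> x) U > 0" using U unfolding measure_support_def by blast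
    moreover have "emeasure (\<mu> x) U = 0"
      using AE0 sets_open[OF x U] x by (subst (asm) AE_iff_measurable[of U]) (auto simp: U_def)
    ultimately show False by simp
  qed
  then show ?thesis using ge eq by simp
qed

text \<open>Left invariance makes the integral \<open>N\<close> of the cutoff constant on orbits.
  The denominator \<open>N (src G k)\<close> may therefore be replaced by
  \<open>N (tgt G k)\<close>, which is the constant \<open>N x\<close> on the fiber over
  \<open>x\<close>.\<close>

lemma normalised_cutoff:
  assumes c: "cutoff_function G c"
  obtains d where "cutoff_function G d" "\<And>x. x \<in> Xo \<Longrightarrow> (\<integral>k. d (src G k) \<partial>\<mu> x) = 1"
proof -
  define N where "N = (\<lambda>x. \<integral>k. c (src G k) \<partial>\<mu> x)"
  have N: "continuous_map (obj G) euclideanreal N" unfolding N_def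
    using int_cut_cont[OF c, of "\<lambda>_. 1"] by simp
  have pos: "N x > 0" if "x \<in> Xo" for x using int_cut_pos[OF c that] by (simp add: N_def)
  have inv: "N (src G g) = N (tgt G g)" if g: "g \<in> Ga" for g
  proof -
    obtain \<eta> B C where \<eta>: "continuous_map (obj G) euclideanreal \<eta>" and B: "openin (obj G) B" "tgt G g \<in> B"
      "\<And>y. y \<in> B \<Longrightarrow> \<eta> y = 1" and C: "compactin (obj G) C" "\<And>y. y \<in> Xo \<Longrightarrow> y \<notin> C \<Longrightarrow> \<eta> y = 0"
      by (rule bump[OF tgt_in[OF g]]) blast
    define f where "f = (\<lambda>k. c (src G k) * \<eta> (tgt G k) * 1)"
    have f: "f \<in> Cc (arr G)" unfolding f_def by (rule Cc_cut[OF c \<eta> C]) auto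
    have cs: "continuous_map (arr G) euclideanreal (\<lambda>k. c (src G k))"
      using continuous_map_compose[OF cont_src0 cutoff_facts(1)[OF c]] by (simp add: o_def)
    have "N (tgt G g) = (\<integral>k. f k \<partial>\<mu> (tgt G g))" unfolding N_def
    proof (rule integral_cong_AE)
      show "AE k in \<mu> (tgt G g). c (src G k) = f k" using B by (auto simp: f_def intro: eventually_mono[OF AE_tgt[OF tgt_in[OF g]]])
    qed (use cont_measurable[OF tgt_in[OF g]] cs Cc_cont[OF f] in auto)
    also have "\<dots> = (\<integral>h. indicator {h. tgt G h = src G g} h * f (comp G g h) \<partial>(\<mu> (src G g)))"
      using left_inv[OF g f] by simp
    \<comment> \<open>Left translation keeps sources, and the translated arrows have target
      \<open>tgt G g\<close>, where the bump is 1. Intersecting with the arrow space makes the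
      indicator that of a closed, hence measurable, set.\<close>
    also have "\<dots> = (\<integral>h. indicator {h \<in> Ga. tgt G h = src G g} h * c (src G h) \<partial>(\<mu> (src G g)))"
      using g B by (intro Bochner_Integration.integral_cong refl) (auto simp: f_def indicator_def)
    also have "\<dots> = N (src G g)" unfolding N_def
    proof (rule integral_cong_AE)
      have S: "{h \<in> Ga. tgt G h = src G g} \<in> sets (\<mu> (src G g))"
        by (rule sets_closed[OF _ tfib_closed]) (use g in auto)
      have "(\<lambda>h. c (src G h)) \<in> borel_measurable (\<mu> (src G g))" using cont_measurable cs g by simp
      then show "(\<lambda>h. indicator {h \<in> Ga. tgt G h = src G g} h * c (src G h)) \<in> borel_measurable (\<mu> (src G g))"
        using S by (intro borel_measurable_times borel_measurable_indicator)
      show "(\<lambda>h. c (src G h)) \<in> borel_measurable (\<mu> (src G g))" by fact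
      show "AE h in \<mu> (src G g). indicator {h \<in> Ga. tgt G h = src G g} h * c (src G h) = c (src G h)"
        using AE_tgt[of "src G g"] AE_space[of "\<mu> (src G g)"] g by (auto elim!: eventually_elim2)
    qed
    finally show ?thesis by simp
  qed
  define d where "d = (\<lambda>x. c x / N x)"
  have nz: "d (src G k) \<noteq> 0 \<longleftrightarrow> c (src G k) \<noteq> 0" if "k \<in> Ga" for k
    using pos[of "src G k"] that by (simp add: d_def)
  then have seteq: "{g \<in> Ga. d (src G g) \<noteq> 0} = {g \<in> Ga. c (src G g) \<noteq> 0}" by blast
  have orbX: "y \<in> Xo" if "y \<in> orbit G x" for x y using that unfolding orbit_def by auto
  have "cutoff_function G d" unfolding cutoff_function_def
  proof (intro conjI ballI allI impI)
    show "continuous_map (obj G) euclideanreal d" unfolding d_def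
      using cutoff_facts(1)[OF c] N pos by (intro continuous_intros) (auto simp: less_le)
    show "0 \<le> d x" if "x \<in> Xo" for x using cutoff_facts(2)[OF c that] pos[OF that] by (simp add: d_def)
    show "compactin (arr G) ((arr G closure_of {g \<in> Ga. d (src G g) \<noteq> 0}) \<inter> {g \<in> Ga. tgt G g \<in> C})"
      if "compactin (obj G) C" for C
      unfolding seteq using cutoff_facts(3)[OF c that] .
    show "\<exists>y\<in>orbit G x. 0 < d y" if x: "x \<in> Xo" for x
    proof -
      obtain y where "y \<in> orbit G x" "c y > 0" using c x unfolding cutoff_function_def by blast
      then show ?thesis using pos[OF orbX] by (intro bexI[of _ y]) (auto simp: d_def)
    qed
  qed
  moreover have "(\<integral>k. d (src G k) \<partial>\<mu> x) = 1" if x: "x \<in> Xo" for x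
  proof -
    have "(\<integral>k. d (src G k) \<partial>\<mu> x) = (\<integral>k. c (src G k) / N x \<partial>\<mu> x)"
    proof (rule integral_cong_AE)
      have "continuous_map (arr G) euclideanreal (\<lambda>k. d (src G k))"
        using continuous_map_compose[OF cont_src0 \<open>cutoff_function G d\<close>[THEN cutoff_facts(1)]] by (simp add: o_def)
      then show "(\<lambda>k. d (src G k)) \<in> borel_measurable (\<mu> x)" by (rule cont_measurable[OF x])
      have "continuous_map (arr G) euclideanreal (\<lambda>k. c (src G k))"
        using continuous_map_compose[OF cont_src0 cutoff_facts(1)[OF c]] by (simp add: o_def)
      then show "(\<lambda>k. c (src G k) / N x) \<in> borel_measurable (\<mu> x)" 
        by (intro borel_measurable_divide cont_measurable[OF x]) auto
      show "AE k in \<mu> x. d (src G k) = c (src G k) / N x"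
        using AE_tgt[OF x] AE_space[of "\<mu> x"]
      proof eventually_elim
        case (elim k)
        then show ?case using inv[of k] x by (simp add: d_def)
      qed
    qed
    also have "\<dots> = 1" using pos[OF x] by (simp add: N_def)
    finally show ?thesis .
  qed
  ultimately show ?thesis using that by blast
qed

end

locale cut_groupoid = lc_groupoid G \<mu> for G :: "('g,'x) groupoid" and \<mu> :: "'x \<Rightarrow> 'g measure" +
  fixes c :: "'x \<Rightarrow> real"
  assumes cut: "cutoff_function G c" and cut_int: "x \<in> Xo \<Longrightarrow> (\<integral>k. c (src G k) \<partial>\<mu> x) = 1"
begin

section \<open>Weighted averages over a target fiber\<close>

definition tfib :: "'x \<Rightarrow> 'g topology" where
  "tfib x = subtopology (arr G) {k \<in> Ga. tgt G k = x}"

text \<open>The functions to be averaged make sense only on the arrows with target \<open>x\<close>;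
  elsewhere their values are arbitrary and perhaps not measurable. The indicator removes those
  values before integration.\<close>

definition Av :: "'x \<Rightarrow> ('g \<Rightarrow> real) \<Rightarrow> real" where
  "Av x f = (\<integral>k. indicator {k. tgt G k = x} k * (c (src G k) * f k) \<partial>\<mu> x)"

lemma topspace_tfib [simp]: "topspace (tfib x) = {k \<in> Ga. tgt G k = x}"
  by (auto simp: tfib_def)

lemma c_nonneg: "k \<in> Ga \<Longrightarrow> c (src G k) \<ge> 0"
  using cutoff_facts(2)[OF cut] by simp

text \<open>Haar integrals are controlled for compactly supported functions on all arrows, whereas
  \<open>f\<close> is continuous on one fiber only. On that fiber the weight vanishes outside a
  compact set \<open>K\<close>; Tietze's theorem extends \<open>f\<close> from \<open>K\<close>, and
  the weight and a bump supply compact support.\<close>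

lemma Cc_extension:
  assumes x: "x \<in> Xo" and f: "continuous_map (tfib x) euclideanreal f"
  obtains F where "F \<in> Cc (arr G)" "\<And>k. k \<in> Ga \<Longrightarrow> tgt G k = x \<Longrightarrow> F k = c (src G k) * f k"
proof -
  obtain \<eta> B C where \<eta>: "continuous_map (obj G) euclideanreal \<eta>" and B: "openin (obj G) B" "x \<in> B"
    "\<And>y. y \<in> B \<Longrightarrow> \<eta> y = 1" and C: "compactin (obj G) C" "\<And>y. y \<in> Xo \<Longrightarrow> y \<notin> C \<Longrightarrow> \<eta> y = 0"
    by (rule bump[OF x]) blast
  \<comment> \<open>The properness condition is used with the compact set of targets
    \<open>{x}\<close>.\<close>
  define K where "K = (arr G closure_of {g \<in> Ga. c (src G g) \<noteq> 0}) \<inter> {g \<in> Ga. tgt G g \<in> {x}}"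
  have K: "compactin (arr G) K" unfolding K_def using x by (intro cutoff_facts(3)[OF cut]) simp
  have "continuous_map (subtopology (arr G) K) euclideanreal f"
    using continuous_map_from_subtopology_mono[OF f[unfolded tfib_def], of K] by (auto simp: K_def)
  then obtain g where g: "continuous_map (arr G) euclideanreal g" "\<And>k. k \<in> K \<Longrightarrow> g k = f k"
    using Tietze_extension_completely_regular[OF arr_creg K is_interval_univ, of f] by auto
  show ?thesis
  proof (rule that[OF Cc_cut[OF cut \<eta> C g(1)]])
    fix k assume k: "k \<in> Ga" "tgt G k = x"
    have "k \<in> K" if "c (src G k) \<noteq> 0"
      using closure_of_subset[of "{g \<in> Ga. c (src G g) \<noteq> 0}" "arr G"] k that by (auto simp: K_def)
    then show "c (src G k) * \<eta> (tgt G k) * g k = c (src G k) * f k" using g(2) k B by auto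
  qed
qed

lemma Av_Cc:
  assumes x: "x \<in> Xo" and F: "F \<in> Cc (arr G)"
    and eq: "\<And>k. k \<in> Ga \<Longrightarrow> tgt G k = x \<Longrightarrow> F k = c (src G k) * f k"
  shows "Av x f = (\<integral>k. F k \<partial>\<mu> x)"
proof -
  let ?S = "{k \<in> Ga. tgt G k = x}"
  have "Av x f = (\<integral>k. indicator ?S k * F k \<partial>\<mu> x)" unfolding Av_def
    using x eq by (intro Bochner_Integration.integral_cong refl) (auto simp: indicator_def)
  also have "\<dots> = (\<integral>k. F k \<partial>\<mu> x)"
  proof (rule integral_cong_AE)
    have S: "?S \<in> sets (\<mu> x)" by (rule sets_closed[OF x tfib_closed[OF x]])
    show "F \<in> borel_measurable (\<mu> x)" using cont_measurable[OF x Cc_cont[OF F]] .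
    then show "(\<lambda>k. indicator ?S k * F k) \<in> borel_measurable (\<mu> x)"
      using S by (intro borel_measurable_times borel_measurable_indicator)
    show "AE k in \<mu> x. indicator ?S k * F k = F k"
      using AE_tgt[OF x] AE_space[of "\<mu> x"] x by (auto elim!: eventually_elim2)
  qed
  finally show ?thesis .
qed

lemma Av_cong: "(\<And>k. k \<in> Ga \<Longrightarrow> tgt G k = x \<Longrightarrow> c (src G k) \<noteq> 0 \<Longrightarrow> f k = g k) \<Longrightarrow> x \<in> Xo \<Longrightarrow> Av x f = Av x g"
  unfolding Av_def by (intro Bochner_Integration.integral_cong refl) (auto simp: indicator_def)

lemma Cc_add: assumes "F \<in> Cc (arr G)" "H \<in> Cc (arr G)" shows "(\<lambda>k. F k + H k) \<in> Cc (arr G)"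
proof -
  let ?A = "arr G closure_of {k \<in> Ga. F k \<noteq> 0}" and ?B = "arr G closure_of {k \<in> Ga. H k \<noteq> 0}"
  have "compactin (arr G) (?A \<union> ?B)" using assms by (intro compactin_Un) (auto simp: Cc_def)
  moreover have "arr G closure_of {k \<in> Ga. F k + H k \<noteq> 0} \<subseteq> ?A \<union> ?B"
    unfolding closure_of_Un[symmetric] by (rule closure_of_mono) auto
  ultimately have "compactin (arr G) (arr G closure_of {k \<in> Ga. F k + H k \<noteq> 0})"
    by (rule closed_compactin) simp
  then show ?thesis using assms by (auto simp: Cc_def intro!: continuous_intros)
qed

lemma Av_add:
  assumes x: "x \<in> Xo" and f: "continuous_map (tfib x) euclideanreal f" and g: "continuous_map (tfib x) euclideanreal g"
  shows "Av x (\<lambda>k. f k + g k) = Av x f + Av x g"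
proof -
  obtain F where F: "F \<in> Cc (arr G)" "\<And>k. k \<in> Ga \<Longrightarrow> tgt G k = x \<Longrightarrow> F k = c (src G k) * f k"
    using Cc_extension[OF x f] by metis
  obtain H where H: "H \<in> Cc (arr G)" "\<And>k. k \<in> Ga \<Longrightarrow> tgt G k = x \<Longrightarrow> H k = c (src G k) * g k"
    using Cc_extension[OF x g] by metis
  have "Av x (\<lambda>k. f k + g k) = (\<integral>k. F k + H k \<partial>\<mu> x)"
    using F H by (intro Av_Cc[OF x Cc_add]) (auto simp: algebra_simps)
  also have "\<dots> = (\<integral>k. F k \<partial>\<mu> x) + (\<integral>k. H k \<partial>\<mu> x)"
    using Cc_integrable[OF x F(1)] Cc_integrable[OF x H(1)] by simp
  finally show ?thesis using Av_Cc[OF x F] Av_Cc[OF x H] by simp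
qed

lemma Av_scale: "Av x (\<lambda>k. a * f k) = a * Av x f"
proof -
  have "(\<lambda>k. indicator {k. tgt G k = x} k * (c (src G k) * (a * f k))) =
      (\<lambda>k. a * (indicator {k. tgt G k = x} k * (c (src G k) * f k)))" by (auto simp: algebra_simps)
  then show ?thesis unfolding Av_def by simp
qed

lemma Av_diff:
  assumes x: "x \<in> Xo" and f: "continuous_map (tfib x) euclideanreal f" and g: "continuous_map (tfib x) euclideanreal g"
  shows "Av x (\<lambda>k. f k - g k) = Av x f - Av x g"
  using Av_add[OF x f, of "\<lambda>k. (-1) * g k"] Av_scale[of x "-1" g] continuous_map_real_mult_left[OF g, of "-1"] by simp

lemma Av_const: assumes x: "x \<in> Xo" shows "Av x (\<lambda>_. a) = a"
proof -
  have "Av x (\<lambda>_. 1) = 1"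
  proof -
    let ?S = "{k \<in> Ga. tgt G k = x}"
    have cs: "continuous_map (arr G) euclideanreal (\<lambda>k. c (src G k))"
      using continuous_map_compose[OF cont_src0 cutoff_facts(1)[OF cut]] by (simp add: o_def)
    have m: "(\<lambda>k. c (src G k)) \<in> borel_measurable (\<mu> x)" by (rule cont_measurable[OF x cs])
    have "Av x (\<lambda>_. 1) = (\<integral>k. indicator ?S k * c (src G k) \<partial>\<mu> x)" unfolding Av_def
      using x by (intro Bochner_Integration.integral_cong refl) (auto simp: indicator_def)
    also have "\<dots> = (\<integral>k. c (src G k) \<partial>\<mu> x)"
    proof (rule integral_cong_AE[OF _ m])
      have S: "?S \<in> sets (\<mu> x)" by (rule sets_closed[OF x tfib_closed[OF x]])
      then show "(\<lambda>k. indicator ?S k * c (src G k)) \<in> borel_measurable (\<mu> x)"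
        using m by (intro borel_measurable_times borel_measurable_indicator)
      show "AE k in \<mu> x. indicator ?S k * c (src G k) = c (src G k)"
        using AE_tgt[OF x] AE_space[of "\<mu> x"] x by (auto elim!: eventually_elim2)
    qed
    finally show ?thesis using cut_int[OF x] by simp
  qed
  then show ?thesis using Av_scale[of x a "\<lambda>_. 1"] by simp
qed

lemma Av_mono:
  assumes x: "x \<in> Xo" and f: "continuous_map (tfib x) euclideanreal f" and g: "continuous_map (tfib x) euclideanreal g"
    and le: "\<And>k. k \<in> Ga \<Longrightarrow> tgt G k = x \<Longrightarrow> c (src G k) \<noteq> 0 \<Longrightarrow> f k \<le> g k"
  shows "Av x f \<le> Av x g"
proof -
  obtain F where F: "F \<in> Cc (arr G)" "\<And>k. k \<in> Ga \<Longrightarrow> tgt G k = x \<Longrightarrow> F k = c (src G k) * f k"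
    using Cc_extension[OF x f] by metis
  obtain H where H: "H \<in> Cc (arr G)" "\<And>k. k \<in> Ga \<Longrightarrow> tgt G k = x \<Longrightarrow> H k = c (src G k) * g k"
    using Cc_extension[OF x g] by metis
  have "(\<integral>k. F k \<partial>\<mu> x) \<le> (\<integral>k. H k \<partial>\<mu> x)"
  proof (rule integral_mono_AE[OF Cc_integrable[OF x F(1)] Cc_integrable[OF x H(1)]])
    show "AE k in \<mu> x. F k \<le> H k" using AE_tgt[OF x] AE_space[of "\<mu> x"]
    proof eventually_elim
      case (elim k)
      then have k: "k \<in> Ga" "tgt G k = x" using x by auto
      show ?case using F(2)[OF k] H(2)[OF k] le[OF k] c_nonneg[OF k(1)]
        by (cases "c (src G k) = 0") (auto intro: mult_left_mono)
    qed
  qed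
  then show ?thesis using Av_Cc[OF x F] Av_Cc[OF x H] by simp
qed

lemma Av_le:
  assumes x: "x \<in> Xo" and f: "continuous_map (tfib x) euclideanreal f"
    and le: "\<And>k. k \<in> Ga \<Longrightarrow> tgt G k = x \<Longrightarrow> c (src G k) \<noteq> 0 \<Longrightarrow> f k \<le> B"
  shows "Av x f \<le> B"
  using Av_mono[OF x f, of "\<lambda>_. B"] le Av_const[OF x] by simp

lemma Av_sum:
  assumes x: "x \<in> Xo" and f: "\<And>i. i \<in> I \<Longrightarrow> continuous_map (tfib x) euclideanreal (f i)" and I: "finite I"
  shows "Av x (\<lambda>k. \<Sum>i\<in>I. f i k) = (\<Sum>i\<in>I. Av x (f i))"
  using I f
proof (induction I rule: finite_induct)
  case empty then show ?case using Av_const[OF x, of 0] by simp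
next
  case (insert i I)
  have "Av x (\<lambda>k. f i k + (\<Sum>i\<in>I. f i k)) = Av x (f i) + Av x (\<lambda>k. \<Sum>i\<in>I. f i k)"
    using insert by (intro Av_add[OF x] continuous_map_sum) auto
  then show ?case using insert by simp
qed

text \<open>The weight depends on the source alone, and left translation does not change sources; so
  left invariance of the measures passes to the weighted averages.\<close>

lemma Av_invariant:
  assumes g: "g \<in> Ga" and f: "continuous_map (tfib (tgt G g)) euclideanreal f"
  shows "Av (src G g) (\<lambda>k. f (comp G g k)) = Av (tgt G g) f"
proof -
  obtain F where F: "F \<in> Cc (arr G)" "\<And>k. k \<in> Ga \<Longrightarrow> tgt G k = tgt G g \<Longrightarrow> F k = c (src G k) * f k"
    using Cc_extension[OF tgt_in[OF g] f] by metis
  have "Av (tgt G g) f = (\<integral>k. F k \<partial>\<mu> (tgt G g))" using Av_Cc[OF tgt_in[OF g] F] .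
  also have "\<dots> = (\<integral>h. indicator {h. tgt G h = src G g} h * F (comp G g h) \<partial>(\<mu> (src G g)))"
    using left_inv[OF g F(1)] by simp
  also have "\<dots> = Av (src G g) (\<lambda>k. f (comp G g k))" unfolding Av_def
    using g F(2) by (intro Bochner_Integration.integral_cong refl) (auto simp: indicator_def)
  finally show ?thesis by simp
qed

lemma Av_cont:
  assumes F: "continuous_map (arr G) euclideanreal F"
  shows "continuous_map (obj G) euclideanreal (\<lambda>x. Av x F)"
proof -
  have "Av x F = (\<integral>k. c (src G k) * F k \<partial>\<mu> x)" if x: "x \<in> Xo" for x
  proof -
    let ?S = "{k \<in> Ga. tgt G k = x}"
    have "continuous_map (arr G) euclideanreal (\<lambda>k. c (src G k) * F k)"
      using continuous_map_compose[OF cont_src0 cutoff_facts(1)[OF cut]] F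
      by (intro continuous_intros) (auto simp: o_def)
    then have m: "(\<lambda>k. c (src G k) * F k) \<in> borel_measurable (\<mu> x)" by (rule cont_measurable[OF x])
    have "Av x F = (\<integral>k. indicator ?S k * (c (src G k) * F k) \<partial>\<mu> x)" unfolding Av_def
      using x by (intro Bochner_Integration.integral_cong refl) (auto simp: indicator_def)
    also have "\<dots> = (\<integral>k. c (src G k) * F k \<partial>\<mu> x)"
    proof (rule integral_cong_AE[OF _ m])
      have S: "?S \<in> sets (\<mu> x)" by (rule sets_closed[OF x tfib_closed[OF x]])
      then show "(\<lambda>k. indicator ?S k * (c (src G k) * F k)) \<in> borel_measurable (\<mu> x)"
        using m by (intro borel_measurable_times[of _ _ "\<lambda>k. c (src G k) * F k"] borel_measurable_indicator)
      show "AE k in \<mu> x. indicator ?S k * (c (src G k) * F k) = c (src G k) * F k"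
        using AE_tgt[OF x] AE_space[of "\<mu> x"] x by (auto elim!: eventually_elim2)
    qed
    finally show ?thesis .
  qed
  then show ?thesis using int_cut_cont[OF cut F] by (simp add: continuous_map_eq)
qed

end

section \<open>Integrals of sections\<close>

lemma compactin_finite_subcover:
  assumes K: "compactin Z K" and V: "\<And>k. k \<in> K \<Longrightarrow> openin Z (V k)" "\<And>k. k \<in> K \<Longrightarrow> k \<in> V k"
  obtains I where "I \<subseteq> K" "finite I" "K \<subseteq> (\<Union>i\<in>I. V i)"
proof -
  have "(\<forall>U\<in>V ` K. openin Z U) \<and> K \<subseteq> \<Union>(V ` K)" using V by auto
  then have "\<exists>\<F>. finite \<F> \<and> \<F> \<subseteq> V ` K \<and> K \<subseteq> \<Union>\<F>"
    using K unfolding compactin_def by blast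
  then obtain \<F> where \<F>: "finite \<F>" "\<F> \<subseteq> V ` K" "K \<subseteq> \<Union>\<F>" by metis
  obtain I where "I \<subseteq> K" "finite I" "\<F> = V ` I" using finite_subset_image[OF \<F>(1,2)] by metis
  then show ?thesis using that \<F>(3) by blast
qed

context fell_bundle begin

text \<open>A functional lives on one fiber and carries no continuity across fibers. On its fiber it
  is Lipschitz for the norm, which suffices for maps that stay in that fiber.\<close>

lemma dual_cont:
  assumes h: "continuous_map Z (btop E) h" "\<And>z. z \<in> topspace Z \<Longrightarrow> h z \<in> fiber E y" and \<phi>: "\<phi> \<in> dual y"
  shows "continuous_map Z euclideanreal (\<lambda>z. \<phi> (h z))"
proof (rule continuous_map_openI)
  fix z N assume z: "z \<in> topspace Z" and N: "openin euclideanreal N" "\<phi> (h z) \<in> N"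
  then have "open N" by simp
  then obtain \<epsilon> where \<epsilon>: "\<epsilon> > 0" "\<And>r. \<bar>r - \<phi> (h z)\<bar> < \<epsilon> \<Longrightarrow> r \<in> N"
    using N(2) unfolding open_dist dist_real_def by metis
  have hz: "h z \<in> fiber E y" using h z by simp
  have "continuous_map Z euclideanreal (\<lambda>w. bnorm E (bminus E (h w) (h z)))"
  proof (intro cont_norm cont_minus h(1))
    show "continuous_map Z (btop E) (\<lambda>w. h z)" using fiberD(1)[OF hz] by simp
    show "bproj E (h w) = bproj E (h z)" if "w \<in> topspace Z" for w
      using fiberD(2)[OF h(2)[OF that]] fiberD(2)[OF hz] by simp
  qed
  from openin_continuous_map_preimage[OF this, of "{..<\<epsilon>}"]
  have M: "openin Z {w \<in> topspace Z. bnorm E (bminus E (h w) (h z)) < \<epsilon>}" by simp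
  have "\<phi> (h w) \<in> N" if w: "w \<in> topspace Z" "bnorm E (bminus E (h w) (h z)) < \<epsilon>" for w
  proof (rule \<epsilon>(2))
    have "\<bar>\<phi> (h w) - \<phi> (h z)\<bar> = \<bar>\<phi> (bminus E (h w) (h z))\<bar>" using \<phi> h(2)[OF w(1)] hz by simp
    also have "\<dots> \<le> bnorm E (bminus E (h w) (h z))" using h(2)[OF w(1)] hz by (intro dual_abs[OF \<phi>]) simp
    finally show "\<bar>\<phi> (h w) - \<phi> (h z)\<bar> < \<epsilon>" using w by simp
  qed
  then show "\<exists>M. openin Z M \<and> z \<in> M \<and> (\<forall>y\<in>M. \<phi> (h y) \<in> N)"
    using M z \<epsilon>(1) norm_minus_self[OF hz] by (intro exI[of _ "{w \<in> topspace Z. bnorm E (bminus E (h w) (h z)) < \<epsilon>}"]) auto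
qed auto

text \<open>A finite linear combination in one fiber, written as a fold over a list because addition
  in a fiber is not an operation on a type.\<close>

definition blin :: "'x \<Rightarrow> ('i \<Rightarrow> real) \<Rightarrow> ('i \<Rightarrow> 'e) \<Rightarrow> 'i list \<Rightarrow> 'e" where
  "blin y a e ks = foldr (\<lambda>k acc. badd E (bscale E (a k) (e k)) acc) ks (bzero E y)"

lemma blin_Nil [simp]: "blin y a e [] = bzero E y"
  and blin_Cons [simp]: "blin y a e (k # ks) = badd E (bscale E (a k) (e k)) (blin y a e ks)"
  by (simp_all add: blin_def)

lemma blin_in: "y \<in> topspace X \<Longrightarrow> (\<And>k. k \<in> set ks \<Longrightarrow> e k \<in> fiber E y) \<Longrightarrow> blin y a e ks \<in> fiber E y"
  by (induction ks) auto

lemma dual_blin: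
  assumes "\<phi> \<in> dual y" "y \<in> topspace X" "distinct ks" "\<And>k. k \<in> set ks \<Longrightarrow> e k \<in> fiber E y"
  shows "\<phi> (blin y a e ks) = (\<Sum>k\<in>set ks. a k * \<phi> (e k))"
  using assms(3,4)
proof (induction ks)
  case (Cons k ks)
  have "blin y a e ks \<in> fiber E y" using Cons.prems assms(2) by (intro blin_in) auto
  then show ?case using Cons assms(1) by simp
qed (use assms in simp)

lemma add_scale_nbhd:
  assumes u: "u \<in> fiber E y" "v \<in> fiber E y" and N: "openin (btop E) N" "badd E (bscale E r u) v \<in> N"
  obtains R U V where "open R" "r \<in> R" "openin (btop E) U" "u \<in> U" "openin (btop E) V" "v \<in> V"
    "\<And>s e f. s \<in> R \<Longrightarrow> e \<in> U \<Longrightarrow> f \<in> V \<Longrightarrow> bproj E e = bproj E f \<Longrightarrow> badd E (bscale E s e) f \<in> N"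
proof -
  let ?P = "subtopology (prod_topology (prod_topology euclideanreal (btop E)) (btop E)) {((s,e),f). bproj E e = bproj E f}"
  have f: "continuous_map ?P (prod_topology euclideanreal (btop E)) fst"
    by (intro continuous_map_from_subtopology continuous_map_fst)
  have 1: "continuous_map ?P euclideanreal (\<lambda>p. fst (fst p))"
    using continuous_map_compose[OF f continuous_map_fst] by (simp add: o_def)
  have 2: "continuous_map ?P (btop E) (\<lambda>p. snd (fst p))"
    using continuous_map_compose[OF f continuous_map_snd] by (simp add: o_def)
  have 3: "continuous_map ?P (btop E) snd"
    by (intro continuous_map_from_subtopology continuous_map_snd)
  have c: "continuous_map ?P (btop E) (\<lambda>p. badd E (bscale E (fst (fst p)) (snd (fst p))) (snd p))"
    by (intro cont_add cont_scale 1 2 3) (auto simp: cont_fiber_proj)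
  have "((r,u),v) \<in> topspace ?P" using u by (auto simp: fiber_def)
  then obtain M where M: "openin ?P M" "((r,u),v) \<in> M"
    "\<And>p. p \<in> M \<Longrightarrow> badd E (bscale E (fst (fst p)) (snd (fst p))) (snd p) \<in> N"
    using continuous_map_openD[OF c _ N(1), of "((r,u),v)"] N(2) by auto
  obtain Q V where Q: "openin (prod_topology euclideanreal (btop E)) Q" "(r,u) \<in> Q" "openin (btop E) V" "v \<in> V"
    "\<And>e f. e \<in> Q \<Longrightarrow> f \<in> V \<Longrightarrow> (e,f) \<in> {((s,e),f). bproj E e = bproj E f} \<Longrightarrow> (e,f) \<in> M"
    using openin_prod_subE[OF M(1,2)] by metis
  obtain R U where R: "openin euclideanreal R" "openin (btop E) U" "r \<in> R" "u \<in> U" "R \<times> U \<subseteq> Q"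
    using Q(1)[unfolded openin_prod_topology_alt] Q(2) by metis
  show ?thesis
  proof (rule that[of R U V])
    fix s e f assume "s \<in> R" "e \<in> U" "f \<in> V" "bproj E e = bproj E f"
    then have "((s,e),f) \<in> M" using R(5) by (intro Q(5)) auto
    from M(3)[OF this] show "badd E (bscale E s e) f \<in> N" by simp
  qed (use R Q in auto)
qed

text \<open>Without continuous sections through given vectors, a continuous linear combination of
  varying vectors has to be controlled by neighbourhoods of the vectors.\<close>

lemma blin_nbhd:
  assumes \<pi>: "continuous_map Z X \<pi>" and z0: "z0 \<in> topspace Z"
    and a: "\<And>k. k \<in> set ks \<Longrightarrow> continuous_map Z euclideanreal (\<lambda>z. a z k)"
    and v: "\<And>k. k \<in> set ks \<Longrightarrow> v k \<in> fiber E (\<pi> z0)"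
    and N: "openin (btop E) N" "blin (\<pi> z0) (a z0) v ks \<in> N"
  shows "\<exists>W M. (\<forall>k\<in>set ks. openin (btop E) (W k) \<and> v k \<in> W k) \<and> openin Z M \<and> z0 \<in> M \<and>
    (\<forall>z\<in>M. \<forall>e. (\<forall>k\<in>set ks. e k \<in> W k \<and> e k \<in> fiber E (\<pi> z)) \<longrightarrow> blin (\<pi> z) (a z) e ks \<in> N)"
  using a v N
proof (induction ks arbitrary: N)
  case Nil
  have x: "\<pi> z0 \<in> topspace X" using continuous_map_image_subset_topspace[OF \<pi>] z0 by blast
  obtain \<epsilon> B where B: "\<epsilon> > 0" "openin X B" "\<pi> z0 \<in> B"
    "\<And>e. e \<in> topspace (btop E) \<Longrightarrow> bproj E e \<in> B \<Longrightarrow> bnorm E e < \<epsilon> \<Longrightarrow> e \<in> N"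
    using zero_nbhd[OF x Nil(3)] Nil(4) by (metis blin_Nil)
  have "bzero E (\<pi> z) \<in> N" if "z \<in> topspace Z" "\<pi> z \<in> B" for z
  proof -
    have "\<pi> z \<in> topspace X" using openin_subset[OF B(2)] that by blast
    then show ?thesis using B(4)[of "bzero E (\<pi> z)"] fiberD[OF zero_in] B(1) that by simp
  qed
  then show ?case using openin_continuous_map_preimage[OF \<pi> B(2)] z0 B(3)
    by (intro exI[of _ "\<lambda>_. UNIV"] exI[of _ "{z \<in> topspace Z. \<pi> z \<in> B}"]) auto
next
  case (Cons k ks)
  have x: "\<pi> z0 \<in> topspace X" using continuous_map_image_subset_topspace[OF \<pi>] z0 by blast
  have l: "blin (\<pi> z0) (a z0) v ks \<in> fiber E (\<pi> z0)" using Cons.prems(2) x by (intro blin_in) auto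
  have vk: "v k \<in> fiber E (\<pi> z0)" using Cons.prems by simp
  obtain R U V where R: "open R" "a z0 k \<in> R" "openin (btop E) U" "v k \<in> U" "openin (btop E) V"
    "blin (\<pi> z0) (a z0) v ks \<in> V"
    "\<And>s e f. s \<in> R \<Longrightarrow> e \<in> U \<Longrightarrow> f \<in> V \<Longrightarrow> bproj E e = bproj E f \<Longrightarrow> badd E (bscale E s e) f \<in> N"
    using add_scale_nbhd[OF vk l Cons.prems(3), of "a z0 k"] Cons.prems(4) by (metis blin_Cons)
  have "\<exists>W M. (\<forall>k\<in>set ks. openin (btop E) (W k) \<and> v k \<in> W k) \<and> openin Z M \<and> z0 \<in> M \<and>
    (\<forall>z\<in>M. \<forall>e. (\<forall>k\<in>set ks. e k \<in> W k \<and> e k \<in> fiber E (\<pi> z)) \<longrightarrow> blin (\<pi> z) (a z) e ks \<in> V)"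
    using Cons.prems R by (intro Cons.IH) auto
  then obtain W M where W: "\<And>k. k \<in> set ks \<Longrightarrow> openin (btop E) (W k) \<and> v k \<in> W k" "openin Z M" "z0 \<in> M"
    "\<And>z e. z \<in> M \<Longrightarrow> \<forall>k\<in>set ks. e k \<in> W k \<and> e k \<in> fiber E (\<pi> z) \<Longrightarrow> blin (\<pi> z) (a z) e ks \<in> V"
    by metis
  \<comment> \<open>The index \<open>k\<close> may occur again in \<open>ks\<close>; its
    neighbourhood then has to serve both occurrences.\<close>
  define W' where "W' = (\<lambda>i. if i \<in> set ks then (if i = k then W i \<inter> U else W i) else U)"
  have "continuous_map Z euclideanreal (\<lambda>z. a z k)" using Cons.prems(1) by simp
  then obtain M2 where M2: "openin Z M2" "z0 \<in> M2" "\<And>z. z \<in> M2 \<Longrightarrow> a z k \<in> R"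
    using continuous_map_openD[of Z euclideanreal "\<lambda>z. a z k" z0 R] z0 R(1,2) by auto
  have 1: "openin (btop E) (W' i) \<and> v i \<in> W' i" if "i \<in> set (k # ks)" for i
    using that W(1) R by (auto simp: W'_def)
  have 2: "blin (\<pi> z) (a z) e (k # ks) \<in> N"
    if z: "z \<in> M \<inter> M2" and e: "\<forall>i\<in>set (k # ks). e i \<in> W' i \<and> e i \<in> fiber E (\<pi> z)" for z e
  proof -
    have zx: "\<pi> z \<in> topspace X" using base e by auto
    have "blin (\<pi> z) (a z) e ks \<in> fiber E (\<pi> z)" using e zx by (intro blin_in) auto
    moreover have "\<forall>i\<in>set ks. e i \<in> W i \<and> e i \<in> fiber E (\<pi> z)" using e by (auto simp: W'_def split: if_splits)
    then have "blin (\<pi> z) (a z) e ks \<in> V" using W(4) z by blast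
    moreover have "e k \<in> U" using e by (auto simp: W'_def split: if_splits)
    ultimately show ?thesis using R(7)[of "a z k" "e k" "blin (\<pi> z) (a z) e ks"] M2 z e by (auto simp: fiber_def)
  qed
  show ?case using 1 2 W(2,3) M2(1,2) by (intro exI[of _ W'] exI[of _ "M \<inter> M2"]) auto
qed

end

text \<open>The base \<open>Y\<close> is kept apart from the object space. It is instantiated with
  \<open>obj G\<close> for the bundle \<open>E\<close>, and with a one-point space for the operators
  on a model fiber.\<close>

locale avg_bundle = cut_groupoid G \<mu> c + fell_bundle Y E
  for G :: "('g,'x) groupoid" and \<mu> :: "'x \<Rightarrow> 'g measure" and c :: "'x \<Rightarrow> real"
    and Y :: "'y topology" and E :: "('y,'e,'w) bbundle_scheme"
begin

section \<open>Weak integrals of continuous families\<close>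

definition vint :: "'y \<Rightarrow> 'x \<Rightarrow> ('g \<Rightarrow> 'e) \<Rightarrow> 'e" where
  "vint y x h = (THE v. v \<in> fiber E y \<and> (\<forall>\<phi>\<in>dual y. \<phi> v = Av x (\<lambda>k. \<phi> (h k))))"

text \<open>Two base points belong to a parameter \<open>z\<close>: the average runs over arrows
  with target \<open>q z\<close>, while the values lie in the fiber over \<open>\<pi> z\<close>. For
  the averaged operator applied to \<open>(g,e)\<close> these are the source and the target of
  \<open>g\<close>.\<close>

definition integrand :: "'p topology \<Rightarrow> ('p \<Rightarrow> 'x) \<Rightarrow> ('p \<Rightarrow> 'y) \<Rightarrow> ('p \<Rightarrow> 'g \<Rightarrow> 'e) \<Rightarrow> bool" where
  "integrand Z q \<pi> f \<longleftrightarrow> continuous_map Z (obj G) q \<and> continuous_map Z Y \<pi> \<and>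
    continuous_map (subtopology (prod_topology Z (arr G)) {(z,k). tgt G k = q z}) (btop E) (\<lambda>(z,k). f z k) \<and>
    (\<forall>z\<in>topspace Z. \<forall>k\<in>Ga. tgt G k = q z \<longrightarrow> f z k \<in> fiber E (\<pi> z))"

lemma integrandD:
  assumes "integrand Z q \<pi> f"
  shows "continuous_map Z (obj G) q" "continuous_map Z Y \<pi>"
    "continuous_map (subtopology (prod_topology Z (arr G)) {(z,k). tgt G k = q z}) (btop E) (\<lambda>(z,k). f z k)"
    "z \<in> topspace Z \<Longrightarrow> k \<in> Ga \<Longrightarrow> tgt G k = q z \<Longrightarrow> f z k \<in> fiber E (\<pi> z)"
    "z \<in> topspace Z \<Longrightarrow> q z \<in> Xo" "z \<in> topspace Z \<Longrightarrow> \<pi> z \<in> topspace Y"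
proof -
  show a: "continuous_map Z (obj G) q" "continuous_map Z Y \<pi>"
    "continuous_map (subtopology (prod_topology Z (arr G)) {(z,k). tgt G k = q z}) (btop E) (\<lambda>(z,k). f z k)"
    "z \<in> topspace Z \<Longrightarrow> k \<in> Ga \<Longrightarrow> tgt G k = q z \<Longrightarrow> f z k \<in> fiber E (\<pi> z)"
    using assms unfolding integrand_def by simp_all
  show "z \<in> topspace Z \<Longrightarrow> q z \<in> Xo" "z \<in> topspace Z \<Longrightarrow> \<pi> z \<in> topspace Y"
    using continuous_map_image_subset_topspace[OF a(1)] continuous_map_image_subset_topspace[OF a(2)] by auto
qed

lemma integrand_section:
  assumes f: "integrand Z q \<pi> f" and z: "z \<in> topspace Z"
  shows "continuous_map (tfib (q z)) (btop E) (f z)"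
proof -
  have "continuous_map (tfib (q z)) (prod_topology Z (arr G)) (\<lambda>k. (z,k))"
    using z by (intro continuous_map_pairedI) (auto simp: tfib_def intro: continuous_map_from_subtopology)
  then have "continuous_map (tfib (q z)) (subtopology (prod_topology Z (arr G)) {(z,k). tgt G k = q z}) (\<lambda>k. (z,k))"
    by (auto simp: continuous_map_in_subtopology)
  from continuous_map_compose[OF this integrandD(3)[OF f]] show ?thesis by (simp add: o_def)
qed

lemma integrand_dual:
  assumes f: "integrand Z q \<pi> f" and z: "z \<in> topspace Z" and \<phi>: "\<phi> \<in> dual (\<pi> z)"
  shows "continuous_map (tfib (q z)) euclideanreal (\<lambda>k. \<phi> (f z k))"
  using integrand_section[OF f z] integrandD(4)[OF f z] by (intro dual_cont[OF _ _ \<phi>]) auto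

text \<open>The neighbourhoods are uniform in the parameter near \<open>z0\<close>, so that one partition of unity serves
  both the existence and the continuity of the integral.\<close>

lemma integrand_partition:
  assumes f: "integrand Z q \<pi> f" and z0: "z0 \<in> topspace Z" and \<epsilon>: "\<epsilon> > 0"
  obtains I p W N where "finite I" "I \<subseteq> Ga" "\<And>i. i \<in> I \<Longrightarrow> tgt G i = q z0"
    "\<And>i. i \<in> I \<Longrightarrow> continuous_map (arr G) euclideanreal (p i)"
    "\<And>i. i \<in> I \<Longrightarrow> openin (btop E) (W i)" "\<And>i. i \<in> I \<Longrightarrow> f z0 i \<in> W i" "openin Z N" "z0 \<in> N"
    "\<And>z k. z \<in> N \<Longrightarrow> k \<in> Ga \<Longrightarrow> tgt G k = q z \<Longrightarrow> c (src G k) \<noteq> 0 \<Longrightarrow> (\<Sum>i\<in>I. p i k) = 1"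
    "\<And>i k. i \<in> I \<Longrightarrow> k \<in> Ga \<Longrightarrow> 0 \<le> p i k"
    "\<And>z k i e. z \<in> N \<Longrightarrow> k \<in> Ga \<Longrightarrow> tgt G k = q z \<Longrightarrow> i \<in> I \<Longrightarrow> p i k \<noteq> 0 \<Longrightarrow> e \<in> W i \<Longrightarrow> e \<in> fiber E (\<pi> z) \<Longrightarrow>
        bnorm E (bminus E (f z k) e) < \<epsilon>"
proof -
  let ?S = "arr G closure_of {g \<in> Ga. c (src G g) \<noteq> 0}"
  let ?P = "subtopology (prod_topology Z (arr G)) {(z,k). tgt G k = q z}"
  \<comment> \<open>All arrows over \<open>q z0\<close> that carry weight lie in this compact
    set.\<close>
  define K where "K = ?S \<inter> {g \<in> Ga. tgt G g \<in> {q z0}}"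
  have K: "compactin (arr G) K" unfolding K_def using integrandD(5)[OF f z0] by (intro cutoff_facts(3)[OF cut]) simp
  define good where "good = (\<lambda>k Nk Ok Wk g. openin Z Nk \<and> z0 \<in> Nk \<and> openin (btop E) Wk \<and> f z0 k \<in> Wk \<and>
      continuous_map (arr G) euclideanreal g \<and> g k = (1::real) \<and> (\<forall>k'\<in>Ga. 0 \<le> g k') \<and>
      (\<forall>k'\<in>Ga. g k' \<noteq> 0 \<longrightarrow> k' \<in> Ok) \<and>
      (\<forall>z\<in>Nk. \<forall>k'\<in>Ok. \<forall>e\<in>Wk. tgt G k' = q z \<longrightarrow> e \<in> fiber E (\<pi> z) \<longrightarrow> bnorm E (bminus E (f z k') e) < \<epsilon>))"
  have "\<exists>Nk Ok Wk g. good k Nk Ok Wk g"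
    if k: "k \<in> K" for k
  proof -
    have kG: "k \<in> Ga" "tgt G k = q z0" using k by (auto simp: K_def)
    have v: "f z0 k \<in> fiber E (\<pi> z0)" using integrandD(4)[OF f z0 kG] .
    have "bnorm E (bminus E (f z0 k) (f z0 k)) < \<epsilon>" using \<epsilon> norm_minus_self[OF v] by simp
    then obtain U1 U2 where U: "openin (btop E) U1" "f z0 k \<in> U1" "openin (btop E) U2" "f z0 k \<in> U2"
      "\<And>e e'. e \<in> U1 \<Longrightarrow> e' \<in> U2 \<Longrightarrow> bproj E e = bproj E e' \<Longrightarrow> bnorm E (bminus E e e') < \<epsilon>"
      using dist_nbhd[OF v v] by metis
    have "(z0,k) \<in> topspace ?P" using z0 kG by auto
    moreover have "(\<lambda>(z,k). f z k) (z0,k) \<in> U1" using U by simp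
    ultimately obtain M where M: "openin ?P M" "(z0,k) \<in> M" "\<And>p. p \<in> M \<Longrightarrow> (\<lambda>(z,k). f z k) p \<in> U1"
      using continuous_map_openD[OF integrandD(3)[OF f] _ U(1)] by metis
    obtain Nk Ok where N: "openin Z Nk" "z0 \<in> Nk" "openin (arr G) Ok" "k \<in> Ok"
      "\<And>z k. z \<in> Nk \<Longrightarrow> k \<in> Ok \<Longrightarrow> (z,k) \<in> {(z,k). tgt G k = q z} \<Longrightarrow> (z,k) \<in> M"
      using openin_prod_subE[OF M(1,2)] by metis
    have "closedin (arr G) (Ga - Ok)" "k \<in> Ga - (Ga - Ok)" using N kG by auto
    then obtain g where g: "continuous_map (arr G) (top_of_set {0..1}) g" "g k = (0::real)" "g ` (Ga - Ok) \<subseteq> {1}"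
      using arr_creg unfolding completely_regular_space_def by metis
    have gc: "continuous_map (arr G) euclideanreal g" using g(1) continuous_map_into_fulltopology by blast
    have g1: "g k' \<le> 1" if "k' \<in> Ga" for k' using continuous_map_image_subset_topspace[OF g(1)] that by auto
    show ?thesis unfolding good_def
    proof (intro exI conjI ballI impI)
      show "openin Z Nk" "z0 \<in> Nk" "openin (btop E) U2" "f z0 k \<in> U2" by fact+
      show "continuous_map (arr G) euclideanreal (\<lambda>k. 1 - g k)" using gc by (intro continuous_intros) auto
      show "1 - g k = 1" using g by simp
      show "0 \<le> 1 - g k'" if "k' \<in> Ga" for k' using g1[OF that] by simp
      show "k' \<in> Ok" if "k' \<in> Ga" "1 - g k' \<noteq> 0" for k' using g(3) that by auto
      fix z k' e assume a: "z \<in> Nk" "k' \<in> Ok" "e \<in> U2" "tgt G k' = q z" "e \<in> fiber E (\<pi> z)"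
      then have "(z,k') \<in> M" using N(5) by simp
      then have "f z k' \<in> U1" using M(3) by fastforce
      moreover have "f z k' \<in> fiber E (\<pi> z)"
        using a openin_subset[OF N(1)] openin_subset[OF N(3)] by (intro integrandD(4)[OF f]) auto
      ultimately show "bnorm E (bminus E (f z k') e) < \<epsilon>" using U(5) a by (auto simp: fiber_def)
    qed
  qed
  then obtain NN OK WW gg where "\<And>k. k \<in> K \<Longrightarrow> good k (NN k) (OK k) (WW k) (gg k)" by metis
  then have loc: "\<And>k. k \<in> K \<Longrightarrow> openin Z (NN k) \<and> z0 \<in> NN k \<and> openin (btop E) (WW k) \<and> f z0 k \<in> WW k \<and>
      continuous_map (arr G) euclideanreal (gg k) \<and> gg k k = (1::real) \<and> (\<forall>k'\<in>Ga. 0 \<le> gg k k') \<and>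
      (\<forall>k'\<in>Ga. gg k k' \<noteq> 0 \<longrightarrow> k' \<in> OK k) \<and>
      (\<forall>z\<in>NN k. \<forall>k'\<in>OK k. \<forall>e\<in>WW k. tgt G k' = q z \<longrightarrow> e \<in> fiber E (\<pi> z) \<longrightarrow> bnorm E (bminus E (f z k') e) < \<epsilon>)"
    unfolding good_def .
  define V where "V = (\<lambda>k. {k' \<in> Ga. gg k k' \<in> {1/2<..}})"
  have KG: "K \<subseteq> Ga" by (auto simp: K_def)
  have V: "openin (arr G) (V k)" "k \<in> V k" if "k \<in> K" for k
  proof -
    show "openin (arr G) (V k)" unfolding V_def
      by (rule openin_continuous_map_preimage[where Y = euclideanreal]) (use loc[OF that] in auto)
    show "k \<in> V k" using loc[OF that] that KG by (auto simp: V_def)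
  qed
  obtain I where I: "I \<subseteq> K" "finite I" "K \<subseteq> (\<Union>i\<in>I. V i)"
    using compactin_finite_subcover[OF K V] by metis
  have ggnn: "0 \<le> gg i k" if "i \<in> I" "k \<in> Ga" for i k
    using loc[of i] that I(1) by blast
  define g where "g = (\<lambda>k. \<Sum>i\<in>I. gg i k)"
  \<comment> \<open>Near \<open>K\<close> the denominator equals \<open>g\<close>, because
    \<open>g > 1/2\<close> there; the maximum keeps it positive everywhere else.\<close>
  define p where "p = (\<lambda>i k. gg i k / max (g k) (1/2))"
  have gc: "continuous_map (arr G) euclideanreal g" unfolding g_def
    using I loc by (intro continuous_map_sum) auto
  define P where "P = {k \<in> Ga. g k \<in> {1/2<..}}"
  have P: "openin (arr G) P" unfolding P_def by (rule openin_continuous_map_preimage[OF gc]) auto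
  have KP: "K \<subseteq> P"
  proof
    fix k assume k: "k \<in> K"
    then obtain i where i: "i \<in> I" "k \<in> V i" using I(3) by blast
    have "gg i k \<le> g k" unfolding g_def using i I(2) ggnn k KG by (intro member_le_sum) auto
    then show "k \<in> P" using i k KG by (auto simp: P_def V_def)
  qed
  obtain B C where BC: "openin (obj G) B" "compactin (obj G) C" "q z0 \<in> B" "B \<subseteq> C"
    using obj_loc_comp integrandD(5)[OF f z0] unfolding locally_compact_space_def by metis
  \<comment> \<open>A tube argument: \<open>L\<close> collects the arrows over the compact set
    \<open>C\<close> that may carry weight but are missed by the bumps. It is compact, so its
    targets form a closed set, which does not contain \<open>q z0\<close>; off that set the
    partition sums to 1 wherever there is weight.\<close>
  define L where "L = (?S \<inter> {g \<in> Ga. tgt G g \<in> C}) \<inter> (Ga - P)"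
  have "compactin (arr G) L" unfolding L_def
    by (rule compact_Int_closedin[OF cutoff_facts(3)[OF cut BC(2)]]) (use P in auto)
  then have "closedin (obj G) (tgt G ` L)"
    using image_compactin[OF _ cont_tgt0] compactin_imp_closedin[OF obj_haus] by blast
  then have B': "openin (obj G) (B - tgt G ` L)" using BC(1) by blast
  have "q z0 \<notin> tgt G ` L"
  proof
    assume "q z0 \<in> tgt G ` L"
    then obtain k where "k \<in> L" "tgt G k = q z0" by force
    then have "k \<in> K" "k \<notin> P" by (auto simp: L_def K_def)
    then show False using KP by blast
  qed
  define N where "N = {z \<in> topspace Z. q z \<in> B - tgt G ` L} \<inter> (topspace Z \<inter> (\<Inter>i\<in>I. NN i))"
  have inP: "k \<in> P" if "z \<in> N" "k \<in> Ga" "tgt G k = q z" "c (src G k) \<noteq> 0" for z k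
  proof (rule ccontr)
    assume "k \<notin> P"
    moreover have "k \<in> ?S" using closure_of_subset[of "{g \<in> Ga. c (src G g) \<noteq> 0}" "arr G"] that by auto
    ultimately have "k \<in> L" using that BC(4) by (auto simp: L_def N_def)
    then have "tgt G k \<in> tgt G ` L" by blast
    then show False using that(1) unfolding that(3) by (simp add: N_def)
  qed
  show ?thesis
  proof (rule that[of I p WW N])
    show "finite I" by fact
    show "I \<subseteq> Ga" using I KG by blast
    show "tgt G i = q z0" if "i \<in> I" for i using I that by (auto simp: K_def)
    show "continuous_map (arr G) euclideanreal (p i)" if "i \<in> I" for i unfolding p_def
      using loc[of i] that I gc by (intro continuous_intros) (auto simp: max_def)
    show "openin (btop E) (WW i)" "f z0 i \<in> WW i" if "i \<in> I" for i using loc[of i] that I by auto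
    have "openin Z (topspace Z \<inter> (\<Inter>i\<in>I. NN i))"
    proof (cases "I = {}")
      case False
      then have "openin Z (\<Inter>i\<in>I. NN i)" using I loc by (intro openin_INT2) auto
      then show ?thesis by blast
    qed simp
    then show "openin Z N" unfolding N_def using openin_continuous_map_preimage[OF integrandD(1)[OF f] B'] by blast
    show "z0 \<in> N" using z0 BC(3) \<open>q z0 \<notin> tgt G ` L\<close> loc I by (auto simp: N_def)
    show "(\<Sum>i\<in>I. p i k) = 1" if "z \<in> N" "k \<in> Ga" "tgt G k = q z" "c (src G k) \<noteq> 0" for z k
    proof -
      have "g k > 1/2" using inP[OF that] by (simp add: P_def)
      have "(\<Sum>i\<in>I. p i k) = g k / max (g k) (1/2)"
        by (simp add: p_def g_def sum_divide_distrib)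
      then show ?thesis using \<open>g k > 1/2\<close> by simp
    qed
    show "0 \<le> p i k" if "i \<in> I" "k \<in> Ga" for i k using loc[of i] that I by (auto simp: p_def)
    show "bnorm E (bminus E (f z k) e) < \<epsilon>"
      if "z \<in> N" "k \<in> Ga" "tgt G k = q z" "i \<in> I" "p i k \<noteq> 0" "e \<in> WW i" "e \<in> fiber E (\<pi> z)" for z k i e
    proof -
      have i: "i \<in> K" using that I by blast
      have "gg i k \<noteq> 0" using that by (auto simp: p_def)
      then have "k \<in> OK i" using loc[OF i] that by blast
      moreover have "z \<in> NN i" using that by (simp add: N_def)
      ultimately show ?thesis using loc[OF i] that by blast
    qed
  qed
qed

text \<open>After applying \<open>\<phi>\<close>, the sum is itself an average. Where the weight is
  nonzero the \<open>p i\<close> sum to 1, so the two integrands differ by a convex combination of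
  errors below \<open>\<epsilon>\<close>.\<close>

lemma partition_estimate:
  assumes f: "integrand Z q \<pi> f" and z: "z \<in> topspace Z" and I: "finite I"
    and p: "\<And>i. i \<in> I \<Longrightarrow> continuous_map (arr G) euclideanreal (p i)"
    and one: "\<And>k. k \<in> Ga \<Longrightarrow> tgt G k = q z \<Longrightarrow> c (src G k) \<noteq> 0 \<Longrightarrow> (\<Sum>i\<in>I. p i k) = 1"
    and nn: "\<And>i k. i \<in> I \<Longrightarrow> k \<in> Ga \<Longrightarrow> 0 \<le> p i k"
    and e: "\<And>i. i \<in> I \<Longrightarrow> e i \<in> fiber E (\<pi> z)"
    and near: "\<And>k i. k \<in> Ga \<Longrightarrow> tgt G k = q z \<Longrightarrow> i \<in> I \<Longrightarrow> p i k \<noteq> 0 \<Longrightarrow> bnorm E (bminus E (f z k) (e i)) < \<epsilon>"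
    and \<phi>: "\<phi> \<in> dual (\<pi> z)"
  shows "\<bar>Av (q z) (\<lambda>k. \<phi> (f z k)) - (\<Sum>i\<in>I. Av (q z) (p i) * \<phi> (e i))\<bar> \<le> \<epsilon>"
proof -
  have qz: "q z \<in> Xo" using integrandD(5)[OF f z] .
  have pc: "continuous_map (tfib (q z)) euclideanreal (\<lambda>k. \<phi> (e i) * p i k)" if "i \<in> I" for i
    unfolding tfib_def using p[OF that] by (intro continuous_intros continuous_map_from_subtopology)
  have sc: "continuous_map (tfib (q z)) euclideanreal (\<lambda>k. \<Sum>i\<in>I. \<phi> (e i) * p i k)"
    using pc I by (intro continuous_map_sum) auto
  have fc: "continuous_map (tfib (q z)) euclideanreal (\<lambda>k. \<phi> (f z k))" using integrand_dual[OF f z \<phi>] .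
  have eq: "(\<Sum>i\<in>I. Av (q z) (p i) * \<phi> (e i)) = Av (q z) (\<lambda>k. \<Sum>i\<in>I. \<phi> (e i) * p i k)"
    using Av_sum[OF qz pc I] by (simp add: Av_scale mult.commute)
  have bd: "\<bar>\<phi> (f z k) - (\<Sum>i\<in>I. \<phi> (e i) * p i k)\<bar> \<le> \<epsilon>"
    if k: "k \<in> Ga" "tgt G k = q z" "c (src G k) \<noteq> 0" for k
  proof -
    have fz: "f z k \<in> fiber E (\<pi> z)" using integrandD(4)[OF f z k(1,2)] .
    have "\<phi> (f z k) - (\<Sum>i\<in>I. \<phi> (e i) * p i k) = (\<Sum>i\<in>I. p i k * (\<phi> (f z k) - \<phi> (e i)))"
      using one[OF k] by (simp add: algebra_simps sum_subtractf) (simp add: sum_distrib_right[symmetric])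
    also have "\<bar>\<dots>\<bar> \<le> (\<Sum>i\<in>I. p i k * \<epsilon>)"
    proof (rule order_trans[OF sum_abs sum_mono])
      fix i assume i: "i \<in> I"
      show "\<bar>p i k * (\<phi> (f z k) - \<phi> (e i))\<bar> \<le> p i k * \<epsilon>"
      proof (cases "p i k = 0")
        case False
        have "\<bar>\<phi> (f z k) - \<phi> (e i)\<bar> = \<bar>\<phi> (bminus E (f z k) (e i))\<bar>" using \<phi> fz e[OF i] by simp
        also have "\<dots> \<le> \<epsilon>" using dual_abs[OF \<phi>, of "bminus E (f z k) (e i)"] near[OF k(1,2) i False] fz e[OF i] by simp
        finally show ?thesis using nn[OF i k(1)] by (simp add: abs_mult mult_left_mono)
      qed simp
    qed
    also have "\<dots> = \<epsilon>" using one[OF k] by (simp add: sum_distrib_right[symmetric])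
    finally show ?thesis .
  qed
  have "Av (q z) (\<lambda>k. \<phi> (f z k) - (\<Sum>i\<in>I. \<phi> (e i) * p i k)) \<le> \<epsilon>"
    using bd by (intro Av_le[OF qz] continuous_intros fc sc) fastforce
  moreover have "Av (q z) (\<lambda>k. (\<Sum>i\<in>I. \<phi> (e i) * p i k) - \<phi> (f z k)) \<le> \<epsilon>"
    using bd by (intro Av_le[OF qz] continuous_intros fc sc) fastforce
  ultimately show ?thesis unfolding eq using Av_diff[OF qz fc sc] Av_diff[OF qz sc fc] by simp
qed

text \<open>The finite sums approximate the required values uniformly over the dual unit ball. This
  makes them a Cauchy sequence in norm, and completeness of the fiber supplies the vector.\<close>

lemma vint_exists:
  assumes f: "integrand Z q \<pi> f" and z: "z \<in> topspace Z"
  shows "\<exists>v\<in>fiber E (\<pi> z). \<forall>\<phi>\<in>dual (\<pi> z). \<phi> v = Av (q z) (\<lambda>k. \<phi> (f z k))"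
proof -
  have y: "\<pi> z \<in> topspace Y" using integrandD(6)[OF f z] .
  have "\<exists>v\<in>fiber E (\<pi> z). \<forall>\<phi>\<in>dual (\<pi> z). \<bar>Av (q z) (\<lambda>k. \<phi> (f z k)) - \<phi> v\<bar> \<le> \<epsilon>" if \<epsilon>: "\<epsilon> > 0" for \<epsilon>
  proof (rule integrand_partition[OF f z \<epsilon>])
    fix I p W N
    assume I: "finite I" "I \<subseteq> Ga" "\<And>i. i \<in> I \<Longrightarrow> tgt G i = q z"
      "\<And>i. i \<in> I \<Longrightarrow> continuous_map (arr G) euclideanreal (p i)"
      "\<And>i. i \<in> I \<Longrightarrow> openin (btop E) (W i)" "\<And>i. i \<in> I \<Longrightarrow> f z i \<in> W i" "openin Z N" "z \<in> N"
      "\<And>z k. z \<in> N \<Longrightarrow> k \<in> Ga \<Longrightarrow> tgt G k = q z \<Longrightarrow> c (src G k) \<noteq> 0 \<Longrightarrow> (\<Sum>i\<in>I. p i k) = 1"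
      "\<And>i k. i \<in> I \<Longrightarrow> k \<in> Ga \<Longrightarrow> 0 \<le> p i k"
      "\<And>z k i e. z \<in> N \<Longrightarrow> k \<in> Ga \<Longrightarrow> tgt G k = q z \<Longrightarrow> i \<in> I \<Longrightarrow> p i k \<noteq> 0 \<Longrightarrow> e \<in> W i \<Longrightarrow> e \<in> fiber E (\<pi> z) \<Longrightarrow>
        bnorm E (bminus E (f z k) e) < \<epsilon>"
    obtain ks where ks: "set ks = I" "distinct ks" using finite_distinct_list[OF I(1)] by metis
    have e: "f z i \<in> fiber E (\<pi> z)" if "i \<in> I" for i using integrandD(4)[OF f z] I that by blast
    show ?thesis
    proof (intro bexI ballI)
      show v: "blin (\<pi> z) (\<lambda>i. Av (q z) (p i)) (f z) ks \<in> fiber E (\<pi> z)" using e ks by (intro blin_in[OF y]) auto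
      fix \<phi> assume \<phi>: "\<phi> \<in> dual (\<pi> z)"
      have "\<phi> (blin (\<pi> z) (\<lambda>i. Av (q z) (p i)) (f z) ks) = (\<Sum>i\<in>I. Av (q z) (p i) * \<phi> (f z i))"
        using dual_blin[OF \<phi> y ks(2)] e ks(1) by simp
      moreover have "\<bar>Av (q z) (\<lambda>k. \<phi> (f z k)) - (\<Sum>i\<in>I. Av (q z) (p i) * \<phi> (f z i))\<bar> \<le> \<epsilon>"
        by (rule partition_estimate[OF f z I(1,4) I(9)[OF I(8)] I(10) e _ \<phi>]) (use I e in auto)
      ultimately show "\<bar>Av (q z) (\<lambda>k. \<phi> (f z k)) - \<phi> (blin (\<pi> z) (\<lambda>i. Av (q z) (p i)) (f z) ks)\<bar> \<le> \<epsilon>" by simp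
    qed
  qed
  then have "\<forall>n. \<exists>v. v \<in> fiber E (\<pi> z) \<and> (\<forall>\<phi>\<in>dual (\<pi> z). \<bar>Av (q z) (\<lambda>k. \<phi> (f z k)) - \<phi> v\<bar> \<le> 1 / real (Suc n))"
    by (meson divide_pos_pos of_nat_0_less_iff zero_less_Suc zero_less_one)
  then obtain S where S: "\<And>n. S n \<in> fiber E (\<pi> z)"
    "\<And>n \<phi>. \<phi> \<in> dual (\<pi> z) \<Longrightarrow> \<bar>Av (q z) (\<lambda>k. \<phi> (f z k)) - \<phi> (S n)\<bar> \<le> 1 / real (Suc n)"
    by metis
  have cau: "bnorm E (bminus E (S m) (S n)) \<le> 1 / real (Suc m) + 1 / real (Suc n)" for m n
  proof (rule norm_leI)
    show "bminus E (S m) (S n) \<in> fiber E (\<pi> z)" using S by simp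
    fix \<phi> assume \<phi>: "\<phi> \<in> dual (\<pi> z)"
    have "\<phi> (bminus E (S m) (S n)) = \<phi> (S m) - \<phi> (S n)" using \<phi> S by simp
    then show "\<phi> (bminus E (S m) (S n)) \<le> 1 / real (Suc m) + 1 / real (Suc n)"
      using S(2)[OF \<phi>, of m] S(2)[OF \<phi>, of n] by linarith
  qed
  obtain l where l: "l \<in> fiber E (\<pi> z)" "(\<lambda>n. bnorm E (bminus E (S n) l)) \<longlonglongrightarrow> 0"
  proof (rule fiber_complete[OF S(1)])
    fix \<epsilon> :: real assume "\<epsilon> > 0"
    then obtain N where N: "1 / real (Suc N) < \<epsilon>/2" using nat_approx_posE[of "\<epsilon>/2"] by auto
    have "bnorm E (bminus E (S m) (S n)) < \<epsilon>" if "m \<ge> N" "n \<ge> N" for m n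
    proof -
      have "1 / real (Suc m) \<le> 1 / real (Suc N)" "1 / real (Suc n) \<le> 1 / real (Suc N)"
        using that by (auto intro!: divide_left_mono)
      then show ?thesis using cau[of m n] N by linarith
    qed
    then show "\<exists>N. \<forall>m\<ge>N. \<forall>n\<ge>N. bnorm E (bminus E (S m) (S n)) < \<epsilon>" by blast
  qed blast
  have "\<phi> l = Av (q z) (\<lambda>k. \<phi> (f z k))" if \<phi>: "\<phi> \<in> dual (\<pi> z)" for \<phi>
  proof -
    have "(\<lambda>n. \<phi> (S n)) \<longlonglongrightarrow> \<phi> l"
    proof (rule LIM_zero_cancel, rule Lim_null_comparison[OF _ l(2)])
      show "\<forall>\<^sub>F n in sequentially. norm (\<phi> (S n) - \<phi> l) \<le> bnorm E (bminus E (S n) l)"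
        using dual_abs[OF \<phi> minus_in[OF S(1) l(1)]] \<phi> S l by (intro always_eventually) simp
    qed
    moreover have "(\<lambda>n. \<phi> (S n)) \<longlonglongrightarrow> Av (q z) (\<lambda>k. \<phi> (f z k))"
    proof (rule LIM_zero_cancel, rule Lim_null_comparison[OF _ LIMSEQ_inverse_real_of_nat])
      show "\<forall>\<^sub>F n in sequentially. norm (\<phi> (S n) - Av (q z) (\<lambda>k. \<phi> (f z k))) \<le> inverse (real (Suc n))"
      proof (intro always_eventually allI)
        fix n show "norm (\<phi> (S n) - Av (q z) (\<lambda>k. \<phi> (f z k))) \<le> inverse (real (Suc n))"
          using S(2)[OF \<phi>, of n] by (simp only: real_norm_def abs_minus_commute inverse_eq_divide)
      qed
    qed
    ultimately show ?thesis using LIMSEQ_unique by blast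
  qed
  then show ?thesis using l by blast
qed

lemma vint_props:
  assumes x: "x \<in> Xo" "y \<in> topspace Y" and h: "continuous_map (tfib x) (btop E) h"
    and hf: "\<And>k. k \<in> Ga \<Longrightarrow> tgt G k = x \<Longrightarrow> h k \<in> fiber E y"
  shows "vint y x h \<in> fiber E y" "\<phi> \<in> dual y \<Longrightarrow> \<phi> (vint y x h) = Av x (\<lambda>k. \<phi> (h k))"
proof -
  \<comment> \<open>A single section is a family over a one-point parameter space.\<close>
  let ?Z = "discrete_topology {()}"
  have "integrand ?Z (\<lambda>_. x) (\<lambda>_. y) (\<lambda>_. h)" unfolding integrand_def
  proof (intro conjI ballI impI)
    have "continuous_map (subtopology (prod_topology ?Z (arr G)) {(z,k). tgt G k = x}) (tfib x) snd"
      unfolding tfib_def by (auto simp: continuous_map_in_subtopology intro: continuous_map_from_subtopology continuous_map_snd)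
    from continuous_map_compose[OF this h]
    show "continuous_map (subtopology (prod_topology ?Z (arr G)) {(z,k). tgt G k = x}) (btop E) (\<lambda>(z,k). h k)"
      by (simp add: o_def case_prod_unfold)
  qed (use x hf in auto)
  from vint_exists[OF this, of "()"] obtain v where v: "v \<in> fiber E y" "\<forall>\<phi>\<in>dual y. \<phi> v = Av x (\<lambda>k. \<phi> (h k))" by auto
  have "vint y x h = v" unfolding vint_def
    using v by (intro the_equality) (auto intro!: fiber_eqI)
  then show "vint y x h \<in> fiber E y" "\<phi> \<in> dual y \<Longrightarrow> \<phi> (vint y x h) = Av x (\<lambda>k. \<phi> (h k))" using v by auto
qed

text \<open>Near \<open>z0\<close> the integral stays within \<open>\<epsilon>\<close> of a
  combination whose coefficients \<open>Av (q z) (p i)\<close> are continuous in \<open>z\<close>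
  and whose vectors may be any elements of \<open>W i\<close> over \<open>\<pi> z\<close>. Such
  combinations are controlled by \<open>blin_nbhd\<close>.\<close>

lemma vint_cont:
  assumes f: "integrand Z q \<pi> f"
  shows "continuous_map Z (btop E) (\<lambda>z. vint (\<pi> z) (q z) (f z))"
proof -
  define J where "J = (\<lambda>z. vint (\<pi> z) (q z) (f z))"
  have J: "J z \<in> fiber E (\<pi> z)" "\<And>\<phi>. \<phi> \<in> dual (\<pi> z) \<Longrightarrow> \<phi> (J z) = Av (q z) (\<lambda>k. \<phi> (f z k))" if "z \<in> topspace Z" for z
    unfolding J_def using vint_props[OF integrandD(5,6)[OF f that] integrand_section[OF f that] integrandD(4)[OF f that]] by auto
  have "continuous_map Z (btop E) J"
  proof (rule cont_crit[OF J(1)])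
    fix z0 V and \<epsilon>0 :: real
    assume z0: "z0 \<in> topspace Z" and V: "openin (btop E) V" "J z0 \<in> V" and \<epsilon>0: "\<epsilon>0 > 0"
    \<comment> \<open>The final distance splits into one part of at most \<open>\<epsilon>\<close>
      and one below \<open>2 * \<epsilon>\<close>, which stays below
      \<open>\<epsilon>0\<close>.\<close>
    define \<epsilon> where "\<epsilon> = \<epsilon>0 / 4"
    have \<epsilon>: "\<epsilon> > 0" using \<epsilon>0 by (simp add: \<epsilon>_def)
    have y: "\<pi> z \<in> topspace Y" if "z \<in> topspace Z" for z using integrandD(6)[OF f that] .
    show "\<exists>N. openin Z N \<and> z0 \<in> N \<and> (\<forall>y\<in>N. \<exists>e\<in>V. e \<in> fiber E (\<pi> y) \<and> bnorm E (bminus E (J y) e) < \<epsilon>0)"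
    proof (rule integrand_partition[OF f z0 \<epsilon>])
      fix I p W N
      assume I: "finite I" "I \<subseteq> Ga" "\<And>i. i \<in> I \<Longrightarrow> tgt G i = q z0"
        "\<And>i. i \<in> I \<Longrightarrow> continuous_map (arr G) euclideanreal (p i)"
        "\<And>i. i \<in> I \<Longrightarrow> openin (btop E) (W i)" "\<And>i. i \<in> I \<Longrightarrow> f z0 i \<in> W i" "openin Z N" "z0 \<in> N"
        "\<And>z k. z \<in> N \<Longrightarrow> k \<in> Ga \<Longrightarrow> tgt G k = q z \<Longrightarrow> c (src G k) \<noteq> 0 \<Longrightarrow> (\<Sum>i\<in>I. p i k) = 1"
        "\<And>i k. i \<in> I \<Longrightarrow> k \<in> Ga \<Longrightarrow> 0 \<le> p i k"
        "\<And>z k i e. z \<in> N \<Longrightarrow> k \<in> Ga \<Longrightarrow> tgt G k = q z \<Longrightarrow> i \<in> I \<Longrightarrow> p i k \<noteq> 0 \<Longrightarrow> e \<in> W i \<Longrightarrow> e \<in> fiber E (\<pi> z) \<Longrightarrow>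
          bnorm E (bminus E (f z k) e) < \<epsilon>"
      obtain ks where ks: "set ks = I" "distinct ks" using finite_distinct_list[OF I(1)] by metis
      define a where "a = (\<lambda>z i. Av (q z) (p i))"
      have ac: "continuous_map Z euclideanreal (\<lambda>z. a z i)" if "i \<in> I" for i
        unfolding a_def using continuous_map_compose[OF integrandD(1)[OF f] Av_cont[OF I(4)[OF that]]] by (simp add: o_def)
      have est: "bnorm E (bminus E (J z) (blin (\<pi> z) (a z) e ks)) \<le> \<epsilon>"
        if z: "z \<in> N" and e: "\<And>i. i \<in> I \<Longrightarrow> e i \<in> W i" "\<And>i. i \<in> I \<Longrightarrow> e i \<in> fiber E (\<pi> z)" for z e
      proof -
        have zZ: "z \<in> topspace Z" using z I(7) openin_subset by blast
        have b: "blin (\<pi> z) (a z) e ks \<in> fiber E (\<pi> z)" using e ks by (intro blin_in y zZ) auto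
        show ?thesis
        proof (rule norm_leI)
          show "bminus E (J z) (blin (\<pi> z) (a z) e ks) \<in> fiber E (\<pi> z)" using J(1)[OF zZ] b by simp
          fix \<phi> assume \<phi>: "\<phi> \<in> dual (\<pi> z)"
          have "\<phi> (blin (\<pi> z) (a z) e ks) = (\<Sum>i\<in>I. Av (q z) (p i) * \<phi> (e i))"
            using dual_blin[OF \<phi> y[OF zZ] ks(2)] e ks(1) by (simp add: a_def)
          moreover have "\<bar>Av (q z) (\<lambda>k. \<phi> (f z k)) - (\<Sum>i\<in>I. Av (q z) (p i) * \<phi> (e i))\<bar> \<le> \<epsilon>"
            by (rule partition_estimate[OF f zZ I(1,4) I(9)[OF z] I(10) e(2) _ \<phi>]) (use I e z in auto)
          moreover have "\<phi> (bminus E (J z) (blin (\<pi> z) (a z) e ks)) = \<phi> (J z) - \<phi> (blin (\<pi> z) (a z) e ks)"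
            using \<phi> J(1)[OF zZ] b by simp
          ultimately show "\<phi> (bminus E (J z) (blin (\<pi> z) (a z) e ks)) \<le> \<epsilon>" using J(2)[OF zZ \<phi>] by linarith
        qed
      qed
      have e0: "f z0 i \<in> fiber E (\<pi> z0)" if "i \<in> I" for i using integrandD(4)[OF f z0] I that by blast
      define v where "v = blin (\<pi> z0) (a z0) (f z0) ks"
      have v: "v \<in> fiber E (\<pi> z0)" unfolding v_def using e0 ks by (intro blin_in y z0) auto
      have "bnorm E (bminus E (J z0) v) < 2 * \<epsilon>" using est[OF I(8) I(6) e0] \<epsilon> by (simp add: v_def)
      then obtain U1 U2 where U: "openin (btop E) U1" "J z0 \<in> U1" "openin (btop E) U2" "v \<in> U2"
        "\<And>e e'. e \<in> U1 \<Longrightarrow> e' \<in> U2 \<Longrightarrow> bproj E e = bproj E e' \<Longrightarrow> bnorm E (bminus E e e') < 2 * \<epsilon>"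
        using dist_nbhd[OF J(1)[OF z0] v] by metis
      have "\<exists>W M. (\<forall>k\<in>set ks. openin (btop E) (W k) \<and> f z0 k \<in> W k) \<and> openin Z M \<and> z0 \<in> M \<and>
        (\<forall>z\<in>M. \<forall>e. (\<forall>k\<in>set ks. e k \<in> W k \<and> e k \<in> fiber E (\<pi> z)) \<longrightarrow> blin (\<pi> z) (a z) e ks \<in> U2)"
        using ac e0 ks U(4) by (intro blin_nbhd integrandD(2)[OF f] z0 U(3)) (auto simp: v_def)
      then obtain W' M where W': "\<And>i. i \<in> I \<Longrightarrow> openin (btop E) (W' i) \<and> f z0 i \<in> W' i" "openin Z M" "z0 \<in> M"
        "\<And>z e. z \<in> M \<Longrightarrow> \<forall>i\<in>I. e i \<in> W' i \<and> e i \<in> fiber E (\<pi> z) \<Longrightarrow> blin (\<pi> z) (a z) e ks \<in> U2"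
        unfolding ks(1) by metis
      \<comment> \<open>Over nearby points the vectors are taken in \<open>W i\<close> for the
        estimate of the integral and in \<open>W' i\<close> so that their combination lands in
        \<open>U2\<close>.\<close>
      have "\<exists>Mi. openin Z Mi \<and> z0 \<in> Mi \<and> (\<forall>z\<in>Mi. \<exists>e\<in>W i \<inter> W' i. e \<in> fiber E (\<pi> z))" if i: "i \<in> I" for i
        using lift_nbhd[OF integrandD(2)[OF f] z0, of "W i \<inter> W' i" "f z0 i"] I(5,6)[OF i] W'(1)[OF i] fiberD(2)[OF e0[OF i]]
        by (metis IntI openin_Int)
      then obtain MM where MM: "\<And>i. i \<in> I \<Longrightarrow> openin Z (MM i) \<and> z0 \<in> MM i \<and> (\<forall>z\<in>MM i. \<exists>e\<in>W i \<inter> W' i. e \<in> fiber E (\<pi> z))"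
        by metis
      obtain N1 where N1: "openin Z N1" "z0 \<in> N1" "\<And>z. z \<in> N1 \<Longrightarrow> \<exists>e\<in>V \<inter> U1. e \<in> fiber E (\<pi> z)"
        using lift_nbhd[OF integrandD(2)[OF f] z0, of "V \<inter> U1" "J z0"] V U fiberD(2)[OF J(1)[OF z0]]
        by (metis IntI openin_Int)
      define Q where "Q = N \<inter> M \<inter> N1 \<inter> (topspace Z \<inter> (\<Inter>i\<in>I. MM i))"
      have "openin Z (topspace Z \<inter> (\<Inter>i\<in>I. MM i))"
      proof (cases "I = {}")
        case False
        then have "openin Z (\<Inter>i\<in>I. MM i)" using I(1) MM by (intro openin_INT2) auto
        then show ?thesis by blast
      qed simp
      then have Q: "openin Z Q" "z0 \<in> Q" unfolding Q_def using I(7,8) W'(2,3) N1(1,2) z0 MM by auto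
      have "\<exists>e\<in>V. e \<in> fiber E (\<pi> z) \<and> bnorm E (bminus E (J z) e) < \<epsilon>0" if z: "z \<in> Q" for z
      proof -
        have zs: "z \<in> topspace Z" "z \<in> N" "z \<in> M" "z \<in> N1" "\<And>i. i \<in> I \<Longrightarrow> z \<in> MM i" using z by (auto simp: Q_def)
        have "\<forall>i\<in>I. \<exists>e. e \<in> W i \<inter> W' i \<and> e \<in> fiber E (\<pi> z)" using MM zs(5) by blast
        then obtain e where e: "\<And>i. i \<in> I \<Longrightarrow> e i \<in> W i \<inter> W' i \<and> e i \<in> fiber E (\<pi> z)" by metis
        obtain u where u: "u \<in> V" "u \<in> U1" "u \<in> fiber E (\<pi> z)" using N1(3)[OF zs(4)] by blast
        let ?b = "blin (\<pi> z) (a z) e ks"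
        have b: "?b \<in> fiber E (\<pi> z)" using e ks by (intro blin_in y zs) auto
        have "?b \<in> U2" using W'(4)[OF zs(3)] e by blast
        then have "bnorm E (bminus E u ?b) < 2 * \<epsilon>" using U(5) u b by (auto simp: fiber_def)
        moreover have "bnorm E (bminus E (J z) ?b) \<le> \<epsilon>" using est[OF zs(2)] e by blast
        moreover have "bnorm E (bminus E (J z) u) \<le> bnorm E (bminus E (J z) ?b) + bnorm E (bminus E ?b u)"
          using norm_minus_tri[OF J(1)[OF zs(1)] b u(3)] .
        ultimately have "bnorm E (bminus E (J z) u) < \<epsilon>0" using norm_minus_commute[OF u(3) b] \<epsilon> by (simp add: \<epsilon>_def)
        then show ?thesis using u by blast
      qed
      then show ?thesis using Q by blast
    qed
  qed
  then show ?thesis by (simp add: J_def)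
qed

end

section \<open>Multipliers and modules\<close>

context fell_bundle begin

lemma eq_of_small:
  assumes "e \<in> fiber E x" "f \<in> fiber E x" "\<And>\<epsilon>. \<epsilon> > 0 \<Longrightarrow> bnorm E (bminus E e f) \<le> \<epsilon>"
  shows "e = f"
proof (rule minus_eq_zero[OF assms(1,2)])
  have "bnorm E (bminus E e f) \<le> 0" by (rule field_le_epsilon) (use assms(3) in simp)
  then show "bminus E e f = bzero E x"
    using norm_ge0[of "bminus E e f" x] norm_eq0[of "bminus E e f" x] assms(1,2) by simp
qed

lemma geometric_limit:
  assumes S: "\<And>n. S n \<in> fiber E x" and r: "0 \<le> r" "r < 1" and C: "C \<ge> 0"
    and step: "\<And>n. bnorm E (bminus E (S (Suc n)) (S n)) \<le> C * r ^ n"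
  obtains l where "l \<in> fiber E x" "\<And>n. bnorm E (bminus E l (S n)) \<le> C / (1 - r) * r ^ n"
proof -
  \<comment> \<open>The factor \<open>1 - r ^ k\<close> is the exact partial geometric sum; without
    it the bound would not reproduce itself in the induction.\<close>
  have tail: "bnorm E (bminus E (S (n + k)) (S n)) \<le> C / (1 - r) * r ^ n * (1 - r ^ k)" for n k
  proof (induction k)
    case 0 then show ?case using norm_minus_self[OF S] by simp
  next
    case (Suc k)
    have "bnorm E (bminus E (S (n + Suc k)) (S n)) \<le>
        bnorm E (bminus E (S (Suc (n + k))) (S (n + k))) + bnorm E (bminus E (S (n + k)) (S n))"
      using norm_minus_tri[OF S[of "Suc (n+k)"] S[of "n+k"] S[of n]] by simp
    also have "\<dots> \<le> C * r ^ (n + k) + C / (1 - r) * r ^ n * (1 - r ^ k)" using step[of "n+k"] Suc by simp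
    also have "\<dots> = C / (1 - r) * r ^ n * (1 - r ^ Suc k)" using r by (simp add: field_simps power_add)
    finally show ?case .
  qed
  have tail2: "bnorm E (bminus E (S (n + k)) (S n)) \<le> C / (1 - r) * r ^ n" for n k
  proof -
    have "C / (1 - r) * r ^ n * (1 - r ^ k) \<le> C / (1 - r) * r ^ n * 1"
      using r C by (intro mult_left_mono) auto
    then show ?thesis using tail[of n k] by simp
  qed
  have lim: "(\<lambda>n. C / (1 - r) * r ^ n) \<longlonglongrightarrow> 0"
    using LIMSEQ_power_zero[of r] r tendsto_mult_right_zero[of "\<lambda>n. r ^ n" sequentially "C / (1 - r)"] by auto
  obtain l where l: "l \<in> fiber E x" "(\<lambda>n. bnorm E (bminus E (S n) l)) \<longlonglongrightarrow> 0"
  proof (rule fiber_complete[OF S])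
    fix \<epsilon> :: real assume "\<epsilon> > 0"
    then obtain N where N: "\<And>n. n \<ge> N \<Longrightarrow> norm (C / (1 - r) * r ^ n - 0) < \<epsilon> / 2"
      using LIMSEQ_D[OF lim, of "\<epsilon>/2"] by auto
    have "bnorm E (bminus E (S m) (S n)) < \<epsilon>" if "m \<ge> N" "n \<ge> N" for m n
    proof -
      have "bnorm E (bminus E (S m) (S n)) \<le> bnorm E (bminus E (S m) (S N)) + bnorm E (bminus E (S N) (S n))"
        using norm_minus_tri[OF S S S] .
      also have "\<dots> \<le> C / (1 - r) * r ^ N + C / (1 - r) * r ^ N"
        using tail2[of N "m - N"] tail2[of N "n - N"] that norm_minus_commute[OF S S, of N n] by simp
      also have "\<dots> < \<epsilon>" using N[OF order_refl] unfolding real_norm_def diff_0_right by linarith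
      finally show ?thesis .
    qed
    then show "\<exists>N. \<forall>m\<ge>N. \<forall>n\<ge>N. bnorm E (bminus E (S m) (S n)) < \<epsilon>" by blast
  qed blast
  show ?thesis
  proof (rule that[OF l(1)])
    fix n
    show "bnorm E (bminus E l (S n)) \<le> C / (1 - r) * r ^ n"
    proof (rule field_le_epsilon)
      fix \<epsilon> :: real assume "\<epsilon> > 0"
      then obtain N where N: "\<And>m. m \<ge> N \<Longrightarrow> norm (bnorm E (bminus E (S m) l) - 0) < \<epsilon>"
        using LIMSEQ_D[OF l(2), of \<epsilon>] by auto
      have "bnorm E (bminus E l (S n)) \<le> bnorm E (bminus E l (S (n + N))) + bnorm E (bminus E (S (n + N)) (S n))"
        using norm_minus_tri[OF l(1) S S] .
      also have "bnorm E (bminus E l (S (n + N))) \<le> \<epsilon>"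
        using N[of "n + N"] norm_minus_commute[OF l(1) S, of "n + N"] by simp
      also have "bnorm E (bminus E (S (n + N)) (S n)) \<le> C / (1 - r) * r ^ n" by (rule tail2)
      finally show "bnorm E (bminus E l (S n)) \<le> C / (1 - r) * r ^ n + \<epsilon>" by simp
    qed
  qed
qed

text \<open>The Neumann series in the form of the iteration
  \<open>S (Suc n) = w + (S n - L (S n))\<close>, whose steps shrink by the factor \<open>r\<close>
  and whose fixed points solve \<open>L v = w\<close>.\<close>

lemma near_identity_surj:
  assumes L: "\<And>e. e \<in> fiber E x \<Longrightarrow> L e \<in> fiber E x"
    and add: "\<And>e f. e \<in> fiber E x \<Longrightarrow> f \<in> fiber E x \<Longrightarrow> L (badd E e f) = badd E (L e) (L f)"
    and scale: "\<And>t e. e \<in> fiber E x \<Longrightarrow> L (bscale E t e) = bscale E t (L e)"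
    and r: "0 \<le> r" "r < 1" and near: "\<And>e. e \<in> fiber E x \<Longrightarrow> bnorm E (bminus E e (L e)) \<le> r * bnorm E e"
    and w: "w \<in> fiber E x"
  obtains v where "v \<in> fiber E x" "L v = w"
proof -
  define S where "S = rec_nat w (\<lambda>_ e. badd E w (bminus E e (L e)))"
  have S0: "S 0 = w" and SS: "S (Suc n) = badd E w (bminus E (S n) (L (S n)))" for n by (simp_all add: S_def)
  have S: "S n \<in> fiber E x" for n by (induction n) (use w L in \<open>auto simp: S0 SS\<close>)
  have Lm: "L (bminus E e f) = bminus E (L e) (L f)" if "e \<in> fiber E x" "f \<in> fiber E x" for e f
    using that by (simp add: bminus_def add scale)
  have step: "bnorm E (bminus E (S (Suc n)) (S n)) \<le> bnorm E w * r ^ n" for n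
  proof (induction n)
    case 0
    have "bminus E (S (Suc 0)) (S 0) = bminus E w (L w)"
      by (rule fiber_eqI[of _ x]) (use w L in \<open>auto simp: S0 SS\<close>)
    then show ?case using near[OF w] r norm_ge0[OF w] mult_left_le_one_le[of "bnorm E w" r] by simp
  next
    case (Suc n)
    define d where "d = bminus E (S (Suc n)) (S n)"
    have d: "d \<in> fiber E x" using S by (simp add: d_def)
    have "bminus E (S (Suc (Suc n))) (S (Suc n)) = bminus E d (L d)"
      unfolding SS[of "Suc n"] unfolding d_def Lm[OF S S]
    proof (rule fiber_eqI[of _ x])
      fix \<phi> assume \<phi>: "\<phi> \<in> dual x"
      have "\<phi> (S (Suc n)) = \<phi> w + \<phi> (S n) - \<phi> (L (S n))" using \<phi> w S[of n] L[OF S[of n]] by (simp add: SS)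
      then show "\<phi> (bminus E (badd E w (bminus E (S (Suc n)) (L (S (Suc n))))) (S (Suc n))) =
        \<phi> (bminus E (bminus E (S (Suc n)) (S n)) (bminus E (L (S (Suc n))) (L (S n))))"
        using \<phi> w S L[OF S] by simp
    qed (use w S L[OF S] in auto)
    then have "bnorm E (bminus E (S (Suc (Suc n))) (S (Suc n))) \<le> r * bnorm E d" using near[OF d] by simp
    also have "\<dots> \<le> r * (bnorm E w * r ^ n)" using Suc r by (intro mult_left_mono) (auto simp: d_def)
    finally show ?case by (simp add: mult_ac)
  qed
  obtain l where l: "l \<in> fiber E x" "\<And>n. bnorm E (bminus E l (S n)) \<le> bnorm E w / (1 - r) * r ^ n"
    using geometric_limit[OF S r norm_ge0[OF w] step] by metis
  have lim: "(\<lambda>n. (3 * (bnorm E w / (1 - r))) * r ^ n) \<longlonglongrightarrow> 0"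
    using LIMSEQ_power_zero[of r] r by (intro tendsto_mult_right_zero) auto
  have "L l = w"
  proof (rule eq_of_small[OF L[OF l(1)] w])
    fix \<epsilon> :: real assume "\<epsilon> > 0"
    then obtain n where n: "norm (3 * (bnorm E w / (1 - r)) * r ^ n - 0) < \<epsilon>"
      using LIMSEQ_D[OF lim, of \<epsilon>] by blast
    define d where "d = bminus E l (S n)"
    have d: "d \<in> fiber E x" using S l by (simp add: d_def)
    have Ld: "bnorm E (L d) \<le> 2 * bnorm E d"
    proof -
      have "bnorm E (L d) \<le> bnorm E d + bnorm E (bminus E (L d) d)" using norm_le_minus[OF L[OF d] d] .
      also have "bnorm E (bminus E (L d) d) \<le> r * bnorm E d" using near[OF d] norm_minus_commute[OF d L[OF d]] by simp
      also have "\<dots> \<le> 1 * bnorm E d" using r norm_ge0[OF d] by (intro mult_right_mono) auto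
      finally show ?thesis by simp
    qed
    \<comment> \<open>By the recursion \<open>S n - S (Suc n) = L (S n) - w\<close>, so the residual
      at the limit is a tail of the iteration plus one step.\<close>
    have eq: "bminus E (L l) w = badd E (L d) (bminus E (S n) (S (Suc n)))"
    proof (rule fiber_eqI[of _ x])
      fix \<phi> assume \<phi>: "\<phi> \<in> dual x"
      have "L d = bminus E (L l) (L (S n))" unfolding d_def by (rule Lm[OF l(1) S])
      then show "\<phi> (bminus E (L l) w) = \<phi> (badd E (L d) (bminus E (S n) (S (Suc n))))"
        using \<phi> w S[of n] S[of "Suc n"] L[OF S[of n]] L[OF l(1)] d L[OF d] by (simp add: SS[of n])
    qed (use w S L l d in auto)
    have "bnorm E (bminus E (L l) w) \<le> bnorm E (L d) + bnorm E (bminus E (S n) (S (Suc n)))"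
      unfolding eq using norm_tri[of "L d" x "bminus E (S n) (S (Suc n))"] L[OF d] S by simp
    also have "\<dots> \<le> 2 * bnorm E d + bnorm E w * r ^ n"
      using Ld step[of n] norm_minus_commute[OF S S, of n "Suc n"] by simp
    also have "bnorm E d \<le> bnorm E w / (1 - r) * r ^ n" using l(2) by (simp add: d_def)
    also have "bnorm E w * r ^ n \<le> bnorm E w / (1 - r) * r ^ n"
    proof (rule mult_right_mono)
      have "bnorm E w * (1 - r) \<le> bnorm E w" using norm_ge0[OF w] r by (simp add: algebra_simps)
      then show "bnorm E w \<le> bnorm E w / (1 - r)" using r by (simp add: field_simps)
    qed (use r in simp)
    finally have "bnorm E (bminus E (L l) w) \<le> 3 * (bnorm E w / (1 - r)) * r ^ n" by simp
    then show "bnorm E (bminus E (L l) w) \<le> \<epsilon>" using n unfolding real_norm_def diff_0_right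
      by linarith
  qed
  then show ?thesis using that l(1) by blast
qed

end

section \<open>The module action, the multiplier and the orbits\<close>

locale rep_setting = avg_bundle G \<mu> c "obj G" E
  for G :: "('g,'x) groupoid" and \<mu> :: "'x \<Rightarrow> 'g measure" and c :: "'x \<Rightarrow> real"
    and E :: "('x,'e,'w) bbundle_scheme" +
  fixes A :: "('x,'a,'u) balg_scheme" and gact :: "'g \<Rightarrow> 'a \<Rightarrow> 'a"
    and act :: "'a \<Rightarrow> 'e \<Rightarrow> 'e" and \<sigma> :: "'g \<Rightarrow> 'g \<Rightarrow> 'a"
  assumes alg_G: "banach_algebra_G_bundle G A gact"
    and module: "banach_module_bundle (obj G) A E act"
    and mult: "multiplier G A gact \<sigma>"
begin

lemma alg: "banach_algebra_bundle (obj G) A" using alg_G unfolding banach_algebra_G_bundle_def by simp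

sublocale A: fell_bundle "obj G" A
  by unfold_locales (use alg in \<open>simp add: banach_algebra_bundle_def\<close>)

lemmas module_rest = module[unfolded banach_module_bundle_def, THEN conjunct2, THEN conjunct2]
lemmas act_cont0 = module_rest[THEN conjunct1]
lemmas module_norm = module_rest[THEN conjunct2, THEN conjunct1, rule_format]
lemmas module_one = module_rest[THEN conjunct2, THEN conjunct2, THEN conjunct1, rule_format]
lemmas module_laws = module_rest[THEN conjunct2, THEN conjunct2, THEN conjunct2, rule_format]

lemma act_in [simp]: "a \<in> fiber A x \<Longrightarrow> e \<in> fiber E x \<Longrightarrow> act a e \<in> fiber E x"
  and act_norm: "a \<in> fiber A x \<Longrightarrow> e \<in> fiber E x \<Longrightarrow> bnorm E (act a e) \<le> bnorm A a * bnorm E e"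
  using module_norm[of x a e] base[of e x] by simp_all

lemma act_one: "e \<in> fiber E x \<Longrightarrow> act (bone A x) e = e"
  using module_one[of x e] base[of e x] by simp

lemma act_mult: "a \<in> fiber A x \<Longrightarrow> b \<in> fiber A x \<Longrightarrow> e \<in> fiber E x \<Longrightarrow> act (bmult A a b) e = act a (act b e)"
  using module_laws[of x a b e e 0] base[of e x] by simp

lemma act_add: "a \<in> fiber A x \<Longrightarrow> e \<in> fiber E x \<Longrightarrow> f \<in> fiber E x \<Longrightarrow> act a (badd E e f) = badd E (act a e) (act a f)"
  using module_laws[of x a a e f 0] base[of e x] by simp

lemma act_scale: "a \<in> fiber A x \<Longrightarrow> e \<in> fiber E x \<Longrightarrow> act a (bscale E r e) = bscale E r (act a e)"
  using module_laws[of x a a e e r] base[of e x] by simp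

lemma act_minus: "a \<in> fiber A x \<Longrightarrow> e \<in> fiber E x \<Longrightarrow> f \<in> fiber E x \<Longrightarrow> act a (bminus E e f) = bminus E (act a e) (act a f)"
  by (simp add: bminus_def act_add[of _ x] act_scale[of _ x])

lemma cont_act:
  assumes "continuous_map Z (btop A) u" "continuous_map Z (btop E) v"
    "\<And>z. z \<in> topspace Z \<Longrightarrow> bproj A (u z) = bproj E (v z)"
  shows "continuous_map Z (btop E) (\<lambda>z. act (u z) (v z))"
proof -
  have "continuous_map Z (subtopology (prod_topology (btop A) (btop E))
          {(a,e). a \<in> topspace (btop A) \<and> e \<in> topspace (btop E) \<and> bproj A a = bproj E e}) (\<lambda>z. (u z, v z))"
    using assms continuous_map_image_subset_topspace[OF assms(1)] continuous_map_image_subset_topspace[OF assms(2)]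
    by (auto simp: continuous_map_in_subtopology intro!: continuous_map_pairedI)
  from continuous_map_compose[OF this act_cont0] show ?thesis by (simp add: o_def)
qed

lemmas alg_rest = alg[unfolded banach_algebra_bundle_def, THEN conjunct2]
lemmas mult_cont0 = alg_rest[THEN conjunct1]
lemmas one_cont0 = alg_rest[THEN conjunct2, THEN conjunct1]
lemmas alg_laws = alg_rest[THEN conjunct2, THEN conjunct2, THEN bspec]

lemma one_in [simp]: "x \<in> Xo \<Longrightarrow> bone A x \<in> fiber A x"
  using alg_laws[of x] by simp

lemma mult_in [simp]: "a \<in> fiber A x \<Longrightarrow> b \<in> fiber A x \<Longrightarrow> bmult A a b \<in> fiber A x"
  and norm_mult: "a \<in> fiber A x \<Longrightarrow> b \<in> fiber A x \<Longrightarrow> bnorm A (bmult A a b) \<le> bnorm A a * bnorm A b"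
  using alg_laws[of x] A.base[of a x] by simp_all

lemma mult_assoc: "a \<in> fiber A x \<Longrightarrow> b \<in> fiber A x \<Longrightarrow> d \<in> fiber A x \<Longrightarrow> bmult A (bmult A a b) d = bmult A a (bmult A b d)"
  and mult_add_right: "a \<in> fiber A x \<Longrightarrow> b \<in> fiber A x \<Longrightarrow> d \<in> fiber A x \<Longrightarrow> bmult A a (badd A b d) = badd A (bmult A a b) (bmult A a d)"
  and mult_scale_right: "a \<in> fiber A x \<Longrightarrow> b \<in> fiber A x \<Longrightarrow> bmult A a (bscale A r b) = bscale A r (bmult A a b)"
  and one_mult: "a \<in> fiber A x \<Longrightarrow> bmult A (bone A x) a = a"
  and mult_one: "a \<in> fiber A x \<Longrightarrow> bmult A a (bone A x) = a"
  using alg_laws[of x] A.base[of a x] by simp_all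

lemma cont_mult:
  assumes "continuous_map Z (btop A) u" "continuous_map Z (btop A) v"
    "\<And>z. z \<in> topspace Z \<Longrightarrow> bproj A (u z) = bproj A (v z)"
  shows "continuous_map Z (btop A) (\<lambda>z. bmult A (u z) (v z))"
proof -
  have "continuous_map Z (subtopology (prod_topology (btop A) (btop A)) (fibered_pairs A)) (\<lambda>z. (u z, v z))"
    using assms continuous_map_image_subset_topspace[OF assms(1)] continuous_map_image_subset_topspace[OF assms(2)]
    by (auto simp: continuous_map_in_subtopology fibered_pairs_def intro!: continuous_map_pairedI)
  from continuous_map_compose[OF this mult_cont0] show ?thesis by (simp add: o_def)
qed

lemmas alg_G_rest = alg_G[unfolded banach_algebra_G_bundle_def, THEN conjunct2, THEN conjunct2]
lemmas alg_G_fiber = alg_G_rest[THEN conjunct1, THEN bspec]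
lemmas alg_G_unit = alg_G_rest[THEN conjunct2, THEN conjunct1, rule_format]
lemmas alg_G_comp = alg_G_rest[THEN conjunct2, THEN conjunct2, THEN bspec]

lemma gact_in [simp]: "g \<in> Ga \<Longrightarrow> a \<in> fiber A (src G g) \<Longrightarrow> gact g a \<in> fiber A (tgt G g)"
  using alg_G_fiber[of g] by (simp add: fib_linear_def)

lemma gact_unit: "a \<in> fiber A x \<Longrightarrow> gact (unit G x) a = a"
  using alg_G_unit[of x a] A.base[of a x] by simp

lemma gact_comp: "g \<in> Ga \<Longrightarrow> h \<in> Ga \<Longrightarrow> src G g = tgt G h \<Longrightarrow> a \<in> fiber A (src G h) \<Longrightarrow>
    gact (comp G g h) a = gact g (gact h a)"
  using alg_G_comp[OF composableI, of g h] by simp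

lemmas sigma_cont0 = mult[unfolded multiplier_def, THEN conjunct1]
lemmas sigma_values = mult[unfolded multiplier_def, THEN conjunct2, THEN conjunct1, THEN bspec]
lemmas sigma_cocycle0 = mult[unfolded multiplier_def, THEN conjunct2, THEN conjunct2, rule_format]

lemma sigma_in [simp]: "g \<in> Ga \<Longrightarrow> h \<in> Ga \<Longrightarrow> src G g = tgt G h \<Longrightarrow> \<sigma> g h \<in> fiber A (tgt G g)"
  and sigma_inv: "g \<in> Ga \<Longrightarrow> h \<in> Ga \<Longrightarrow> src G g = tgt G h \<Longrightarrow> invertible_in A (\<sigma> g h)"
  and sigma_central: "g \<in> Ga \<Longrightarrow> h \<in> Ga \<Longrightarrow> src G g = tgt G h \<Longrightarrow> central_in A (\<sigma> g h)"
  and sigma_unit: "g \<in> Ga \<Longrightarrow> h \<in> Ga \<Longrightarrow> src G g = tgt G h \<Longrightarrow> is_unit G g \<or> is_unit G h \<Longrightarrow> \<sigma> g h = bone A (tgt G g)"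
  using sigma_values[OF composableI, of g h] by (simp, simp, simp, blast)

lemma sigma_cocycle: "g \<in> Ga \<Longrightarrow> h \<in> Ga \<Longrightarrow> k \<in> Ga \<Longrightarrow> src G g = tgt G h \<Longrightarrow> src G h = tgt G k \<Longrightarrow>
    bmult A (\<sigma> g h) (\<sigma> (comp G g h) k) = bmult A (gact g (\<sigma> h k)) (\<sigma> g (comp G h k))"
  by (rule sigma_cocycle0) auto

lemma sigma_commute: "g \<in> Ga \<Longrightarrow> h \<in> Ga \<Longrightarrow> src G g = tgt G h \<Longrightarrow> a \<in> fiber A (tgt G g) \<Longrightarrow>
    bmult A (\<sigma> g h) a = bmult A a (\<sigma> g h)"
  using sigma_central[of g h] A.fiberD(2)[OF sigma_in, of g h] by (simp add: central_in_def)

lemma cont_sigma: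
  assumes "continuous_map Z (arr G) u" "continuous_map Z (arr G) v"
    "\<And>z. z \<in> topspace Z \<Longrightarrow> src G (u z) = tgt G (v z)"
  shows "continuous_map Z (btop A) (\<lambda>z. \<sigma> (u z) (v z))"
proof -
  have "continuous_map Z (subtopology (prod_topology (arr G) (arr G)) (composable G)) (\<lambda>z. (u z, v z))"
    using assms continuous_map_image_subset_topspace[OF assms(1)] continuous_map_image_subset_topspace[OF assms(2)]
    by (auto simp: continuous_map_in_subtopology composable_def intro!: continuous_map_pairedI)
  from continuous_map_compose[OF this sigma_cont0] show ?thesis by (simp add: o_def)
qed

lemma ainv_facts:
  assumes a: "invertible_in A a" "a \<in> fiber A x"
  shows "ainv A a \<in> fiber A x" "bmult A a (ainv A a) = bone A x" "bmult A (ainv A a) a = bone A x"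
proof -
  have p: "bproj A a = x" using a A.fiberD by blast
  obtain b where b: "b \<in> fiber A x" "bmult A a b = bone A x" "bmult A b a = bone A x"
    using a p unfolding invertible_in_def by auto
  have "ainv A a = b" unfolding ainv_def p
  proof (rule the_equality)
    fix d assume d: "d \<in> fiber A x \<and> bmult A a d = bone A x \<and> bmult A d a = bone A x"
    have "d = bmult A d (bmult A a b)" using d b mult_one by simp
    also have "\<dots> = bmult A (bmult A d a) b" using mult_assoc[of d x a b] d a b by simp
    also have "\<dots> = b" using d b one_mult by simp
    finally show "d = b" .
  qed (use b in simp)
  then show "ainv A a \<in> fiber A x" "bmult A a (ainv A a) = bone A x" "bmult A (ainv A a) a = bone A x"
    using b by simp_all
qed

text \<open>A vector \<open>b\<close> near the inverse at \<open>z0\<close> satisfies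
  \<open>|1 - a b| < 1/2\<close> over nearby points. Multiplying by the inverse \<open>i\<close> of
  \<open>a\<close> gives \<open>|i - b| \<le> |i|/2\<close>, hence \<open>|i| \<le> 2 |b|\<close>.
  Local boundedness of the inverse is what the continuity of \<open>Tinv\<close> requires.\<close>

lemma ainv_locally_bounded:
  assumes a: "continuous_map Z (btop A) a" and inv: "\<And>z. z \<in> topspace Z \<Longrightarrow> invertible_in A (a z)"
    and z0: "z0 \<in> topspace Z"
  obtains N C where "openin Z N" "z0 \<in> N" "\<And>z. z \<in> N \<Longrightarrow> bnorm A (ainv A (a z)) \<le> C" "C > 0"
proof -
  define \<pi> where "\<pi> = (\<lambda>z. bproj A (a z))"
  have \<pi>: "continuous_map Z (obj G) \<pi>" unfolding \<pi>_def by (rule A.cont_proj[OF a])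
  have af: "a z \<in> fiber A (\<pi> z)" if "z \<in> topspace Z" for z
    using continuous_map_image_subset_topspace[OF a] that by (auto simp: \<pi>_def fiber_def)
  have iv: "ainv A (a z) \<in> fiber A (\<pi> z)" "bmult A (ainv A (a z)) (a z) = bone A (\<pi> z)"
    "bmult A (a z) (ainv A (a z)) = bone A (\<pi> z)" if "z \<in> topspace Z" for z
    using ainv_facts[OF inv[OF that] af[OF that]] by auto
  let ?b0 = "ainv A (a z0)"
  let ?P = "subtopology (prod_topology Z (btop A)) {(z,b). bproj A b = \<pi> z}"
  have f: "continuous_map ?P Z fst" and s: "continuous_map ?P (btop A) snd"
    by (intro continuous_map_from_subtopology continuous_map_fst continuous_map_snd)+
  have af1: "continuous_map ?P (btop A) (\<lambda>p. a (fst p))" using continuous_map_compose[OF f a] by (simp add: o_def)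
  have pf1: "continuous_map ?P (obj G) (\<lambda>p. \<pi> (fst p))" using continuous_map_compose[OF f \<pi>] by (simp add: o_def)
  have o1: "continuous_map ?P (btop A) (\<lambda>p. bone A (\<pi> (fst p)))"
    using continuous_map_compose[OF pf1 one_cont0] by (simp add: o_def)
  have fib: "a (fst p) \<in> fiber A (\<pi> (fst p))" "snd p \<in> fiber A (\<pi> (fst p))" "\<pi> (fst p) \<in> Xo" if "p \<in> topspace ?P" for p
    using that af[of "fst p"] continuous_map_image_subset_topspace[OF \<pi>] by (auto simp: fiber_def)
  have "continuous_map ?P euclideanreal (\<lambda>p. bnorm A (bminus A (bone A (\<pi> (fst p))) (bmult A (a (fst p)) (snd p))))"
  proof (intro A.cont_norm A.cont_minus o1 cont_mult af1 s)
    fix p assume p: "p \<in> topspace ?P"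
    show "bproj A (a (fst p)) = bproj A (snd p)" using fib[OF p] A.fiberD(2) by metis
    show "bproj A (bone A (\<pi> (fst p))) = bproj A (bmult A (a (fst p)) (snd p))"
      using A.fiberD(2)[OF one_in[OF fib(3)[OF p]]] A.fiberD(2)[OF mult_in[OF fib(1,2)[OF p]]] by simp
  qed
  from openin_continuous_map_preimage[OF this, of "{..<1/2}"]
  have M0: "openin ?P {p \<in> topspace ?P. bnorm A (bminus A (bone A (\<pi> (fst p))) (bmult A (a (fst p)) (snd p))) < 1/2}"
    by simp
  define M where "M = {p \<in> topspace ?P. bnorm A (bminus A (bone A (\<pi> (fst p))) (bmult A (a (fst p)) (snd p))) < 1/2}"
  have Mo: "openin ?P M" unfolding M_def by (rule M0)
  have "(z0, ?b0) \<in> topspace ?P" using z0 A.fiberD[OF iv(1)[OF z0]] by simp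
  moreover have "bnorm A (bminus A (bone A (\<pi> z0)) (bmult A (a z0) ?b0)) = 0"
    unfolding iv(3)[OF z0] by (rule A.norm_minus_self[OF one_in[OF A.base[OF af[OF z0]]]])
  ultimately have M1: "(z0, ?b0) \<in> M" by (simp add: M_def)
  obtain N V where N: "openin Z N" "z0 \<in> N" "openin (btop A) V" "?b0 \<in> V"
    "\<And>z b. z \<in> N \<Longrightarrow> b \<in> V \<Longrightarrow> (z,b) \<in> {(z,b). bproj A b = \<pi> z} \<Longrightarrow> (z,b) \<in> M"
    using openin_prod_subE[OF Mo M1] by metis
  define C where "C = bnorm A ?b0 + 1"
  define V' where "V' = V \<inter> {b \<in> topspace (btop A). bnorm A b \<in> {..<C}}"
  have V': "openin (btop A) V'" unfolding V'_def
    using N(3) openin_continuous_map_preimage[OF A.norm_cont, of "{..<C}"] by auto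
  have "?b0 \<in> V'" using N(4) iv(1)[OF z0] A.fiberD(1) by (auto simp: V'_def C_def)
  then obtain N2 where N2: "openin Z N2" "z0 \<in> N2" "\<And>z. z \<in> N2 \<Longrightarrow> \<exists>b\<in>V'. b \<in> fiber A (\<pi> z)"
    using A.lift_nbhd[OF \<pi> z0 V', of ?b0] A.fiberD(2)[OF iv(1)[OF z0]] by metis
  have "bnorm A (ainv A (a z)) \<le> 2 * C" if z: "z \<in> N \<inter> N2" for z
  proof -
    have zZ: "z \<in> topspace Z" using z N(1) openin_subset by blast
    obtain b where b: "b \<in> V'" "b \<in> fiber A (\<pi> z)" using N2(3) z by blast
    have "(z,b) \<in> M" using N(5)[of z b] z b by (auto simp: V'_def fiber_def)
    then have half: "bnorm A (bminus A (bone A (\<pi> z)) (bmult A (a z) b)) < 1/2" by (simp add: M_def)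
    define i where "i = ainv A (a z)"
    have i: "i \<in> fiber A (\<pi> z)" "bmult A i (a z) = bone A (\<pi> z)" using iv[OF zZ] by (simp_all add: i_def)
    have x: "\<pi> z \<in> Xo" using A.base[OF i(1)] .
    let ?d = "bminus A (bone A (\<pi> z)) (bmult A (a z) b)"
    have d: "?d \<in> fiber A (\<pi> z)" using b(2) af[OF zZ] x by simp
    have "bmult A i ?d = bminus A i b"
    proof -
      have "bmult A i ?d = badd A (bmult A i (bone A (\<pi> z))) (bscale A (-1) (bmult A i (bmult A (a z) b)))"
        unfolding bminus_def using i(1) b(2) af[OF zZ] x
        by (simp add: mult_add_right[of i "\<pi> z"] mult_scale_right[of i "\<pi> z"])
      also have "bmult A i (bmult A (a z) b) = b"
        using mult_assoc[OF i(1) af[OF zZ] b(2)] i(2) one_mult[OF b(2)] by simp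
      finally show ?thesis using mult_one[OF i(1)] by (simp add: bminus_def)
    qed
    then have "bnorm A (bminus A i b) \<le> bnorm A i * bnorm A ?d" using norm_mult[OF i(1) d] by simp
    also have "\<dots> \<le> bnorm A i * (1/2)" using half A.norm_ge0[OF i(1)] by (intro mult_left_mono) auto
    finally have "bnorm A i \<le> bnorm A b + bnorm A i / 2" using A.norm_le_minus[OF i(1) b(2)] by simp
    moreover have "bnorm A b < C" using b(1) by (simp add: V'_def)
    ultimately show ?thesis by (simp add: i_def)
  qed
  moreover have "C > 0" using A.norm_ge0[OF iv(1)[OF z0]] by (simp add: C_def)
  ultimately show ?thesis using N N2 by (intro that[of "N \<inter> N2" "2 * C"]) auto
qed

abbreviation "sginv g h \<equiv> ainv A (\<sigma> g h)"

lemma sginv_in [simp]: "g \<in> Ga \<Longrightarrow> h \<in> Ga \<Longrightarrow> src G g = tgt G h \<Longrightarrow> sginv g h \<in> fiber A (tgt G g)"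
  and sginv_act: "g \<in> Ga \<Longrightarrow> h \<in> Ga \<Longrightarrow> src G g = tgt G h \<Longrightarrow> e \<in> fiber E (tgt G g) \<Longrightarrow> act (sginv g h) (act (\<sigma> g h) e) = e"
proof -
  assume gh: "g \<in> Ga" "h \<in> Ga" "src G g = tgt G h"
  note a = ainv_facts[OF sigma_inv[OF gh] sigma_in[OF gh]]
  show "sginv g h \<in> fiber A (tgt G g)" by (rule a(1))
  assume e: "e \<in> fiber E (tgt G g)"
  show "act (sginv g h) (act (\<sigma> g h) e) = e"
    using act_mult[OF a(1) sigma_in[OF gh] e] a(3) act_one[OF e] by simp
qed

lemma ell_ge1: "ell G A \<sigma> g \<ge> 1" and ell_pos: "ell G A \<sigma> g > 0"
  and ell_ge: "bnorm A (sginv g (ginv G g)) \<le> ell G A \<sigma> g"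
  by (auto simp: ell_def)

lemma inv_inv [simp]: assumes "g \<in> Ga" shows "ginv G (ginv G g) = g"
proof -
  have "ginv G (ginv G g) = comp G (ginv G (ginv G g)) (comp G (ginv G g) g)" using comp_unit[of "ginv G (ginv G g)"] assms by simp
  also have "\<dots> = g" using comp_inv_cancel[of "ginv G g" g] assms by simp
  finally show ?thesis .
qed

lemma orbit_self [simp]: "x \<in> Xo \<Longrightarrow> x \<in> orbit G x"
  unfolding orbit_def by (auto intro!: exI[of _ "unit G x"])

lemma orbit_src: assumes g: "g \<in> Ga" shows "tgt G g \<in> orbit G x \<longleftrightarrow> src G g \<in> orbit G x"
proof
  assume "tgt G g \<in> orbit G x"
  then obtain h where "h \<in> Ga" "src G h = x" "tgt G h = tgt G g" unfolding orbit_def by force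
  then show "src G g \<in> orbit G x" unfolding orbit_def using g by (auto intro!: exI[of _ "comp G (ginv G g) h"])
next
  assume "src G g \<in> orbit G x"
  then obtain h where "h \<in> Ga" "src G h = x" "tgt G h = src G g" unfolding orbit_def by force
  then show "tgt G g \<in> orbit G x" unfolding orbit_def using g by (auto intro!: exI[of _ "comp G g h"])
qed

lemma orbit_X: "y \<in> orbit G x \<Longrightarrow> y \<in> Xo"
  unfolding orbit_def by auto

end

section \<open>Averaging an almost representation\<close>

context rep_setting begin

definition lin_rep :: "('g \<Rightarrow> 'e \<Rightarrow> 'e) \<Rightarrow> bool" where
  "lin_rep T \<longleftrightarrow> pseudorep G E T \<and> A_linear G A E act gact T"

lemma lin_rep_in [simp]: "lin_rep T \<Longrightarrow> g \<in> Ga \<Longrightarrow> e \<in> fiber E (src G g) \<Longrightarrow> T g e \<in> fiber E (tgt G g)"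
  and lin_rep_add: "lin_rep T \<Longrightarrow> g \<in> Ga \<Longrightarrow> e \<in> fiber E (src G g) \<Longrightarrow> f \<in> fiber E (src G g) \<Longrightarrow>
    T g (badd E e f) = badd E (T g e) (T g f)"
  and lin_rep_scale: "lin_rep T \<Longrightarrow> g \<in> Ga \<Longrightarrow> e \<in> fiber E (src G g) \<Longrightarrow> T g (bscale E r e) = bscale E r (T g e)"
  and lin_rep_act: "lin_rep T \<Longrightarrow> g \<in> Ga \<Longrightarrow> a \<in> fiber A (src G g) \<Longrightarrow> e \<in> fiber E (src G g) \<Longrightarrow>
    T g (act a e) = act (gact g a) (T g e)"
  unfolding lin_rep_def pseudorep_def fib_linear_def A_linear_def by simp_all

lemma lin_rep_minus: "lin_rep T \<Longrightarrow> g \<in> Ga \<Longrightarrow> e \<in> fiber E (src G g) \<Longrightarrow> f \<in> fiber E (src G g) \<Longrightarrow>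
    T g (bminus E e f) = bminus E (T g e) (T g f)"
  by (simp add: bminus_def lin_rep_add lin_rep_scale)

lemma cont_in: "continuous_map Z (btop E) v \<Longrightarrow> z \<in> topspace Z \<Longrightarrow> bproj E (v z) = x \<Longrightarrow> v z \<in> fiber E x"
  using continuous_map_image_subset_topspace[of Z "btop E" v] by (auto simp: fiber_def)

lemma cont_in_arr: "continuous_map Z (arr G) u \<Longrightarrow> z \<in> topspace Z \<Longrightarrow> u z \<in> Ga"
  using continuous_map_image_subset_topspace[of Z "arr G" u] by auto

lemma lin_rep_cont:
  assumes T: "lin_rep T" and u: "continuous_map Z (arr G) u" and v: "continuous_map Z (btop E) v"
    and p: "\<And>z. z \<in> topspace Z \<Longrightarrow> bproj E (v z) = src G (u z)"
  shows "continuous_map Z (btop E) (\<lambda>z. T (u z) (v z))"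
proof -
  have "continuous_map Z (subtopology (prod_topology (arr G) (btop E)) {(g,e). bproj E e = src G g}) (\<lambda>z. (u z, v z))"
    using u v p by (auto simp: continuous_map_in_subtopology intro!: continuous_map_pairedI)
  moreover have "continuous_map (subtopology (prod_topology (arr G) (btop E)) {(g,e). bproj E e = src G g})
      (subtopology (prod_topology (arr G) (btop E)) {(g,e). bproj E e = tgt G g}) (\<lambda>(g,e). (g, T g e))"
    using T unfolding lin_rep_def pseudorep_def pullback_bundle_def by simp
  ultimately have "continuous_map Z (subtopology (prod_topology (arr G) (btop E)) {(g,e). bproj E e = tgt G g})
      (\<lambda>z. (u z, T (u z) (v z)))"
    using continuous_map_compose by (fastforce simp: o_def)
  then have "continuous_map Z (prod_topology (arr G) (btop E)) (\<lambda>z. (u z, T (u z) (v z)))"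
    by (rule continuous_map_into_fulltopology)
  from continuous_map_compose[OF this continuous_map_snd] show ?thesis by (simp add: o_def)
qed

lemma lin_repI:
  assumes c: "continuous_map (subtopology (prod_topology (arr G) (btop E)) {(g,e). bproj E e = src G g}) (btop E) (\<lambda>(g,e). T g e)"
    and i: "\<And>g e. g \<in> Ga \<Longrightarrow> e \<in> fiber E (src G g) \<Longrightarrow> T g e \<in> fiber E (tgt G g)"
    and a: "\<And>g e f. g \<in> Ga \<Longrightarrow> e \<in> fiber E (src G g) \<Longrightarrow> f \<in> fiber E (src G g) \<Longrightarrow>
      T g (badd E e f) = badd E (T g e) (T g f)"
    and s: "\<And>g e r. g \<in> Ga \<Longrightarrow> e \<in> fiber E (src G g) \<Longrightarrow> T g (bscale E r e) = bscale E r (T g e)"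
    and m: "\<And>g a e. g \<in> Ga \<Longrightarrow> a \<in> fiber A (src G g) \<Longrightarrow> e \<in> fiber E (src G g) \<Longrightarrow>
      T g (act a e) = act (gact g a) (T g e)"
  shows "lin_rep T"
proof -
  let ?P = "subtopology (prod_topology (arr G) (btop E)) {(g,e). bproj E e = src G g}"
  have c': "continuous_map ?P (btop E) (\<lambda>p. T (fst p) (snd p))" using c by (simp add: case_prod_unfold)
  have "continuous_map ?P (arr G) fst" by (intro continuous_map_from_subtopology continuous_map_fst)
  then have "continuous_map ?P (prod_topology (arr G) (btop E)) (\<lambda>p. (fst p, T (fst p) (snd p)))"
    by (rule continuous_map_pairedI[OF _ c'])
  moreover have "bproj E (T g e) = tgt G g" if "(g,e) \<in> topspace ?P" for g e
    using fiberD(2)[OF i[of g e]] that by (auto simp: fiber_def)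
  ultimately have "continuous_map ?P (subtopology (prod_topology (arr G) (btop E)) {(g,e). bproj E e = tgt G g}) (\<lambda>p. (fst p, T (fst p) (snd p)))"
    unfolding continuous_map_in_subtopology by auto
  then have "pseudorep G E T" unfolding pseudorep_def pullback_bundle_def fib_linear_def
    using i a s by (simp add: case_prod_unfold)
  then show ?thesis unfolding lin_rep_def A_linear_def using m by simp
qed

text \<open>Real upper bounds, taken vector by vector, for the two suprema whose sum is
  \<open>rdef\<close>. Upper bounds pass through the iteration without extended reals; the unit part
  and the multiplicative part are separate because averaging makes the former vanish.\<close>

definition defect :: "('g \<Rightarrow> 'e \<Rightarrow> 'e) \<Rightarrow> 'x \<Rightarrow> real \<Rightarrow> real \<Rightarrow> bool" where
  "defect T x r1 r2 \<longleftrightarrow>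
    (\<forall>y\<in>orbit G x. \<forall>e\<in>fiber E y. bnorm E (bminus E e (T (unit G y) e)) \<le> r1 * bnorm E e) \<and>
    (\<forall>g\<in>Ga. \<forall>h\<in>Ga. src G g = tgt G h \<longrightarrow> tgt G g \<in> orbit G x \<longrightarrow> (\<forall>e\<in>fiber E (src G h).
      ell G A \<sigma> g * bnorm E (bminus E (act (\<sigma> g h) (T (comp G g h) e)) (T g (T h e))) \<le> r2 * bnorm E e))"

definition bdd :: "('g \<Rightarrow> 'e \<Rightarrow> 'e) \<Rightarrow> 'x \<Rightarrow> real \<Rightarrow> bool" where
  "bdd T x b \<longleftrightarrow> (\<forall>g\<in>Ga. tgt G g \<in> orbit G x \<longrightarrow> (\<forall>e\<in>fiber E (src G g). ell G A \<sigma> g * bnorm E (T g e) \<le> b * bnorm E e))"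

text \<open>Just what makes every \<open>T k\<close> invertible and the average defined: no uniform
  operator bound is included, since \<open>b\<close> may be infinite on some orbits.\<close>

definition nice :: "('g \<Rightarrow> 'e \<Rightarrow> 'e) \<Rightarrow> bool" where
  "nice T \<longleftrightarrow> lin_rep T \<and> (\<forall>x\<in>Xo. \<exists>r1 r2. 0 \<le> r1 \<and> 0 \<le> r2 \<and> r1 + r2 \<le> 1/4 \<and> defect T x r1 r2)"

lemma defectD:
  assumes "defect T x r1 r2"
  shows "y \<in> orbit G x \<Longrightarrow> e \<in> fiber E y \<Longrightarrow> bnorm E (bminus E e (T (unit G y) e)) \<le> r1 * bnorm E e"
    "g \<in> Ga \<Longrightarrow> h \<in> Ga \<Longrightarrow> src G g = tgt G h \<Longrightarrow> tgt G g \<in> orbit G x \<Longrightarrow> e \<in> fiber E (src G h) \<Longrightarrow>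
      ell G A \<sigma> g * bnorm E (bminus E (act (\<sigma> g h) (T (comp G g h) e)) (T g (T h e))) \<le> r2 * bnorm E e"
  using assms unfolding defect_def by blast+

text \<open>Since \<open>T(k^-1) T(k)\<close> is close to \<open>\<sigma>(k^-1,k) T(1)\<close>,
  cancelling the multiplier leaves an operator close to the identity. The inverse multiplier that
  occurs is the one bounded by \<open>ell\<close> at \<open>ginv G k\<close>.\<close>

definition almost_id :: "('g \<Rightarrow> 'e \<Rightarrow> 'e) \<Rightarrow> 'g \<Rightarrow> 'e \<Rightarrow> 'e" where
  "almost_id T k u = act (sginv (ginv G k) k) (T (ginv G k) (T k u))"

lemma almost_id_in [simp]: "lin_rep T \<Longrightarrow> k \<in> Ga \<Longrightarrow> u \<in> fiber E (src G k) \<Longrightarrow> almost_id T k u \<in> fiber E (src G k)"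
  using act_in[of "sginv (ginv G k) k" "src G k"] sginv_in[of "ginv G k" k] lin_rep_in[of T "ginv G k" "T k u"]
  by (simp add: almost_id_def)

lemma almost_id_minus: "lin_rep T \<Longrightarrow> k \<in> Ga \<Longrightarrow> u \<in> fiber E (src G k) \<Longrightarrow> v \<in> fiber E (src G k) \<Longrightarrow>
    almost_id T k (bminus E u v) = bminus E (almost_id T k u) (almost_id T k v)"
  using act_minus[of "sginv (ginv G k) k" "src G k"] sginv_in[of "ginv G k" k]
    lin_rep_in[of T "ginv G k" "T k u"] lin_rep_in[of T "ginv G k" "T k v"]
  by (simp add: almost_id_def lin_rep_minus)

lemma almost_id_near:
  assumes T: "lin_rep T" and d: "defect T x r1 r2" and k: "k \<in> Ga" and o: "src G k \<in> orbit G x"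
    and u: "u \<in> fiber E (src G k)"
  shows "bnorm E (bminus E u (almost_id T k u)) \<le> (r1 + r2) * bnorm E u"
proof -
  let ?k = "ginv G k" and ?y = "src G k"
  have k': "?k \<in> Ga" "src G ?k = tgt G k" "tgt G ?k = ?y" using k by auto
  let ?w = "T (unit G ?y) u"
  have y: "?y \<in> Xo" using k by simp
  have w: "?w \<in> fiber E ?y" using lin_rep_in[OF T, of "unit G ?y" u] u y by simp
  have si: "sginv ?k k \<in> fiber A ?y" using sginv_in[OF k'(1) k k'(2)] k' by simp
  have s: "\<sigma> ?k k \<in> fiber A ?y" using sigma_in[OF k'(1) k k'(2)] k' by simp
  have TT: "T ?k (T k u) \<in> fiber E ?y" using lin_rep_in[OF T k'(1), of "T k u"] lin_rep_in[OF T k u] k' by simp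
  have weq: "?w = act (sginv ?k k) (act (\<sigma> ?k k) ?w)" using sginv_act[OF k'(1) k k'(2)] w k' by simp
  have "bminus E ?w (almost_id T k u) = act (sginv ?k k) (bminus E (act (\<sigma> ?k k) ?w) (T ?k (T k u)))"
    unfolding almost_id_def act_minus[OF si act_in[OF s w] TT] using weq by simp
  then have "bnorm E (bminus E ?w (almost_id T k u)) \<le>
      bnorm A (sginv ?k k) * bnorm E (bminus E (act (\<sigma> ?k k) ?w) (T ?k (T k u)))"
    using act_norm[OF si, of "bminus E (act (\<sigma> ?k k) ?w) (T ?k (T k u))"] s w TT by simp
  also have "\<dots> \<le> ell G A \<sigma> ?k * bnorm E (bminus E (act (\<sigma> ?k k) ?w) (T ?k (T k u)))"
    using ell_ge[of ?k] k norm_ge0[of _ ?y] s w TT by (intro mult_right_mono) auto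
  also have "\<dots> \<le> r2 * bnorm E u"
    using defectD(2)[OF d k'(1) k k'(2) _ u] o k k' by simp
  finally have 1: "bnorm E (bminus E ?w (almost_id T k u)) \<le> r2 * bnorm E u" .
  have "bnorm E (bminus E u (almost_id T k u)) \<le> bnorm E (bminus E u ?w) + bnorm E (bminus E ?w (almost_id T k u))"
    using norm_minus_tri[OF u w almost_id_in[OF T k u]] .
  also have "bnorm E (bminus E u ?w) \<le> r1 * bnorm E u" using defectD(1)[OF d o u] .
  finally show ?thesis using 1 by (simp add: algebra_simps)
qed

lemma almost_id_lower:
  assumes "lin_rep T" "defect T x r1 r2" "k \<in> Ga" "src G k \<in> orbit G x" "u \<in> fiber E (src G k)" "r1 + r2 \<le> 1/4"
  shows "3/4 * bnorm E u \<le> bnorm E (almost_id T k u)"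
proof -
  have "bnorm E u \<le> bnorm E (almost_id T k u) + bnorm E (bminus E u (almost_id T k u))"
    using norm_le_minus[OF assms(5) almost_id_in[OF assms(1,3,5)]] .
  also have "bnorm E (bminus E u (almost_id T k u)) \<le> (r1 + r2) * bnorm E u"
    using almost_id_near[OF assms(1-5)] .
  also have "\<dots> \<le> 1/4 * bnorm E u" using assms(6) norm_ge0[OF assms(5)] by (intro mult_right_mono) auto
  finally show ?thesis by simp
qed

lemma niceD: assumes "nice T" "x \<in> Xo"
  obtains r1 r2 where "0 \<le> r1" "0 \<le> r2" "r1 + r2 \<le> 1/4" "defect T x r1 r2"
  using assms unfolding nice_def by blast

lemma nice_lin: "nice T \<Longrightarrow> lin_rep T" by (simp add: nice_def)

lemma nice_lower:
  assumes T: "nice T" and k: "k \<in> Ga" and u: "u \<in> fiber E (src G k)"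
  shows "3/4 * bnorm E u \<le> bnorm E (almost_id T k u)"
proof -
  obtain r1 r2 where r: "0 \<le> r1" "0 \<le> r2" "r1 + r2 \<le> 1/4" "defect T (src G k) r1 r2"
    using niceD[OF T src_in[OF k]] by metis
  show ?thesis using almost_id_lower[OF nice_lin[OF T] r(4) k _ u r(3)] k by simp
qed

lemma nice_inj:
  assumes T: "nice T" and k: "k \<in> Ga" and u: "u \<in> fiber E (src G k)" "v \<in> fiber E (src G k)" and eq: "T k u = T k v"
  shows "u = v"
proof (rule minus_eq_zero[OF u])
  have d: "bminus E u v \<in> fiber E (src G k)" using u by simp
  have "almost_id T k u = almost_id T k v" by (simp add: almost_id_def eq)
  then have "bnorm E (almost_id T k (bminus E u v)) = 0"
    using almost_id_minus[OF nice_lin[OF T] k u] norm_minus_self[OF almost_id_in[OF nice_lin[OF T] k u(2)]] by simp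
  then have "bnorm E (bminus E u v) = 0" using nice_lower[OF T k d] norm_ge0[OF d] by simp
  then show "bminus E u v = bzero E (src G k)" using norm_eq0[OF d] by simp
qed

text \<open>Applied to \<open>k^-1\<close>, \<open>almost_id\<close> becomes
  \<open>\<sigma>(k,k^-1)^-1 T(k) T(k^-1)\<close>, which is onto by the Neumann series. The
  multiplier stands to the left of \<open>T(k)\<close> and has to be moved inside it to exhibit a
  preimage.\<close>

lemma nice_surj:
  assumes T: "nice T" and k: "k \<in> Ga" and w: "w \<in> fiber E (tgt G k)"
  obtains u where "u \<in> fiber E (src G k)" "T k u = w"
proof -
  let ?k = "ginv G k" and ?y = "tgt G k"
  note L = nice_lin[OF T]
  have k': "?k \<in> Ga" "src G ?k = ?y" "tgt G ?k = src G k" using k by auto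
  have y: "?y \<in> Xo" using k by simp
  obtain r1 r2 where r: "0 \<le> r1" "0 \<le> r2" "r1 + r2 \<le> 1/4" "defect T ?y r1 r2"
    using niceD[OF T y] by metis
  have wk: "w \<in> fiber E (src G ?k)" using w k' by simp
  define S where "S = almost_id T ?k"
  have Sin: "S e \<in> fiber E ?y" if "e \<in> fiber E ?y" for e using almost_id_in[OF L k'(1), of e] that k' by (simp add: S_def)
  have Tin: "T ?k e \<in> fiber E (src G k)" if "e \<in> fiber E ?y" for e using lin_rep_in[OF L k'(1), of e] that k' by simp
  have si: "sginv k ?k \<in> fiber A ?y" using sginv_in[of k ?k] k k' by simp
  have Sdef: "S e = act (sginv k ?k) (T k (T ?k e))" for e using k by (simp add: S_def almost_id_def)
  obtain v where v: "v \<in> fiber E ?y" "S v = w"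
  proof (rule near_identity_surj[of ?y S "r1 + r2" w])
    show "S (badd E e f) = badd E (S e) (S f)" if "e \<in> fiber E ?y" "f \<in> fiber E ?y" for e f
      unfolding Sdef using that Tin k k' si by (simp add: lin_rep_add[OF L] act_add[OF si] lin_rep_in[OF L])
    show "S (bscale E t e) = bscale E t (S e)" if "e \<in> fiber E ?y" for t e
      unfolding Sdef using that Tin k k' si by (simp add: lin_rep_scale[OF L] act_scale[OF si] lin_rep_in[OF L])
    show "bnorm E (bminus E e (S e)) \<le> (r1 + r2) * bnorm E e" if "e \<in> fiber E ?y" for e
      unfolding S_def using almost_id_near[OF L r(4) k'(1)] that k' y by simp
  qed (use Sin r w in auto)
  \<comment> \<open>Linearity over \<open>A\<close> moves a coefficient through \<open>T(k)\<close>
    at the price of the action of \<open>k\<close>; acting by \<open>k^-1\<close> beforehand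
    compensates.\<close>
  define a where "a = gact ?k (sginv k ?k)"
  have a: "a \<in> fiber A (src G k)" using gact_in[OF k'(1), of "sginv k ?k"] si k' by (simp add: a_def)
  have "gact k a = sginv k ?k"
    unfolding a_def using gact_comp[OF k k'(1), of "sginv k ?k"] si k k' gact_unit[OF si] by simp
  then have "T k (act a (T ?k v)) = w"
    using lin_rep_act[OF L k a Tin[OF v(1)]] v(2) by (simp add: Sdef)
  then show ?thesis using that[of "act a (T ?k v)"] act_in[OF a Tin[OF v(1)]] by blast
qed

section \<open>The inverse operators and their continuity\<close>

definition Tinv :: "('g \<Rightarrow> 'e \<Rightarrow> 'e) \<Rightarrow> 'g \<Rightarrow> 'e \<Rightarrow> 'e" where
  "Tinv T k w = (THE u. u \<in> fiber E (src G k) \<and> T k u = w)"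

lemma Tinv_eq: "nice T \<Longrightarrow> k \<in> Ga \<Longrightarrow> u \<in> fiber E (src G k) \<Longrightarrow> Tinv T k (T k u) = u"
  unfolding Tinv_def by (rule the_equality) (auto intro: nice_inj)

lemma Tinv_in [simp]: "nice T \<Longrightarrow> k \<in> Ga \<Longrightarrow> w \<in> fiber E (tgt G k) \<Longrightarrow> Tinv T k w \<in> fiber E (src G k)"
  and T_Tinv: "nice T \<Longrightarrow> k \<in> Ga \<Longrightarrow> w \<in> fiber E (tgt G k) \<Longrightarrow> T k (Tinv T k w) = w"
  by (metis nice_surj Tinv_eq)+

lemma Tinv_add: "nice T \<Longrightarrow> k \<in> Ga \<Longrightarrow> v \<in> fiber E (tgt G k) \<Longrightarrow> w \<in> fiber E (tgt G k) \<Longrightarrow>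
    Tinv T k (badd E v w) = badd E (Tinv T k v) (Tinv T k w)"
  by (rule nice_inj[of T k]) (auto simp: T_Tinv lin_rep_add nice_lin)

lemma Tinv_scale: "nice T \<Longrightarrow> k \<in> Ga \<Longrightarrow> w \<in> fiber E (tgt G k) \<Longrightarrow>
    Tinv T k (bscale E t w) = bscale E t (Tinv T k w)"
  by (rule nice_inj[of T k]) (auto simp: T_Tinv lin_rep_scale nice_lin)

lemma Tinv_act: assumes "nice T" "k \<in> Ga" "a \<in> fiber A (tgt G k)" "w \<in> fiber E (tgt G k)"
  shows "Tinv T k (act a w) = act (gact (ginv G k) a) (Tinv T k w)"
proof -
  have a: "gact (ginv G k) a \<in> fiber A (src G k)" using gact_in[of "ginv G k" a] assms by simp
  have "gact k (gact (ginv G k) a) = a" using gact_comp[of k "ginv G k" a] assms gact_unit by simp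
  then have "T k (act (gact (ginv G k) a) (Tinv T k w)) = act a w"
    using lin_rep_act[OF nice_lin[OF assms(1)] assms(2) a] assms by (simp add: T_Tinv)
  then show ?thesis using Tinv_eq[OF assms(1,2)] act_in[OF a] assms by (metis Tinv_in)
qed

text \<open>The inverse is compared with arbitrary vectors \<open>f\<close> near its value at
  \<open>z0\<close>. The vector \<open>F = T(k^-1) (T(k) f - v)\<close> is continuous in all data
  and has norm 0 at the base point; up to the inverse multiplier it is \<open>almost_id\<close>
  applied to \<open>f - Tinv T k v\<close>, and \<open>almost_id\<close> is bounded below by
  \<open>3/4\<close>.\<close>

lemma Tinv_cont:
  assumes T: "nice T" and u: "continuous_map Z (arr G) u" and v: "continuous_map Z (btop E) v"
    and p: "\<And>z. z \<in> topspace Z \<Longrightarrow> bproj E (v z) = tgt G (u z)"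
  shows "continuous_map Z (btop E) (\<lambda>z. Tinv T (u z) (v z))"
proof (rule cont_crit2[where \<pi> = "\<lambda>z. src G (u z)"])
  note L = nice_lin[OF T]
  have uG: "u z \<in> Ga" if "z \<in> topspace Z" for z using cont_in_arr[OF u that] .
  have vE: "v z \<in> fiber E (tgt G (u z))" if "z \<in> topspace Z" for z using cont_in[OF v that p[OF that]] .
  show J: "Tinv T (u z) (v z) \<in> fiber E (src G (u z))" if "z \<in> topspace Z" for z
    using T uG[OF that] vE[OF that] by simp
  show pi: "continuous_map Z (obj G) (\<lambda>z. src G (u z))" by (rule cont_src[OF u])
  fix z0 and \<epsilon> :: real assume z0: "z0 \<in> topspace Z" and \<epsilon>: "\<epsilon> > 0"
  let ?f0 = "Tinv T (u z0) (v z0)"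
  have sc: "continuous_map Z (btop A) (\<lambda>z. \<sigma> (ginv G (u z)) (u z))"
    using uG by (intro cont_sigma cont_ginv u) auto
  obtain N1 C where N1: "openin Z N1" "z0 \<in> N1" "C > 0"
    "\<And>z. z \<in> N1 \<Longrightarrow> bnorm A (sginv (ginv G (u z)) (u z)) \<le> C"
    using ainv_locally_bounded[OF sc _ z0] uG sigma_inv by (metis inv_in src_inv)
  let ?P = "subtopology (prod_topology Z (btop E)) {(z,f). bproj E f = src G (u z)}"
  have fst: "continuous_map ?P Z fst" and snd: "continuous_map ?P (btop E) snd"
    by (intro continuous_map_from_subtopology continuous_map_fst continuous_map_snd)+
  have uf: "continuous_map ?P (arr G) (\<lambda>q. u (fst q))" and vf: "continuous_map ?P (btop E) (\<lambda>q. v (fst q))"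
    using continuous_map_compose[OF fst u] continuous_map_compose[OF fst v] by (simp_all add: o_def)
  define F where "F = (\<lambda>q. T (ginv G (u (fst q))) (bminus E (T (u (fst q)) (snd q)) (v (fst q))))"
  have fib: "fst q \<in> topspace Z" "snd q \<in> fiber E (src G (u (fst q)))" if "q \<in> topspace ?P" for q
    using that by (auto simp: fiber_def)
  have mid: "bminus E (T (u (fst q)) (snd q)) (v (fst q)) \<in> fiber E (tgt G (u (fst q)))" if "q \<in> topspace ?P" for q
    using lin_rep_in[OF L uG fib(2)] fib[OF that] vE that by simp
  have "continuous_map ?P (btop E) F" unfolding F_def
  proof (intro lin_rep_cont[OF L] cont_ginv uf cont_minus snd vf)
    fix q assume q: "q \<in> topspace ?P"
    show "bproj E (bminus E (T (u (fst q)) (snd q)) (v (fst q))) = src G (ginv G (u (fst q)))"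
      using fiberD(2)[OF mid[OF q]] uG[OF fib(1)[OF q]] by simp
    show "bproj E (T (u (fst q)) (snd q)) = bproj E (v (fst q))"
      using fiberD(2)[OF lin_rep_in[OF L uG fib(2)]] fib[OF q] q p by simp
    show "bproj E (snd q) = src G (u (fst q))" using fib[OF q] fiberD(2) by blast
  qed
  then have "continuous_map ?P euclideanreal (\<lambda>q. bnorm E (F q))" by (rule cont_norm)
  \<comment> \<open>With the multiplier bounded by \<open>C\<close> this gives
    \<open>3/4 * |f - Tinv T k v| < \<epsilon>/2\<close>, so the distance is below
    \<open>\<epsilon>\<close>.\<close>
  from openin_continuous_map_preimage[OF this, of "{..<\<epsilon> / (2 * C)}"]
  have M0: "openin ?P {q \<in> topspace ?P. bnorm E (F q) < \<epsilon> / (2 * C)}" by simp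
  define M where "M = {q \<in> topspace ?P. bnorm E (F q) < \<epsilon> / (2 * C)}"
  have Mo: "openin ?P M" unfolding M_def by (rule M0)
  have q0: "(z0, ?f0) \<in> topspace ?P" using z0 fiberD[OF J[OF z0]] by simp
  have F0: "bnorm E (F (z0, ?f0)) = 0"
  proof -
    have t: "tgt G (u z0) \<in> Xo" "src G (u z0) \<in> Xo" using uG[OF z0] by auto
    have "T (u z0) ?f0 = v z0" using T_Tinv[OF T uG[OF z0] vE[OF z0]] .
    then have "F (z0, ?f0) = T (ginv G (u z0)) (bscale E 0 (v z0))"
      using add_neg[OF vE[OF z0]] scale_0[OF vE[OF z0]] by (simp add: F_def bminus_def)
    also have "\<dots> = bscale E 0 (T (ginv G (u z0)) (v z0))"
      using lin_rep_scale[OF L, of "ginv G (u z0)" "v z0" 0] uG[OF z0] vE[OF z0] by simp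
    finally show ?thesis using lin_rep_in[OF L, of "ginv G (u z0)" "v z0"] uG[OF z0] vE[OF z0]
        norm_scale[of "T (ginv G (u z0)) (v z0)" "src G (u z0)" 0] by simp
  qed
  have M1: "(z0, ?f0) \<in> M" unfolding M_def using q0 F0 \<epsilon> N1(3) by simp
  obtain N2 V where N2: "openin Z N2" "z0 \<in> N2" "openin (btop E) V" "?f0 \<in> V"
    "\<And>z f. z \<in> N2 \<Longrightarrow> f \<in> V \<Longrightarrow> (z,f) \<in> {(z,f). bproj E f = src G (u z)} \<Longrightarrow> (z,f) \<in> M"
    using openin_prod_subE[OF Mo M1] by metis
  have main: "bnorm E (bminus E (Tinv T (u z) (v z)) f) < \<epsilon>"
    if z: "z \<in> N1 \<inter> N2" and f: "f \<in> V" "f \<in> fiber E (src G (u z))" for z f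
  proof -
    have zZ: "z \<in> topspace Z" using z N1(1) openin_subset by blast
    let ?J = "Tinv T (u z) (v z)" and ?k = "u z"
    have k: "?k \<in> Ga" "ginv G ?k \<in> Ga" "src G (ginv G ?k) = tgt G ?k" "tgt G (ginv G ?k) = src G ?k" using uG[OF zZ] by auto
    have d: "bminus E f ?J \<in> fiber E (src G ?k)" using f J[OF zZ] by simp
    have "(z,f) \<in> M" using N2(5)[of z f] z f fiberD(2) by auto
    then have small: "bnorm E (F (z,f)) < \<epsilon> / (2 * C)" by (simp add: M_def)
    have Td: "T ?k (bminus E f ?J) = bminus E (T ?k f) (v z)"
      using lin_rep_minus[OF L k(1) f(2) J[OF zZ]] T_Tinv[OF T k(1) vE[OF zZ]] by simp
    have Fin: "F (z,f) \<in> fiber E (src G ?k)"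
      using lin_rep_in[OF L k(2), of "T ?k (bminus E f ?J)"] lin_rep_in[OF L k(1) d] k Td by (simp add: F_def)
    have "3/4 * bnorm E (bminus E f ?J) \<le> bnorm E (almost_id T ?k (bminus E f ?J))"
      using nice_lower[OF T k(1) d] .
    also have "almost_id T ?k (bminus E f ?J) = act (sginv (ginv G ?k) ?k) (F (z,f))"
      unfolding almost_id_def Td F_def by simp
    also have "bnorm E \<dots> \<le> bnorm A (sginv (ginv G ?k) ?k) * bnorm E (F (z,f))"
      using act_norm[OF _ Fin] sginv_in[OF k(2,1,3)] k(4) by simp
    also have "\<dots> \<le> C * bnorm E (F (z,f))" using N1(4) z norm_ge0[OF Fin] by (intro mult_right_mono) auto
    also have "\<dots> < C * (\<epsilon> / (2 * C))" using small N1(3) by (intro mult_strict_left_mono) auto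
    also have "\<dots> = \<epsilon> / 2" using N1(3) by simp
    finally show ?thesis using norm_minus_commute[OF f(2) J[OF zZ]] \<epsilon> by simp
  qed
  have "bnorm E (bminus E ?f0 ?f0) < \<epsilon>" using norm_minus_self[OF J[OF z0]] \<epsilon> by simp
  then show "\<exists>w V N. w \<in> fiber E (src G (u z0)) \<and> bnorm E (bminus E ?f0 w) < \<epsilon> \<and>
        openin (btop E) V \<and> w \<in> V \<and> openin Z N \<and> z0 \<in> N \<and>
        (\<forall>y\<in>N. \<forall>e\<in>V. e \<in> fiber E (src G (u y)) \<longrightarrow> bnorm E (bminus E (Tinv T (u y) (v y)) e) < \<epsilon>)"
    using J[OF z0] N1(1,2) N2(1-4) main
    by (intro exI[of _ ?f0] exI[of _ V] exI[of _ "N1 \<inter> N2"]) auto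
qed

text \<open>Exact multiplicativity would give \<open>D T g k = T g\<close> for all \<open>k\<close>.\<close>

definition D :: "('g \<Rightarrow> 'e \<Rightarrow> 'e) \<Rightarrow> 'g \<Rightarrow> 'g \<Rightarrow> 'e \<Rightarrow> 'e" where
  "D T g k w = act (\<sigma> g k) (T (comp G g k) (Tinv T k w))"

lemma D_arg [simp]:
  assumes "nice T" "g \<in> Ga" "k \<in> Ga" "tgt G k = src G g" "w \<in> fiber E (src G g)"
  shows "T (comp G g k) (Tinv T k w) \<in> fiber E (tgt G g)"
  using lin_rep_in[OF nice_lin[OF assms(1)], of "comp G g k" "Tinv T k w"] assms by simp

lemma D_in [simp]:
  assumes "nice T" "g \<in> Ga" "k \<in> Ga" "tgt G k = src G g" "w \<in> fiber E (src G g)"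
  shows "D T g k w \<in> fiber E (tgt G g)"
  unfolding D_def by (rule act_in[OF sigma_in D_arg]) (use assms in auto)

lemma D_add:
  assumes "nice T" "g \<in> Ga" "k \<in> Ga" "tgt G k = src G g" "w \<in> fiber E (src G g)" "v \<in> fiber E (src G g)"
  shows "D T g k (badd E w v) = badd E (D T g k w) (D T g k v)"
  unfolding D_def using assms
  by (simp add: Tinv_add lin_rep_add[OF nice_lin[OF assms(1)]] act_add[OF sigma_in D_arg D_arg])

lemma D_scale:
  assumes "nice T" "g \<in> Ga" "k \<in> Ga" "tgt G k = src G g" "w \<in> fiber E (src G g)"
  shows "D T g k (bscale E t w) = bscale E t (D T g k w)"
  unfolding D_def using assms
  by (simp add: Tinv_scale lin_rep_scale[OF nice_lin[OF assms(1)]] act_scale[OF sigma_in D_arg])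

lemma D_minus:
  assumes "nice T" "g \<in> Ga" "k \<in> Ga" "tgt G k = src G g" "w \<in> fiber E (src G g)" "v \<in> fiber E (src G g)"
  shows "D T g k (bminus E w v) = bminus E (D T g k w) (D T g k v)"
  unfolding bminus_def using assms by (simp add: D_add D_scale)

text \<open>The actions of \<open>k\<close> and of its inverse cancel, which leaves
  \<open>gact g a\<close> to be moved past \<open>\<sigma> g k\<close>: here centrality of the
  multiplier enters.\<close>

lemma D_act:
  assumes T: "nice T" and g: "g \<in> Ga" and k: "k \<in> Ga" "tgt G k = src G g" and a: "a \<in> fiber A (src G g)" and w: "w \<in> fiber E (src G g)"
  shows "D T g k (act a w) = act (gact g a) (D T g k w)"
proof -
  have gk: "comp G g k \<in> Ga" "src G (comp G g k) = src G k" "tgt G (comp G g k) = tgt G g" using g k by auto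
  have ga: "gact g a \<in> fiber A (tgt G g)" using g a by simp
  have a': "gact (ginv G k) a \<in> fiber A (src G k)" using gact_in[of "ginv G k" a] a k by simp
  have u: "Tinv T k w \<in> fiber E (src G k)" using T k w by simp
  have s: "\<sigma> g k \<in> fiber A (tgt G g)" using g k by simp
  have "gact (comp G g k) (gact (ginv G k) a) = gact g a"
  proof -
    have "gact (comp G g k) (gact (ginv G k) a) = gact g (gact k (gact (ginv G k) a))"
      using gact_comp[of g k] g k a' by simp
    also have "gact k (gact (ginv G k) a) = a" using gact_comp[of k "ginv G k" a] k a gact_unit by simp
    finally show ?thesis .
  qed
  then have "T (comp G g k) (Tinv T k (act a w)) = act (gact g a) (T (comp G g k) (Tinv T k w))"
    using Tinv_act[OF T k(1)] a w k lin_rep_act[OF nice_lin[OF T] gk(1)] a' u gk by simp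
  then have "D T g k (act a w) = act (bmult A (\<sigma> g k) (gact g a)) (T (comp G g k) (Tinv T k w))"
    unfolding D_def using act_mult[OF s ga D_arg[OF T g k w]] by simp
  also have "bmult A (\<sigma> g k) (gact g a) = bmult A (gact g a) (\<sigma> g k)" using sigma_commute[of g k "gact g a"] g k ga by simp
  finally show ?thesis unfolding D_def using act_mult[OF ga s D_arg[OF T g k w]] by simp
qed

text \<open>The inverse in \<open>D T g (comp G h k)\<close> cancels the operator
  \<open>T(hk)\<close> inside \<open>D T h k\<close>; the two multipliers then merge by the cocycle
  identity.\<close>

lemma D_shift:
  assumes T: "nice T" and g: "g \<in> Ga" and h: "h \<in> Ga" "tgt G h = src G g" and k: "k \<in> Ga" "tgt G k = src G h"
    and e: "e \<in> fiber E (src G h)"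
  shows "D T g (comp G h k) (D T h k e) = act (\<sigma> g h) (D T (comp G g h) k e)"
proof -
  let ?u = "Tinv T k e" and ?hk = "comp G h k" and ?gh = "comp G g h"
  have hk: "?hk \<in> Ga" "src G ?hk = src G k" "tgt G ?hk = src G g" using h k by auto
  have gh: "?gh \<in> Ga" "src G ?gh = src G h" "tgt G ?gh = tgt G g" using g h by auto
  have u: "?u \<in> fiber E (src G k)" using T k e by simp
  have v: "T ?hk ?u \<in> fiber E (src G g)" using lin_rep_in[OF nice_lin[OF T] hk(1)] u hk by simp
  have s: "\<sigma> h k \<in> fiber A (src G g)" using h k sigma_in[of h k] by simp
  have gs: "gact g (\<sigma> h k) \<in> fiber A (tgt G g)" using g s by simp
  have s2: "\<sigma> g ?hk \<in> fiber A (tgt G g)" "\<sigma> g h \<in> fiber A (tgt G g)" "\<sigma> ?gh k \<in> fiber A (tgt G g)"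
    using sigma_in[of g ?hk] sigma_in[of g h] sigma_in[of ?gh k] g h k hk gh by auto
  let ?w = "T (comp G g ?hk) ?u"
  have w: "?w \<in> fiber E (tgt G g)" using lin_rep_in[OF nice_lin[OF T], of "comp G g ?hk" ?u] u g hk by simp
  have "D T g ?hk (D T h k e) = act (gact g (\<sigma> h k)) (D T g ?hk (T ?hk ?u))"
    unfolding D_def[of T h k e] by (rule D_act[OF T g hk(1,3) s v])
  also have "D T g ?hk (T ?hk ?u) = act (\<sigma> g ?hk) ?w"
    unfolding D_def using Tinv_eq[OF T hk(1)] u hk by simp
  also have "act (gact g (\<sigma> h k)) \<dots> = act (bmult A (\<sigma> g h) (\<sigma> ?gh k)) ?w"
    using act_mult[OF gs s2(1) w] sigma_cocycle[of g h k] g h k by simp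
  also have "\<dots> = act (\<sigma> g h) (act (\<sigma> ?gh k) (T (comp G ?gh k) ?u))"
    using act_mult[OF s2(2,3) w] comp_assoc[of g h k] g h k by simp
  finally show ?thesis unfolding D_def[of T ?gh k e] .
qed

lemma D_cont:
  assumes T: "nice T" and u: "continuous_map Z (arr G) u" and k: "continuous_map Z (arr G) k" and v: "continuous_map Z (btop E) v"
    and p: "\<And>z. z \<in> topspace Z \<Longrightarrow> tgt G (k z) = src G (u z)" "\<And>z. z \<in> topspace Z \<Longrightarrow> bproj E (v z) = src G (u z)"
  shows "continuous_map Z (btop E) (\<lambda>z. D T (u z) (k z) (v z))"
  unfolding D_def
proof (intro cont_act cont_sigma u k lin_rep_cont[OF nice_lin[OF T]] cont_comp Tinv_cont[OF T] v)
  fix z assume z: "z \<in> topspace Z"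
  have G: "u z \<in> Ga" "k z \<in> Ga" "v z \<in> fiber E (src G (u z))"
    using cont_in_arr[OF u z] cont_in_arr[OF k z] cont_in[OF v z p(2)[OF z]] by auto
  show "src G (u z) = tgt G (k z)" "src G (u z) = tgt G (k z)" "bproj E (v z) = tgt G (k z)" using p[OF z] by auto
  show "bproj E (Tinv T (k z) (v z)) = src G (comp G (u z) (k z))"
    using fiberD(2)[OF Tinv_in[OF T G(2), of "v z"]] G p[OF z] by simp
  show "bproj A (\<sigma> (u z) (k z)) = bproj E (T (comp G (u z) (k z)) (Tinv T (k z) (v z)))"
    using fiberD(2)[OF D_arg[OF T G(1,2) p(1)[OF z] G(3)]] A.fiberD(2)[OF sigma_in[OF G(1,2)]] p[OF z] by simp
qed

section \<open>The averaged pseudorepresentation\<close>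

definition avg :: "('g \<Rightarrow> 'e \<Rightarrow> 'e) \<Rightarrow> 'g \<Rightarrow> 'e \<Rightarrow> 'e" where
  "avg T g w = vint (tgt G g) (src G g) (\<lambda>k. D T g k w)"

lemma tfib_incl: "continuous_map (tfib x) (arr G) (\<lambda>k. k)"
  unfolding tfib_def by (intro continuous_map_from_subtopology) auto

lemma D_section_cont:
  assumes T: "nice T" and g: "g \<in> Ga" and w: "w \<in> fiber E (src G g)"
  shows "continuous_map (tfib (src G g)) (btop E) (\<lambda>k. D T g k w)"
  by (rule D_cont[OF T]) (use g w fiberD[OF w] tfib_incl in auto)

lemma avg_in [simp]: "nice T \<Longrightarrow> g \<in> Ga \<Longrightarrow> w \<in> fiber E (src G g) \<Longrightarrow> avg T g w \<in> fiber E (tgt G g)"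
  unfolding avg_def by (rule vint_props(1)) (auto intro: D_section_cont)

text \<open>The integral is characterised by the dual unit ball of its own fiber, but functionals
  such as \<open>\<phi>\<close> composed with \<open>T g\<close> or with the action of an algebra
  element are needed too. They are bounded, so a rescaling brings them into the ball.\<close>

lemma functional_avg:
  assumes T: "nice T" and g: "g \<in> Ga" and w: "w \<in> fiber E (src G g)"
    and add: "\<And>e f. e \<in> fiber E (tgt G g) \<Longrightarrow> f \<in> fiber E (tgt G g) \<Longrightarrow> \<psi> (badd E e f) = \<psi> e + \<psi> f"
    and scale: "\<And>t e. e \<in> fiber E (tgt G g) \<Longrightarrow> \<psi> (bscale E t e) = t * \<psi> e"
    and bd: "\<And>e. e \<in> fiber E (tgt G g) \<Longrightarrow> \<psi> e \<le> M * bnorm E e"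
  shows "\<psi> (avg T g w) = Av (src G g) (\<lambda>k. \<psi> (D T g k w))"
    "continuous_map (tfib (src G g)) euclideanreal (\<lambda>k. \<psi> (D T g k w))"
proof -
  \<comment> \<open>The maximum with 1 permits division also when \<open>M\<close> is not
    positive.\<close>
  define K where "K = max M 1"
  have K: "K > 0" by (simp add: K_def)
  define \<phi> where "\<phi> = (\<lambda>e. \<psi> e / K)"
  have \<phi>: "\<phi> \<in> dual (tgt G g)" unfolding dual_def
  proof (intro CollectI conjI ballI allI)
    fix e assume e: "e \<in> fiber E (tgt G g)"
    have "\<psi> e \<le> K * bnorm E e" using bd[OF e] norm_ge0[OF e] mult_right_mono[of M K "bnorm E e"] by (simp add: K_def)
    then show "\<phi> e \<le> bnorm E e" using K by (simp add: \<phi>_def field_simps)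
  qed (use add scale in \<open>auto simp: \<phi>_def add_divide_distrib\<close>)
  have "\<phi> (avg T g w) = Av (src G g) (\<lambda>k. \<phi> (D T g k w))"
    unfolding avg_def by (rule vint_props(2)[OF _ _ _ _ \<phi>]) (use g T w in \<open>auto intro: D_section_cont\<close>)
  also have "\<dots> = (1 / K) * Av (src G g) (\<lambda>k. \<psi> (D T g k w))"
    using Av_scale[of "src G g" "1 / K" "\<lambda>k. \<psi> (D T g k w)"] by (simp add: \<phi>_def)
  finally show "\<psi> (avg T g w) = Av (src G g) (\<lambda>k. \<psi> (D T g k w))" using K by (simp add: \<phi>_def)
  have "continuous_map (tfib (src G g)) euclideanreal (\<lambda>k. \<phi> (D T g k w))"
    by (rule dual_cont[OF D_section_cont[OF T g w] _ \<phi>]) (use T g w in auto)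
  then have "continuous_map (tfib (src G g)) euclideanreal (\<lambda>k. K * \<phi> (D T g k w))"
    by (rule continuous_map_real_mult_left)
  then show "continuous_map (tfib (src G g)) euclideanreal (\<lambda>k. \<psi> (D T g k w))" using K by (simp add: \<phi>_def)
qed

lemma dual_avg:
  assumes T: "nice T" and g: "g \<in> Ga" and w: "w \<in> fiber E (src G g)" and \<phi>: "\<phi> \<in> dual (tgt G g)"
  shows "\<phi> (avg T g w) = Av (src G g) (\<lambda>k. \<phi> (D T g k w))"
    "continuous_map (tfib (src G g)) euclideanreal (\<lambda>k. \<phi> (D T g k w))"
  using functional_avg[OF T g w, of \<phi> 1] \<phi> dual_le[OF \<phi>] by simp_all

lemma act_functional_avg:
  assumes T: "nice T" and g: "g \<in> Ga" and w: "w \<in> fiber E (src G g)" and \<phi>: "\<phi> \<in> dual (tgt G g)"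
    and a: "a \<in> fiber A (tgt G g)"
  shows "\<phi> (act a (avg T g w)) = Av (src G g) (\<lambda>k. \<phi> (act a (D T g k w)))"
    "continuous_map (tfib (src G g)) euclideanreal (\<lambda>k. \<phi> (act a (D T g k w)))"
proof -
  have "\<phi> (act a e) \<le> bnorm A a * bnorm E e" if "e \<in> fiber E (tgt G g)" for e
    using dual_le[OF \<phi> act_in[OF a that]] act_norm[OF a that] by simp
  then show "\<phi> (act a (avg T g w)) = Av (src G g) (\<lambda>k. \<phi> (act a (D T g k w)))"
    "continuous_map (tfib (src G g)) euclideanreal (\<lambda>k. \<phi> (act a (D T g k w)))"
    using functional_avg[OF T g w, of "\<lambda>e. \<phi> (act a e)" "bnorm A a"] \<phi> a
    by (simp_all add: act_add[OF a] act_scale[OF a])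
qed

lemma avg_lin_rep: assumes T: "nice T" shows "lin_rep (avg T)"
proof (rule lin_repI)
  let ?Z = "subtopology (prod_topology (arr G) (btop E)) {(g,e). bproj E e = src G g}"
  have f: "continuous_map ?Z (arr G) fst" and s: "continuous_map ?Z (btop E) snd"
    by (intro continuous_map_from_subtopology continuous_map_fst continuous_map_snd)+
  have "integrand ?Z (\<lambda>p. src G (fst p)) (\<lambda>p. tgt G (fst p)) (\<lambda>p k. D T (fst p) k (snd p))"
    unfolding integrand_def
  proof (intro conjI ballI impI cont_src cont_tgt f)
    let ?W = "subtopology (prod_topology ?Z (arr G)) {(z,k). tgt G k = src G (fst z)}"
    have f2: "continuous_map ?W ?Z fst" and s2: "continuous_map ?W (arr G) snd"
      by (intro continuous_map_from_subtopology continuous_map_fst continuous_map_snd)+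
    have "continuous_map ?W (btop E) (\<lambda>q. D T (fst (fst q)) (snd q) (snd (fst q)))"
      using continuous_map_compose[OF f2 f] continuous_map_compose[OF f2 s]
      by (intro D_cont[OF T] s2) (auto simp: o_def)
    then show "continuous_map ?W (btop E) (\<lambda>(z,k). D T (fst z) k (snd z))" by (simp add: case_prod_unfold)
    fix z k assume "z \<in> topspace ?Z" "k \<in> Ga" "tgt G k = src G (fst z)"
    moreover from this have "fst z \<in> Ga" "snd z \<in> fiber E (src G (fst z))" by (auto simp: fiber_def)
    ultimately show "D T (fst z) k (snd z) \<in> fiber E (tgt G (fst z))" using D_in[OF T] by simp
  qed
  from vint_cont[OF this]
  show "continuous_map ?Z (btop E) (\<lambda>(g,e). avg T g e)" unfolding avg_def by (simp add: case_prod_unfold)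
  fix g e assume g: "g \<in> Ga" and e: "e \<in> fiber E (src G g)"
  show "avg T g e \<in> fiber E (tgt G g)" using T g e by simp
  show "avg T g (badd E e f) = badd E (avg T g e) (avg T g f)" if f: "f \<in> fiber E (src G g)" for f
  proof (rule fiber_eqI)
    show "avg T g (badd E e f) \<in> fiber E (tgt G g)" "badd E (avg T g e) (avg T g f) \<in> fiber E (tgt G g)"
      using T g e f by simp_all
    fix \<phi> assume \<phi>: "\<phi> \<in> dual (tgt G g)"
    have "\<phi> (avg T g (badd E e f)) = Av (src G g) (\<lambda>k. \<phi> (D T g k (badd E e f)))"
      using dual_avg(1)[OF T g _ \<phi>] e f by simp
    also have "\<dots> = Av (src G g) (\<lambda>k. \<phi> (D T g k e) + \<phi> (D T g k f))"
      by (rule Av_cong) (use T g e f \<phi> in \<open>auto simp: D_add dual_add[OF \<phi> D_in D_in]\<close>)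
    also have "\<dots> = \<phi> (avg T g e) + \<phi> (avg T g f)"
      using Av_add[OF src_in[OF g] dual_avg(2)[OF T g e \<phi>] dual_avg(2)[OF T g f \<phi>]]
        dual_avg(1)[OF T g e \<phi>] dual_avg(1)[OF T g f \<phi>] by simp
    finally show "\<phi> (avg T g (badd E e f)) = \<phi> (badd E (avg T g e) (avg T g f))" using \<phi> T g e f by simp
  qed
  show "avg T g (bscale E r e) = bscale E r (avg T g e)" for r
  proof (rule fiber_eqI)
    show "avg T g (bscale E r e) \<in> fiber E (tgt G g)" "bscale E r (avg T g e) \<in> fiber E (tgt G g)"
      using T g e by simp_all
    fix \<phi> assume \<phi>: "\<phi> \<in> dual (tgt G g)"
    have "\<phi> (avg T g (bscale E r e)) = Av (src G g) (\<lambda>k. \<phi> (D T g k (bscale E r e)))"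
      using dual_avg(1)[OF T g _ \<phi>] e by simp
    also have "\<dots> = Av (src G g) (\<lambda>k. r * \<phi> (D T g k e))"
      by (rule Av_cong) (use T g e \<phi> in \<open>auto simp: D_scale dual_scale[OF \<phi> D_in]\<close>)
    also have "\<dots> = r * \<phi> (avg T g e)" using Av_scale dual_avg(1)[OF T g e \<phi>] by simp
    finally show "\<phi> (avg T g (bscale E r e)) = \<phi> (bscale E r (avg T g e))" using \<phi> T g e by simp
  qed
  show "avg T g (act a e) = act (gact g a) (avg T g e)" if a: "a \<in> fiber A (src G g)" for a
  proof (rule fiber_eqI)
    have ga: "gact g a \<in> fiber A (tgt G g)" using g a by simp
    show "avg T g (act a e) \<in> fiber E (tgt G g)" "act (gact g a) (avg T g e) \<in> fiber E (tgt G g)"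
      using T g e act_in[OF a e] act_in[OF ga] by simp_all
    fix \<phi> assume \<phi>: "\<phi> \<in> dual (tgt G g)"
    have "\<phi> (avg T g (act a e)) = Av (src G g) (\<lambda>k. \<phi> (D T g k (act a e)))"
      using dual_avg(1)[OF T g _ \<phi>] act_in[OF a e] by simp
    also have "\<dots> = Av (src G g) (\<lambda>k. \<phi> (act (gact g a) (D T g k e)))"
      by (rule Av_cong) (use T g e a in \<open>auto simp: D_act\<close>)
    also have "\<dots> = \<phi> (act (gact g a) (avg T g e))" using act_functional_avg(1)[OF T g e \<phi> ga] by simp
    finally show "\<phi> (avg T g (act a e)) = \<phi> (act (gact g a) (avg T g e))" .
  qed
qed

text \<open>At a unit the multiplier is 1 and \<open>comp\<close> is trivial, so the integrand is
  \<open>T(k) T(k)^-1 = id\<close>. The unit defect is therefore exactly 0 from the first averaging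
  on.\<close>

lemma avg_unit: assumes T: "nice T" and x: "x \<in> Xo" and e: "e \<in> fiber E x" shows "avg T (unit G x) e = e"
proof (rule fiber_eqI)
  have u: "unit G x \<in> Ga" "src G (unit G x) = x" "tgt G (unit G x) = x" using x by auto
  show "avg T (unit G x) e \<in> fiber E x" using avg_in[OF T u(1)] e u by simp
  fix \<phi> assume \<phi>: "\<phi> \<in> dual x"
  have "\<phi> (avg T (unit G x) e) = Av x (\<lambda>k. \<phi> (D T (unit G x) k e))"
    using dual_avg(1)[OF T u(1)] e u \<phi> by simp
  also have "\<dots> = Av x (\<lambda>k. \<phi> e)"
  proof (rule Av_cong[OF _ x])
    fix k assume k: "k \<in> Ga" "tgt G k = x"
    have "\<sigma> (unit G x) k = bone A x" using sigma_unit[OF u(1) k(1)] u k x by (auto simp: is_unit_def)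
    moreover have "comp G (unit G x) k = k" using unit_comp[OF k(1)] k by simp
    ultimately have "D T (unit G x) k e = e" unfolding D_def using T_Tinv[OF T k(1)] e k act_one[OF e] by simp
    then show "\<phi> (D T (unit G x) k e) = \<phi> e" by simp
  qed
  also have "\<dots> = \<phi> e" by (rule Av_const[OF x])
  finally show "\<phi> (avg T (unit G x) e) = \<phi> e" .
qed (rule e)

text \<open>A closed ball is convex: each functional of the dual unit ball bounds the average as it
  bounds the integrands, and the weights have total mass 1.\<close>

lemma avg_norm_le:
  assumes T: "nice T" and g: "g \<in> Ga" and w: "w \<in> fiber E (src G g)" and v: "v \<in> fiber E (tgt G g)"
    and le: "\<And>k. k \<in> Ga \<Longrightarrow> tgt G k = src G g \<Longrightarrow> bnorm E (bminus E (D T g k w) v) \<le> B"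
  shows "bnorm E (bminus E (avg T g w) v) \<le> B"
proof (rule norm_leI)
  show "bminus E (avg T g w) v \<in> fiber E (tgt G g)" using T g w v by simp
  fix \<phi> assume \<phi>: "\<phi> \<in> dual (tgt G g)"
  have "Av (src G g) (\<lambda>k. \<phi> (D T g k w)) \<le> \<phi> v + B"
  proof (rule Av_le[OF src_in[OF g] dual_avg(2)[OF T g w \<phi>]])
    fix k assume k: "k \<in> Ga" "tgt G k = src G g"
    have Dk: "D T g k w \<in> fiber E (tgt G g)" using T g k w by simp
    have "\<phi> (bminus E (D T g k w) v) \<le> B" using dual_le[OF \<phi> minus_in[OF Dk v]] le[OF k] by simp
    then show "\<phi> (D T g k w) \<le> \<phi> v + B" using \<phi> Dk v by simp
  qed
  then show "\<phi> (bminus E (avg T g w) v) \<le> B" using dual_avg(1)[OF T g w \<phi>] \<phi> T g w v by simp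
qed

text \<open>The factor \<open>4/3\<close> inverts the lower bound \<open>3/4\<close> of
  \<open>almost_id\<close>. The weight \<open>ell\<close> in \<open>bdd\<close>, taken at the
  inverse arrow, is used up by the inverse multiplier.\<close>

lemma Tinv_bound:
  assumes T: "nice T" and b: "bdd T x \<beta>" and k: "k \<in> Ga" "tgt G k \<in> orbit G x" and w: "w \<in> fiber E (tgt G k)"
  shows "bnorm E (Tinv T k w) \<le> 4/3 * \<beta> * bnorm E w"
proof -
  let ?k = "ginv G k" and ?u = "Tinv T k w"
  have k': "?k \<in> Ga" "src G ?k = tgt G k" "tgt G ?k = src G k" using k by auto
  have u: "?u \<in> fiber E (src G k)" using T k w by simp
  have Tw: "T ?k w \<in> fiber E (src G k)" using lin_rep_in[OF nice_lin[OF T] k'(1)] w k' by simp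
  have "3/4 * bnorm E ?u \<le> bnorm E (almost_id T k ?u)" using nice_lower[OF T k(1) u] .
  also have "\<dots> = bnorm E (act (sginv ?k k) (T ?k w))" by (simp add: almost_id_def T_Tinv[OF T k(1) w])
  also have "\<dots> \<le> bnorm A (sginv ?k k) * bnorm E (T ?k w)"
    using act_norm[OF _ Tw] sginv_in[OF k'(1) k(1) k'(2)] k' by simp
  also have "\<dots> \<le> ell G A \<sigma> ?k * bnorm E (T ?k w)"
    using ell_ge[of ?k] k norm_ge0[OF Tw] by (intro mult_right_mono) auto
  also have "\<dots> \<le> \<beta> * bnorm E w" using b k' w k orbit_src[OF k(1)] unfolding bdd_def by simp
  finally show ?thesis by simp
qed

text \<open>Writing \<open>w = T k u\<close> turns the deviation into the multiplicative defect of
  the pair \<open>(g,k)\<close> at the vector \<open>u\<close>. The denominator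
  \<open>ell G A \<sigma> g\<close> is retained because the new defect is again weighted with
  \<open>ell\<close>.\<close>

lemma D_dev:
  assumes T: "nice T" and b: "bdd T x \<beta>" and d: "defect T x r1 r2" and r: "0 \<le> r1" "0 \<le> r2" "0 \<le> \<beta>"
    and g: "g \<in> Ga" "tgt G g \<in> orbit G x" and k: "k \<in> Ga" "tgt G k = src G g" and w: "w \<in> fiber E (src G g)"
  shows "bnorm E (bminus E (D T g k w) (T g w)) \<le> 4/3 * \<beta> * (r1 + r2) / ell G A \<sigma> g * bnorm E w"
proof -
  let ?u = "Tinv T k w"
  have u: "?u \<in> fiber E (src G k)" using T k w by simp
  have eq: "T g w = T g (T k ?u)" using T_Tinv[OF T k(1)] w k by simp
  have "ell G A \<sigma> g * bnorm E (bminus E (D T g k w) (T g w)) \<le> r2 * bnorm E ?u"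
    unfolding eq D_def by (rule defectD(2)[OF d g(1) k(1) _ g(2) u]) (use k in simp)
  also have "\<dots> \<le> (r1 + r2) * bnorm E ?u" using r norm_ge0[OF u] by (intro mult_right_mono) auto
  also have "\<dots> \<le> (r1 + r2) * (4/3 * \<beta> * bnorm E w)"
    using Tinv_bound[OF T b k(1)] k g w r orbit_src[OF g(1)] by (intro mult_left_mono) auto
  finally show ?thesis using ell_pos[of g] by (simp add: field_simps)
qed

lemma avg_dev:
  assumes T: "nice T" and b: "bdd T x \<beta>" and d: "defect T x r1 r2" and r: "0 \<le> r1" "0 \<le> r2" "0 \<le> \<beta>"
    and g: "g \<in> Ga" "tgt G g \<in> orbit G x" and w: "w \<in> fiber E (src G g)"
  shows "bnorm E (bminus E (avg T g w) (T g w)) \<le> 4/3 * \<beta> * (r1 + r2) / ell G A \<sigma> g * bnorm E w"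
  by (rule avg_norm_le[OF T g(1) w]) (use D_dev[OF assms(1-8)] g w T nice_lin in auto)

text \<open>A vanishing defect makes all integrands equal to \<open>T g w\<close>, whatever the size
  of the operators; this serves the orbits on which no bound \<open>\<beta>\<close> exists.\<close>

lemma avg_exact:
  assumes T: "nice T" and d: "defect T x 0 0" and g: "g \<in> Ga" "tgt G g \<in> orbit G x" and w: "w \<in> fiber E (src G g)"
  shows "avg T g w = T g w"
proof (rule eq_of_small)
  show "avg T g w \<in> fiber E (tgt G g)" "T g w \<in> fiber E (tgt G g)" using T g w nice_lin[OF T] by simp_all
  fix \<epsilon> :: real assume \<epsilon>: "\<epsilon> > 0"
  show "bnorm E (bminus E (avg T g w) (T g w)) \<le> \<epsilon>"
  proof (rule avg_norm_le[OF T g(1) w])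
    show "T g w \<in> fiber E (tgt G g)" using g w nice_lin[OF T] by simp
    fix k assume k: "k \<in> Ga" "tgt G k = src G g"
    let ?u = "Tinv T k w"
    have u: "?u \<in> fiber E (src G k)" using T k w by simp
    have eq: "T g w = T g (T k ?u)" using T_Tinv[OF T k(1)] w k by simp
    have "ell G A \<sigma> g * bnorm E (bminus E (D T g k w) (T g w)) \<le> 0 * bnorm E ?u"
      unfolding eq D_def by (rule defectD(2)[OF d g(1) k(1) _ g(2) u]) (use k in simp)
    then have "bnorm E (bminus E (D T g k w) (T g w)) \<le> 0" using ell_pos[of g] by (simp add: mult_le_0_iff)
    then show "bnorm E (bminus E (D T g k w) (T g w)) \<le> \<epsilon>" using \<epsilon> by simp
  qed
qed

text \<open>The new multiplicativity defect is a covariance of the deviations of the integrands from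
  their approximate values, hence quadratic in the old one.\<close>

lemma avg_defect:
  assumes T: "nice T" and b: "bdd T x \<beta>" and d: "defect T x r1 r2" and r: "0 \<le> r1" "0 \<le> r2" "0 \<le> \<beta>"
  defines "a \<equiv> 4/3 * \<beta> * (r1 + r2)"
  shows "defect (avg T) x 0 (2 * a^2)"
  unfolding defect_def
proof (intro conjI ballI impI)
  fix y e assume "y \<in> orbit G x" "e \<in> fiber E y"
  then show "bnorm E (bminus E e (avg T (unit G y) e)) \<le> 0 * bnorm E e"
    using avg_unit[OF T orbit_X] norm_minus_self by simp
next
  fix g h e
  assume g: "g \<in> Ga" and h: "h \<in> Ga" and sg: "src G g = tgt G h" and o: "tgt G g \<in> orbit G x" and e: "e \<in> fiber E (src G h)"
  note L = nice_lin[OF T]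
  have a0: "a \<ge> 0" using r by (simp add: a_def)
  have oh: "tgt G h \<in> orbit G x" using o orbit_src[OF g] sg by simp
  let ?l = "ell G A \<sigma>"
  define t where "t = T h e"
  define W where "W = avg T h e"
  have t: "t \<in> fiber E (src G g)" using lin_rep_in[OF L h e] sg by (simp add: t_def)
  have W: "W \<in> fiber E (src G g)" using avg_in[OF T h e] sg by (simp add: W_def)
  have gh: "comp G g h \<in> Ga" "src G (comp G g h) = src G h" "tgt G (comp G g h) = tgt G g" using g h sg by auto
  have s: "\<sigma> g h \<in> fiber A (tgt G g)" using g h sg by simp
  have Wt: "bnorm E (bminus E W t) \<le> a * bnorm E e"
  proof -
    have "bnorm E (bminus E W t) \<le> a / ?l h * bnorm E e"
      unfolding W_def t_def a_def using avg_dev[OF T b d r h oh e] .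
    also have "\<dots> \<le> a * bnorm E e" using ell_ge1[of h] a0 norm_ge0[OF e]
      by (intro mult_right_mono) (simp_all add: divide_le_eq mult_le_cancel_left1)
    finally show ?thesis .
  qed
  have X: "act (\<sigma> g h) (avg T (comp G g h) e) \<in> fiber E (tgt G g)" "avg T g W \<in> fiber E (tgt G g)"
    using act_in[OF s] avg_in[OF T gh(1), of e] gh e T g W by simp_all
  have "bnorm E (bminus E (act (\<sigma> g h) (avg T (comp G g h) e)) (avg T g W)) \<le> 2 * a^2 / ?l g * bnorm E e"
  proof (rule norm_leI)
    show "bminus E (act (\<sigma> g h) (avg T (comp G g h) e)) (avg T g W) \<in> fiber E (tgt G g)" using X by simp
    fix \<phi> assume \<phi>: "\<phi> \<in> dual (tgt G g)"
    \<comment> \<open>Put \<open>X k = D T g (comp G h k) - T g\<close> and let \<open>Y k\<close>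
      be \<open>D T h k e - t\<close>. Then \<open>\<phi> (X k (Y k))\<close> expands to
      \<open>F k - Q k - (P k - \<phi> (T g t))\<close>, where the form of \<open>F\<close> comes
      from \<open>D_shift\<close>.\<close>
    define F where "F = (\<lambda>k. \<phi> (act (\<sigma> g h) (D T (comp G g h) k e)))"
    define P where "P = (\<lambda>k. \<phi> (T g (D T h k e)))"
    define Q where "Q = (\<lambda>k. \<phi> (D T g (comp G h k) t))"
    have F: "\<phi> (act (\<sigma> g h) (avg T (comp G g h) e)) = Av (src G h) F" "continuous_map (tfib (src G h)) euclideanreal F"
      using act_functional_avg[OF T gh(1), of e \<phi> "\<sigma> g h"] gh e \<phi> s by (simp_all add: F_def)
    have "\<phi> (T g v) \<le> \<beta> * bnorm E v" if v: "v \<in> fiber E (src G g)" for v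
    proof -
      have Tv: "T g v \<in> fiber E (tgt G g)" using lin_rep_in[OF L g v] .
      have "\<phi> (T g v) \<le> 1 * bnorm E (T g v)" using dual_le[OF \<phi> Tv] by simp
      also have "\<dots> \<le> ?l g * bnorm E (T g v)" using ell_ge1[of g] norm_ge0[OF Tv] by (intro mult_right_mono)
      also have "\<dots> \<le> \<beta> * bnorm E v" using b g o v unfolding bdd_def by simp
      finally show ?thesis .
    qed
    then have P: "\<phi> (T g W) = Av (src G h) P" "continuous_map (tfib (src G h)) euclideanreal P"
      unfolding W_def P_def using functional_avg[OF T h e, of "\<lambda>v. \<phi> (T g v)" \<beta>] g sg \<phi>
      by (simp_all add: lin_rep_add[OF L] lin_rep_scale[OF L] lin_rep_in[OF L])
    \<comment> \<open>Invariance under translation by \<open>h\<close> replaces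
      \<open>comp G h k\<close> by a variable arrow with source fiber of \<open>g\<close>, so
      \<open>Q\<close> averages to \<open>avg T g\<close>.\<close>
    have Q: "\<phi> (avg T g t) = Av (src G h) Q"
      unfolding Q_def using dual_avg[OF T g t \<phi>] Av_invariant[OF h, of "\<lambda>k. \<phi> (D T g k t)"] sg by simp
    have "continuous_map (tfib (src G h)) (btop E) (\<lambda>k. D T g (comp G h k) t)"
      using fiberD[OF t] g h sg by (intro D_cont[OF T] cont_comp tfib_incl) auto
    then have Qc: "continuous_map (tfib (src G h)) euclideanreal Q" unfolding Q_def
      by (rule dual_cont[OF _ _ \<phi>]) (use T g h sg t in auto)
    \<comment> \<open>This is the average of the product \<open>X k (Y k)\<close> before averaging:
      each deviation contributes a factor \<open>a\<close>, and \<open>1 / ?l g\<close> comes from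
      \<open>X k\<close>.\<close>
    have pt: "F k - P k - Q k \<le> a^2 / ?l g * bnorm E e - \<phi> (T g t)"
      if k: "k \<in> Ga" "tgt G k = src G h" for k
    proof -
      let ?v = "D T h k e" and ?m = "comp G h k"
      have v: "?v \<in> fiber E (src G g)" using T h k e sg D_in[of T h k e] by simp
      have m: "?m \<in> Ga" "tgt G ?m = src G g" using h k sg by auto
      have vt: "bminus E ?v t \<in> fiber E (src G g)" using v t by simp
      have nvt: "bnorm E (bminus E ?v t) \<le> a * bnorm E e"
      proof -
        have "bnorm E (bminus E ?v t) \<le> a / ?l h * bnorm E e"
          unfolding t_def a_def using D_dev[OF T b d r h oh k e] .
        also have "\<dots> \<le> a * bnorm E e" using ell_ge1[of h] a0 norm_ge0[OF e]
          by (intro mult_right_mono) (simp_all add: divide_le_eq mult_le_cancel_left1)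
        finally show ?thesis .
      qed
      have Feq: "F k = \<phi> (D T g ?m ?v)" unfolding F_def using D_shift[OF T g h sg[symmetric] k e] by simp
      let ?Y = "bminus E (D T g ?m (bminus E ?v t)) (T g (bminus E ?v t))"
      have Y: "?Y \<in> fiber E (tgt G g)" using T g m vt L by simp
      have Tgs: "T g ?v \<in> fiber E (tgt G g)" "T g t \<in> fiber E (tgt G g)" using lin_rep_in[OF L g] v t by auto
      have Ds: "D T g ?m ?v \<in> fiber E (tgt G g)" "D T g ?m t \<in> fiber E (tgt G g)" using T g m v t by auto
      have "\<phi> ?Y = F k - Q k - (P k - \<phi> (T g t))"
        unfolding Feq Q_def P_def D_minus[OF T g m v t] lin_rep_minus[OF L g v t]
        using \<phi> Tgs Ds by simp
      moreover have "\<phi> ?Y \<le> a / ?l g * bnorm E (bminus E ?v t)"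
        using dual_le[OF \<phi> Y] D_dev[OF T b d r g o m vt] by (simp add: a_def)
      moreover have "a / ?l g * bnorm E (bminus E ?v t) \<le> a / ?l g * (a * bnorm E e)"
        using nvt a0 ell_pos[of g] by (intro mult_left_mono) (auto intro: divide_nonneg_pos)
      ultimately show ?thesis by (simp add: power2_eq_square)
    qed
    have "Av (src G h) (\<lambda>k. F k - P k - Q k) \<le> a^2 / ?l g * bnorm E e - \<phi> (T g t)"
      using pt by (intro Av_le src_in h continuous_map_diff F(2) P(2) Qc) auto
    moreover have "Av (src G h) (\<lambda>k. F k - P k - Q k) = Av (src G h) F - Av (src G h) P - Av (src G h) Q"
      using Av_diff[OF src_in[OF h] continuous_map_diff[OF F(2) P(2)] Qc] Av_diff[OF src_in[OF h] F(2) P(2)] by simp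
    ultimately have 1: "\<phi> (act (\<sigma> g h) (avg T (comp G g h) e)) - \<phi> (T g W) - \<phi> (avg T g t) \<le> a^2 / ?l g * bnorm E e - \<phi> (T g t)"
      using F(1) P(1) Q by simp
    \<comment> \<open>What remains is the product of the two averaged deviations,
      \<open>avg T g - T g\<close> applied to \<open>W - t\<close>; it supplies the second
      \<open>a^2\<close>.\<close>
    let ?d = "bminus E W t"
    have dd: "?d \<in> fiber E (src G g)" using W t by simp
    have fs: "T g W \<in> fiber E (tgt G g)" "T g t \<in> fiber E (tgt G g)" "avg T g t \<in> fiber E (tgt G g)"
      using lin_rep_in[OF L g] W t avg_in[OF T g t] by auto
    have "- \<phi> (bminus E (avg T g ?d) (T g ?d)) \<le> bnorm E (bminus E (avg T g ?d) (T g ?d))"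
      using dual_abs[OF \<phi>, of "bminus E (avg T g ?d) (T g ?d)"] T g dd L by simp
    also have "\<dots> \<le> a / ?l g * bnorm E ?d" using avg_dev[OF T b d r g o dd] by (simp add: a_def)
    also have "\<dots> \<le> a / ?l g * (a * bnorm E e)"
      using Wt a0 ell_pos[of g] by (intro mult_left_mono) (auto intro: divide_nonneg_pos)
    finally have "- \<phi> (bminus E (avg T g ?d) (T g ?d)) \<le> a^2 / ?l g * bnorm E e" by (simp add: power2_eq_square)
    moreover have "\<phi> (bminus E (avg T g ?d) (T g ?d)) = \<phi> (avg T g W) - \<phi> (avg T g t) - (\<phi> (T g W) - \<phi> (T g t))"
      unfolding lin_rep_minus[OF avg_lin_rep[OF T] g W t] lin_rep_minus[OF L g W t] using \<phi> fs X by simp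
    ultimately show "\<phi> (bminus E (act (\<sigma> g h) (avg T (comp G g h) e)) (avg T g W)) \<le> 2 * a^2 / ?l g * bnorm E e"
      using 1 \<phi> X by simp
  qed
  then show "?l g * bnorm E (bminus E (act (\<sigma> g h) (avg T (comp G g h) e)) (avg T g (avg T h e))) \<le> 2 * a^2 * bnorm E e"
    using ell_pos[of g] by (simp add: W_def field_simps)
qed

lemma avg_bdd:
  assumes T: "nice T" and b: "bdd T x \<beta>" and d: "defect T x r1 r2" and r: "0 \<le> r1" "0 \<le> r2" "0 \<le> \<beta>"
  shows "bdd (avg T) x (\<beta> + 4/3 * \<beta> * (r1 + r2))"
  unfolding bdd_def
proof (intro ballI impI)
  fix g e assume g: "g \<in> Ga" and o: "tgt G g \<in> orbit G x" and e: "e \<in> fiber E (src G g)"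
  let ?l = "ell G A \<sigma> g"
  have fs: "avg T g e \<in> fiber E (tgt G g)" "T g e \<in> fiber E (tgt G g)" using T g e nice_lin[OF T] by auto
  have "?l * bnorm E (avg T g e) \<le> ?l * (bnorm E (T g e) + bnorm E (bminus E (avg T g e) (T g e)))"
    using norm_le_minus[OF fs] ell_pos[of g] by (intro mult_left_mono) auto
  also have "\<dots> = ?l * bnorm E (T g e) + ?l * bnorm E (bminus E (avg T g e) (T g e))" by (simp add: algebra_simps)
  also have "?l * bnorm E (T g e) \<le> \<beta> * bnorm E e" using b g o e unfolding bdd_def by simp
  also have "?l * bnorm E (bminus E (avg T g e) (T g e)) \<le> 4/3 * \<beta> * (r1 + r2) * bnorm E e"
    using avg_dev[OF T b d r g o e] ell_pos[of g] by (simp add: field_simps)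
  finally show "?l * bnorm E (avg T g e) \<le> (\<beta> + 4/3 * \<beta> * (r1 + r2)) * bnorm E e" by (simp add: algebra_simps)
qed

end

section \<open>Iteration and convergence\<close>

lemma le_zero_of_geometric:
  fixes x K r :: real
  assumes "\<And>n. x \<le> K * r ^ n" "0 \<le> r" "r < 1" shows "x \<le> 0"
proof -
  have "(\<lambda>n. K * r ^ n) \<longlonglongrightarrow> 0"
    using LIMSEQ_power_zero[of r] assms(2,3) by (intro tendsto_mult_right_zero) auto
  then show ?thesis using assms(1) by (intro LIMSEQ_le_const[of "\<lambda>n. K * r ^ n" 0 x]) auto
qed

context rep_setting begin

text \<open>The condition \<open>\<beta>\<^sup>2 * (r1 + r2) \<le> 1/9\<close> reproduces itself
  under averaging. The parameters \<open>b\<close> and \<open>r\<close> only bound the product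
  \<open>\<beta> * (r1 + r2)\<close> and the defect, which shrink, while \<open>\<beta>\<close>
  itself may grow.\<close>

definition ctrl :: "('g \<Rightarrow> 'e \<Rightarrow> 'e) \<Rightarrow> 'x \<Rightarrow> real \<Rightarrow> real \<Rightarrow> bool" where
  "ctrl T x b r \<longleftrightarrow> (\<exists>\<beta> r1 r2. 0 \<le> \<beta> \<and> 0 \<le> r1 \<and> 0 \<le> r2 \<and> r1 + r2 \<le> 1/4 \<and> \<beta>\<^sup>2 * (r1 + r2) \<le> 1/9 \<and>
     defect T x r1 r2 \<and> bdd T x \<beta> \<and> \<beta> * (r1 + r2) \<le> b \<and> r1 + r2 \<le> r)"

text \<open>The first alternative covers the orbits with \<open>b = \<infinity>\<close>, on which \<open>r = 0\<close>.\<close>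

definition good :: "('g \<Rightarrow> 'e \<Rightarrow> 'e) \<Rightarrow> 'x \<Rightarrow> real \<Rightarrow> real \<Rightarrow> bool" where
  "good T x b r \<longleftrightarrow> defect T x 0 0 \<or> ctrl T x b r"

lemma good_defect:
  assumes "good T x b r" "0 \<le> r"
  obtains r1 r2 where "0 \<le> r1" "0 \<le> r2" "r1 + r2 \<le> 1/4" "r1 + r2 \<le> r" "defect T x r1 r2"
proof (cases "defect T x 0 0")
  case True then show ?thesis using that[of 0 0] assms(2) by simp
next
  case False then show ?thesis using assms(1) that unfolding good_def ctrl_def by blast
qed

lemma good_nice:
  assumes "lin_rep T" "\<And>x. x \<in> Xo \<Longrightarrow> good T x (b x) (r x)" "\<And>x. x \<in> Xo \<Longrightarrow> 0 \<le> r x"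
  shows "nice T"
  unfolding nice_def
proof (intro conjI ballI assms(1))
  fix x assume x: "x \<in> Xo"
  show "\<exists>r1 r2. 0 \<le> r1 \<and> 0 \<le> r2 \<and> r1 + r2 \<le> 1 / 4 \<and> defect T x r1 r2"
    by (rule good_defect[OF assms(2)[OF x] assms(3)[OF x]]) blast
qed

text \<open>The operator bound \<open>\<beta>\<close> grows at most by the factor \<open>4/3\<close>, and \<open>2 (4/3 \<beta> \<rho>)\<^sup>2 \<le> 32/81 \<rho>\<close> because
  \<open>\<beta>\<^sup>2 \<rho> \<le> 1/9\<close>; the product of the two factors is \<open>128/243\<close>.\<close>

lemma good_step:
  assumes T: "nice T" and gd: "good T x b r" and nn: "0 \<le> b" "0 \<le> r"
  shows "good (avg T) x (128/243 * b) (32/81 * r)"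
    "g \<in> Ga \<Longrightarrow> tgt G g \<in> orbit G x \<Longrightarrow> w \<in> fiber E (src G g) \<Longrightarrow>
      bnorm E (bminus E (avg T g w) (T g w)) \<le> 4/3 * b * bnorm E w"
proof -
  note L = nice_lin[OF T]
  have "good (avg T) x (128/243 * b) (32/81 * r) \<and> (\<forall>g w. g \<in> Ga \<longrightarrow> tgt G g \<in> orbit G x \<longrightarrow> w \<in> fiber E (src G g) \<longrightarrow>
      bnorm E (bminus E (avg T g w) (T g w)) \<le> 4/3 * b * bnorm E w)"
  proof (cases "defect T x 0 0")
    \<comment> \<open>On an orbit where \<open>T\<close> is already exact, averaging changes
      nothing, so no operator bound is consulted.\<close>
    case True
    have eq: "avg T g w = T g w" if "g \<in> Ga" "tgt G g \<in> orbit G x" "w \<in> fiber E (src G g)" for g w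
      using avg_exact[OF T True that] .
    have "defect (avg T) x 0 0" unfolding defect_def
    proof (intro conjI ballI impI)
      fix y e assume y: "y \<in> orbit G x" "e \<in> fiber E y"
      then show "bnorm E (bminus E e (avg T (unit G y) e)) \<le> 0 * bnorm E e"
        using eq[of "unit G y" e] orbit_X[of y x] defectD(1)[OF True y] by simp
    next
      fix g h e assume g: "g \<in> Ga" "h \<in> Ga" "src G g = tgt G h" "tgt G g \<in> orbit G x" "e \<in> fiber E (src G h)"
      have oh: "tgt G h \<in> orbit G x" using g orbit_src[OF g(1)] by simp
      show "ell G A \<sigma> g * bnorm E (bminus E (act (\<sigma> g h) (avg T (comp G g h) e)) (avg T g (avg T h e))) \<le> 0 * bnorm E e"
        using eq[of "comp G g h" e] eq[of h e] eq[of g "T h e"] g oh lin_rep_in[OF L g(2,5)] defectD(2)[OF True g] by simp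
    qed
    moreover have "bnorm E (bminus E (avg T g w) (T g w)) \<le> 4/3 * b * bnorm E w"
      if "g \<in> Ga" "tgt G g \<in> orbit G x" "w \<in> fiber E (src G g)" for g w
      unfolding eq[OF that] using norm_minus_self[OF lin_rep_in[OF L that(1,3)]] nn norm_ge0[OF that(3)] by simp
    ultimately show ?thesis unfolding good_def by blast
  next
    case False
    then obtain \<beta> r1 r2 where c: "0 \<le> \<beta>" "0 \<le> r1" "0 \<le> r2" "r1 + r2 \<le> 1/4" "\<beta>\<^sup>2 * (r1 + r2) \<le> 1/9"
      "defect T x r1 r2" "bdd T x \<beta>" "\<beta> * (r1 + r2) \<le> b" "r1 + r2 \<le> r"
      using gd unfolding good_def ctrl_def by blast
    define \<rho> where "\<rho> = r1 + r2"
    have \<rho>: "0 \<le> \<rho>" "\<rho> \<le> 1/4" "\<beta>\<^sup>2 * \<rho> \<le> 1/9" "\<beta> * \<rho> \<le> b" "\<rho> \<le> r" using c by (simp_all add: \<rho>_def)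
    define \<beta>' where "\<beta>' = \<beta> + 4/3 * \<beta> * \<rho>"
    define \<rho>' where "\<rho>' = 2 * (4/3 * \<beta> * \<rho>)\<^sup>2"
    have "\<rho>' = (32/9) * (\<beta>\<^sup>2 * \<rho>) * \<rho>" by (simp add: \<rho>'_def power2_eq_square)
    also have "\<dots> \<le> (32/9) * (1/9) * \<rho>" using \<rho> by (intro mult_right_mono mult_left_mono) auto
    finally have r1: "\<rho>' \<le> 32/81 * \<rho>" by simp
    have r0: "0 \<le> \<rho>'" by (simp add: \<rho>'_def)
    have b0: "0 \<le> \<beta>'" using c(1) \<rho>(1) by (simp add: \<beta>'_def)
    have "4/3 * \<beta> * \<rho> \<le> 4/3 * \<beta> * (1/4)" using c(1) \<rho> by (intro mult_left_mono) auto
    then have b1: "\<beta>' \<le> 4/3 * \<beta>" by (simp add: \<beta>'_def)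
    have "\<beta>' * \<rho>' \<le> (4/3 * \<beta>) * (32/81 * \<rho>)" using b0 b1 r0 r1 c(1) by (intro mult_mono) auto
    then have br: "\<beta>' * \<rho>' \<le> 128/243 * b" using \<rho>(4) by simp
    \<comment> \<open>The factor \<open>(4/3)^2 * 32/81 = 512/729\<close> is below 1, so the
      threshold \<open>1/9\<close> is preserved.\<close>
    have "\<beta>'\<^sup>2 * \<rho>' \<le> (4/3 * \<beta>)\<^sup>2 * (32/81 * \<rho>)" using b0 b1 r0 r1 c(1) by (intro mult_mono power_mono) auto
    also have "\<dots> = 512/729 * (\<beta>\<^sup>2 * \<rho>)" by (simp add: power2_eq_square)
    finally have bbr: "\<beta>'\<^sup>2 * \<rho>' \<le> 1/9" using \<rho>(3) by simp
    have "defect (avg T) x 0 \<rho>'" unfolding \<rho>'_def \<rho>_def using avg_defect[OF T c(7,6,2,3,1)] .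
    moreover have "bdd (avg T) x \<beta>'" unfolding \<beta>'_def \<rho>_def using avg_bdd[OF T c(7,6,2,3,1)] .
    ultimately have "ctrl (avg T) x (128/243 * b) (32/81 * r)"
      unfolding ctrl_def using b0 r0 br bbr r1 \<rho> by (intro exI[of _ \<beta>'] exI[of _ 0] exI[of _ \<rho>']) auto
    moreover have "bnorm E (bminus E (avg T g w) (T g w)) \<le> 4/3 * b * bnorm E w"
      if g: "g \<in> Ga" "tgt G g \<in> orbit G x" and w: "w \<in> fiber E (src G g)" for g w
    proof -
      have "bnorm E (bminus E (avg T g w) (T g w)) \<le> 4/3 * \<beta> * (r1 + r2) / ell G A \<sigma> g * bnorm E w"
        using avg_dev[OF T c(7,6,2,3,1) g w] .
      also have "\<dots> \<le> 4/3 * b * bnorm E w"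
      proof (intro mult_right_mono norm_ge0[OF w])
        have "4/3 * \<beta> * (r1 + r2) / ell G A \<sigma> g \<le> 4/3 * \<beta> * (r1 + r2) / 1"
          using ell_ge1[of g] c by (intro divide_left_mono) auto
        then show "4/3 * \<beta> * (r1 + r2) / ell G A \<sigma> g \<le> 4/3 * b" using c(8) by simp
      qed
      finally show ?thesis .
    qed
    ultimately show ?thesis unfolding good_def by blast
  qed
  then show "good (avg T) x (128/243 * b) (32/81 * r)"
    "g \<in> Ga \<Longrightarrow> tgt G g \<in> orbit G x \<Longrightarrow> w \<in> fiber E (src G g) \<Longrightarrow>
      bnorm E (bminus E (avg T g w) (T g w)) \<le> 4/3 * b * bnorm E w" by blast+
qed

text \<open>Continuity at the zero vector bounds each single operator. This is needed where
  \<open>bdef\<close> is infinite and gives no bound.\<close>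

lemma lin_rep_bounded:
  assumes T: "lin_rep T" and g: "g \<in> Ga"
  obtains M where "M > 0" "\<And>v. v \<in> fiber E (src G g) \<Longrightarrow> bnorm E (T g v) \<le> M * bnorm E v"
proof -
  let ?x = "src G g"
  let ?Z = "subtopology (btop E) {e. bproj E e = ?x}"
  have x: "?x \<in> Xo" using g by simp
  have "continuous_map ?Z (btop E) (\<lambda>v. T g v)"
    by (rule lin_rep_cont[OF T, of _ "\<lambda>_. g"]) (use g in \<open>auto intro: continuous_map_from_subtopology\<close>)
  then have "continuous_map ?Z euclideanreal (\<lambda>v. bnorm E (T g v))" by (rule cont_norm)
  from openin_continuous_map_preimage[OF this, of "{..<1}"]
  have "openin ?Z {v \<in> topspace ?Z. bnorm E (T g v) < 1}" by simp
  then obtain U where U: "openin (btop E) U" "{v \<in> topspace ?Z. bnorm E (T g v) < 1} = U \<inter> {e. bproj E e = ?x}"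
    unfolding openin_subtopology by metis
  have z: "bzero E ?x \<in> fiber E ?x" using x by simp
  have "T g (bscale E 0 (bzero E ?x)) = bscale E 0 (T g (bzero E ?x))" using lin_rep_scale[OF T g z] .
  then have "bnorm E (T g (bzero E ?x)) = 0"
    using scale_zero[OF x] norm_scale[OF lin_rep_in[OF T g z], of 0] by simp
  then have "bzero E ?x \<in> {v \<in> topspace ?Z. bnorm E (T g v) < 1}" using fiberD[OF z] by simp
  then have "bzero E ?x \<in> U" using U(2) by blast
  then obtain \<epsilon> B where B: "\<epsilon> > 0" "openin (obj G) B" "?x \<in> B"
    "\<And>e. e \<in> topspace (btop E) \<Longrightarrow> bproj E e \<in> B \<Longrightarrow> bnorm E e < \<epsilon> \<Longrightarrow> e \<in> U"
    using zero_nbhd[OF x U(1)] by metis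
  have small: "bnorm E (T g v) < 1" if v: "v \<in> fiber E ?x" "bnorm E v < \<epsilon>" for v
  proof -
    have "v \<in> U" using B(4)[of v] fiberD[OF v(1)] v B(3) by simp
    then have "v \<in> {v \<in> topspace ?Z. bnorm E (T g v) < 1}" unfolding U(2) using fiberD[OF v(1)] by simp
    then show ?thesis by simp
  qed
  show ?thesis
  proof (rule that[of "2 / \<epsilon>"])
    show "2 / \<epsilon> > 0" using B(1) by simp
    fix v assume v: "v \<in> fiber E ?x"
    show "bnorm E (T g v) \<le> 2 / \<epsilon> * bnorm E v"
    proof (cases "bnorm E v = 0")
      case True
      then have "v = bscale E 0 (bzero E ?x)" using norm_eq0[OF v] scale_zero[OF x] by simp
      then show ?thesis using \<open>bnorm E (T g (bzero E ?x)) = 0\<close> scale_zero[OF x] True by simp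
    next
      case False
      then have p: "bnorm E v > 0" using norm_ge0[OF v] by simp
      \<comment> \<open>Half of the radius \<open>\<epsilon>\<close>, so that the scaled vector lies
        strictly inside the tube; this explains the bound \<open>2 / \<epsilon>\<close>.\<close>
      define t where "t = \<epsilon> / (2 * bnorm E v)"
      have t: "t > 0" using p B(1) by (simp add: t_def)
      have "bnorm E (bscale E t v) < \<epsilon>" using norm_scale[OF v, of t] t p B(1) by (simp add: t_def)
      then have "bnorm E (T g (bscale E t v)) < 1" using small v by simp
      then have "t * bnorm E (T g v) < 1" using lin_rep_scale[OF T g v] norm_scale[OF lin_rep_in[OF T g v], of t] t by simp
      then show ?thesis using p B(1) by (simp add: t_def field_simps)
    qed
  qed
qed

lemma iterate_limit:
  assumes T: "lin_rep T" and gd: "\<And>x. x \<in> Xo \<Longrightarrow> good T x (b x) (r x)"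
    and nn: "\<And>x. x \<in> Xo \<Longrightarrow> 0 \<le> b x" "\<And>x. x \<in> Xo \<Longrightarrow> 0 \<le> r x" "\<And>x. x \<in> Xo \<Longrightarrow> b x \<le> 1/4"
  defines "S \<equiv> (\<lambda>n. (avg ^^ n) T)"
  obtains R where "sigma_rep G A E act gact \<sigma> R" "\<And>n. nice (S n)"
    "\<And>n g w. g \<in> Ga \<Longrightarrow> w \<in> fiber E (src G g) \<Longrightarrow>
      bnorm E (bminus E (R g w) (S n g w)) \<le> 4 * b (tgt G g) * (128/243) ^ n * bnorm E w"
proof -
  let ?q = "128/243 :: real"
  have S0: "S 0 = T" and SS: "S (Suc n) = avg (S n)" for n by (simp_all add: S_def)
  have inv: "lin_rep (S n) \<and> (\<forall>x\<in>Xo. good (S n) x (?q ^ n * b x) ((32/81) ^ n * r x))" for n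
  proof (induction n)
    case 0 then show ?case using T gd by (simp add: S0)
  next
    case (Suc n)
    have nice: "nice (S n)" using good_nice[of "S n" "\<lambda>x. ?q ^ n * b x" "\<lambda>x. (32/81) ^ n * r x"] Suc nn by simp
    show ?case unfolding SS
    proof (intro conjI ballI)
      show "lin_rep (avg (S n))" by (rule avg_lin_rep[OF nice])
      fix x assume x: "x \<in> Xo"
      have "good (avg (S n)) x (?q * (?q ^ n * b x)) (32/81 * ((32/81) ^ n * r x))"
        by (rule good_step(1)[OF nice]) (use Suc nn x in auto)
      then show "good (avg (S n)) x (?q ^ Suc n * b x) ((32/81) ^ Suc n * r x)" by (simp only: power_Suc mult.assoc)
    qed
  qed
  have nice: "nice (S n)" for n
    using good_nice[of "S n" "\<lambda>x. ?q ^ n * b x" "\<lambda>x. (32/81) ^ n * r x"] inv[of n] nn by simp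
  have Sin: "S n g w \<in> fiber E (tgt G g)" if "g \<in> Ga" "w \<in> fiber E (src G g)" for n g w
    using lin_rep_in[OF nice_lin[OF nice] that] .
  have ex: "\<exists>l. l \<in> fiber E (tgt G g) \<and> (\<forall>n. bnorm E (bminus E l (S n g w)) \<le> 4 * b (tgt G g) * ?q ^ n * bnorm E w)"
    if g: "g \<in> Ga" and w: "w \<in> fiber E (src G g)" for g w
  proof -
    let ?x = "tgt G g" let ?C = "4/3 * b ?x * bnorm E w"
    have x: "?x \<in> Xo" using g by simp
    have C: "?C \<ge> 0" using nn x norm_ge0[OF w] by simp
    have step: "bnorm E (bminus E (S (Suc n) g w) (S n g w)) \<le> ?C * ?q ^ n" for n
    proof -
      have "bnorm E (bminus E (avg (S n) g w) (S n g w)) \<le> 4/3 * (?q ^ n * b ?x) * bnorm E w"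
        by (rule good_step(2)[OF nice[of n], of ?x _ "(32/81) ^ n * r ?x"]) (use inv nn x g w in auto)
      then show ?thesis by (simp add: SS mult_ac)
    qed
    obtain l where l: "l \<in> fiber E ?x" "\<And>n. bnorm E (bminus E l (S n g w)) \<le> ?C / (1 - ?q) * ?q ^ n"
      using geometric_limit[of "\<lambda>n. S n g w" ?x ?q ?C] Sin[OF g w] C step by auto
    have "?C / (1 - ?q) * ?q ^ n \<le> 4 * b ?x * ?q ^ n * bnorm E w" for n
    proof -
      \<comment> \<open>The geometric series gives \<open>(4/3) / (1 - 128/243) = 324/115\<close>,
        which is below the constant 4 of the theorem.\<close>
      have "?C / (1 - ?q) \<le> 4 * b ?x * bnorm E w" using nn(1)[OF x] norm_ge0[OF w] by (simp add: field_simps)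
      then have "?C / (1 - ?q) * ?q ^ n \<le> (4 * b ?x * bnorm E w) * ?q ^ n" by (rule mult_right_mono) simp
      then show ?thesis by (simp add: mult_ac)
    qed
    then show ?thesis using l by (meson order_trans)
  qed
  define R where "R = (\<lambda>g w. SOME l. l \<in> fiber E (tgt G g) \<and>
      (\<forall>n. bnorm E (bminus E l (S n g w)) \<le> 4 * b (tgt G g) * ?q ^ n * bnorm E w))"
  have R: "R g w \<in> fiber E (tgt G g)"
    "bnorm E (bminus E (R g w) (S n g w)) \<le> 4 * b (tgt G g) * ?q ^ n * bnorm E w"
    if "g \<in> Ga" "w \<in> fiber E (src G g)" for g w n
    using someI_ex[OF ex[OF that]] unfolding R_def by blast+
  \<comment> \<open>Because \<open>4 * b \<le> 1\<close> at every point, the rate no longer depends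
    on the orbit: the convergence is uniform on the whole groupoid.\<close>
  have R1: "bnorm E (bminus E (R g w) (S n g w)) \<le> ?q ^ n * bnorm E w"
    if g: "g \<in> Ga" and w: "w \<in> fiber E (src G g)" for g w n
  proof -
    have "4 * b (tgt G g) * (?q ^ n * bnorm E w) \<le> 1 * (?q ^ n * bnorm E w)"
      using nn(3)[of "tgt G g"] g norm_ge0[OF w] by (intro mult_right_mono) auto
    moreover have "bnorm E (bminus E (R g w) (S n g w)) \<le> 4 * b (tgt G g) * (?q ^ n * bnorm E w)"
      using R(2)[OF g w, of n] by (simp only: mult.assoc)
    ultimately show ?thesis by linarith
  qed
  \<comment> \<open>The hypothesis asks only for a Lipschitz estimate, so that \<open>\<phi>\<close>
    may be composed with the action of an algebra element.\<close>
  have limf: "(\<lambda>n. \<psi> (S n g w)) \<longlonglongrightarrow> \<psi> (R g w)"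
    if g: "g \<in> Ga" and w: "w \<in> fiber E (src G g)"
      and \<psi>: "\<And>e f. e \<in> fiber E (tgt G g) \<Longrightarrow> f \<in> fiber E (tgt G g) \<Longrightarrow> \<bar>\<psi> e - \<psi> f\<bar> \<le> M * bnorm E (bminus E e f)" for \<psi> M g w
  proof (rule LIM_zero_cancel, rule Lim_null_comparison)
    show "(\<lambda>n. \<bar>M\<bar> * bnorm E w * ?q ^ n) \<longlonglongrightarrow> 0"
      using LIMSEQ_power_zero[of ?q] by (intro tendsto_mult_right_zero) auto
    show "\<forall>\<^sub>F n in sequentially. norm (\<psi> (S n g w) - \<psi> (R g w)) \<le> \<bar>M\<bar> * bnorm E w * ?q ^ n"
    proof (intro always_eventually allI)
      fix n
      have "norm (\<psi> (S n g w) - \<psi> (R g w)) \<le> M * bnorm E (bminus E (R g w) (S n g w))"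
        using \<psi>[OF R(1)[OF g w] Sin[OF g w]] by (simp add: abs_minus_commute)
      also have "\<dots> \<le> \<bar>M\<bar> * bnorm E (bminus E (R g w) (S n g w))"
        using norm_ge0[OF minus_in[OF R(1)[OF g w] Sin[OF g w, of n]]] by (intro mult_right_mono) auto
      also have "\<dots> \<le> \<bar>M\<bar> * (?q ^ n * bnorm E w)" using R1[OF g w] by (intro mult_left_mono) auto
      finally show "norm (\<psi> (S n g w) - \<psi> (R g w)) \<le> \<bar>M\<bar> * bnorm E w * ?q ^ n" by (simp add: mult_ac)
    qed
  qed
  have dlip: "\<bar>\<phi> e - \<phi> f\<bar> \<le> 1 * bnorm E (bminus E e f)" if "\<phi> \<in> dual x" "e \<in> fiber E x" "f \<in> fiber E x" for \<phi> e f x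
    using dual_abs[OF that(1) minus_in[OF that(2,3)]] that by simp
  have lim: "(\<lambda>n. \<phi> (S n g w)) \<longlonglongrightarrow> \<phi> (R g w)" if "g \<in> Ga" "w \<in> fiber E (src G g)" "\<phi> \<in> dual (tgt G g)" for \<phi> g w
    by (rule limf[OF that(1,2) dlip[OF that(3)]])
  have linR: "lin_rep R"
  proof (rule lin_repI)
    let ?Z = "subtopology (prod_topology (arr G) (btop E)) {(g,e). bproj E e = src G g}"
    have f: "continuous_map ?Z (arr G) fst" and s: "continuous_map ?Z (btop E) snd"
      by (intro continuous_map_from_subtopology continuous_map_fst continuous_map_snd)+
    have zs: "fst z \<in> Ga" "snd z \<in> fiber E (src G (fst z))" if "z \<in> topspace ?Z" for z using that by (auto simp: fiber_def)
    have "continuous_map ?Z (btop E) (\<lambda>z. R (fst z) (snd z))"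
    proof (rule cont_uniform_limit[where S = "\<lambda>n z. S n (fst z) (snd z)" and \<pi> = "\<lambda>z. tgt G (fst z)"])
      show "R (fst z) (snd z) \<in> fiber E (tgt G (fst z))" if "z \<in> topspace ?Z" for z using R(1) zs[OF that] .
      show "S n (fst z) (snd z) \<in> fiber E (tgt G (fst z))" if "z \<in> topspace ?Z" for z n using Sin zs[OF that] .
      show "continuous_map ?Z (obj G) (\<lambda>z. tgt G (fst z))" by (rule cont_tgt[OF f])
      show "continuous_map ?Z (btop E) (\<lambda>z. S n (fst z) (snd z))" for n
        by (rule lin_rep_cont[OF nice_lin[OF nice] f s]) auto
      fix z and \<epsilon> :: real assume z: "z \<in> topspace ?Z" and \<epsilon>: "\<epsilon> > 0"
      \<comment> \<open>The error is proportional to the norm of the vector; on the open set of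
        vectors of norm below \<open>?K\<close> the convergence is uniform.\<close>
      let ?K = "bnorm E (snd z) + 1"
      have K: "?K > 0" using norm_ge0[OF zs(2)[OF z]] by simp
      obtain n where n: "?q ^ n < \<epsilon> / ?K" using real_arch_pow_inv[of "\<epsilon> / ?K" ?q] \<epsilon> K by auto
      have "openin ?Z {y \<in> topspace ?Z. bnorm E (snd y) \<in> {..<?K}}"
        by (rule openin_continuous_map_preimage[OF cont_norm[OF s]]) simp
      moreover have "bnorm E (bminus E (R (fst y) (snd y)) (S n (fst y) (snd y))) < \<epsilon>"
        if y: "y \<in> topspace ?Z" "bnorm E (snd y) < ?K" for y
      proof -
        have "bnorm E (bminus E (R (fst y) (snd y)) (S n (fst y) (snd y))) \<le> ?q ^ n * bnorm E (snd y)"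
          using R1 zs[OF y(1)] .
        also have "\<dots> \<le> ?q ^ n * ?K" using y by (intro mult_left_mono) auto
        also have "\<dots> < \<epsilon>" using n K by (simp add: field_simps)
        finally show ?thesis .
      qed
      ultimately show "\<exists>n N. openin ?Z N \<and> z \<in> N \<and> (\<forall>y\<in>N. bnorm E (bminus E (R (fst y) (snd y)) (S n (fst y) (snd y))) < \<epsilon>)"
        using z by (intro exI[of _ n] exI[of _ "{y \<in> topspace ?Z. bnorm E (snd y) \<in> {..<?K}}"]) auto
    qed
    then show "continuous_map ?Z (btop E) (\<lambda>(g,e). R g e)" by (simp add: case_prod_unfold)
    fix g e assume g: "g \<in> Ga" and e: "e \<in> fiber E (src G g)"
    show "R g e \<in> fiber E (tgt G g)" using R(1) g e .
    show "R g (badd E e f) = badd E (R g e) (R g f)" if f': "f \<in> fiber E (src G g)" for f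
    proof (rule fiber_eqI)
      fix \<phi> assume \<phi>: "\<phi> \<in> dual (tgt G g)"
      have "(\<lambda>n. \<phi> (S n g (badd E e f))) = (\<lambda>n. \<phi> (S n g e) + \<phi> (S n g f))"
        using lin_rep_add[OF nice_lin[OF nice] g e f'] dual_add[OF \<phi> Sin[OF g e] Sin[OF g f']] by simp
      then have "\<phi> (R g (badd E e f)) = \<phi> (R g e) + \<phi> (R g f)"
        using tendsto_add[OF lim[OF g e \<phi>] lim[OF g f' \<phi>]] lim[OF g add_in[OF e f'] \<phi>] LIMSEQ_unique by metis
      then show "\<phi> (R g (badd E e f)) = \<phi> (badd E (R g e) (R g f))" using \<phi> R(1) g e f' by simp
    qed (use R(1) g e f' in auto)
    show "R g (bscale E t e) = bscale E t (R g e)" for t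
    proof (rule fiber_eqI)
      fix \<phi> assume \<phi>: "\<phi> \<in> dual (tgt G g)"
      have "(\<lambda>n. \<phi> (S n g (bscale E t e))) = (\<lambda>n. t * \<phi> (S n g e))"
        using lin_rep_scale[OF nice_lin[OF nice] g e] dual_scale[OF \<phi> Sin[OF g e]] by simp
      then have "\<phi> (R g (bscale E t e)) = t * \<phi> (R g e)"
        using tendsto_mult_left[OF lim[OF g e \<phi>], of t] lim[OF g scale_in[OF e] \<phi>] LIMSEQ_unique by metis
      then show "\<phi> (R g (bscale E t e)) = \<phi> (bscale E t (R g e))" using \<phi> R(1) g e by simp
    qed (use R(1) g e in auto)
    show "R g (act a e) = act (gact g a) (R g e)" if a: "a \<in> fiber A (src G g)" for a
    proof (rule fiber_eqI)
      have ga: "gact g a \<in> fiber A (tgt G g)" using g a by simp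
      have ae: "act a e \<in> fiber E (src G g)" using act_in[OF a e] .
      show "R g (act a e) \<in> fiber E (tgt G g)" "act (gact g a) (R g e) \<in> fiber E (tgt G g)"
        using R(1)[OF g] ae e act_in[OF ga] by auto
      fix \<phi> assume \<phi>: "\<phi> \<in> dual (tgt G g)"
      have "\<bar>\<phi> (act (gact g a) u) - \<phi> (act (gact g a) v)\<bar> \<le> bnorm A (gact g a) * bnorm E (bminus E u v)"
        if u: "u \<in> fiber E (tgt G g)" "v \<in> fiber E (tgt G g)" for u v
        using dlip[OF \<phi> act_in[OF ga u(1)] act_in[OF ga u(2)]] act_minus[OF ga u] act_norm[OF ga minus_in[OF u]] by simp
      from limf[OF g e this] have "(\<lambda>n. \<phi> (act (gact g a) (S n g e))) \<longlonglongrightarrow> \<phi> (act (gact g a) (R g e))" .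
      moreover have "(\<lambda>n. \<phi> (S n g (act a e))) = (\<lambda>n. \<phi> (act (gact g a) (S n g e)))"
        using lin_rep_act[OF nice_lin[OF nice] g a e] by simp
      ultimately show "\<phi> (R g (act a e)) = \<phi> (act (gact g a) (R g e))" using lim[OF g ae \<phi>] LIMSEQ_unique by metis
    qed
  qed
  have unitR: "R (unit G x) e = e" if x: "x \<in> Xo" and e: "e \<in> fiber E x" for x e
  proof (rule fiber_eqI)
    have u: "unit G x \<in> Ga" "src G (unit G x) = x" "tgt G (unit G x) = x" using x by auto
    show "R (unit G x) e \<in> fiber E x" using R(1)[OF u(1)] e u by simp
    fix \<phi> assume \<phi>: "\<phi> \<in> dual x"
    have "(\<lambda>n. \<phi> (S n (unit G x) e)) \<longlonglongrightarrow> \<phi> (R (unit G x) e)" using lim[OF u(1)] u e \<phi> by simp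
    \<comment> \<open>The values are constant from index 1 on; \<open>T\<close> itself need not be
      the identity at units.\<close>
    moreover have "\<phi> (S (Suc n) (unit G x) e) = \<phi> e" for n unfolding SS using avg_unit[OF nice x e] by simp
    then have "(\<lambda>n. \<phi> (S n (unit G x) e)) \<longlonglongrightarrow> \<phi> e" by (subst filterlim_sequentially_Suc[symmetric]) simp
    ultimately show "\<phi> (R (unit G x) e) = \<phi> e" using LIMSEQ_unique by blast
  qed (rule e)
  have multR: "act (\<sigma> g h) (R (comp G g h) e) = R g (R h e)"
    if g: "g \<in> Ga" and h: "h \<in> Ga" and sg: "src G g = tgt G h" and e: "e \<in> fiber E (src G h)" for g h e
  proof (rule eq_of_small)
    let ?gh = "comp G g h"
    have gh: "?gh \<in> Ga" "src G ?gh = src G h" "tgt G ?gh = tgt G g" using g h sg by auto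
    have s: "\<sigma> g h \<in> fiber A (tgt G g)" using g h sg by simp
    have Re: "R h e \<in> fiber E (src G g)" "R ?gh e \<in> fiber E (tgt G g)" using R(1)[OF h e] R(1)[OF gh(1)] gh e sg by auto
    show fs: "act (\<sigma> g h) (R ?gh e) \<in> fiber E (tgt G g)" "R g (R h e) \<in> fiber E (tgt G g)"
      using act_in[OF s Re(2)] R(1)[OF g Re(1)] by auto
    obtain M where M: "M > 0" "\<And>v. v \<in> fiber E (src G g) \<Longrightarrow> bnorm E (R g v) \<le> M * bnorm E v"
      using lin_rep_bounded[OF linR g] by metis
    \<comment> \<open>One summand for each step of the comparison: \<open>R\<close> by
      \<open>S n\<close> at the product, the defect of \<open>S n\<close>, \<open>S n\<close> by
      \<open>R\<close> at the outer arrow, and \<open>S n\<close> by \<open>R\<close> at the inner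
      arrow.\<close>
    let ?K = "bnorm A (\<sigma> g h) * bnorm E e + r (tgt G g) * bnorm E e + (bnorm E (R h e) + bnorm E e) + M * bnorm E e"
    have "bnorm E (bminus E (act (\<sigma> g h) (R ?gh e)) (R g (R h e))) \<le> ?K * ?q ^ n" for n
    proof -
      have Se: "S n h e \<in> fiber E (src G g)" "S n ?gh e \<in> fiber E (tgt G g)" using Sin[OF h e] Sin[OF gh(1)] gh e sg by auto
      have vs: "act (\<sigma> g h) (S n ?gh e) \<in> fiber E (tgt G g)" "S n g (S n h e) \<in> fiber E (tgt G g)" "R g (S n h e) \<in> fiber E (tgt G g)"
        using act_in[OF s Se(2)] Sin[OF g Se(1)] R(1)[OF g Se(1)] by auto
      have q1: "?q ^ n \<le> 1" by (rule power_le_one) auto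
      have 1: "bnorm E (bminus E (act (\<sigma> g h) (R ?gh e)) (act (\<sigma> g h) (S n ?gh e))) \<le> bnorm A (\<sigma> g h) * bnorm E e * ?q ^ n"
      proof -
        have "bnorm E (bminus E (act (\<sigma> g h) (R ?gh e)) (act (\<sigma> g h) (S n ?gh e))) \<le> bnorm A (\<sigma> g h) * bnorm E (bminus E (R ?gh e) (S n ?gh e))"
          using act_norm[OF s minus_in[OF Re(2) Se(2)]] act_minus[OF s Re(2) Se(2)] by simp
        also have "\<dots> \<le> bnorm A (\<sigma> g h) * (?q ^ n * bnorm E e)"
          using R1[OF gh(1), of e n] gh e A.norm_ge0[OF s] by (intro mult_left_mono) auto
        finally show ?thesis by (simp add: mult_ac)
      qed
      have 2: "bnorm E (bminus E (act (\<sigma> g h) (S n ?gh e)) (S n g (S n h e))) \<le> r (tgt G g) * bnorm E e * ?q ^ n"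
      proof -
        have x: "tgt G g \<in> Xo" using g by simp
        obtain r1 r2 where r12: "0 \<le> r1" "0 \<le> r2" "r1 + r2 \<le> 1/4" "r1 + r2 \<le> (32/81) ^ n * r (tgt G g)" "defect (S n) (tgt G g) r1 r2"
          by (rule good_defect[of "S n" "tgt G g" "?q ^ n * b (tgt G g)" "(32/81) ^ n * r (tgt G g)"]) (use inv[of n] nn x in auto)
        let ?X = "bminus E (act (\<sigma> g h) (S n ?gh e)) (S n g (S n h e))"
        have "bnorm E ?X \<le> ell G A \<sigma> g * bnorm E ?X"
          using ell_ge1[of g] norm_ge0[OF minus_in[OF vs(1,2)]] by (simp add: mult_le_cancel_right1)
        also have "\<dots> \<le> r2 * bnorm E e" using defectD(2)[OF r12(5) g h sg _ e] x by simp
        also have "\<dots> \<le> ((32/81) ^ n * r (tgt G g)) * bnorm E e" using r12 norm_ge0[OF e] by (intro mult_right_mono) auto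
        \<comment> \<open>The defect decays faster, since \<open>32/81 = 96/243\<close>; it is
          weakened to the common rate.\<close>
        also have "\<dots> \<le> (?q ^ n * r (tgt G g)) * bnorm E e"
          using norm_ge0[OF e] nn(2)[OF x] by (intro mult_right_mono power_mono) auto
        finally show ?thesis by (simp add: mult_ac)
      qed
      have 3: "bnorm E (bminus E (S n g (S n h e)) (R g (S n h e))) \<le> (bnorm E (R h e) + bnorm E e) * ?q ^ n"
      proof -
        have "bnorm E (S n h e) \<le> bnorm E (R h e) + bnorm E (bminus E (S n h e) (R h e))" using norm_le_minus[OF Se(1) Re(1)] .
        also have "bnorm E (bminus E (S n h e) (R h e)) \<le> ?q ^ n * bnorm E e"
          using R1[OF h e, of n] norm_minus_commute[OF Se(1) Re(1)] by simp
        also have "\<dots> \<le> 1 * bnorm E e" using q1 norm_ge0[OF e] by (intro mult_right_mono) auto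
        finally have "bnorm E (S n h e) \<le> bnorm E (R h e) + bnorm E e" by simp
        then have "?q ^ n * bnorm E (S n h e) \<le> ?q ^ n * (bnorm E (R h e) + bnorm E e)" by (intro mult_left_mono) auto
        from order_trans[OF R1[OF g Se(1), of n] this] show ?thesis
          unfolding norm_minus_commute[OF vs(2,3)] by (simp only: mult.commute)
      qed
      have 4: "bnorm E (bminus E (R g (S n h e)) (R g (R h e))) \<le> M * bnorm E e * ?q ^ n"
      proof -
        have "bnorm E (bminus E (R g (S n h e)) (R g (R h e))) \<le> M * bnorm E (bminus E (S n h e) (R h e))"
          using M(2)[OF minus_in[OF Se(1) Re(1)]] lin_rep_minus[OF linR g Se(1) Re(1)] by simp
        also have "\<dots> \<le> M * (?q ^ n * bnorm E e)"
          using R1[OF h e, of n] norm_minus_commute[OF Se(1) Re(1)] M(1) by (intro mult_left_mono) auto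
        finally show ?thesis by (simp add: mult_ac)
      qed
      have "bnorm E (bminus E (act (\<sigma> g h) (R ?gh e)) (R g (R h e))) \<le>
        bnorm E (bminus E (act (\<sigma> g h) (R ?gh e)) (act (\<sigma> g h) (S n ?gh e))) +
        (bnorm E (bminus E (act (\<sigma> g h) (S n ?gh e)) (S n g (S n h e))) +
        (bnorm E (bminus E (S n g (S n h e)) (R g (S n h e))) + bnorm E (bminus E (R g (S n h e)) (R g (R h e)))))"
        using norm_minus_tri[OF fs(1) vs(1) fs(2)] norm_minus_tri[OF vs(1) vs(2) fs(2)] norm_minus_tri[OF vs(2) vs(3) fs(2)]
        by linarith
      then show ?thesis using 1 2 3 4 by (simp add: algebra_simps)
    qed
    from le_zero_of_geometric[OF this] show "bnorm E (bminus E (act (\<sigma> g h) (R ?gh e)) (R g (R h e))) \<le> \<epsilon>" if "\<epsilon> > 0" for \<epsilon>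
      using that by simp
  qed
  show ?thesis
  proof (rule that[of R])
    show "sigma_rep G A E act gact \<sigma> R" unfolding sigma_rep_def
      using linR unitR multR by (auto simp: lin_rep_def composable_def)
    show "nice (S n)" for n by (rule nice)
    show "bnorm E (bminus E (R g w) (S n g w)) \<le> 4 * b (tgt G g) * ?q ^ n * bnorm E w"
      if "g \<in> Ga" "w \<in> fiber E (src G g)" for n g w using R(2)[OF that] .
  qed
qed

section \<open>From extended-real suprema to real bounds\<close>

definition fib_hom :: "'x \<Rightarrow> 'x \<Rightarrow> ('e \<Rightarrow> 'e) \<Rightarrow> bool" where
  "fib_hom x y L \<longleftrightarrow> x \<in> Xo \<and> (\<forall>e\<in>fiber E x. L e \<in> fiber E y \<and> (\<forall>t. L (bscale E t e) = bscale E t (L e)))"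

lemma opnorm_leD:
  assumes L: "fib_hom x y L" and B: "opnorm E x L \<le> ereal B" and e: "e \<in> fiber E x"
  shows "bnorm E (L e) \<le> B * bnorm E e"
proof -
  have Le: "L u \<in> fiber E y" "L (bscale E t u) = bscale E t (L u)" if "u \<in> fiber E x" for u t
    using L that unfolding fib_hom_def by auto
  show ?thesis
  proof (cases "bnorm E e = 0")
    case True
    then have "e = bscale E 0 e" using norm_eq0[OF e] scale_0[OF e] by simp
    then have "L e = bscale E 0 (L e)" using Le(2)[OF e, of 0] by simp
    then have "bnorm E (L e) = 0" using norm_scale[OF Le(1)[OF e], of 0] by simp
    then show ?thesis using True by simp
  next
    case False
    then have p: "bnorm E e > 0" using norm_ge0[OF e] by simp
    let ?u = "bscale E (1 / bnorm E e) e"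
    have u: "?u \<in> fiber E x" "bnorm E ?u \<le> 1" using e p by (simp_all add: norm_scale[OF e])
    have "ereal (bnorm E (L ?u)) \<le> opnorm E x L" unfolding opnorm_def by (rule SUP_upper) (use u in simp)
    then have "bnorm E (L ?u) \<le> B" using B by (metis ereal_less_eq(3) order_trans)
    then show ?thesis using Le[OF e] norm_scale[OF Le(1)[OF e], of "1 / bnorm E e"] p by (simp add: field_simps)
  qed
qed

lemma opnorm_leI:
  assumes "\<And>e. e \<in> fiber E x \<Longrightarrow> bnorm E (L e) \<le> B * bnorm E e" "B \<ge> 0"
  shows "opnorm E x L \<le> ereal B"
  unfolding opnorm_def
proof (rule SUP_least)
  fix e assume e: "e \<in> {e \<in> fiber E x. bnorm E e \<le> 1}"
  have "bnorm E (L e) \<le> B * bnorm E e" using assms(1) e by simp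
  also have "\<dots> \<le> B * 1" using assms(2) e by (intro mult_left_mono) auto
  finally show "ereal (bnorm E (L e)) \<le> ereal B" by simp
qed

lemma opnorm_nonneg: assumes L: "fib_hom x y L" shows "0 \<le> opnorm E x L"
proof -
  have x: "x \<in> Xo" using L by (simp add: fib_hom_def)
  have z: "bzero E x \<in> fiber E x" using x by simp
  have "ereal (bnorm E (L (bzero E x))) \<le> opnorm E x L" unfolding opnorm_def
    by (rule SUP_upper) (use z x in simp)
  moreover have "0 \<le> bnorm E (L (bzero E x))" using L z norm_ge0 unfolding fib_hom_def by blast
  ultimately show ?thesis by (meson ereal_less_eq(5) order_trans)
qed

lemma fib_hom_minus:
  assumes "fib_hom x y L" "fib_hom x y K" shows "fib_hom x y (\<lambda>e. bminus E (L e) (K e))"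
  using assms unfolding fib_hom_def
proof (intro conjI ballI allI)
  fix e t assume e: "e \<in> fiber E x"
  have f: "L e \<in> fiber E y" "K e \<in> fiber E y" "L (bscale E t e) = bscale E t (L e)" "K (bscale E t e) = bscale E t (K e)"
    using assms e unfolding fib_hom_def by auto
  show "bminus E (L (bscale E t e)) (K (bscale E t e)) = bscale E t (bminus E (L e) (K e))"
    unfolding f(3,4) by (rule fiber_eqI[of _ y]) (use f(1,2) in \<open>auto simp: algebra_simps\<close>)
qed auto

lemma fib_hom_rep: "lin_rep T \<Longrightarrow> g \<in> Ga \<Longrightarrow> fib_hom (src G g) (tgt G g) (T g)"
  unfolding fib_hom_def using lin_rep_scale by simp

lemma ereal_scaled_le:
  fixes z :: ereal
  assumes "ereal l * z \<le> ereal B" "l > 0" "0 \<le> z" shows "z \<le> ereal (B / l)"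
  using assms by (cases z) (auto simp: field_simps)

text \<open>The smallness condition is read off in extended reals. If \<open>bdef\<close> is
  infinite it forces the defect to vanish; otherwise it gives a real \<open>\<beta>\<close> with
  \<open>\<beta>\<^sup>2 * (r1 + r2) \<le> 1/9\<close>.\<close>

lemma almost_data:
  assumes T: "lin_rep T" and alm: "almost_sigma_rep G A E act \<sigma> T" and x: "x \<in> Xo"
  obtains r1 r2 where "0 \<le> r1" "0 \<le> r2" "r1 + r2 \<le> 1/4" "rdef G A E act \<sigma> T x = ereal (r1 + r2)" "defect T x r1 r2"
    "(bdef G A E \<sigma> T x = \<infinity> \<and> r1 = 0 \<and> r2 = 0) \<or>
     (\<exists>\<beta>\<ge>0. bdef G A E \<sigma> T x = ereal \<beta> \<and> bdd T x \<beta> \<and> \<beta>\<^sup>2 * (r1 + r2) \<le> 1/9)"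
proof -
  define S1 where "S1 = (SUP y\<in>orbit G x. opnorm E y (\<lambda>e. bminus E e (T (unit G y) e)))"
  define P where "P = {(g,h). (g,h) \<in> composable G \<and> tgt G g \<in> orbit G x}"
  define S2 where "S2 = (SUP (g,h)\<in>P. ereal (ell G A \<sigma> g) *
        opnorm E (src G h) (\<lambda>e. bminus E (act (\<sigma> g h) (T (comp G g h) e)) (T g (T h e))))"
  have rd: "rdef G A E act \<sigma> T x = S1 + S2" unfolding rdef_def S1_def S2_def P_def ..
  have h1: "fib_hom y y (\<lambda>e. bminus E e (T (unit G y) e))" if y: "y \<in> orbit G x" for y
  proof -
    have yX: "y \<in> Xo" using orbit_X[OF y] .
    have "fib_hom y y (\<lambda>e. e)" using yX by (simp add: fib_hom_def)
    moreover have "fib_hom y y (T (unit G y))" using fib_hom_rep[OF T, of "unit G y"] yX by simp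
    ultimately show ?thesis by (rule fib_hom_minus)
  qed
  have h2: "fib_hom (src G h) (tgt G g) (\<lambda>e. bminus E (act (\<sigma> g h) (T (comp G g h) e)) (T g (T h e)))"
    if g: "g \<in> Ga" "h \<in> Ga" "src G g = tgt G h" for g h
  proof (rule fib_hom_minus)
    have gh: "comp G g h \<in> Ga" "src G (comp G g h) = src G h" "tgt G (comp G g h) = tgt G g" using g by auto
    show "fib_hom (src G h) (tgt G g) (\<lambda>e. act (\<sigma> g h) (T (comp G g h) e))" unfolding fib_hom_def
    proof (intro conjI ballI allI)
      fix e t assume e: "e \<in> fiber E (src G h)"
      have Te: "T (comp G g h) e \<in> fiber E (tgt G g)" using lin_rep_in[OF T gh(1)] gh e by simp
      show "act (\<sigma> g h) (T (comp G g h) e) \<in> fiber E (tgt G g)" using act_in[OF sigma_in[OF g] Te] .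
      show "act (\<sigma> g h) (T (comp G g h) (bscale E t e)) = bscale E t (act (\<sigma> g h) (T (comp G g h) e))"
        using lin_rep_scale[OF T gh(1)] gh e act_scale[OF sigma_in[OF g] Te] by simp
    qed (use g in simp)
    show "fib_hom (src G h) (tgt G g) (\<lambda>e. T g (T h e))" unfolding fib_hom_def
      using g lin_rep_in[OF T] lin_rep_scale[OF T] by simp
  qed
  have S1: "0 \<le> S1" unfolding S1_def using opnorm_nonneg[OF h1[OF orbit_self[OF x]]] orbit_self[OF x]
    by (rule SUP_upper2[rotated])
  \<comment> \<open>A supremum of nonnegative terms is known to be nonnegative once its index set is
    inhabited.\<close>
  have uP: "(unit G x, unit G x) \<in> P" using x by (simp add: P_def composable_def)
  have S2: "0 \<le> S2" unfolding S2_def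
  proof (rule SUP_upper2[OF uP])
    show "0 \<le> (case (unit G x, unit G x) of (g, h) \<Rightarrow> ereal (ell G A \<sigma> g) *
        opnorm E (src G h) (\<lambda>e. bminus E (act (\<sigma> g h) (T (comp G g h) e)) (T g (T h e))))"
      using opnorm_nonneg[OF h2[of "unit G x" "unit G x"]] x ell_pos[of "unit G x"] by simp
  qed
  have le: "S1 + S2 \<le> 1/4" "S1 + S2 \<le> inverse ((bdef G A E \<sigma> T x)\<^sup>2) / 9"
  proof -
    have "S1 + S2 \<le> min (1/4) (inverse ((bdef G A E \<sigma> T x)\<^sup>2) / 9)"
      using alm x unfolding almost_sigma_rep_def rd[symmetric] by blast
    then show "S1 + S2 \<le> 1/4" "S1 + S2 \<le> inverse ((bdef G A E \<sigma> T x)\<^sup>2) / 9"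
      unfolding min.bounded_iff by blast+
  qed
  have "S1 \<noteq> \<infinity>" "S2 \<noteq> \<infinity>" using le(1) S1 S2 by auto
  then obtain r1 r2 where r: "S1 = ereal r1" "S2 = ereal r2" using S1 S2 by (cases S1; cases S2) auto
  have r0: "0 \<le> r1" "0 \<le> r2" using S1 S2 r by auto
  have "(1/4 :: ereal) = ereal (1/4)"
    by (metis ereal_divide numeral_eq_ereal one_ereal_def zero_neq_numeral)
  then have "ereal (r1 + r2) \<le> ereal (1/4)" using le(1) r by (metis plus_ereal.simps(1))
  then have r14: "r1 + r2 \<le> 1/4" by simp
  have d: "defect T x r1 r2" unfolding defect_def
  proof (intro conjI ballI impI)
    fix y e assume y: "y \<in> orbit G x" and e: "e \<in> fiber E y"
    have "opnorm E y (\<lambda>e. bminus E e (T (unit G y) e)) \<le> ereal r1" unfolding r(1)[symmetric] S1_def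
      by (rule SUP_upper[OF y])
    from opnorm_leD[OF h1[OF y] this e] show "bnorm E (bminus E e (T (unit G y) e)) \<le> r1 * bnorm E e" .
  next
    fix g h e assume g: "g \<in> Ga" "h \<in> Ga" "src G g = tgt G h" and o: "tgt G g \<in> orbit G x" and e: "e \<in> fiber E (src G h)"
    have "(g,h) \<in> P" using g o by (simp add: P_def composable_def)
    then have "ereal (ell G A \<sigma> g) * opnorm E (src G h) (\<lambda>e. bminus E (act (\<sigma> g h) (T (comp G g h) e)) (T g (T h e))) \<le> ereal r2"
      unfolding r(2)[symmetric] S2_def by (rule SUP_upper2) simp
    from opnorm_leD[OF h2[OF g] ereal_scaled_le[OF this ell_pos opnorm_nonneg[OF h2[OF g]]] e]
    show "ell G A \<sigma> g * bnorm E (bminus E (act (\<sigma> g h) (T (comp G g h) e)) (T g (T h e))) \<le> r2 * bnorm E e"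
      using ell_pos[of g] by (simp add: field_simps)
  qed
  let ?b = "bdef G A E \<sigma> T x"
  have bge: "ereal (ell G A \<sigma> g) * opnorm E (src G g) (T g) \<le> ?b" if "g \<in> Ga" "tgt G g \<in> orbit G x" for g
    unfolding bdef_def by (rule SUP_upper) (use that in simp)
  have b0: "0 \<le> ?b"
  proof -
    have "0 \<le> ereal (ell G A \<sigma> (unit G x)) * opnorm E (src G (unit G x)) (T (unit G x))"
      using opnorm_nonneg[OF fib_hom_rep[OF T, of "unit G x"]] x ell_pos[of "unit G x"] by simp
    also have "\<dots> \<le> ?b" by (rule bge) (use x in auto)
    finally show ?thesis .
  qed
  have "(?b = \<infinity> \<and> r1 = 0 \<and> r2 = 0) \<or> (\<exists>\<beta>\<ge>0. ?b = ereal \<beta> \<and> bdd T x \<beta> \<and> \<beta>\<^sup>2 * (r1 + r2) \<le> 1/9)"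
  proof (cases "?b")
    case PInf
    \<comment> \<open>The inverse of infinity is 0, so the second member of the minimum is
      0.\<close>
    then have "ereal (r1 + r2) \<le> 0" using le(2) r by (simp add: power2_eq_square)
    then have "r1 + r2 \<le> 0" by simp
    then show ?thesis using PInf r0 by simp
  next
    case (real \<beta>)
    have \<beta>: "\<beta> \<ge> 0" using b0 real by simp
    have "bdd T x \<beta>" unfolding bdd_def
    proof (intro ballI impI)
      fix g e assume g: "g \<in> Ga" and o: "tgt G g \<in> orbit G x" and e: "e \<in> fiber E (src G g)"
      have "ereal (ell G A \<sigma> g) * opnorm E (src G g) (T g) \<le> ereal \<beta>" using bge[OF g o] real by simp
      from opnorm_leD[OF fib_hom_rep[OF T g] ereal_scaled_le[OF this ell_pos opnorm_nonneg[OF fib_hom_rep[OF T g]]] e]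
      show "ell G A \<sigma> g * bnorm E (T g e) \<le> \<beta> * bnorm E e" using ell_pos[of g] by (simp add: field_simps)
    qed
    moreover have "\<beta>\<^sup>2 * (r1 + r2) \<le> 1/9"
    \<comment> \<open>For \<open>\<beta> = 0\<close> the extended inverse is infinite and bounds
      nothing, but then the claim is trivial.\<close>
    proof (cases "\<beta> = 0")
      case False
      then have p: "\<beta>\<^sup>2 > 0" by simp
      have "ereal (r1 + r2) \<le> ereal (inverse (\<beta>\<^sup>2) / 9)" using le(2) r real p False by (simp add: power2_eq_square)
      then have "r1 + r2 \<le> inverse (\<beta>\<^sup>2) / 9" by simp
      then show ?thesis using p by (simp add: field_simps)
    qed simp
    ultimately show ?thesis using real \<beta> by blast
  next
    case MInf then show ?thesis using b0 by simp
  qed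
  then show ?thesis using that[OF r0 r14 _ d] rd r by simp
qed

text \<open>Small \<open>\<beta>\<close> is handled by \<open>\<rho> \<le> 1/4\<close>, large
  \<open>\<beta>\<close> by the quadratic condition. Thus both members of the minimum in the
  definition of an almost representation enter, and the product is bounded uniformly over all
  orbits.\<close>

lemma sq_bound:
  fixes \<beta> \<rho> :: real
  assumes "0 \<le> \<beta>" "0 \<le> \<rho>" "\<rho> \<le> 1/4" "\<beta>\<^sup>2 * \<rho> \<le> 1/9" shows "\<beta> * \<rho> \<le> 1/4"
proof (cases "\<beta> \<le> 1")
  case True
  then have "\<beta> * \<rho> \<le> 1 * (1/4)" using assms by (intro mult_mono) auto
  then show ?thesis by simp
next
  case False
  then have "\<beta> * \<rho> \<le> \<beta>\<^sup>2 * \<rho>" using assms by (intro mult_right_mono) (auto simp: power2_eq_square)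
  then show ?thesis using assms(4) by simp
qed

lemma averaging_theorem:
  assumes lin: "A_linear G A E act gact T" and alm: "almost_sigma_rep G A E act \<sigma> T"
  obtains R where "sigma_rep G A E act gact \<sigma> R" "\<And>n. nice ((avg ^^ n) T)"
    "\<And>n g w. g \<in> Ga \<Longrightarrow> w \<in> fiber E (src G g) \<Longrightarrow>
      bnorm E (bminus E (R g w) ((avg ^^ n) T g w)) \<le> (128/243) ^ n * bnorm E w"
    "\<And>g. g \<in> Ga \<Longrightarrow> opnorm E (src G g) (\<lambda>e. bminus E (R g e) (T g e))
        \<le> 4 * bdef G A E \<sigma> T (tgt G g) * rdef G A E act \<sigma> T (tgt G g)"
proof -
  have T: "lin_rep T" using lin alm by (simp add: lin_rep_def almost_sigma_rep_def)
  let ?b = "bdef G A E \<sigma> T" and ?r = "rdef G A E act \<sigma> T"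
  have "\<exists>b r. 0 \<le> b \<and> 0 \<le> r \<and> b \<le> 1/4 \<and> good T x b r \<and> ereal (4 * b) \<le> 4 * ?b x * ?r x" if x: "x \<in> Xo" for x
  proof -
    obtain r1 r2 where r: "0 \<le> r1" "0 \<le> r2" "r1 + r2 \<le> 1/4" "?r x = ereal (r1 + r2)" "defect T x r1 r2"
      and c: "(?b x = \<infinity> \<and> r1 = 0 \<and> r2 = 0) \<or> (\<exists>\<beta>\<ge>0. ?b x = ereal \<beta> \<and> bdd T x \<beta> \<and> \<beta>\<^sup>2 * (r1 + r2) \<le> 1/9)"
      using almost_data[OF T alm x] by metis
    from c show ?thesis
    proof (elim disjE conjE exE)
      \<comment> \<open>The witnesses are 0; the right-hand side is
        \<open>\<infinity> * 0 = 0\<close> in extended reals, so on such an orbit the estimate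
        forces agreement with \<open>T\<close>.\<close>
      assume "?b x = \<infinity>" "r1 = 0" "r2 = 0"
      then show ?thesis using r by (intro exI[of _ 0]) (auto simp: good_def)
    next
      fix \<beta> assume b: "0 \<le> \<beta>" "?b x = ereal \<beta>" "bdd T x \<beta>" "\<beta>\<^sup>2 * (r1 + r2) \<le> 1 / 9"
      have "good T x (\<beta> * (r1 + r2)) (r1 + r2)" unfolding good_def ctrl_def using b r by blast
      moreover have "\<beta> * (r1 + r2) \<le> 1/4" using sq_bound[of \<beta> "r1 + r2"] b r by simp
      moreover have "ereal (4 * (\<beta> * (r1 + r2))) \<le> 4 * ?b x * ?r x" unfolding b(2) r(4)
        by (simp add: mult.assoc flip: numeral_eq_ereal times_ereal.simps(1))
      ultimately show ?thesis using b r by (intro exI[of _ "\<beta> * (r1 + r2)"] exI[of _ "r1 + r2"]) auto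
    qed
  qed
  then obtain b r where br: "\<And>x. x \<in> Xo \<Longrightarrow> 0 \<le> b x" "\<And>x. x \<in> Xo \<Longrightarrow> 0 \<le> r x" "\<And>x. x \<in> Xo \<Longrightarrow> b x \<le> 1/4"
    "\<And>x. x \<in> Xo \<Longrightarrow> good T x (b x) (r x)" "\<And>x. x \<in> Xo \<Longrightarrow> ereal (4 * b x) \<le> 4 * ?b x * ?r x"
    by metis
  obtain R where R: "sigma_rep G A E act gact \<sigma> R" "\<And>n. nice ((avg ^^ n) T)"
    "\<And>n g w. g \<in> Ga \<Longrightarrow> w \<in> fiber E (src G g) \<Longrightarrow>
      bnorm E (bminus E (R g w) ((avg ^^ n) T g w)) \<le> 4 * b (tgt G g) * (128/243) ^ n * bnorm E w"
    using iterate_limit[OF T br(4,1,2,3)] by metis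
  show ?thesis
  proof (rule that[OF R(1,2)])
    fix n g w assume g: "g \<in> Ga" and w: "w \<in> fiber E (src G g)"
    have "4 * b (tgt G g) * ((128/243) ^ n * bnorm E w) \<le> 1 * ((128/243) ^ n * bnorm E w)"
      using br(3)[of "tgt G g"] g norm_ge0[OF w] by (intro mult_right_mono) auto
    moreover have "bnorm E (bminus E (R g w) ((avg ^^ n) T g w)) \<le> 4 * b (tgt G g) * ((128/243) ^ n * bnorm E w)"
      using R(3)[OF g w, of n] by (simp only: mult.assoc)
    ultimately show "bnorm E (bminus E (R g w) ((avg ^^ n) T g w)) \<le> (128/243) ^ n * bnorm E w" by linarith
  next
    fix g assume g: "g \<in> Ga"
    have "opnorm E (src G g) (\<lambda>e. bminus E (R g e) (T g e)) \<le> ereal (4 * b (tgt G g))"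
      using R(3)[OF g, of _ 0] br(1)[of "tgt G g"] g by (intro opnorm_leI) auto
    also have "\<dots> \<le> 4 * ?b (tgt G g) * ?r (tgt G g)" using br(5)[of "tgt G g"] g by simp
    finally show "opnorm E (src G g) (\<lambda>e. bminus E (R g e) (T g e)) \<le> 4 * ?b (tgt G g) * ?r (tgt G g)" .
  qed
qed

end

section \<open>Operator-norm continuity\<close>

lemma continuous_map_metricI:
  fixes F :: "'z \<Rightarrow> 'b::metric_space"
  assumes "\<And>z \<epsilon>. z \<in> topspace Z \<Longrightarrow> \<epsilon> > 0 \<Longrightarrow> \<exists>M. openin Z M \<and> z \<in> M \<and> (\<forall>y\<in>M. dist (F y) (F z) < \<epsilon>)"
  shows "continuous_map Z euclidean F"
proof (rule continuous_map_openI)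
  fix z N assume z: "z \<in> topspace Z" and N: "openin euclidean N" "F z \<in> N"
  then have "open N" by simp
  then obtain \<epsilon> where \<epsilon>: "\<epsilon> > 0" "\<And>y. dist y (F z) < \<epsilon> \<Longrightarrow> y \<in> N" using N(2) unfolding open_dist by metis
  obtain M where "openin Z M" "z \<in> M" "\<And>y. y \<in> M \<Longrightarrow> dist (F y) (F z) < \<epsilon>" using assms[OF z \<epsilon>(1)] by metis
  then show "\<exists>M. openin Z M \<and> z \<in> M \<and> (\<forall>y\<in>M. F y \<in> N)" using \<epsilon>(2) by metis
qed simp

lemma continuous_map_metricD:
  fixes F :: "'z \<Rightarrow> 'b::metric_space"
  assumes "continuous_map Z euclidean F" "z \<in> topspace Z" "\<epsilon> > 0"
  obtains M where "openin Z M" "z \<in> M" "\<And>y. y \<in> M \<Longrightarrow> dist (F y) (F z) < \<epsilon>"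
proof -
  have "openin euclidean (ball (F z) \<epsilon>)" "F z \<in> ball (F z) \<epsilon>" using assms(3) by auto
  then obtain M where "openin Z M" "z \<in> M" "\<And>y. y \<in> M \<Longrightarrow> F y \<in> ball (F z) \<epsilon>"
    using continuous_map_openD[OF assms(1,2)] by metis
  then show ?thesis using that by (simp add: dist_commute)
qed

lemma continuous_map_locally:
  assumes "\<And>z. z \<in> topspace Z \<Longrightarrow> \<exists>B. openin Z B \<and> z \<in> B \<and> continuous_map (subtopology Z B) Y f"
  shows "continuous_map Z Y f"
proof (rule continuous_map_openI)
  fix z assume z: "z \<in> topspace Z"
  obtain B where B: "openin Z B" "z \<in> B" "continuous_map (subtopology Z B) Y f" using assms[OF z] by metis
  have zB: "z \<in> topspace (subtopology Z B)" using z B by simp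
  show "f z \<in> topspace Y" using continuous_map_image_subset_topspace[OF B(3)] zB by blast
  fix N assume "openin Y N" "f z \<in> N"
  then obtain M where M: "openin (subtopology Z B) M" "z \<in> M" "\<And>y. y \<in> M \<Longrightarrow> f y \<in> N"
    using continuous_map_openD[OF B(3) zB] by metis
  then have "openin Z M" using B(1) openin_open_subtopology by metis
  then show "\<exists>M. openin Z M \<and> z \<in> M \<and> (\<forall>y\<in>M. f y \<in> N)" using M by blast
qed

lemma continuous_map_blinfun_compose:
  fixes F H :: "'z \<Rightarrow> 'v::real_normed_vector \<Rightarrow>\<^sub>L 'v"
  assumes "continuous_map Z euclidean F" "continuous_map Z euclidean H"
  shows "continuous_map Z euclidean (\<lambda>z. F z o\<^sub>L H z)"
proof -
  have "continuous_map Z (prod_topology euclidean euclidean) (\<lambda>z. (F z, H z))" using assms by (rule continuous_map_pairedI)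
  then have 1: "continuous_map Z euclidean (\<lambda>z. (F z, H z))" by simp
  have "continuous_on UNIV (\<lambda>p::('v \<Rightarrow>\<^sub>L 'v) \<times> ('v \<Rightarrow>\<^sub>L 'v). fst p o\<^sub>L snd p)"
    by (rule bounded_bilinear.continuous_on[OF bounded_bilinear_blinfun_compose]) (auto intro: continuous_intros)
  then have "continuous_map euclidean euclidean (\<lambda>p::('v \<Rightarrow>\<^sub>L 'v) \<times> ('v \<Rightarrow>\<^sub>L 'v). fst p o\<^sub>L snd p)" by simp
  from continuous_map_compose[OF 1 this] show ?thesis by (simp add: o_def)
qed

text \<open>The resolvent identity \<open>B z - B z0 = B z (F z0 - F z) B z0\<close>, preceded by a
  bound for \<open>B z\<close> near \<open>z0\<close> extracted from the same identity.\<close>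

lemma continuous_map_blinfun_inverse:
  fixes F B :: "'z \<Rightarrow> 'v::real_normed_vector \<Rightarrow>\<^sub>L 'v"
  assumes F: "continuous_map Z euclidean F"
    and BF: "\<And>z v. z \<in> topspace Z \<Longrightarrow> B z (F z v) = v" and FB: "\<And>z v. z \<in> topspace Z \<Longrightarrow> F z (B z v) = v"
  shows "continuous_map Z euclidean B"
proof (rule continuous_map_metricI)
  fix z0 and \<epsilon> :: real assume z0: "z0 \<in> topspace Z" and \<epsilon>: "\<epsilon> > 0"
  define m where "m = norm (B z0) + 1"
  have m: "m > 0" "norm (B z0) \<le> m" by (simp_all add: m_def add_nonneg_pos)
  \<comment> \<open>The first bound yields \<open>norm (B z) \<le> 2 * m\<close>, the second makes
    the product at most \<open>\<epsilon>/2\<close>.\<close>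
  define \<delta> where "\<delta> = min (1 / (2 * m)) (\<epsilon> / (4 * m\<^sup>2))"
  have \<delta>: "\<delta> > 0" "\<delta> \<le> 1 / (2 * m)" "\<delta> \<le> \<epsilon> / (4 * m\<^sup>2)" using m \<epsilon> by (auto simp: \<delta>_def)
  obtain M where M: "openin Z M" "z0 \<in> M" "\<And>z. z \<in> M \<Longrightarrow> dist (F z) (F z0) < \<delta>"
    using continuous_map_metricD[OF F z0 \<delta>(1)] by metis
  have "dist (B z) (B z0) < \<epsilon>" if z: "z \<in> M" for z
  proof -
    have zZ: "z \<in> topspace Z" using z M(1) openin_subset by blast
    have "B z - B z0 = B z o\<^sub>L ((F z0 - F z) o\<^sub>L B z0)"
      by (rule blinfun_eqI) (simp add: blinfun.diff_left blinfun.diff_right BF[OF zZ] FB[OF z0])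
    then have "norm (B z - B z0) \<le> norm (B z) * norm ((F z0 - F z) o\<^sub>L B z0)" using norm_blinfun_compose by metis
    also have "\<dots> \<le> norm (B z) * (norm (F z0 - F z) * norm (B z0))"
      by (intro mult_left_mono norm_blinfun_compose) simp
    also have "\<dots> \<le> norm (B z) * (\<delta> * m)"
      using M(3)[OF z] m \<delta>(1) by (intro mult_left_mono mult_mono) (auto simp: dist_norm norm_minus_commute)
    finally have 1: "norm (B z - B z0) \<le> norm (B z) * (\<delta> * m)" .
    have "\<delta> * m \<le> 1/2" using mult_right_mono[OF \<delta>(2), of m] m by simp
    then have "norm (B z) * (\<delta> * m) \<le> norm (B z) * (1/2)" by (intro mult_left_mono) auto
    then have "norm (B z) \<le> 2 * m" using 1 m norm_triangle_ineq2[of "B z" "B z0"] by simp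
    then have "norm (B z) * (\<delta> * m) \<le> (2 * m) * (\<delta> * m)" using \<delta>(1) m by (intro mult_right_mono) auto
    also have "\<dots> = 2 * m\<^sup>2 * \<delta>" by (simp add: power2_eq_square)
    also have "\<dots> \<le> 2 * m\<^sup>2 * (\<epsilon> / (4 * m\<^sup>2))" using \<delta>(3) by (intro mult_left_mono) auto
    also have "\<dots> < \<epsilon>" using m \<epsilon> by simp
    finally show ?thesis using 1 by (simp add: dist_norm)
  qed
  then show "\<exists>M. openin Z M \<and> z0 \<in> M \<and> (\<forall>y\<in>M. dist (B y) (B z0) < \<epsilon>)" using M by blast
qed

text \<open>A Banach space as a bundle over a point, so that the integral and its continuity apply
  to it without a separate construction.\<close>

definition point_bundle :: "(unit, 'b::banach) bbundle" where
  "point_bundle = \<lparr> btop = euclidean, bproj = (\<lambda>_. ()), bzero = (\<lambda>_. 0), badd = (+), bscale = (*\<^sub>R), bnorm = norm \<rparr>"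

lemma point_bundle_simps [simp]:
  "btop point_bundle = euclidean" "bproj point_bundle e = ()" "bzero point_bundle x = 0"
  "badd point_bundle e f = e + f" "bscale point_bundle r e = r *\<^sub>R e" "bnorm point_bundle e = norm e"
  "fiber point_bundle x = UNIV" "bminus point_bundle e f = e - f"
  by (auto simp: point_bundle_def fiber_def bminus_def)

lemma banach_point_bundle: "banach_bundle (discrete_topology {()}) (point_bundle :: (unit, 'b::banach) bbundle)"
  unfolding banach_bundle_def
proof (intro conjI ballI allI impI)
  let ?E = "point_bundle :: (unit, 'b) bbundle"
  show "Hausdorff_space (btop ?E)" by simp
  show "continuous_map (btop ?E) (discrete_topology {()}) (bproj ?E)" by (simp add: point_bundle_def)
  show "open_map (btop ?E) (discrete_topology {()}) (bproj ?E)" by (auto simp: open_map_def)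
  show "bproj ?E ` topspace (btop ?E) = topspace (discrete_topology {()})" by auto
  have f: "fibered_pairs ?E = UNIV" by (auto simp: fibered_pairs_def)
  have "continuous_on UNIV (\<lambda>p::'b\<times>'b. fst p + snd p)" by (intro continuous_intros)
  then show "continuous_map (subtopology (prod_topology (btop ?E) (btop ?E)) (fibered_pairs ?E)) (btop ?E) (\<lambda>(e,f). badd ?E e f)"
    by (simp add: f case_prod_unfold)
  have "continuous_on UNIV (\<lambda>p::real\<times>'b. fst p *\<^sub>R snd p)" by (intro continuous_intros)
  then show "continuous_map (prod_topology euclideanreal (btop ?E)) (btop ?E) (\<lambda>(c,e). bscale ?E c e)"
    by (simp add: case_prod_unfold)
  have "continuous_on UNIV (norm :: 'b \<Rightarrow> real)" by (intro continuous_intros)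
  moreover have "bnorm ?E = norm" by (simp add: point_bundle_def)
  ultimately show "continuous_map (btop ?E) euclideanreal (bnorm ?E)" by simp
next
  let ?E = "point_bundle :: (unit, 'b) bbundle"
  fix x and S :: "nat \<Rightarrow> 'b"
  assume "(\<forall>n. S n \<in> fiber ?E x) \<and> (\<forall>\<epsilon>>0. \<exists>N. \<forall>m\<ge>N. \<forall>n\<ge>N. bnorm ?E (bminus ?E (S m) (S n)) < \<epsilon>)"
  then have "Cauchy S" by (simp add: Cauchy_iff)
  then obtain l where "S \<longlonglongrightarrow> l" using Cauchy_convergent convergent_def by blast
  then have "(\<lambda>n. bnorm ?E (bminus ?E (S n) l)) \<longlonglongrightarrow> 0" by (simp add: LIM_zero tendsto_norm_zero)
  then show "\<exists>l\<in>fiber ?E x. (\<lambda>n. bnorm ?E (bminus ?E (S n) l)) \<longlonglongrightarrow> 0" by auto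
next
  let ?E = "point_bundle :: (unit, 'b) bbundle"
  fix F :: "'b filter" and x
  assume "(\<forall>\<^sub>F e in F. e \<in> topspace (btop ?E)) \<and> limitin (discrete_topology {()}) (bproj ?E) x F \<and> ((\<lambda>e. bnorm ?E e) \<longlongrightarrow> 0) F"
  then have "((\<lambda>e. e) \<longlongrightarrow> 0) F" by (simp add: tendsto_norm_zero_iff)
  then show "limitin (btop ?E) (\<lambda>e. e) (bzero ?E x) F" by simp
qed (auto simp: algebra_simps norm_triangle_ineq scaleR_add_left scaleR_add_right)

context cut_groupoid begin

lemma avg_bundle_point: "avg_bundle G \<mu> c (discrete_topology {()}) (point_bundle :: (unit, 'b::banach) bbundle)"
  by (intro avg_bundle.intro cut_groupoid_axioms fell_bundle.intro banach_point_bundle)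

end

lemma chart_props:
  assumes "local_triv B A E act d" "b \<in> fst d"
  shows "snd d b v \<in> fiber E b" "chart_inv (snd d) b (snd d b v) = v"
    "e \<in> fiber E b \<Longrightarrow> snd d b (chart_inv (snd d) b e) = e"
    "snd d b (v + w) = badd E (snd d b v) (snd d b w)" "snd d b (r *\<^sub>R v) = bscale E r (snd d b v)"
proof -
  have b: "bij_betw (snd d b) UNIV (fiber E b)"
    and l: "\<And>v w. snd d b (v + w) = badd E (snd d b v) (snd d b w)" "\<And>r v. snd d b (r *\<^sub>R v) = bscale E r (snd d b v)"
    using assms unfolding local_triv_def Let_def by auto
  show "snd d b v \<in> fiber E b" using b by (auto simp: bij_betw_def)
  have inj: "snd d b v = snd d b w \<Longrightarrow> v = w" for v w using b by (auto simp: bij_betw_def inj_on_def)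
  show i: "chart_inv (snd d) b (snd d b v) = v" for v unfolding chart_inv_def by (rule the_equality) (auto dest: inj)
  show "snd d b (chart_inv (snd d) b e) = e" if "e \<in> fiber E b"
  proof -
    have "e \<in> snd d b ` UNIV" using that bij_betw_imp_surj_on[OF b] by simp
    then obtain v where "e = snd d b v" by (rule imageE)
    then show ?thesis using i[of v] by simp
  qed
qed (use assms in \<open>auto simp: local_triv_def Let_def\<close>)

text \<open>The charts \<open>Ch\<close> are a norm-preserving atlas of the
  \<open>GI\<close>-structure, separate from the given atlas. Isometry lets fiberwise estimates
  become operator-norm estimates of local expressions with the same constants.\<close>

locale chart_setting = rep_setting G \<mu> c E A gact act \<sigma>
  for G :: "('g,'x) groupoid" and \<mu> :: "'x \<Rightarrow> 'g measure" and c :: "'x \<Rightarrow> real"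
    and E :: "('x,'e,'w) bbundle_scheme" and A :: "('x,'a,'u) balg_scheme" and gact :: "'g \<Rightarrow> 'a \<Rightarrow> 'a"
    and act :: "'a \<Rightarrow> 'e \<Rightarrow> 'e" and \<sigma> :: "'g \<Rightarrow> 'g \<Rightarrow> 'a" +
  fixes Ch :: "('x set \<times> ('x \<Rightarrow> 'v::banach \<Rightarrow> 'e)) set"
  assumes atlas: "is_atlas (obj G) A E act Ch" and isometric: "d \<in> Ch \<Longrightarrow> norm_preserving_chart E d"
begin

section \<open>Local expressions of operators in isometric charts\<close>

lemma chart_triv: "d \<in> Ch \<Longrightarrow> local_triv (obj G) A E act d"
  using atlas unfolding is_atlas_def by blast

lemma chart_cover: "x \<in> Xo \<Longrightarrow> \<exists>d\<in>Ch. x \<in> fst d"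
  using atlas unfolding is_atlas_def by blast

lemma chart_open: "d \<in> Ch \<Longrightarrow> openin (obj G) (fst d)"
  using chart_triv unfolding local_triv_def Let_def by blast

lemma chart_norm: "d \<in> Ch \<Longrightarrow> x \<in> fst d \<Longrightarrow> bnorm E (snd d x v) = norm v"
  using isometric unfolding norm_preserving_chart_def by blast

lemmas chart = chart_props[OF chart_triv]

lemma chart_inv_norm: "d \<in> Ch \<Longrightarrow> x \<in> fst d \<Longrightarrow> e \<in> fiber E x \<Longrightarrow> norm (chart_inv (snd d) x e) = bnorm E e"
  using chart_norm[of d x "chart_inv (snd d) x e"] chart(3)[of d x e] by simp

lemma chart_inv_add: "d \<in> Ch \<Longrightarrow> x \<in> fst d \<Longrightarrow> e \<in> fiber E x \<Longrightarrow> f \<in> fiber E x \<Longrightarrow>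
    chart_inv (snd d) x (badd E e f) = chart_inv (snd d) x e + chart_inv (snd d) x f"
  using chart(2)[of d x "chart_inv (snd d) x e + chart_inv (snd d) x f"] by (simp add: chart(3,4))

lemma chart_inv_scale: "d \<in> Ch \<Longrightarrow> x \<in> fst d \<Longrightarrow> e \<in> fiber E x \<Longrightarrow>
    chart_inv (snd d) x (bscale E r e) = r *\<^sub>R chart_inv (snd d) x e"
  using chart(2)[of d x "r *\<^sub>R chart_inv (snd d) x e"] by (simp add: chart(3,5))

lemma chart_inv_minus: "d \<in> Ch \<Longrightarrow> x \<in> fst d \<Longrightarrow> e \<in> fiber E x \<Longrightarrow> f \<in> fiber E x \<Longrightarrow>
    chart_inv (snd d) x (bminus E e f) = chart_inv (snd d) x e - chart_inv (snd d) x f"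
  by (simp add: bminus_def chart_inv_add chart_inv_scale)

text \<open>The two base points are independent arguments, so that not only \<open>T g\<close> but
  also inverses, compositions and multipliers have local expressions.\<close>

definition conj_op :: "'x set \<times> ('x \<Rightarrow> 'v \<Rightarrow> 'e) \<Rightarrow> 'x set \<times> ('x \<Rightarrow> 'v \<Rightarrow> 'e) \<Rightarrow> 'x \<Rightarrow> 'x \<Rightarrow> ('e \<Rightarrow> 'e) \<Rightarrow> 'v \<Rightarrow>\<^sub>L 'v" where
  "conj_op d1 d2 x y L = Blinfun (\<lambda>v. chart_inv (snd d2) y (L (snd d1 x v)))"

definition bounded_op :: "'x \<Rightarrow> 'x \<Rightarrow> ('e \<Rightarrow> 'e) \<Rightarrow> bool" where
  "bounded_op x y L \<longleftrightarrow> fib_linear E E x y L \<and> (\<exists>M. \<forall>e\<in>fiber E x. bnorm E (L e) \<le> M * bnorm E e)"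

lemma conj_op_apply:
  assumes d: "d1 \<in> Ch" "d2 \<in> Ch" "x \<in> fst d1" "y \<in> fst d2" and L: "bounded_op x y L"
  shows "conj_op d1 d2 x y L v = chart_inv (snd d2) y (L (snd d1 x v))"
proof -
  obtain M where M: "\<And>e. e \<in> fiber E x \<Longrightarrow> bnorm E (L e) \<le> M * bnorm E e" using L unfolding bounded_op_def by blast
  have Lf: "L e \<in> fiber E y" "L (badd E e f) = badd E (L e) (L f)" "L (bscale E r e) = bscale E r (L e)"
    if "e \<in> fiber E x" "f \<in> fiber E x" for e f r
    using L that unfolding bounded_op_def fib_linear_def by auto
  have "bounded_linear (\<lambda>v. chart_inv (snd d2) y (L (snd d1 x v)))"
  proof (rule bounded_linear_intro[of _ M])
    fix v w r
    show "chart_inv (snd d2) y (L (snd d1 x (v + w))) = chart_inv (snd d2) y (L (snd d1 x v)) + chart_inv (snd d2) y (L (snd d1 x w))"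
      using Lf(2)[OF chart(1)[OF d(1,3)] chart(1)[OF d(1,3)]] chart_inv_add[OF d(2,4) Lf(1)[OF chart(1)[OF d(1,3)] chart(1)[OF d(1,3)]] Lf(1)[OF chart(1)[OF d(1,3)] chart(1)[OF d(1,3)]]]
      by (simp add: chart(4)[OF d(1,3)])
    show "chart_inv (snd d2) y (L (snd d1 x (r *\<^sub>R v))) = r *\<^sub>R chart_inv (snd d2) y (L (snd d1 x v))"
      using Lf(3)[OF chart(1)[OF d(1,3)] chart(1)[OF d(1,3)]] chart_inv_scale[OF d(2,4) Lf(1)[OF chart(1)[OF d(1,3)] chart(1)[OF d(1,3)]]]
      by (simp add: chart(5)[OF d(1,3)])
    show "norm (chart_inv (snd d2) y (L (snd d1 x v))) \<le> norm v * M"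
      using M[OF chart(1)[OF d(1,3), of v]] chart_norm[OF d(1,3)]
        chart_inv_norm[OF d(2,4) Lf(1)[OF chart(1)[OF d(1,3)] chart(1)[OF d(1,3)]]] by (simp add: mult.commute)
  qed
  then show ?thesis unfolding conj_op_def by (simp add: bounded_linear_Blinfun_apply)
qed

lemma conj_op_dist:
  assumes d: "d1 \<in> Ch" "d2 \<in> Ch" "x \<in> fst d1" "y \<in> fst d2" and L: "bounded_op x y L" "bounded_op x y K"
    and B: "\<And>e. e \<in> fiber E x \<Longrightarrow> bnorm E (bminus E (L e) (K e)) \<le> B * bnorm E e" and "B \<ge> 0"
  shows "dist (conj_op d1 d2 x y L) (conj_op d1 d2 x y K) \<le> B"
  unfolding dist_norm
proof (rule norm_blinfun_bound[OF \<open>B \<ge> 0\<close>])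
  fix v
  let ?e = "snd d1 x v"
  have e: "?e \<in> fiber E x" using chart(1)[OF d(1,3)] .
  have f: "L ?e \<in> fiber E y" "K ?e \<in> fiber E y" using L e unfolding bounded_op_def fib_linear_def by auto
  have "norm ((conj_op d1 d2 x y L - conj_op d1 d2 x y K) v) = bnorm E (bminus E (L ?e) (K ?e))"
    using conj_op_apply[OF d L(1)] conj_op_apply[OF d L(2)] chart_inv_minus[OF d(2,4) f] chart_inv_norm[OF d(2,4) minus_in[OF f]]
    by (simp add: blinfun.diff_left)
  also have "\<dots> \<le> B * norm v" using B[OF e] chart_norm[OF d(1,3)] by simp
  finally show "norm ((conj_op d1 d2 x y L - conj_op d1 d2 x y K) v) \<le> B * norm v" .
qed

lemma bounded_op_rep: assumes "lin_rep T" "g \<in> Ga" shows "bounded_op (src G g) (tgt G g) (T g)"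
proof -
  obtain M where "\<And>v. v \<in> fiber E (src G g) \<Longrightarrow> bnorm E (T g v) \<le> M * bnorm E v" using lin_rep_bounded[OF assms] by metis
  then show ?thesis unfolding bounded_op_def fib_linear_def using assms by (auto simp: lin_rep_add lin_rep_scale)
qed

lemma bounded_op_compose:
  assumes "bounded_op x y L" "bounded_op y z K" shows "bounded_op x z (\<lambda>e. K (L e))"
proof -
  obtain M where M: "\<And>e. e \<in> fiber E x \<Longrightarrow> bnorm E (L e) \<le> M * bnorm E e" using assms(1) unfolding bounded_op_def by blast
  obtain M' where M': "\<And>e. e \<in> fiber E y \<Longrightarrow> bnorm E (K e) \<le> M' * bnorm E e" using assms(2) unfolding bounded_op_def by blast
  have l: "fib_linear E E x y L" "fib_linear E E y z K" using assms unfolding bounded_op_def by auto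
  have "bnorm E (K (L e)) \<le> (\<bar>M'\<bar> * M) * bnorm E e" if e: "e \<in> fiber E x" for e
  proof -
    have Le: "L e \<in> fiber E y" using l(1) e unfolding fib_linear_def by blast
    have "bnorm E (K (L e)) \<le> \<bar>M'\<bar> * bnorm E (L e)" using M'[OF Le] mult_right_mono[OF abs_ge_self norm_ge0[OF Le], of M'] by linarith
    also have "\<dots> \<le> \<bar>M'\<bar> * (M * bnorm E e)" using M[OF e] by (intro mult_left_mono) auto
    finally show ?thesis by (simp add: mult.assoc)
  qed
  moreover have "fib_linear E E x z (\<lambda>e. K (L e))" using l unfolding fib_linear_def by auto
  ultimately show ?thesis unfolding bounded_op_def by blast
qed

lemma conj_op_compose:
  assumes d: "d1 \<in> Ch" "d2 \<in> Ch" "d3 \<in> Ch" "x \<in> fst d1" "y \<in> fst d2" "z \<in> fst d3"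
    and L: "bounded_op x y L" "bounded_op y z K"
  shows "conj_op d1 d3 x z (\<lambda>e. K (L e)) = conj_op d2 d3 y z K o\<^sub>L conj_op d1 d2 x y L"
proof (rule blinfun_eqI)
  fix v
  have "L (snd d1 x v) \<in> fiber E y" using L(1) chart(1)[OF d(1,4)] unfolding bounded_op_def fib_linear_def by blast
  then show "conj_op d1 d3 x z (\<lambda>e. K (L e)) v = (conj_op d2 d3 y z K o\<^sub>L conj_op d1 d2 x y L) v"
    using conj_op_apply[OF d(1,3,4,6) bounded_op_compose[OF L]] conj_op_apply[OF d(1,2,4,5) L(1)]
      conj_op_apply[OF d(2,3,5,6) L(2)] chart(3)[OF d(2,5)] by simp
qed

lemma bounded_op_act: assumes a: "a \<in> fiber A x" shows "bounded_op x x (act a)"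
  unfolding bounded_op_def fib_linear_def using a act_norm[OF a] by (auto simp: act_add[OF a] act_scale[OF a])

lemma bounded_op_Tinv: assumes T: "nice T" and k: "k \<in> Ga" shows "bounded_op (tgt G k) (src G k) (Tinv T k)"
proof -
  let ?k = "ginv G k"
  have k': "?k \<in> Ga" "src G ?k = tgt G k" "tgt G ?k = src G k" using k by auto
  obtain M where M: "M > 0" "\<And>v. v \<in> fiber E (src G ?k) \<Longrightarrow> bnorm E (T ?k v) \<le> M * bnorm E v"
    using lin_rep_bounded[OF nice_lin[OF T] k'(1)] by metis
  have si: "sginv ?k k \<in> fiber A (src G k)" using sginv_in[OF k'(1) k k'(2)] k' by simp
  have "bnorm E (Tinv T k w) \<le> (4/3 * bnorm A (sginv ?k k) * M) * bnorm E w" if w: "w \<in> fiber E (tgt G k)" for w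
  proof -
    have Tw: "T ?k w \<in> fiber E (src G k)" using lin_rep_in[OF nice_lin[OF T] k'(1)] w k' by simp
    have "3/4 * bnorm E (Tinv T k w) \<le> bnorm E (almost_id T k (Tinv T k w))" using nice_lower[OF T k Tinv_in[OF T k w]] .
    also have "\<dots> = bnorm E (act (sginv ?k k) (T ?k w))" by (simp add: almost_id_def T_Tinv[OF T k w])
    also have "\<dots> \<le> bnorm A (sginv ?k k) * bnorm E (T ?k w)" using act_norm[OF si Tw] .
    also have "\<dots> \<le> bnorm A (sginv ?k k) * (M * bnorm E w)" using M(2) w k' A.norm_ge0[OF si] by (intro mult_left_mono) auto
    finally show ?thesis by simp
  qed
  then have "\<exists>M. \<forall>w\<in>fiber E (tgt G k). bnorm E (Tinv T k w) \<le> M * bnorm E w" by blast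
  moreover have "fib_linear E E (tgt G k) (src G k) (Tinv T k)"
    unfolding fib_linear_def using T k by (simp add: Tinv_add Tinv_scale)
  ultimately show ?thesis unfolding bounded_op_def by blast
qed

lemma bounded_op_D:
  assumes T: "nice T" and g: "g \<in> Ga" and k: "k \<in> Ga" "tgt G k = src G g"
  shows "bounded_op (src G g) (tgt G g) (D T g k)"
proof -
  have gk: "comp G g k \<in> Ga" "src G (comp G g k) = src G k" "tgt G (comp G g k) = tgt G g" using g k by auto
  have "bounded_op (src G g) (tgt G g) (\<lambda>w. T (comp G g k) (Tinv T k w))"
    using bounded_op_compose[OF bounded_op_Tinv[OF T k(1)]] bounded_op_rep[OF nice_lin[OF T] gk(1)] k gk by simp
  from bounded_op_compose[OF this bounded_op_act[OF sigma_in[OF g k(1) k(2)[symmetric]]]] show ?thesis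
    by (simp add: D_def[abs_def])
qed

definition dom :: "'x set \<times> ('x \<Rightarrow> 'v \<Rightarrow> 'e) \<Rightarrow> 'x set \<times> ('x \<Rightarrow> 'v \<Rightarrow> 'e) \<Rightarrow> 'g set" where
  "dom d1 d2 = {g \<in> Ga. src G g \<in> fst d1 \<and> tgt G g \<in> fst d2}"

definition loc :: "'x set \<times> ('x \<Rightarrow> 'v \<Rightarrow> 'e) \<Rightarrow> 'x set \<times> ('x \<Rightarrow> 'v \<Rightarrow> 'e) \<Rightarrow> ('g \<Rightarrow> 'e \<Rightarrow> 'e) \<Rightarrow> 'g \<Rightarrow> 'v \<Rightarrow>\<^sub>L 'v" where
  "loc d1 d2 T g = conj_op d1 d2 (src G g) (tgt G g) (T g)"

text \<open>Operator-norm continuity tested on the isometric charts only, over the arrows whose ends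
  lie in the two charts. This form is stable under averaging and limits; its equivalence with
  uniform continuity in the whole structure is shown for the pulled-back charts.\<close>

definition norm_cts :: "('g \<Rightarrow> 'e \<Rightarrow> 'e) \<Rightarrow> bool" where
  "norm_cts T \<longleftrightarrow> (\<forall>d1\<in>Ch. \<forall>d2\<in>Ch. continuous_map (subtopology (arr G) (dom d1 d2)) euclidean (loc d1 d2 T))"

lemma norm_ctsD:
  assumes T: "norm_cts T" and d: "d1 \<in> Ch" "d2 \<in> Ch" and u: "continuous_map Z (arr G) u"
    and s: "\<And>z. z \<in> topspace Z \<Longrightarrow> src G (u z) \<in> fst d1" "\<And>z. z \<in> topspace Z \<Longrightarrow> tgt G (u z) \<in> fst d2"
  shows "continuous_map Z euclidean (\<lambda>z. loc d1 d2 T (u z))"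
proof -
  have "continuous_map Z (subtopology (arr G) (dom d1 d2)) u"
    using u s cont_in_arr[OF u] by (auto simp: continuous_map_in_subtopology dom_def)
  moreover have "continuous_map (subtopology (arr G) (dom d1 d2)) euclidean (loc d1 d2 T)"
    using T d unfolding norm_cts_def by blast
  ultimately show ?thesis using continuous_map_compose[of Z _ u euclidean "loc d1 d2 T"] by (simp add: o_def)
qed

text \<open>The source of \<open>k z\<close> lies in neither chart, so a third chart is chosen
  around it, locally in \<open>z\<close>. Through it \<open>D\<close> factors into an inverse, a
  value of \<open>T\<close> and the action of a multiplier; the last is norm continuous by the
  condition on the module action in a local trivialization.\<close>

lemma loc_D_cont:
  assumes T: "nice T" and uc: "norm_cts T" and d: "d1 \<in> Ch" "d2 \<in> Ch"
    and u: "continuous_map Z (arr G) u" and k: "continuous_map Z (arr G) k"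
    and p: "\<And>z. z \<in> topspace Z \<Longrightarrow> tgt G (k z) = src G (u z)"
    and s: "\<And>z. z \<in> topspace Z \<Longrightarrow> src G (u z) \<in> fst d1" "\<And>z. z \<in> topspace Z \<Longrightarrow> tgt G (u z) \<in> fst d2"
  shows "continuous_map Z euclidean (\<lambda>z. conj_op d1 d2 (src G (u z)) (tgt G (u z)) (D T (u z) (k z)))"
proof (rule continuous_map_locally)
  fix z0 assume z0: "z0 \<in> topspace Z"
  obtain d3 where d3: "d3 \<in> Ch" "src G (k z0) \<in> fst d3" using chart_cover[OF src_in[OF cont_in_arr[OF k z0]]] by blast
  define B where "B = {z \<in> topspace Z. src G (k z) \<in> fst d3}"
  have B: "openin Z B" unfolding B_def by (rule openin_continuous_map_preimage[OF cont_src[OF k] chart_open[OF d3(1)]])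
  let ?Z = "subtopology Z B"
  have u': "continuous_map ?Z (arr G) u" and k': "continuous_map ?Z (arr G) k"
    using u k by (auto intro: continuous_map_from_subtopology)
  have zs: "z \<in> topspace Z" "src G (k z) \<in> fst d3" "u z \<in> Ga" "k z \<in> Ga" "tgt G (k z) = src G (u z)"
    "src G (u z) \<in> fst d1" "tgt G (u z) \<in> fst d2" if "z \<in> topspace ?Z" for z
    using that s p cont_in_arr[OF u] cont_in_arr[OF k] by (auto simp: B_def)
  have gk: "continuous_map ?Z (arr G) (\<lambda>z. comp G (u z) (k z))" using zs by (intro cont_comp u' k') auto
  have F1: "continuous_map ?Z euclidean (\<lambda>z. loc d3 d2 T (comp G (u z) (k z)))"
    using zs by (intro norm_ctsD[OF uc d3(1) d(2) gk]) auto
  have F2: "continuous_map ?Z euclidean (\<lambda>z. loc d3 d1 T (k z))"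
    using zs by (intro norm_ctsD[OF uc d3(1) d(1) k']) auto
  have F3: "continuous_map ?Z euclidean (\<lambda>z. conj_op d1 d3 (tgt G (k z)) (src G (k z)) (Tinv T (k z)))"
  proof (rule continuous_map_blinfun_inverse[OF F2])
    fix z v assume z: "z \<in> topspace ?Z"
    have tk: "tgt G (k z) \<in> fst d1" using zs[OF z] by simp
    note a1 = conj_op_apply[OF d3(1) d(1) zs(2)[OF z] tk bounded_op_rep[OF nice_lin[OF T] zs(4)[OF z]]]
    note a2 = conj_op_apply[OF d(1) d3(1) tk zs(2)[OF z] bounded_op_Tinv[OF T zs(4)[OF z]]]
    have e: "snd d3 (src G (k z)) v \<in> fiber E (src G (k z))" "snd d1 (tgt G (k z)) v \<in> fiber E (tgt G (k z))"
      using chart(1)[OF d3(1) zs(2)[OF z]] chart(1)[OF d(1) tk] by auto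
    show "conj_op d1 d3 (tgt G (k z)) (src G (k z)) (Tinv T (k z)) (loc d3 d1 T (k z) v) = v"
      unfolding loc_def a1 a2 using chart(3)[OF d(1) tk lin_rep_in[OF nice_lin[OF T] zs(4)[OF z] e(1)]]
        Tinv_eq[OF T zs(4)[OF z] e(1)] chart(2)[OF d3(1) zs(2)[OF z]] by simp
    show "loc d3 d1 T (k z) (conj_op d1 d3 (tgt G (k z)) (src G (k z)) (Tinv T (k z)) v) = v"
      unfolding loc_def a1 a2 using chart(3)[OF d3(1) zs(2)[OF z] Tinv_in[OF T zs(4)[OF z] e(2)]]
        T_Tinv[OF T zs(4)[OF z] e(2)] chart(2)[OF d(1) tk] by simp
  qed
  obtain FA where FA: "continuous_map (subtopology (btop A) {a \<in> topspace (btop A). bproj A a \<in> fst d2}) euclidean FA"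
    "\<And>a v. a \<in> topspace (btop A) \<Longrightarrow> bproj A a \<in> fst d2 \<Longrightarrow>
      blinfun_apply (FA a) v = chart_inv (snd d2) (bproj A a) (act a (snd d2 (bproj A a) v))"
    using chart_triv[OF d(2)] unfolding local_triv_def Let_def by blast
  have sg: "\<sigma> (u z) (k z) \<in> fiber A (tgt G (u z))" if "z \<in> topspace ?Z" for z using sigma_in zs[OF that] by simp
  have "continuous_map ?Z (btop A) (\<lambda>z. \<sigma> (u z) (k z))" using zs by (intro cont_sigma u' k') auto
  moreover have "\<sigma> (u z) (k z) \<in> {a \<in> topspace (btop A). bproj A a \<in> fst d2}" if "z \<in> topspace ?Z" for z
    using A.fiberD[OF sg[OF that]] zs(7)[OF that] by simp
  ultimately have "continuous_map ?Z (subtopology (btop A) {a \<in> topspace (btop A). bproj A a \<in> fst d2}) (\<lambda>z. \<sigma> (u z) (k z))"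
    unfolding continuous_map_in_subtopology by blast
  from continuous_map_compose[OF this FA(1)]
  have F4: "continuous_map ?Z euclidean (\<lambda>z. FA (\<sigma> (u z) (k z)))" by (simp add: o_def)
  have eq: "conj_op d1 d2 (src G (u z)) (tgt G (u z)) (D T (u z) (k z)) =
    FA (\<sigma> (u z) (k z)) o\<^sub>L (loc d3 d2 T (comp G (u z) (k z)) o\<^sub>L conj_op d1 d3 (tgt G (k z)) (src G (k z)) (Tinv T (k z)))"
    if z: "z \<in> topspace ?Z" for z
  proof -
    note Z = zs[OF z]
    have gkz: "comp G (u z) (k z) \<in> Ga" "src G (comp G (u z) (k z)) = src G (k z)" "tgt G (comp G (u z) (k z)) = tgt G (u z)"
      using Z by auto
    have tk: "tgt G (k z) \<in> fst d1" using Z by simp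
    have b1: "bounded_op (tgt G (k z)) (src G (k z)) (Tinv T (k z))" using bounded_op_Tinv[OF T Z(4)] .
    have b2: "bounded_op (src G (k z)) (tgt G (u z)) (T (comp G (u z) (k z)))"
      using bounded_op_rep[OF nice_lin[OF T] gkz(1)] gkz by simp
    have b3: "bounded_op (tgt G (u z)) (tgt G (u z)) (act (\<sigma> (u z) (k z)))" using bounded_op_act[OF sg[OF z]] .
    have "FA (\<sigma> (u z) (k z)) = conj_op d2 d2 (tgt G (u z)) (tgt G (u z)) (act (\<sigma> (u z) (k z)))"
      using FA(2)[of "\<sigma> (u z) (k z)"] A.fiberD[OF sg[OF z]] Z(7) conj_op_apply[OF d(2,2) Z(7,7) b3]
      by (intro blinfun_eqI) simp
    then show ?thesis
      using conj_op_compose[OF d(1) d3(1) d(2) tk Z(2,7) b1 b2]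
        conj_op_compose[OF d(1,2,2) tk Z(7,7) bounded_op_compose[OF b1 b2] b3] Z(5) gkz
      by (simp add: D_def[abs_def] loc_def)
  qed
  have "continuous_map ?Z euclidean (\<lambda>z. conj_op d1 d2 (src G (u z)) (tgt G (u z)) (D T (u z) (k z)))"
    by (rule continuous_map_eq[OF continuous_map_blinfun_compose[OF F4 continuous_map_blinfun_compose[OF F1 F3]]]) (simp only: eq)
  then show "\<exists>B. openin Z B \<and> z0 \<in> B \<and> continuous_map (subtopology Z B) euclidean
      (\<lambda>z. conj_op d1 d2 (src G (u z)) (tgt G (u z)) (D T (u z) (k z)))"
    using B z0 d3 by (intro exI[of _ B]) (auto simp: B_def)
qed

text \<open>Operator-norm continuity of the average is the continuity of the same integral, taken in the
  Banach space of endomorphisms of the model fibre.\<close>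

lemma norm_cts_avg:
  assumes T: "nice T" and uc: "norm_cts T"
  shows "norm_cts (avg T)"
  unfolding norm_cts_def
proof (intro ballI)
  fix d1 d2 assume d: "d1 \<in> Ch" "d2 \<in> Ch"
  interpret PB: avg_bundle G \<mu> c "discrete_topology {()}" "point_bundle :: (unit, 'v \<Rightarrow>\<^sub>L 'v) bbundle"
    by (rule avg_bundle_point)
  let ?Z = "subtopology (arr G) (dom d1 d2)"
  have id: "continuous_map ?Z (arr G) (\<lambda>g. g)" by (intro continuous_map_from_subtopology) auto
  have dm: "g \<in> Ga" "src G g \<in> fst d1" "tgt G g \<in> fst d2" if "g \<in> topspace ?Z" for g using that by (auto simp: dom_def)
  define f where "f = (\<lambda>g k. conj_op d1 d2 (src G g) (tgt G g) (D T g k))"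
  have int: "PB.integrand ?Z (src G) (\<lambda>_. ()) f" unfolding PB.integrand_def
  proof (intro conjI ballI impI)
    show "continuous_map ?Z (obj G) (src G)" using cont_src[OF id] by simp
    let ?W = "subtopology (prod_topology ?Z (arr G)) {(z,k). tgt G k = src G z}"
    have f1: "continuous_map ?W ?Z fst" and s1: "continuous_map ?W (arr G) snd"
      by (intro continuous_map_from_subtopology continuous_map_fst continuous_map_snd)+
    have f2: "continuous_map ?W (arr G) fst" using continuous_map_into_fulltopology[OF f1] .
    have "continuous_map ?W euclidean (\<lambda>z. conj_op d1 d2 (src G (fst z)) (tgt G (fst z)) (D T (fst z) (snd z)))"
      by (rule loc_D_cont[OF T uc d f2 s1]) (auto simp: dom_def)
    then show "continuous_map ?W (btop point_bundle) (\<lambda>(g,k). f g k)" by (simp add: f_def case_prod_unfold)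
  qed auto
  have cJ: "continuous_map ?Z euclidean (\<lambda>g. PB.vint () (src G g) (f g))" using PB.vint_cont[OF int] by simp
  have "loc d1 d2 (avg T) g = PB.vint () (src G g) (f g)" if gZ: "g \<in> topspace ?Z" for g
  proof (rule blinfun_eqI)
    fix v
    note g = dm[OF gZ]
    let ?J = "PB.vint () (src G g) (f g)" and ?y = "tgt G g" and ?e = "snd d1 (src G g) v"
    have e: "?e \<in> fiber E (src G g)" using chart(1)[OF d(1) g(2)] .
    have sec: "continuous_map (tfib (src G g)) (btop (point_bundle :: (unit, 'v \<Rightarrow>\<^sub>L 'v) bbundle)) (f g)"
      using PB.integrand_section[OF int gZ] .
    have "snd d2 ?y (?J v) = avg T g ?e"
    proof (rule fiber_eqI)
      show "snd d2 ?y (?J v) \<in> fiber E ?y" using chart(1)[OF d(2) g(3)] .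
      show "avg T g ?e \<in> fiber E ?y" using avg_in[OF T g(1) e] .
      fix \<phi> assume \<phi>: "\<phi> \<in> dual ?y"
      \<comment> \<open>Evaluation at \<open>v\<close> followed by \<open>\<phi>\<close> is bounded
        by \<open>norm v\<close> on operators; dividing by \<open>m\<close>, which is positive even
        for \<open>v = 0\<close>, puts it into the dual unit ball.\<close>
      define m where "m = norm v + 1"
      have m: "m > 0" by (simp add: m_def add_nonneg_pos)
      define \<psi> where "\<psi> = (\<lambda>B :: 'v \<Rightarrow>\<^sub>L 'v. \<phi> (snd d2 ?y (B v)) / m)"
      have \<psi>: "\<psi> \<in> PB.dual ()" unfolding PB.dual_def
      proof (intro CollectI conjI ballI allI)
        fix B C :: "'v \<Rightarrow>\<^sub>L 'v" and t
        show "\<psi> (badd point_bundle B C) = \<psi> B + \<psi> C"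
          using \<phi> chart(1)[OF d(2) g(3)] by (simp add: \<psi>_def blinfun.add_left chart(4)[OF d(2) g(3)] add_divide_distrib)
        show "\<psi> (bscale point_bundle t B) = t * \<psi> B"
          using \<phi> chart(1)[OF d(2) g(3)] by (simp add: \<psi>_def blinfun.scaleR_left chart(5)[OF d(2) g(3)])
        have "\<phi> (snd d2 ?y (B v)) \<le> norm (B v)" using dual_le[OF \<phi> chart(1)[OF d(2) g(3)]] chart_norm[OF d(2) g(3)] by metis
        also have "\<dots> \<le> norm B * norm v" by (rule norm_blinfun)
        also have "\<dots> \<le> norm B * m" by (intro mult_left_mono) (auto simp: m_def)
        finally show "\<psi> B \<le> bnorm point_bundle B" using m by (simp add: \<psi>_def divide_le_eq)
      qed
      have "\<psi> ?J = Av (src G g) (\<lambda>k. \<psi> (f g k))"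
        by (rule PB.vint_props(2)[OF _ _ sec _ \<psi>]) (use g in auto)
      also have "\<dots> = Av (src G g) (\<lambda>k. (1/m) * \<phi> (D T g k ?e))"
      proof (rule Av_cong)
        fix k assume k: "k \<in> Ga" "tgt G k = src G g"
        have "f g k v = chart_inv (snd d2) ?y (D T g k ?e)" unfolding f_def
          using conj_op_apply[OF d g(2,3) bounded_op_D[OF T g(1) k]] .
        then show "\<psi> (f g k) = (1/m) * \<phi> (D T g k ?e)"
          using chart(3)[OF d(2) g(3) D_in[OF T g(1) k e]] by (simp add: \<psi>_def)
      qed (use g in simp)
      also have "\<dots> = (1/m) * \<phi> (avg T g ?e)" unfolding Av_scale dual_avg(1)[OF T g(1) e \<phi>] ..
      finally show "\<phi> (snd d2 ?y (?J v)) = \<phi> (avg T g ?e)" using m by (simp add: \<psi>_def)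
    qed
    then have "chart_inv (snd d2) ?y (avg T g ?e) = ?J v" using chart(2)[OF d(2) g(3)] by metis
    then show "loc d1 d2 (avg T) g v = ?J v"
      unfolding loc_def conj_op_apply[OF d g(2,3) bounded_op_rep[OF avg_lin_rep[OF T] g(1)]] .
  qed
  then show "continuous_map ?Z euclidean (loc d1 d2 (avg T))" by (intro continuous_map_eq[OF cJ]) simp
qed

text \<open>In isometric charts the fiberwise rate \<open>q ^ n\<close> is an operator-norm rate,
  uniform over the domain, and uniform limits preserve continuity.\<close>

lemma norm_cts_limit:
  assumes R: "lin_rep R" and S: "\<And>n. lin_rep (S n)" "\<And>n. norm_cts (S n)" and q: "0 \<le> q" "q < (1::real)"
    and lim: "\<And>n g w. g \<in> Ga \<Longrightarrow> w \<in> fiber E (src G g) \<Longrightarrow> bnorm E (bminus E (R g w) (S n g w)) \<le> q ^ n * bnorm E w"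
  shows "norm_cts R"
  unfolding norm_cts_def
proof (intro ballI continuous_map_metricI)
  fix d1 d2 g0 and \<epsilon> :: real
  assume d: "d1 \<in> Ch" "d2 \<in> Ch" and g0: "g0 \<in> topspace (subtopology (arr G) (dom d1 d2))" and \<epsilon>: "\<epsilon> > 0"
  let ?Z = "subtopology (arr G) (dom d1 d2)"
  obtain n where n: "q ^ n < \<epsilon>/3" using real_arch_pow_inv[of "\<epsilon>/3" q] \<epsilon> q by auto
  have close: "dist (loc d1 d2 R g) (loc d1 d2 (S n) g) < \<epsilon>/3" if g: "g \<in> topspace ?Z" for g
  proof -
    have gg: "g \<in> Ga" "src G g \<in> fst d1" "tgt G g \<in> fst d2" using g by (auto simp: dom_def)
    have "dist (loc d1 d2 R g) (loc d1 d2 (S n) g) \<le> q ^ n" unfolding loc_def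
      by (rule conj_op_dist[OF d gg(2,3) bounded_op_rep[OF R gg(1)] bounded_op_rep[OF S(1) gg(1)] lim[OF gg(1)]]) (use q in auto)
    then show ?thesis using n by simp
  qed
  have "continuous_map ?Z euclidean (loc d1 d2 (S n))" using S(2) d unfolding norm_cts_def by blast
  then obtain M where M: "openin ?Z M" "g0 \<in> M" "\<And>g. g \<in> M \<Longrightarrow> dist (loc d1 d2 (S n) g) (loc d1 d2 (S n) g0) < \<epsilon>/3"
    using continuous_map_metricD[OF _ g0, of _ "\<epsilon>/3"] \<epsilon> by (metis divide_pos_pos zero_less_numeral)
  have "dist (loc d1 d2 R g) (loc d1 d2 R g0) < \<epsilon>" if g: "g \<in> M" for g
  proof -
    have "g \<in> topspace ?Z" using g M(1) openin_subset by blast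
    then show ?thesis
      using close[of g] close[OF g0] M(3)[OF g]
        dist_triangle[of "loc d1 d2 R g" "loc d1 d2 R g0" "loc d1 d2 (S n) g"]
        dist_triangle[of "loc d1 d2 (S n) g" "loc d1 d2 R g0" "loc d1 d2 (S n) g0"]
        dist_commute[of "loc d1 d2 R g0" "loc d1 d2 (S n) g0"] by linarith
  qed
  then show "\<exists>M. openin ?Z M \<and> g0 \<in> M \<and> (\<forall>y\<in>M. dist (loc d1 d2 R y) (loc d1 d2 R g0) < \<epsilon>)" using M by blast
qed

end

section \<open>Pulled-back charts\<close>

lemma chart_inv_pullback: "chart_inv (\<lambda>g v. (g, \<phi> (f g) v)) g (g, e) = chart_inv \<phi> (f g) e"
  by (simp add: chart_inv_def)

lemma fiber_pullback:
  "g \<in> topspace T \<Longrightarrow> fiber (pullback_bundle T f E) g = Pair g ` fiber E (f g)"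
  by (auto simp: fiber_def pullback_bundle_def)

text \<open>An arbitrary open set \<open>W\<close> inside the preimage is allowed because the charts
  for source and target have to be restricted to a common domain.\<close>

lemma pullback_local_triv:
  fixes d :: "'x set \<times> ('x \<Rightarrow> 'v::banach \<Rightarrow> 'e)"
    and A :: "('x,'a,'u) balg_scheme" and E :: "('x,'e,'w) bbundle_scheme"
  assumes f: "continuous_map T X f" and d: "local_triv X A E act d"
    and W: "openin T W" "\<And>g. g \<in> W \<Longrightarrow> f g \<in> fst d"
  shows "local_triv T (pullback_alg T f A) (pullback_bundle T f E) (pullback_act act) (W, \<lambda>g v. (g, snd d (f g) v))"
proof -
  let ?U = "fst d" and ?\<phi> = "snd d" and ?P = "pullback_bundle T f E"
  have WT: "g \<in> topspace T" if "g \<in> W" for g using W(1) that openin_subset by blast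
  have H: "homeomorphic_map (prod_topology (subtopology X ?U) euclidean)
          (subtopology (btop E) {e \<in> topspace (btop E). bproj E e \<in> ?U}) (\<lambda>(b,v). ?\<phi> b v)"
    using d unfolding local_triv_def Let_def by blast
  obtain FA :: "'a \<Rightarrow> ('v \<Rightarrow>\<^sub>L 'v)" where
    FA: "continuous_map (subtopology (btop A) {a \<in> topspace (btop A). bproj A a \<in> ?U}) euclidean FA"
      "\<And>a v. a \<in> topspace (btop A) \<Longrightarrow> bproj A a \<in> ?U \<Longrightarrow>
        blinfun_apply (FA a) v = chart_inv ?\<phi> (bproj A a) (act a (?\<phi> (bproj A a) v))"
    using d unfolding local_triv_def Let_def by blast
  note ch = chart_props[OF d]
  have bij: "bij_betw (\<lambda>v. (g, ?\<phi> (f g) v)) UNIV (fiber ?P g)" if g: "g \<in> W" for g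
  proof -
    have "bij_betw (?\<phi> (f g)) UNIV (fiber E (f g))" using d W(2)[OF g] unfolding local_triv_def Let_def by blast
    moreover have "bij_betw (Pair g) (fiber E (f g)) (Pair g ` fiber E (f g))" by (auto simp: bij_betw_def inj_on_def)
    ultimately show ?thesis unfolding fiber_pullback[OF WT[OF g]] using bij_betw_trans by (fastforce simp: o_def)
  qed
  obtain k where k: "homeomorphic_maps (prod_topology (subtopology X ?U) euclidean)
          (subtopology (btop E) {e \<in> topspace (btop E). bproj E e \<in> ?U}) (\<lambda>(b,v). ?\<phi> b v) k"
    using H unfolding homeomorphic_map_maps by blast
  have kc: "continuous_map (prod_topology (subtopology X ?U) euclidean) (subtopology (btop E) {e \<in> topspace (btop E). bproj E e \<in> ?U}) (\<lambda>(b,v). ?\<phi> b v)"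
    "continuous_map (subtopology (btop E) {e \<in> topspace (btop E). bproj E e \<in> ?U}) (prod_topology (subtopology X ?U) euclidean) k"
    using k unfolding homeomorphic_maps_def by blast+
  have k1: "k (?\<phi> b v) = (b,v)" if "b \<in> topspace X" "b \<in> ?U" for b v
    using k that unfolding homeomorphic_maps_def by auto
  have k2: "?\<phi> (fst (k e)) (snd (k e)) = e" "fst (k e) \<in> ?U" if "e \<in> topspace (btop E)" "bproj E e \<in> ?U" for e
  proof -
    show "?\<phi> (fst (k e)) (snd (k e)) = e" using k that unfolding homeomorphic_maps_def by (auto simp: case_prod_unfold)
    have "k e \<in> topspace (prod_topology (subtopology X ?U) (euclidean :: 'v topology))"
      using continuous_map_image_subset_topspace[OF kc(2)] that by auto
    then show "fst (k e) \<in> ?U" by auto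
  qed
  \<comment> \<open>The inverse homeomorphism recovers the base point, hence
    \<open>(g,e) \<mapsto> (g, snd (k e))\<close> inverts the pulled-back chart.\<close>
  have k3: "fst (k e) = bproj E e" if "e \<in> topspace (btop E)" "bproj E e \<in> ?U" for e
    using ch(1)[OF k2(2)[OF that], of "snd (k e)"] k2(1)[OF that] by (simp add: fiber_def)
  let ?D = "prod_topology (subtopology T W) (euclidean :: 'v topology)"
  let ?R = "subtopology (btop ?P) {p \<in> topspace (btop ?P). bproj ?P p \<in> W}"
  have btP: "btop ?P = subtopology (prod_topology T (btop E)) {(g,e). bproj E e = f g}" "bproj ?P = fst"
    by (simp_all add: pullback_bundle_def)
  have tR: "topspace ?R = {(g,e). g \<in> W \<and> e \<in> topspace (btop E) \<and> bproj E e = f g}"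
    using WT by (auto simp: btP)
  have "homeomorphic_maps ?D ?R (\<lambda>(g,v). (g, ?\<phi> (f g) v)) (\<lambda>(g,e). (g, snd (k e)))"
    unfolding homeomorphic_maps_def
  proof (intro conjI)
    have fst: "continuous_map ?D (subtopology T W) fst" and snd: "continuous_map ?D euclidean snd"
      by (rule continuous_map_fst, rule continuous_map_snd)
    have fT: "continuous_map ?D T fst" using continuous_map_into_fulltopology[OF fst] .
    have "continuous_map ?D X (\<lambda>p. f (fst p))" using continuous_map_compose[OF fT f] by (simp add: o_def)
    then have "continuous_map ?D (subtopology X ?U) (\<lambda>p. f (fst p))"
      unfolding continuous_map_in_subtopology using W(2) by auto
    then have "continuous_map ?D (prod_topology (subtopology X ?U) euclidean) (\<lambda>p. (f (fst p), snd p))"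
      using snd by (rule continuous_map_pairedI)
    from continuous_map_into_fulltopology[OF continuous_map_compose[OF this kc(1)]]
    have "continuous_map ?D (btop E) (\<lambda>p. ?\<phi> (f (fst p)) (snd p))" by (simp add: o_def)
    then have c: "continuous_map ?D (prod_topology T (btop E)) (\<lambda>p. (fst p, ?\<phi> (f (fst p)) (snd p)))"
      by (rule continuous_map_pairedI[OF fT])
    have "bproj E (?\<phi> (f g) v) = f g" if "g \<in> W" for g v using ch(1)[OF W(2)[OF that]] by (simp add: fiber_def)
    then have c2: "continuous_map ?D (btop ?P) (\<lambda>p. (fst p, ?\<phi> (f (fst p)) (snd p)))"
      unfolding btP continuous_map_in_subtopology using c by auto
    then have "continuous_map ?D ?R (\<lambda>p. (fst p, ?\<phi> (f (fst p)) (snd p)))"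
      unfolding continuous_map_in_subtopology[of _ "btop ?P"] using continuous_map_image_subset_topspace[OF c2] by (auto simp: btP(2))
    then show "continuous_map ?D ?R (\<lambda>(g,v). (g, ?\<phi> (f g) v))" by (simp add: case_prod_unfold)
  next
    have R1: "continuous_map ?R (prod_topology T (btop E)) (\<lambda>p. p)" unfolding btP by (intro continuous_map_from_subtopology) auto
    have fT: "continuous_map ?R T fst" using continuous_map_compose[OF R1 continuous_map_fst] by (simp add: o_def)
    have sE: "continuous_map ?R (btop E) snd" using continuous_map_compose[OF R1 continuous_map_snd] by (simp add: o_def)
    have "continuous_map ?R (subtopology (btop E) {e \<in> topspace (btop E). bproj E e \<in> ?U}) snd"
      unfolding continuous_map_in_subtopology tR using sE W(2) by auto
    from continuous_map_compose[OF continuous_map_compose[OF this kc(2)] continuous_map_snd]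
    have "continuous_map ?R euclidean (\<lambda>p. snd (k (snd p)))" by (simp add: o_def)
    moreover have "continuous_map ?R (subtopology T W) fst" unfolding continuous_map_in_subtopology tR using fT by auto
    ultimately have "continuous_map ?R ?D (\<lambda>p. (fst p, snd (k (snd p))))" by (intro continuous_map_pairedI)
    then show "continuous_map ?R ?D (\<lambda>(g,e). (g, snd (k e)))" by (simp add: case_prod_unfold)
  next
    have fX: "f g \<in> topspace X" if "g \<in> W" for g using continuous_map_image_subset_topspace[OF f] WT[OF that] by blast
    show "\<forall>p\<in>topspace ?D. (\<lambda>(g,e). (g, snd (k e))) ((\<lambda>(g,v). (g, ?\<phi> (f g) v)) p) = p"
      using k1 fX W(2) by auto
    show "\<forall>p\<in>topspace ?R. (\<lambda>(g,v). (g, ?\<phi> (f g) v)) ((\<lambda>(g,e). (g, snd (k e))) p) = p"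
    proof
      fix p assume p: "p \<in> topspace ?R"
      obtain g e where ge: "p = (g,e)" "g \<in> W" "e \<in> topspace (btop E)" "bproj E e = f g" using p unfolding tR by blast
      have "bproj E e \<in> ?U" using ge W(2) by simp
      then show "(\<lambda>(g,v). (g, ?\<phi> (f g) v)) ((\<lambda>(g,e). (g, snd (k e))) p) = p"
        using k2(1)[OF ge(3)] k3[OF ge(3)] ge by simp
    qed
  qed
  then have hom: "homeomorphic_map ?D ?R (\<lambda>(g,v). (g, ?\<phi> (f g) v))" unfolding homeomorphic_map_maps by blast
  let ?PA = "pullback_alg T f A"
  have btA: "btop ?PA = subtopology (prod_topology T (btop A)) {(g,a). bproj A a = f g}" "bproj ?PA = fst"
    by (simp_all add: pullback_alg_def)
  let ?RA = "subtopology (btop ?PA) {p \<in> topspace (btop ?PA). bproj ?PA p \<in> W}"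
  have "continuous_map ?RA (prod_topology T (btop A)) (\<lambda>p. p)" unfolding btA by (intro continuous_map_from_subtopology) auto
  from continuous_map_compose[OF this continuous_map_snd] have "continuous_map ?RA (btop A) snd" by (simp add: o_def)
  then have "continuous_map ?RA (subtopology (btop A) {a \<in> topspace (btop A). bproj A a \<in> ?U}) snd"
    unfolding continuous_map_in_subtopology using W(2) by (auto simp: btA)
  from continuous_map_compose[OF this FA(1)] have FA1: "continuous_map ?RA euclidean (\<lambda>p. FA (snd p))" by (simp add: o_def)
  have FA2: "blinfun_apply (FA (snd p)) v =
      chart_inv (\<lambda>g v. (g, ?\<phi> (f g) v)) (bproj ?PA p) (pullback_act act p (bproj ?PA p, ?\<phi> (f (bproj ?PA p)) v))"
    if p: "p \<in> topspace (btop ?PA)" "bproj ?PA p \<in> W" for p v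
  proof -
    obtain g a where ga: "p = (g,a)" "g \<in> W" "a \<in> topspace (btop A)" "bproj A a = f g" using p unfolding btA by auto
    show ?thesis using FA(2)[OF ga(3), of v] W(2)[OF ga(2)] ga
      by (simp add: btA pullback_act_def chart_inv_pullback)
  qed
  show ?thesis unfolding local_triv_def Let_def fst_conv snd_conv
  proof (intro conjI ballI)
    fix g assume g: "g \<in> W"
    show "\<forall>v w. (g, ?\<phi> (f g) (v + w)) = badd ?P (g, ?\<phi> (f g) v) (g, ?\<phi> (f g) w)"
      using ch(4)[OF W(2)[OF g]] by (simp add: pullback_bundle_def)
    show "\<forall>r v. (g, ?\<phi> (f g) (r *\<^sub>R v)) = bscale ?P r (g, ?\<phi> (f g) v)"
      using ch(5)[OF W(2)[OF g]] by (simp add: pullback_bundle_def)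
  qed (use W bij hom FA1 FA2 in blast)+
qed

lemma pullback_compatible:
  fixes d d' :: "'x set \<times> ('x \<Rightarrow> 'v::banach \<Rightarrow> 'e)"
  assumes f: "continuous_map T X f" and c: "compatible X d d'" and W: "W \<subseteq> topspace T" "W' \<subseteq> topspace T"
    "\<And>g. g \<in> W \<Longrightarrow> f g \<in> fst d" "\<And>g. g \<in> W' \<Longrightarrow> f g \<in> fst d'"
  shows "compatible T (W, \<lambda>g v. (g, snd d (f g) v)) (W', \<lambda>g v. (g, snd d' (f g) v))"
proof -
  obtain F :: "'x \<Rightarrow> ('v \<Rightarrow>\<^sub>L 'v)" where F: "continuous_map (subtopology X (fst d \<inter> fst d')) euclidean F"
    "\<And>b v. b \<in> fst d \<inter> fst d' \<Longrightarrow> blinfun_apply (F b) v = chart_inv (snd d') b (snd d b v)"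
    using c unfolding compatible_def by blast
  have "continuous_map (subtopology T (W \<inter> W')) (subtopology X (fst d \<inter> fst d')) f"
    unfolding continuous_map_in_subtopology using W f by (auto intro: continuous_map_from_subtopology)
  from continuous_map_compose[OF this F(1)] have "continuous_map (subtopology T (W \<inter> W')) euclidean (\<lambda>g. F (f g))"
    by (simp add: o_def)
  then show ?thesis unfolding compatible_def fst_conv snd_conv
    using F(2) W by (intro exI[of _ "\<lambda>g. F (f g)"]) (auto simp: chart_inv_pullback)
qed

lemma pullback_in_structure:
  fixes d :: "'x set \<times> ('x \<Rightarrow> 'v::banach \<Rightarrow> 'e)"
  assumes f: "continuous_map T X f" and d: "in_structure X A E act \<A> d"
    and W: "openin T W" "\<And>g. g \<in> W \<Longrightarrow> f g \<in> fst d"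
  shows "in_structure T (pullback_alg T f A) (pullback_bundle T f E) (pullback_act act) (pullback_atlas T f \<A>)
    (W, \<lambda>g v. (g, snd d (f g) v))"
  unfolding in_structure_def
proof (intro conjI ballI)
  have WT: "W \<subseteq> topspace T" using W(1) openin_subset by blast
  show "local_triv T (pullback_alg T f A) (pullback_bundle T f E) (pullback_act act) (W, \<lambda>g v. (g, snd d (f g) v))"
    using pullback_local_triv[OF f _ W] d unfolding in_structure_def by blast
  fix p assume "p \<in> pullback_atlas T f \<A>"
  then obtain d' where d': "d' \<in> \<A>" "p = ({g \<in> topspace T. f g \<in> fst d'}, \<lambda>g v. (g, snd d' (f g) v))"
    unfolding pullback_atlas_def by (auto simp: case_prod_unfold)
  have c: "compatible X d d'" "compatible X d' d" using d d'(1) unfolding in_structure_def by auto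
  show "compatible T (W, \<lambda>g v. (g, snd d (f g) v)) p" unfolding d'(2)
    by (rule pullback_compatible[OF f c(1) WT]) (use W in auto)
  show "compatible T p (W, \<lambda>g v. (g, snd d (f g) v))" unfolding d'(2)
    by (rule pullback_compatible[OF f c(2) _ WT]) (use W in auto)
qed

context chart_setting begin

lemma norm_cts_of_uniform:
  fixes \<A> :: "('x set \<times> ('x \<Rightarrow> 'v \<Rightarrow> 'e)) set"
  assumes T: "lin_rep T" and uc: "uniformly_continuous_rep G A E act \<A> T"
    and st: "\<And>d. d \<in> Ch \<Longrightarrow> in_structure (obj G) A E act \<A> d"
  shows "norm_cts T"
  unfolding norm_cts_def
proof (intro ballI)
  fix d1 d2 assume d: "d1 \<in> Ch" "d2 \<in> Ch"
  define W where "W = dom d1 d2"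
  have "W = {g \<in> Ga. src G g \<in> fst d1} \<inter> {g \<in> Ga. tgt G g \<in> fst d2}" by (auto simp: W_def dom_def)
  then have Wo: "openin (arr G) W"
    using openin_continuous_map_preimage[OF cont_src0 chart_open[OF d(1)]]
      openin_continuous_map_preimage[OF cont_tgt0 chart_open[OF d(2)]] by auto
  have Wd: "g \<in> Ga" "src G g \<in> fst d1" "tgt G g \<in> fst d2" if "g \<in> W" for g using that by (auto simp: W_def dom_def)
  let ?\<psi> = "\<lambda>g v. (g, snd d1 (src G g) v)" and ?\<theta> = "\<lambda>g v. (g, snd d2 (tgt G g) v)"
  have s1: "in_structure (arr G) (pullback_alg (arr G) (src G) A) (pullback_bundle (arr G) (src G) E)
           (pullback_act act) (pullback_atlas (arr G) (src G) \<A>) (W, ?\<psi>)"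
    by (rule pullback_in_structure[OF cont_src0 st[OF d(1)] Wo Wd(2)])
  have s2: "in_structure (arr G) (pullback_alg (arr G) (tgt G) A) (pullback_bundle (arr G) (tgt G) E)
           (pullback_act act) (pullback_atlas (arr G) (tgt G) \<A>) (W, ?\<theta>)"
    by (rule pullback_in_structure[OF cont_tgt0 st[OF d(2)] Wo Wd(3)])
  have "\<exists>F :: 'g \<Rightarrow> ('v \<Rightarrow>\<^sub>L 'v). continuous_map (subtopology (arr G) W) euclidean F \<and>
      (\<forall>g\<in>W. \<forall>v. blinfun_apply (F g) v = chart_inv ?\<theta> g (g, T g (snd (?\<psi> g v))))"
    by (rule uc[unfolded uniformly_continuous_rep_def, THEN spec, THEN spec, THEN spec, THEN mp, OF conjI[OF s1 s2]])
  then obtain F :: "'g \<Rightarrow> ('v \<Rightarrow>\<^sub>L 'v)" where F0: "continuous_map (subtopology (arr G) W) euclidean F \<and>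
      (\<forall>g\<in>W. \<forall>v. blinfun_apply (F g) v = chart_inv ?\<theta> g (g, T g (snd (?\<psi> g v))))" by (rule exE)
  note F = F0[THEN conjunct1] F0[THEN conjunct2, rule_format]
  have "F g = loc d1 d2 T g" if g: "g \<in> W" for g
  proof (rule blinfun_eqI)
    fix v
    show "F g v = loc d1 d2 T g v"
      unfolding loc_def conj_op_apply[OF d Wd(2,3)[OF g] bounded_op_rep[OF T Wd(1)[OF g]]] F(2)[OF g]
      by (simp add: chart_inv_pullback)
  qed
  then show "continuous_map (subtopology (arr G) (dom d1 d2)) euclidean (loc d1 d2 T)"
    using continuous_map_eq[OF F(1), of "loc d1 d2 T"] by (simp add: W_def)
qed

text \<open>Charts in the pulled-back structure need not be pulled back from the base, and they are
  compatible only with the charts of the pulled-back atlas. Each side therefore passes through a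
  chart of \<open>\<A>\<close> before an isometric chart of \<open>Ch\<close> is reached.\<close>

lemma uniform_of_norm_cts:
  fixes \<A> :: "('x set \<times> ('x \<Rightarrow> 'v \<Rightarrow> 'e)) set"
  assumes R: "lin_rep R" and nc: "norm_cts R" and at: "is_atlas (obj G) A E act \<A>"
    and st: "\<And>d. d \<in> Ch \<Longrightarrow> in_structure (obj G) A E act \<A> d"
  shows "uniformly_continuous_rep G A E act \<A> R"
  unfolding uniformly_continuous_rep_def
proof (intro allI impI, elim conjE)
  fix W :: "'g set" and \<psi> \<theta> :: "'g \<Rightarrow> 'v \<Rightarrow> 'g \<times> 'e"
  assume s1: "in_structure (arr G) (pullback_alg (arr G) (src G) A) (pullback_bundle (arr G) (src G) E)
           (pullback_act act) (pullback_atlas (arr G) (src G) \<A>) (W, \<psi>)"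
    and s2: "in_structure (arr G) (pullback_alg (arr G) (tgt G) A) (pullback_bundle (arr G) (tgt G) E)
           (pullback_act act) (pullback_atlas (arr G) (tgt G) \<A>) (W, \<theta>)"
  have triv1: "local_triv (arr G) (pullback_alg (arr G) (src G) A) (pullback_bundle (arr G) (src G) E) (pullback_act act) (W, \<psi>)"
    using s1 unfolding in_structure_def by blast
  have Wo: "openin (arr G) W" using triv1 unfolding local_triv_def Let_def by simp
  have WG: "g \<in> Ga" if "g \<in> W" for g using openin_subset[OF Wo] that by blast
  define F where "F = (\<lambda>g. Blinfun (\<lambda>v. chart_inv \<theta> g (g, R g (snd (\<psi> g v)))))"
  let ?Z = "subtopology (arr G) W"
  have key: "\<exists>B H. openin ?Z B \<and> g0 \<in> B \<and> continuous_map (subtopology ?Z B) euclidean H \<and>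
      (\<forall>g\<in>B. \<forall>v. blinfun_apply (H g) v = chart_inv \<theta> g (g, R g (snd (\<psi> g v))))" if g0: "g0 \<in> W" for g0
  proof -
    have g0X: "src G g0 \<in> Xo" "tgt G g0 \<in> Xo" using WG[OF g0] by auto
    obtain d1 d2 where d: "d1 \<in> Ch" "src G g0 \<in> fst d1" "d2 \<in> Ch" "tgt G g0 \<in> fst d2"
      using chart_cover[OF g0X(1)] chart_cover[OF g0X(2)] by blast
    obtain e1 e2 where e: "e1 \<in> \<A>" "src G g0 \<in> fst e1" "e2 \<in> \<A>" "tgt G g0 \<in> fst e2"
      using at g0X unfolding is_atlas_def by blast
    have tr: "local_triv (obj G) A E act e1" "local_triv (obj G) A E act e2" using at e unfolding is_atlas_def by auto
    have op: "openin (obj G) (fst e1)" "openin (obj G) (fst e2)" using tr unfolding local_triv_def Let_def by auto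
    define p1 where "p1 = ({g \<in> Ga. src G g \<in> fst e1}, \<lambda>g v. (g, snd e1 (src G g) v))"
    define p2 where "p2 = ({g \<in> Ga. tgt G g \<in> fst e2}, \<lambda>g v. (g, snd e2 (tgt G g) v))"
    have "p1 \<in> pullback_atlas (arr G) (src G) \<A>" "p2 \<in> pullback_atlas (arr G) (tgt G) \<A>"
      unfolding pullback_atlas_def p1_def p2_def using e(1,3) by (force simp: case_prod_unfold)+
    then have cp: "compatible (arr G) (W, \<psi>) p1" "compatible (arr G) p2 (W, \<theta>)"
      using s1 s2 unfolding in_structure_def by blast+
    have cd: "compatible (obj G) e1 d1" "compatible (obj G) d2 e2"
      using st[OF d(1)] st[OF d(3)] e unfolding in_structure_def by auto
    obtain F1 :: "'g \<Rightarrow> ('v \<Rightarrow>\<^sub>L 'v)" where F1: "continuous_map (subtopology (arr G) (W \<inter> fst p1)) euclidean F1"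
      "\<And>g v. g \<in> W \<inter> fst p1 \<Longrightarrow> blinfun_apply (F1 g) v = chart_inv (snd p1) g (\<psi> g v)"
      using cp(1) unfolding compatible_def fst_conv snd_conv by metis
    obtain F2 :: "'x \<Rightarrow> ('v \<Rightarrow>\<^sub>L 'v)" where F2: "continuous_map (subtopology (obj G) (fst e1 \<inter> fst d1)) euclidean F2"
      "\<And>x v. x \<in> fst e1 \<inter> fst d1 \<Longrightarrow> blinfun_apply (F2 x) v = chart_inv (snd d1) x (snd e1 x v)"
      using cd(1) unfolding compatible_def by metis
    obtain F3 :: "'x \<Rightarrow> ('v \<Rightarrow>\<^sub>L 'v)" where F3: "continuous_map (subtopology (obj G) (fst d2 \<inter> fst e2)) euclidean F3"
      "\<And>x v. x \<in> fst d2 \<inter> fst e2 \<Longrightarrow> blinfun_apply (F3 x) v = chart_inv (snd e2) x (snd d2 x v)"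
      using cd(2) unfolding compatible_def by metis
    obtain F4 :: "'g \<Rightarrow> ('v \<Rightarrow>\<^sub>L 'v)" where F4: "continuous_map (subtopology (arr G) (fst p2 \<inter> W)) euclidean F4"
      "\<And>g v. g \<in> fst p2 \<inter> W \<Longrightarrow> blinfun_apply (F4 g) v = chart_inv \<theta> g (snd p2 g v)"
      using cp(2) unfolding compatible_def fst_conv snd_conv by metis
    define B where "B = W \<inter> ({g \<in> Ga. src G g \<in> fst e1 \<inter> fst d1} \<inter> {g \<in> Ga. tgt G g \<in> fst d2 \<inter> fst e2})"
    have "openin (arr G) ({g \<in> Ga. src G g \<in> fst e1 \<inter> fst d1} \<inter> {g \<in> Ga. tgt G g \<in> fst d2 \<inter> fst e2})"
      using op chart_open[OF d(1)] chart_open[OF d(3)]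
      by (intro openin_Int openin_continuous_map_preimage[OF cont_src0] openin_continuous_map_preimage[OF cont_tgt0])
    then have Bo: "openin ?Z B" unfolding B_def openin_subtopology by blast
    have BW: "W \<inter> B = B" by (auto simp: B_def)
    have ZB: "subtopology ?Z B = subtopology (arr G) B" by (simp add: subtopology_subtopology BW)
    have b: "g \<in> W" "g \<in> Ga" "src G g \<in> fst e1" "src G g \<in> fst d1" "tgt G g \<in> fst d2" "tgt G g \<in> fst e2" if "g \<in> B" for g
      using that by (auto simp: B_def)
    have id: "continuous_map (subtopology (arr G) B) (arr G) (\<lambda>g. g)" by (intro continuous_map_from_subtopology) auto
    have s: "continuous_map (subtopology (arr G) B) (obj G) (src G)" and t: "continuous_map (subtopology (arr G) B) (obj G) (tgt G)"
      using cont_src[OF id] cont_tgt[OF id] by auto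
    have c1: "continuous_map (subtopology (arr G) B) euclidean F1"
      by (rule continuous_map_from_subtopology_mono[OF F1(1)]) (auto simp: B_def p1_def)
    have c4: "continuous_map (subtopology (arr G) B) euclidean F4"
      by (rule continuous_map_from_subtopology_mono[OF F4(1)]) (auto simp: B_def p2_def)
    have "continuous_map (subtopology (arr G) B) (subtopology (obj G) (fst e1 \<inter> fst d1)) (src G)"
      unfolding continuous_map_in_subtopology using s b by auto
    from continuous_map_compose[OF this F2(1)]
    have c2: "continuous_map (subtopology (arr G) B) euclidean (\<lambda>g. F2 (src G g))" by (simp add: o_def)
    have "continuous_map (subtopology (arr G) B) (subtopology (obj G) (fst d2 \<inter> fst e2)) (tgt G)"
      unfolding continuous_map_in_subtopology using t b by auto
    from continuous_map_compose[OF this F3(1)]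
    have c3: "continuous_map (subtopology (arr G) B) euclidean (\<lambda>g. F3 (tgt G g))" by (simp add: o_def)
    have c5: "continuous_map (subtopology (arr G) B) euclidean (\<lambda>g. loc d1 d2 R g)"
      by (rule norm_ctsD[OF nc d(1,3) id]) (use b in auto)
    \<comment> \<open>From right to left: \<open>\<psi>\<close> to \<open>e1\<close>,
      \<open>e1\<close> to \<open>d1\<close>, the local expression of \<open>R\<close>,
      \<open>d2\<close> to \<open>e2\<close>, and \<open>e2\<close> to
      \<open>\<theta>\<close>.\<close>
    define H where "H = (\<lambda>g. F4 g o\<^sub>L (F3 (tgt G g) o\<^sub>L (loc d1 d2 R g o\<^sub>L (F2 (src G g) o\<^sub>L F1 g))))"
    have "continuous_map (subtopology (arr G) B) euclidean H" unfolding H_def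
      by (intro continuous_map_blinfun_compose c1 c2 c3 c4 c5)
    moreover have "blinfun_apply (H g) v = chart_inv \<theta> g (g, R g (snd (\<psi> g v)))" if g: "g \<in> B" for g v
    proof -
      note bg = b[OF g]
      have "\<psi> g v \<in> fiber (pullback_bundle (arr G) (src G) E) g" using chart_props(1)[OF triv1, of g v] bg(1) by simp
      then obtain u where u: "u \<in> fiber E (src G g)" "\<psi> g v = (g,u)" unfolding fiber_pullback[OF bg(2)] by blast
      have Ru: "R g u \<in> fiber E (tgt G g)" using lin_rep_in[OF R bg(2) u(1)] .
      have a1: "blinfun_apply (F1 g) v = chart_inv (snd e1) (src G g) u"
        using F1(2)[of g v] bg u(2) by (simp add: p1_def chart_inv_pullback)
      have a2: "blinfun_apply (F2 (src G g)) (chart_inv (snd e1) (src G g) u) = chart_inv (snd d1) (src G g) u"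
        using F2(2)[of "src G g"] bg chart_props(3)[OF tr(1) bg(3) u(1)] by simp
      have a3: "blinfun_apply (loc d1 d2 R g) (chart_inv (snd d1) (src G g) u) = chart_inv (snd d2) (tgt G g) (R g u)"
        unfolding loc_def conj_op_apply[OF d(1,3) bg(4,5) bounded_op_rep[OF R bg(2)]] chart(3)[OF d(1) bg(4) u(1)] ..
      have a4: "blinfun_apply (F3 (tgt G g)) (chart_inv (snd d2) (tgt G g) (R g u)) = chart_inv (snd e2) (tgt G g) (R g u)"
        using F3(2)[of "tgt G g"] bg chart(3)[OF d(3) bg(5) Ru] by simp
      have a5: "blinfun_apply (F4 g) (chart_inv (snd e2) (tgt G g) (R g u)) = chart_inv \<theta> g (g, R g u)"
        using F4(2)[of g] bg chart_props(3)[OF tr(2) bg(6) Ru] by (simp add: p2_def)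
      show ?thesis unfolding H_def by (simp add: a1 a2 a3 a4 a5 u(2))
    qed
    moreover have "g0 \<in> B" using g0 WG[OF g0] d e by (simp add: B_def)
    ultimately show ?thesis using Bo unfolding ZB[symmetric] by blast
  qed
  \<comment> \<open>The operator at \<open>g\<close> is determined by its values, so the local
    choices of \<open>H\<close> all agree with the single \<open>F\<close> and glue.\<close>
  have Feq: "F g = H g" if "\<And>v. blinfun_apply (H g) v = chart_inv \<theta> g (g, R g (snd (\<psi> g v)))" for g and H :: "'g \<Rightarrow> ('v \<Rightarrow>\<^sub>L 'v)"
    unfolding F_def that[symmetric] by (simp add: blinfun_apply_inverse)
  have "continuous_map ?Z euclidean F"
  proof (rule continuous_map_locally)
    fix g0 assume "g0 \<in> topspace ?Z"
    then have "g0 \<in> W" by simp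
    then obtain B H where B: "openin ?Z B" "g0 \<in> B" "continuous_map (subtopology ?Z B) euclidean H"
      "\<And>g v. g \<in> B \<Longrightarrow> blinfun_apply (H g) v = chart_inv \<theta> g (g, R g (snd (\<psi> g v)))"
      using key by metis
    have "continuous_map (subtopology ?Z B) euclidean F"
      by (rule continuous_map_eq[OF B(3)]) (use Feq[of H] B(4) openin_subset[OF B(1)] in auto)
    then show "\<exists>B. openin ?Z B \<and> g0 \<in> B \<and> continuous_map (subtopology ?Z B) euclidean F" using B by blast
  qed
  moreover have "blinfun_apply (F g) v = chart_inv \<theta> g (g, R g (snd (\<psi> g v)))" if g: "g \<in> W" for g v
  proof -
    obtain B H where B: "g \<in> B" "\<And>g v. g \<in> B \<Longrightarrow> blinfun_apply (H g) v = chart_inv \<theta> g (g, R g (snd (\<psi> g v)))"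
      using key[OF g] by metis
    then show ?thesis using Feq[of H g] by simp
  qed
  ultimately show "\<exists>F :: 'g \<Rightarrow> ('v \<Rightarrow>\<^sub>L 'v). continuous_map (subtopology (arr G) W) euclidean F \<and>
      (\<forall>g\<in>W. \<forall>v. blinfun_apply (F g) v = chart_inv \<theta> g (g, R g (snd (\<psi> g v))))" by blast
qed

end

theorem mainTheorem5:
  fixes G :: "('g,'x) groupoid" and \<mu> :: "'x \<Rightarrow> 'g measure"
    and A :: "('x,'a) balg" and gact :: "'g \<Rightarrow> 'a \<Rightarrow> 'a"
    and E :: "('x,'e) bbundle" and act :: "'a \<Rightarrow> 'e \<Rightarrow> 'e"
    and \<sigma> :: "'g \<Rightarrow> 'g \<Rightarrow> 'a" and T :: "'g \<Rightarrow> 'e \<Rightarrow> 'e"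
  assumes "locally_compact_groupoid G \<mu>"
    and "proper_groupoid G"
    and "banach_algebra_G_bundle G A gact"
    and "banach_module_bundle (obj G) A E act"
    and "multiplier G A gact \<sigma>"
    and "A_linear G A E act gact T"
    and "almost_sigma_rep G A E act \<sigma> T"
  shows "(\<exists>R. sigma_rep G A E act gact \<sigma> R \<and>
            (\<forall>g\<in>topspace (arr G).
               opnorm E (src G g) (\<lambda>e. bminus E (R g e) (T g e))
                 \<le> 4 * bdef G A E \<sigma> T (tgt G g) * rdef G A E act \<sigma> T (tgt G g)))
       \<and> (\<forall>\<A> :: ('x set \<times> ('x \<Rightarrow> 'v::banach \<Rightarrow> 'e)) set.
            GI_structure (obj G) A E act \<A> \<and> uniformly_continuous_rep G A E act \<A> T \<longrightarrow>
            (\<exists>R. sigma_rep G A E act gact \<sigma> R \<and>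
               (\<forall>g\<in>topspace (arr G).
                  opnorm E (src G g) (\<lambda>e. bminus E (R g e) (T g e))
                    \<le> 4 * bdef G A E \<sigma> T (tgt G g) * rdef G A E act \<sigma> T (tgt G g)) \<and>
               uniformly_continuous_rep G A E act \<A> R))"
proof -
  interpret lc_groupoid G \<mu> by unfold_locales (rule assms(1))
  obtain c0 where "cutoff_function G c0" using assms(2) unfolding proper_groupoid_def by blast
  then obtain c where c: "cutoff_function G c" "\<And>x. x \<in> Xo \<Longrightarrow> (\<integral>k. c (src G k) \<partial>\<mu> x) = 1"
    by (rule normalised_cutoff) blast
  have "banach_bundle (obj G) E" using assms(4) unfolding banach_module_bundle_def by blast
  then interpret rep_setting G \<mu> c E A gact act \<sigma>
    by unfold_locales (use c assms in auto)
  obtain R where R: "sigma_rep G A E act gact \<sigma> R" "\<And>n. nice ((avg ^^ n) T)"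
    "\<And>n g w. g \<in> Ga \<Longrightarrow> w \<in> fiber E (src G g) \<Longrightarrow>
      bnorm E (bminus E (R g w) ((avg ^^ n) T g w)) \<le> (128/243) ^ n * bnorm E w"
    "\<And>g. g \<in> Ga \<Longrightarrow> opnorm E (src G g) (\<lambda>e. bminus E (R g e) (T g e))
        \<le> 4 * bdef G A E \<sigma> T (tgt G g) * rdef G A E act \<sigma> T (tgt G g)"
    by (rule averaging_theorem[OF assms(6,7)]) (rule that, assumption+)
  \<comment> \<open>The representation \<open>R\<close> is built without reference to any chart; the
    same one serves both conclusions, and only its regularity remains to be shown.\<close>
  have linR: "lin_rep R" using R(1) by (simp add: sigma_rep_def lin_rep_def)
  have "uniformly_continuous_rep G A E act \<A> R"
    if "GI_structure (obj G) A E act \<A>" "uniformly_continuous_rep G A E act \<A> T"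
    for \<A> :: "('x set \<times> ('x \<Rightarrow> 'v \<Rightarrow> 'e)) set"
  proof -
    have at: "is_atlas (obj G) A E act \<A>"
      and ex: "\<exists>Ch. is_atlas (obj G) A E act Ch \<and> (\<forall>d\<in>Ch. norm_preserving_chart E d) \<and>
          (\<forall>d\<in>Ch. in_structure (obj G) A E act \<A> d)"
      using that(1) by (simp_all add: GI_structure_def)
    from ex obtain Ch where "is_atlas (obj G) A E act Ch \<and> (\<forall>d\<in>Ch. norm_preserving_chart E d) \<and>
          (\<forall>d\<in>Ch. in_structure (obj G) A E act \<A> d)" by (rule exE)
    then have Ch: "is_atlas (obj G) A E act Ch" "\<And>d. d \<in> Ch \<Longrightarrow> norm_preserving_chart E d"
      "\<And>d. d \<in> Ch \<Longrightarrow> in_structure (obj G) A E act \<A> d" by simp_all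
    interpret chart_setting G \<mu> c E A gact act \<sigma> Ch by unfold_locales (use Ch in auto)
    \<comment> \<open>Regularity is carried along the approximating sequence and then to its uniform
      limit.\<close>
    have "norm_cts ((avg ^^ n) T)" for n
    proof (induction n)
      case 0
      then show ?case using norm_cts_of_uniform[OF _ that(2) Ch(3)] nice_lin[OF R(2)[of 0]] by simp
    next
      case (Suc n)
      then show ?case using norm_cts_avg[OF R(2)[of n]] by simp
    qed
    then have "norm_cts R" by (intro norm_cts_limit[OF linR nice_lin[OF R(2)] _ _ _ R(3)]) auto
    then show ?thesis by (rule uniform_of_norm_cts[OF linR _ at Ch(3)])
  qed
  then show ?thesis using R(1,4) by blast
qed

end
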